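(* Let $X=\mathbb C^n$ and let $\varOmega\Subset T^*X$ (conically) be an open conic subset. For any $P(t;z,\zeta,\eta)\in\widehat{\mathfrak S}_{\rm cl}(\varOmega;S)$ set $$P^*(t;z,\zeta,\eta)=e^{t\langle\partial_\zeta,\partial_z\rangle}P(t;z,-\zeta,\eta).$$ (1) $P^*\in\widehat{\mathfrak S}_{\rm cl}(\varOmega^a;S)$, where $\varOmega^a=\{(z;\zeta);\ (z;-\zeta)\in\varOmega\}$, and $P^{**}=P$. Moreover, if $P\in\widehat{\mathfrak N}_{\rm cl}(\varOmega;S)$, then $P^*\in\widehat{\mathfrak N}_{\rm cl}(\varOmega^a;S)$. (2) $(Q\circ P)^*(t;z,\zeta,\eta)=P^*\circ Q^*(t;z,\zeta,\eta)$ (for $P,Q\in\widehat{\mathfrak S}_{\rm cl}(\varOmega;S)$). (3) Let $\varPhi(w)=z$ be a holomorphic coordinate transformation. Then on $\widehat{\mathfrak S}_{\rm cl}(\varOmega^a;S)\otimes_{\mathscr O_X}\varOmega_X$, $$\varPhi^*(P^*(t;z,\zeta,\eta)\otimes dz)=\varPhi^*(P(t;z,\zeta,\eta)\otimes dz)^*,$$ where $\varPhi^*$ also stands for the pull-back of differential forms; that is, $$\det\frac{\partial z}{\partial w}\,\varPhi^*(P^* )=\Bigl(\det\frac{\partial z}{\partial w}\,\varPhi^*P\Bigr)^*=(\varPhi^*P)^*\circ\det\frac{\partial z}{\partial w}.$$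
   Context: $\|z\|=\max_i|z_i|$. $V\Subset U$ conically means that $V$ is generated by a relatively compact subset of $U$ (contained in $\mathbb R_{>0}K$ with $K\subset U$ compact). For an open conic $\varOmega$ and $\rho\ge0$, $\varOmega_\rho$ is the closure of $\bigcup_{(z;\zeta)\in\varOmega}\{(z+z';\zeta+\zeta');\ \|z'\|\le\rho,\ \|\zeta'\|\le\rho\|\zeta\|\}$, $V[d]=\{(z;\zeta)\in V;\ \|\zeta\|\ge d\}$, $d_\rho=d(1-\rho)$. $S=\{\eta\in\mathbb C;\ 0<|\eta|<r,\ |\arg\eta|<\theta/4\}$ with $r,\theta\in]0,\frac12[$. Functions on $\varOmega_\rho[d_\rho]\times S$ are understood to be holomorphic on a neighborhood of it; $t$ is an indeterminate. In (3), $\varOmega_X$ (with subscript $X$) is the sheaf of holomorphic $n$-forms on $X$ and $dz=dz_1\wedge\dots\wedge dz_n$. $\widehat{\mathfrak N}_{\rm cl}(\varOmega;S)$: formal series $P=\sum_{\nu\ge0}t^\nu P_\nu(z,\zeta,\eta)$ such that, for some $d>0$, $\rho\in]0,1[$, all $P_\nu$ are holomorphic on $\varOmega_\rho[d_\rho]\times S$, and there is $A>0$ such that for every $Z\Subset S$, $h>0$ there is $C_{h,Z}>0$ with $\bigl|\sum_{\nu=0}^{m-1}P_\nu\bigr|\le C_{h,Z}\,m!\,A^me^{h\|\zeta\|}/\|\eta\zeta\|^m$ for all $m\in\mathbb N$ on $\varOmega_\rho[d_\rho]\times Z$. $\widehat{\mathfrak S}_{\rm cl}(\varOmega;S)$: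 formal series $P=\sum t^\nu P_\nu$ such that, for some $d>0$, $\rho\in]0,1[$, all $P_\nu$ are holomorphic on $\varOmega_\rho[d_\rho]\times S$; there is $A>0$ such that for every $Z\Subset S$, $h>0$ there is $C_{h,Z}>0$ with $|P_\nu|\le C_{h,Z}\,\nu!\,A^\nu e^{h\|\zeta\|}/\|\eta\zeta\|^\nu$ for all $\nu\ge0$ on $\varOmega_\rho[d_\rho]\times Z$; and $\partial_\eta P\in\widehat{\mathfrak N}_{\rm cl}(\varOmega;S)$. Product: $Q\circ P(t;z,\zeta,\eta)=e^{t\langle\partial_{\zeta'},\partial_{z'}\rangle}Q(t;z,\zeta+\zeta',\eta)P(t;z+z',\zeta,\eta)\big|_{z'=0,\zeta'=0}$. Coordinate transformation: with cotangent coordinates $(z;\zeta)$, $(w;\lambda)$ near $\operatorname{Cl}\varOmega$ and $z=\varPhi(w)$, let $J^*_\varPhi(z',z)$ be a holomorphic $n\times n$ matrix, for $z'$ near $z$, with $\varPhi^{-1}(z')-\varPhi^{-1}(z)=J^*_\varPhi(z',z)(z'-z)$, and $$\varPhi^*P(t;w,\lambda,\eta)=e^{t\langle\partial_{\zeta'},\partial_{z'}\rangle}P\bigl(t;\varPhi(w),\zeta'+{}^{\mathsf t}\!J^*_\varPhi(\varPhi(w)+z',\varPhi(w))\lambda,\eta\bigr)\Big|_{z'=0,\ \zeta'=0}.$$ *)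

theory Defs
  imports "HOL-Analysis.Analysis"
begin

section \<open>Holomorphic functions of several variables\<close>

text \<open>
  The library has no class of complex vector spaces, so the complex scalar multiplication of the
  domain is an explicit argument: \<open>(*s)\<close> on \<open>\<complex>\<^sup>n\<close>, and \<open>scale2\<close>, \<open>scale3\<close> on the products
  \<open>\<complex>\<^sup>n \<times> \<complex>\<^sup>n\<close> and \<open>\<complex>\<^sup>n \<times> \<complex>\<^sup>n \<times> \<complex>\<close>. Holomorphic means: Frechet differentiable at every point,
  with complex-linear derivative. It is only used on open sets.
\<close>

definition holo_on ::
  "(complex \<Rightarrow> 'a \<Rightarrow> 'a) \<Rightarrow> ('a::real_normed_vector \<Rightarrow> complex) \<Rightarrow> 'a set \<Rightarrow> bool" where
  "holo_on sc f U \<longleftrightarrow>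
     (\<forall>x\<in>U. \<exists>D. (f has_derivative D) (at x) \<and> (\<forall>c v. D (sc c v) = c * D v))"

definition scale2 ::
  "complex \<Rightarrow> (complex^'n) \<times> (complex^'n) \<Rightarrow> (complex^'n) \<times> (complex^'n)" where
  "scale2 c = (\<lambda>(z, \<zeta>). (c *s z, c *s \<zeta>))"

definition scale3 ::
  "complex \<Rightarrow> (complex^'n) \<times> (complex^'n) \<times> complex \<Rightarrow> (complex^'n) \<times> (complex^'n) \<times> complex" where
  "scale3 c = (\<lambda>(z, \<zeta>, \<eta>). (c *s z, c *s \<zeta>, c * \<eta>))"

definition holo_near ::
  "(complex \<Rightarrow> 'a \<Rightarrow> 'a) \<Rightarrow> ('a::real_normed_vector \<Rightarrow> complex) \<Rightarrow> 'a set \<Rightarrow> bool" where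
  "holo_near sc f A \<longleftrightarrow> (\<exists>W. open W \<and> A \<subseteq> W \<and> holo_on sc f W)"


section \<open>Conic sets and their thickenings\<close>

text \<open>\<open>T\<^sup>*X\<close> for \<open>X = \<complex>\<^sup>n\<close> is \<open>\<complex>\<^sup>n \<times> \<complex>\<^sup>n\<close>, with points \<open>(z, \<zeta>)\<close>.\<close>

text \<open>\<open>norm\<close> on \<open>complex^'n\<close> is the Euclidean norm and \<open>infnorm\<close> takes the maximum over real and
  imaginary parts; neither is the maximum of the moduli.\<close>

definition maxnorm :: "complex^'n \<Rightarrow> real" where
  "maxnorm z = Max (range (\<lambda>i. cmod (z $ i)))"

definition fibre_conic :: "((complex^'n) \<times> (complex^'n)) set \<Rightarrow> bool" where
  "fibre_conic V \<longleftrightarrow> (\<forall>z \<zeta> c. (z, \<zeta>) \<in> V \<and> c > 0 \<longrightarrow> (z, c *\<^sub>R \<zeta>) \<in> V)"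

definition conically_relcompact_in ::
  "((complex^'n) \<times> (complex^'n)) set \<Rightarrow> ((complex^'n) \<times> (complex^'n)) set \<Rightarrow> bool" where
  "conically_relcompact_in V U \<longleftrightarrow>
     fibre_conic V \<and> (\<exists>K. compact K \<and> K \<subseteq> U \<and> V \<subseteq> {(z, c *\<^sub>R \<zeta>) | z \<zeta> c. (z, \<zeta>) \<in> K \<and> c > 0})"

definition antipodal ::
  "((complex^'n) \<times> (complex^'n)) set \<Rightarrow> ((complex^'n) \<times> (complex^'n)) set" where
  "antipodal \<Omega> = {(z, \<zeta>). (z, - \<zeta>) \<in> \<Omega>}"

definition thicken ::
  "real \<Rightarrow> ((complex^'n) \<times> (complex^'n)) set \<Rightarrow> ((complex^'n) \<times> (complex^'n)) set" where
  "thicken \<rho> \<Omega> = closure (\<Union>(z, \<zeta>)\<in>\<Omega>.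
     {(z + z', \<zeta> + \<zeta>') | z' \<zeta>'. maxnorm z' \<le> \<rho> \<and> maxnorm \<zeta>' \<le> \<rho> * maxnorm \<zeta>})"

definition truncate_below ::
  "((complex^'n) \<times> (complex^'n)) set \<Rightarrow> real \<Rightarrow> ((complex^'n) \<times> (complex^'n)) set" where
  "truncate_below V d = {(z, \<zeta>) \<in> V. maxnorm \<zeta> \<ge> d}"

text \<open>The set \<open>\<Omega>\<^sub>\<rho>[d\<^sub>\<rho>]\<close> with \<open>d\<^sub>\<rho> = d (1 - \<rho>)\<close>.\<close>

definition symb_dom ::
  "((complex^'n) \<times> (complex^'n)) set \<Rightarrow> real \<Rightarrow> real \<Rightarrow> ((complex^'n) \<times> (complex^'n)) set" where
  "symb_dom \<Omega> d \<rho> = truncate_below (thicken \<rho> \<Omega>) (d * (1 - \<rho>))"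

definition sector :: "real \<Rightarrow> real \<Rightarrow> complex set" where
  "sector r \<theta> = {\<eta>. 0 < cmod \<eta> \<and> cmod \<eta> < r \<and> \<bar>Arg \<eta>\<bar> < \<theta> / 4}"

definition relcompact_in :: "complex set \<Rightarrow> complex set \<Rightarrow> bool" where
  "relcompact_in Z S \<longleftrightarrow> compact (closure Z) \<and> closure Z \<subseteq> S"


section \<open>Formal symbols\<close>

text \<open>\<open>P \<nu> z \<zeta> \<eta>\<close> is the coefficient of \<open>t\<^sup>\<nu>\<close>. Coefficients are total functions; their values
  outside the sets \<open>\<Omega>\<^sub>\<rho>[d\<^sub>\<rho>] \<times> S\<close> carry no meaning, see \<open>symb_eq\<close>.\<close>

type_synonym 'n fseries = "nat \<Rightarrow> complex^'n \<Rightarrow> complex^'n \<Rightarrow> complex \<Rightarrow> complex"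

definition coeffs_holo ::
  "((complex^'n) \<times> (complex^'n)) set \<Rightarrow> complex set \<Rightarrow> real \<Rightarrow> real \<Rightarrow> 'n fseries \<Rightarrow> bool" where
  "coeffs_holo \<Omega> S d \<rho> P \<longleftrightarrow>
     (\<forall>\<nu>. holo_near scale3 (\<lambda>(z, \<zeta>, \<eta>). P \<nu> z \<zeta> \<eta>)
            {(z, \<zeta>, \<eta>). (z, \<zeta>) \<in> symb_dom \<Omega> d \<rho> \<and> \<eta> \<in> S})"

definition Ncl ::
  "((complex^'n) \<times> (complex^'n)) set \<Rightarrow> complex set \<Rightarrow> 'n fseries set" where
  "Ncl \<Omega> S = {P. \<exists>d>0. \<exists>\<rho>. 0 < \<rho> \<and> \<rho> < 1 \<and> coeffs_holo \<Omega> S d \<rho> P \<and>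
     (\<exists>A>0. \<forall>Z h. relcompact_in Z S \<and> h > 0 \<longrightarrow>
       (\<exists>C>0. \<forall>m. \<forall>(z, \<zeta>)\<in>symb_dom \<Omega> d \<rho>. \<forall>\<eta>\<in>Z.
          cmod (\<Sum>\<nu><m. P \<nu> z \<zeta> \<eta>)
            \<le> C * fact m * A ^ m * exp (h * maxnorm \<zeta>) / maxnorm (\<eta> *s \<zeta>) ^ m))}"

definition deriv_eta :: "'n::finite fseries \<Rightarrow> 'n fseries" where
  "deriv_eta P = (\<lambda>\<nu> z \<zeta> \<eta>. deriv (P \<nu> z \<zeta>) \<eta>)"

definition Scl ::
  "((complex^'n) \<times> (complex^'n)) set \<Rightarrow> complex set \<Rightarrow> 'n fseries set" where
  "Scl \<Omega> S = {P. (\<exists>d>0. \<exists>\<rho>. 0 < \<rho> \<and> \<rho> < 1 \<and> coeffs_holo \<Omega> S d \<rho> P \<and>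
     (\<exists>A>0. \<forall>Z h. relcompact_in Z S \<and> h > 0 \<longrightarrow>
       (\<exists>C>0. \<forall>\<nu>. \<forall>(z, \<zeta>)\<in>symb_dom \<Omega> d \<rho>. \<forall>\<eta>\<in>Z.
          cmod (P \<nu> z \<zeta> \<eta>)
            \<le> C * fact \<nu> * A ^ \<nu> * exp (h * maxnorm \<zeta>) / maxnorm (\<eta> *s \<zeta>) ^ \<nu>)))
     \<and> deriv_eta P \<in> Ncl \<Omega> S}"

text \<open>Equality of formal symbols over \<open>\<Omega>\<close>: since \<open>d\<close> and \<open>\<rho>\<close> are not fixed, two formal series
  are the same symbol if all coefficients agree on \<open>\<Omega>\<^sub>\<rho>[d\<^sub>\<rho>] \<times> S\<close> for some common \<open>d\<close>, \<open>\<rho>\<close>.\<close>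

definition symb_eq ::
  "((complex^'n) \<times> (complex^'n)) set \<Rightarrow> complex set \<Rightarrow> 'n fseries \<Rightarrow> 'n fseries \<Rightarrow> bool" where
  "symb_eq \<Omega> S P Q \<longleftrightarrow> (\<exists>d>0. \<exists>\<rho>. 0 < \<rho> \<and> \<rho> < 1 \<and>
     (\<forall>\<nu>. \<forall>(z, \<zeta>)\<in>symb_dom \<Omega> d \<rho>. \<forall>\<eta>\<in>S. P \<nu> z \<zeta> \<eta> = Q \<nu> z \<zeta> \<eta>))"


section \<open>The operator \<open>exp (t \<langle>\<partial>\<^sub>\<zeta>, \<partial>\<^sub>z\<rangle>)\<close>; adjoint and product\<close>

text \<open>\<open>\<langle>\<partial>\<^sub>\<zeta>, \<partial>\<^sub>z\<rangle> F = \<Sum>\<^sub>i \<partial>\<^sup>2F / \<partial>\<zeta>\<^sub>i\<partial>z\<^sub>i\<close>\<close>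

definition pair_deriv ::
  "(complex^'n \<Rightarrow> complex^'n \<Rightarrow> complex) \<Rightarrow> complex^'n \<Rightarrow> complex^'n \<Rightarrow> complex" where
  "pair_deriv F = (\<lambda>z \<zeta>. \<Sum>i\<in>UNIV.
     deriv (\<lambda>s. deriv (\<lambda>u. F (z + u *s axis i 1) (\<zeta> + s *s axis i 1)) 0) 0)"

text \<open>The coefficient of \<open>t\<^sup>\<nu>\<close> in \<open>exp (t \<langle>\<partial>\<^sub>\<zeta>, \<partial>\<^sub>z\<rangle>) (\<Sum>\<^sub>k t\<^sup>k F\<^sub>k)\<close>.\<close>

definition exp_pair ::
  "(nat \<Rightarrow> complex^'n \<Rightarrow> complex^'n \<Rightarrow> complex) \<Rightarrow> nat \<Rightarrow> complex^'n \<Rightarrow> complex^'n \<Rightarrow> complex" where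
  "exp_pair F \<nu> z \<zeta> = (\<Sum>k\<le>\<nu>. (pair_deriv ^^ k) (F (\<nu> - k)) z \<zeta> / fact k)"

definition adj :: "'n::finite fseries \<Rightarrow> 'n fseries" where
  "adj P = (\<lambda>\<nu> z \<zeta> \<eta>. exp_pair (\<lambda>k z \<zeta>. P k z (- \<zeta>) \<eta>) \<nu> z \<zeta>)"

definition symb_comp :: "'n::finite fseries \<Rightarrow> 'n fseries \<Rightarrow> 'n fseries" where
  "symb_comp Q P = (\<lambda>\<nu> z \<zeta> \<eta>.
     exp_pair (\<lambda>k z' \<zeta>'. \<Sum>j\<le>k. Q j z (\<zeta> + \<zeta>') \<eta> * P (k - j) (z + z') \<zeta> \<eta>) \<nu> 0 0)"


section \<open>Coordinate transformations\<close>

definition coord_change ::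
  "(complex^'n) set \<Rightarrow> (complex^'n) set \<Rightarrow> (complex^'n \<Rightarrow> complex^'n) \<Rightarrow>
     (complex^'n \<Rightarrow> complex^'n) \<Rightarrow> bool" where
  "coord_change W U \<Phi> \<Psi> \<longleftrightarrow> open W \<and> open U \<and> bij_betw \<Phi> W U \<and> (\<forall>w\<in>W. \<Psi> (\<Phi> w) = w) \<and>
     (\<forall>i. holo_on (*s) (\<lambda>w. \<Phi> w $ i) W) \<and> (\<forall>i. holo_on (*s) (\<lambda>z. \<Psi> z $ i) U)"

text \<open>\<open>J z' z\<close> is an admissible choice of \<open>J\<^sup>*\<^sub>\<Phi>(z', z)\<close>, where \<open>\<Psi>\<close> is the inverse of \<open>\<Phi>\<close>.\<close>

definition difference_matrix ::
  "(complex^'n) set \<Rightarrow> (complex^'n \<Rightarrow> complex^'n) \<Rightarrow>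
     (complex^'n \<Rightarrow> complex^'n \<Rightarrow> complex^'n^'n) \<Rightarrow> bool" where
  "difference_matrix U \<Psi> J \<longleftrightarrow> (\<exists>N. open N \<and> N \<subseteq> U \<times> U \<and> (\<forall>z\<in>U. (z, z) \<in> N) \<and>
     (\<forall>i j. holo_on scale2 (\<lambda>(z', z). J z' z $ i $ j) N) \<and>
     (\<forall>(z', z)\<in>N. \<Psi> z' - \<Psi> z = J z' z *v (z' - z)))"

text \<open>\<open>\<partial>z / \<partial>w\<close>, with entry \<open>\<partial>\<Phi>\<^sub>i / \<partial>w\<^sub>j\<close> in row \<open>i\<close>, column \<open>j\<close>.\<close>

definition cjacobian :: "(complex^'n \<Rightarrow> complex^'n) \<Rightarrow> complex^'n \<Rightarrow> complex^'n^'n" where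
  "cjacobian \<Phi> w = (\<chi> i j. deriv (\<lambda>s. \<Phi> (w + s *s axis j 1) $ i) 0)"

text \<open>\<open>\<Omega>\<close> expressed in the cotangent coordinates \<open>(w; \<mu>)\<close>: from \<open>\<Sum> \<zeta>\<^sub>i dz\<^sub>i = \<Sum> \<mu>\<^sub>j dw\<^sub>j\<close> one gets
  \<open>\<mu> = transpose (\<partial>z / \<partial>w) \<zeta>\<close>.\<close>

definition cotangent_coords ::
  "(complex^'n) set \<Rightarrow> (complex^'n \<Rightarrow> complex^'n) \<Rightarrow>
     ((complex^'n) \<times> (complex^'n)) set \<Rightarrow> ((complex^'n) \<times> (complex^'n)) set" where
  "cotangent_coords W \<Phi> \<Omega> =
     {(w, transpose (cjacobian \<Phi> w) *v \<zeta>) | w \<zeta>. w \<in> W \<and> (\<Phi> w, \<zeta>) \<in> \<Omega>}"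

definition symb_pullback ::
  "(complex^'n \<Rightarrow> complex^'n) \<Rightarrow> (complex^'n \<Rightarrow> complex^'n \<Rightarrow> complex^'n^'n) \<Rightarrow>
     'n fseries \<Rightarrow> 'n fseries" where
  "symb_pullback \<Phi> J P = (\<lambda>\<nu> w \<mu> \<eta>.
     exp_pair (\<lambda>k z' \<zeta>'. P k (\<Phi> w) (\<zeta>' + transpose (J (\<Phi> w + z') (\<Phi> w)) *v \<mu>) \<eta>) \<nu> 0 0)"

definition fun_mult :: "(complex^'n \<Rightarrow> complex) \<Rightarrow> 'n fseries \<Rightarrow> 'n fseries" where
  "fun_mult f P = (\<lambda>\<nu> z \<zeta> \<eta>. f z * P \<nu> z \<zeta> \<eta>)"

definition fun_symb :: "(complex^'n \<Rightarrow> complex) \<Rightarrow> 'n fseries" where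
  "fun_symb f = (\<lambda>\<nu> z \<zeta> \<eta>. if \<nu> = 0 then f z else 0)"

text \<open>
  An \<open>n\<close>-form \<open>\<omega>\<close> is evaluated at a point and at \<open>n\<close> vectors, given as the columns of a matrix
  \<open>V\<close>; so \<open>dz\<^sub>1 \<and> \<dots> \<and> dz\<^sub>n\<close> is the determinant. \<open>P \<otimes> \<omega>\<close> is the symbol-valued form
  \<open>V \<mapsto> \<omega>(V) P\<close>; \<open>\<Phi>\<^sup>*\<close> acts on both factors, and the adjoint acts on the values: it sends
  \<open>P \<otimes> dz\<close> to \<open>P\<^sup>* \<otimes> dz\<close>, as \<open>V\<close> is constant.
\<close>

type_synonym 'n cform = "complex^'n \<Rightarrow> complex^'n^'n \<Rightarrow> complex"

type_synonym 'n symb_form = "complex^'n^'n \<Rightarrow> 'n fseries"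

definition vol_form :: "'n::finite cform" where
  "vol_form z V = det V"

definition form_pullback :: "(complex^'n \<Rightarrow> complex^'n) \<Rightarrow> 'n cform \<Rightarrow> 'n cform" where
  "form_pullback \<Phi> \<omega> w V = \<omega> (\<Phi> w) (cjacobian \<Phi> w ** V)"

definition symb_tensor :: "'n::finite fseries \<Rightarrow> 'n cform \<Rightarrow> 'n symb_form" where
  "symb_tensor P \<omega> V = fun_mult (\<lambda>z. \<omega> z V) P"

definition tensor_pullback ::
  "(complex^'n \<Rightarrow> complex^'n) \<Rightarrow> (complex^'n \<Rightarrow> complex^'n \<Rightarrow> complex^'n^'n) \<Rightarrow>
     'n fseries \<Rightarrow> 'n cform \<Rightarrow> 'n symb_form" where
  "tensor_pullback \<Phi> J P \<omega> = symb_tensor (symb_pullback \<Phi> J P) (form_pullback \<Phi> \<omega>)"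

definition adj_form :: "'n::finite symb_form \<Rightarrow> 'n symb_form" where
  "adj_form F V = adj (F V)"

end

theory Submission
  imports Defs "HOL-Complex_Analysis.Complex_Analysis"
begin

text \<open>
  Adjoint, product and pull-back are all of the form: substitute into a function of possibly
  doubled variables, apply \<open>exp (t \<langle>\<partial>\<^sub>\<zeta>, \<partial>\<^sub>z\<rangle>)\<close>, restrict. An affine substitution conjugates such an
  exponential into another one, and exponentials of commuting operators multiply. This gives
  \<open>P\<^sup>*\<^sup>* = P\<close>, because the sign change of \<open>\<zeta>\<close> inverts the exponential, and the product rule,
  because in doubled variables both sides become the exponential of the same sum of four commuting operators.

  The symbol classes are preserved by Cauchy's inequality: giving up \<open>1 / k\<close> of the radius per
  derivative costs \<open>k ^ (2 k) / k!\<close> in the term of order \<open>k\<close>, which is at most \<open>k! e ^ (2 k)\<close>. For the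
  null class the same estimate is applied to the series of partial sums.

  For the coordinate change, the coefficient of \<open>t\<^sup>\<nu>\<close> at a point only involves a finite jet of \<open>P\<close>
  there, so \<open>P\<close> may be taken to be a polynomial in \<open>\<zeta>\<close> with coefficients depending on \<open>z\<close>. One then
  argues by induction, multiplying by one \<open>\<zeta>\<^sub>i\<close> at a time. The pull-back turns \<open>\<zeta>\<^sub>i\<close> into the vector
  field \<open>\<Sum>\<^sub>j (\<partial>w\<^sub>j / \<partial>z\<^sub>i) \<mu>\<^sub>j\<close>, and the Jacobian determinant \<open>D\<close> enters through the Piola identity
  \<open>\<Sum>\<^sub>j \<partial> (D \<partial>w\<^sub>j / \<partial>z\<^sub>i) / \<partial>w\<^sub>j = 0\<close>.
\<close>

section \<open>Complex normed spaces\<close>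

text \<open>The adjoint reverses products, and this shapes the induction over powers of
  \<open>\<zeta>\<close>. Multiplying \<open>P\<close> by \<open>\<zeta>\<^sub>i\<close> is
  composition with \<open>\<zeta>\<^sub>i\<close> on the right; taking adjoints turns it into
  composition with \<open>-\<zeta>\<^sub>i\<close> on the left. So the pull-back has to be known for
  left and for right multiplication by \<open>\<zeta>\<^sub>i\<close>. The right one leaves symbols
  composed on the right with the functions \<open>\<partial>w\<^sub>j / \<partial>z\<^sub>i\<close>,
  which the adjoint has to move to the left. For a coordinate function this is a commutator
  computation, hence it holds for polynomials; a general holomorphic function is replaced by a
  Taylor polynomial.

  Each coefficient of a symbol is holomorphic on a neighbourhood of its own, and the intersection of
  all of them need not be open. Identities are therefore proved for one power of \<open>t\<close> at
  a time, with the later coefficients replaced by zero. The operations act at fixed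
  \<open>\<eta>\<close>, so most identities are proved for functions of \<open>(z, \<zeta>)\<close>
  and on the square of that space.\<close>

class complex_space = real_normed_vector +
  fixes scaleC :: "complex \<Rightarrow> 'a \<Rightarrow> 'a" (infixr "*\<^sub>C" 75)
  assumes scaleC_add_right: "c *\<^sub>C (x + y) = c *\<^sub>C x + c *\<^sub>C y"
    and scaleC_add_left: "(a + b) *\<^sub>C x = a *\<^sub>C x + b *\<^sub>C x"
    and scaleC_scaleC: "a *\<^sub>C b *\<^sub>C x = (a * b) *\<^sub>C x"
    and scaleC_of_real: "complex_of_real r *\<^sub>C x = r *\<^sub>R x"
    and norm_scaleC: "norm (c *\<^sub>C x) = cmod c * norm x"

instantiation complex :: complex_space
begin
definition scaleC_complex :: "complex \<Rightarrow> complex \<Rightarrow> complex" where "scaleC_complex = (*)"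
instance
  by standard (auto simp: scaleC_complex_def algebra_simps norm_mult scaleR_conv_of_real)
end

instantiation prod :: (complex_space, complex_space) complex_space
begin
definition scaleC_prod :: "complex \<Rightarrow> 'a \<times> 'b \<Rightarrow> 'a \<times> 'b"
  where "scaleC_prod c x = (c *\<^sub>C fst x, c *\<^sub>C snd x)"
instance
proof
  fix c :: complex and x :: "'a \<times> 'b"
  have "norm (c *\<^sub>C x) = sqrt ((cmod c)\<^sup>2 * ((norm (fst x))\<^sup>2 + (norm (snd x))\<^sup>2))"
    by (simp add: scaleC_prod_def norm_prod_def norm_scaleC power_mult_distrib algebra_simps)
  then show "norm (c *\<^sub>C x) = cmod c * norm x"
    by (simp add: norm_prod_def real_sqrt_mult)
qed (auto simp: scaleC_prod_def scaleC_add_right scaleC_add_left scaleC_scaleC scaleC_of_real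
       scaleR_prod_def)
end

instantiation vec :: (complex_space, finite) complex_space
begin
definition scaleC_vec :: "complex \<Rightarrow> 'a ^ 'b \<Rightarrow> 'a ^ 'b"
  where "scaleC_vec c x = (\<chi> i. c *\<^sub>C (x $ i))"
instance
  by standard
    (auto simp: vec_eq_iff scaleC_vec_def scaleC_add_right scaleC_add_left scaleC_scaleC
      scaleC_of_real norm_scaleC norm_vec_def L2_set_right_distrib)
end

lemma scaleC_complex_eq [simp]: "c *\<^sub>C (x::complex) = c * x"
  by (simp add: scaleC_complex_def)

lemma scaleC_Pair [simp]: "c *\<^sub>C (x, y) = (c *\<^sub>C x, c *\<^sub>C y)"
  by (simp add: scaleC_prod_def)

lemma fst_scaleC [simp]: "fst (c *\<^sub>C x) = c *\<^sub>C fst x"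
  and snd_scaleC [simp]: "snd (c *\<^sub>C x) = c *\<^sub>C snd x"
  by (simp_all add: scaleC_prod_def)

lemma vec_nth_scaleC [simp]: "(c *\<^sub>C x) $ i = c *\<^sub>C (x $ i)"
  by (simp add: scaleC_vec_def)

lemma scaleC_vec_eq: "c *\<^sub>C (x::complex^'n) = c *s x"
  by (simp add: vec_eq_iff)

text \<open>Identifies the explicit scalings of the definitions with the class operation, so that
  one notion \<open>holo\<close> serves every space that occurs: base points, cotangent points,
  their squares, and triples with \<open>\<eta>\<close>.\<close>

lemma scale2_eq: "(scale2 :: _ \<Rightarrow> (complex^'n) \<times> (complex^'n) \<Rightarrow> _) = scaleC"
  by (auto simp: scale2_def fun_eq_iff scaleC_vec_eq)

lemma scale3_eq: "(scale3 :: _ \<Rightarrow> (complex^'n) \<times> (complex^'n) \<times> complex \<Rightarrow> _) = scaleC"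
  by (auto simp: scale3_def fun_eq_iff scaleC_vec_eq)

lemma vector_scale_eq: "((*s) :: _ \<Rightarrow> complex^'n \<Rightarrow> _) = scaleC"
  by (simp add: fun_eq_iff scaleC_vec_eq)

lemma bounded_bilinear_scaleC: "bounded_bilinear (scaleC :: complex \<Rightarrow> 'a::complex_space \<Rightarrow> 'a)"
proof
  show "\<exists>K. \<forall>a (b::'a). norm (a *\<^sub>C b) \<le> norm a * norm b * K"
    by (rule exI[of _ 1]) (simp add: norm_scaleC)
  fix r :: real and a :: complex and b :: 'a
  show "(r *\<^sub>R a) *\<^sub>C b = r *\<^sub>R (a *\<^sub>C b)"
    by (simp add: scaleR_conv_of_real flip: scaleC_scaleC scaleC_of_real)
  show "a *\<^sub>C (r *\<^sub>R b) = r *\<^sub>R (a *\<^sub>C b)"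
    by (simp add: scaleC_scaleC mult.commute flip: scaleC_of_real)
qed (simp_all add: scaleC_add_left scaleC_add_right)

lemmas has_derivative_scaleC = bounded_bilinear.FDERIV[OF bounded_bilinear_scaleC]
lemmas continuous_on_scaleC [continuous_intros] =
  bounded_bilinear.continuous_on[OF bounded_bilinear_scaleC]
lemmas bounded_linear_scaleC_left = bounded_bilinear.bounded_linear_left[OF bounded_bilinear_scaleC]
lemmas bounded_linear_scaleC_right = bounded_bilinear.bounded_linear_right[OF bounded_bilinear_scaleC]

lemma scaleC_zero_left [simp]: "0 *\<^sub>C (x::'a::complex_space) = 0"
  using bounded_bilinear.zero_left[OF bounded_bilinear_scaleC] .
lemma scaleC_zero_right [simp]: "c *\<^sub>C (0::'a::complex_space) = 0"
  using bounded_bilinear.zero_right[OF bounded_bilinear_scaleC] .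
lemma scaleC_minus_left [simp]: "(- c) *\<^sub>C x = - (c *\<^sub>C (x::'a::complex_space))"
  using bounded_bilinear.minus_left[OF bounded_bilinear_scaleC] .
lemma scaleC_minus_right [simp]: "c *\<^sub>C (- x) = - (c *\<^sub>C (x::'a::complex_space))"
  using bounded_bilinear.minus_right[OF bounded_bilinear_scaleC] .
lemma scaleC_one [simp]: "1 *\<^sub>C x = (x::'a::complex_space)"
  using scaleC_of_real[of 1 x] by simp


section \<open>Holomorphic functions and directional derivatives\<close>

definition holo_map :: "('a::complex_space \<Rightarrow> 'b::complex_space) \<Rightarrow> 'a set \<Rightarrow> bool" where
  "holo_map g U \<longleftrightarrow> (\<forall>x\<in>U. \<exists>D. (g has_derivative D) (at x) \<and> (\<forall>c v. D (c *\<^sub>C v) = c *\<^sub>C D v))"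

abbreviation holo :: "('a::complex_space \<Rightarrow> complex) \<Rightarrow> 'a set \<Rightarrow> bool" where
  "holo f U \<equiv> holo_on scaleC f U"

lemma holo_map_complex: "holo_map g U = holo g U"
  by (simp add: holo_map_def holo_on_def)

text \<open>A one-variable derivative along a complex line, defined for every function.
  \<open>pair_deriv\<close> is built from exactly these, so it can be rewritten as an operator on
  the product space without any hypothesis.\<close>

definition dirderiv :: "'a::complex_space \<Rightarrow> ('a \<Rightarrow> complex) \<Rightarrow> 'a \<Rightarrow> complex" where
  "dirderiv v f x = deriv (\<lambda>s. f (x + s *\<^sub>C v)) 0"

lemma holo_on_subset: "holo f X \<Longrightarrow> Y \<subseteq> X \<Longrightarrow> holo f Y"
  by (auto simp: holo_on_def)

lemma holo_map_subset: "holo_map f X \<Longrightarrow> Y \<subseteq> X \<Longrightarrow> holo_map f Y"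
  by (auto simp: holo_map_def)

lemma holo_map_continuous_on:
  assumes "holo_map g X"
  shows "continuous_on X g"
proof (rule continuous_at_imp_continuous_on, intro ballI)
  fix x assume "x \<in> X"
  then obtain D where "(g has_derivative D) (at x)" using assms by (auto simp: holo_map_def)
  then show "isCont g x" by (rule has_derivative_continuous)
qed

lemma holo_continuous_on: "holo f X \<Longrightarrow> continuous_on X f"
  using holo_map_continuous_on[of f X] by (simp add: holo_map_complex)

lemma holo_cong:
  assumes "open X" "\<And>x. x \<in> X \<Longrightarrow> f x = g x" "holo f X"
  shows "holo g X"
  unfolding holo_on_def
proof
  fix x assume x: "x \<in> X"
  with assms obtain D where D: "(f has_derivative D) (at x)" "\<forall>c v. D (c *\<^sub>C v) = c * D v"
    unfolding holo_on_def by blast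
  have "(g has_derivative D) (at x)"
    by (rule has_derivative_transform_within_open[OF D(1) assms(1) x]) (auto simp: assms(2))
  with D(2) show "\<exists>D. (g has_derivative D) (at x) \<and> (\<forall>c v. D (c *\<^sub>C v) = c * D v)" by blast
qed

lemma has_field_derivative_along_line:
  fixes f :: "'a::complex_space \<Rightarrow> complex"
  assumes "(f has_derivative D) (at (x + s *\<^sub>C v))" "\<And>c v. D (c *\<^sub>C v) = c * D v"
  shows "((\<lambda>s. f (x + s *\<^sub>C v)) has_field_derivative D v) (at s)"
proof -
  have "((\<lambda>s. x + s *\<^sub>C v) has_derivative (\<lambda>c. c *\<^sub>C v)) (at s)"
    by (auto intro!: derivative_eq_intros has_derivative_scaleC)
  from has_derivative_compose[OF this assms(1)]
  have "((\<lambda>s. f (x + s *\<^sub>C v)) has_derivative (\<lambda>c. c * D v)) (at s)"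
    by (simp add: assms(2))
  moreover have "(\<lambda>c. c * D v) = (*) (D v)" by (simp add: fun_eq_iff mult.commute)
  ultimately show ?thesis
    unfolding has_field_derivative_def by simp
qed

text \<open>A Frechet derivative is determined by its values on lines; hence \<open>dirderiv\<close>
  recovers it, and inherits complex linearity in the direction.\<close>

lemma holo_has_derivative:
  assumes "holo f X" "x \<in> X"
  shows "(f has_derivative (\<lambda>v. dirderiv v f x)) (at x)"
    and "dirderiv (c *\<^sub>C v) f x = c * dirderiv v f x"
    and "dirderiv (v + w) f x = dirderiv v f x + dirderiv w f x"
proof -
  obtain D where D: "(f has_derivative D) (at x)" "\<And>c v. D (c *\<^sub>C v) = c * D v"
    using assms unfolding holo_on_def by blast
  have eq: "dirderiv v f x = D v" for v
    unfolding dirderiv_def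
    by (intro DERIV_imp_deriv has_field_derivative_along_line) (use D in auto)
  show "(f has_derivative (\<lambda>v. dirderiv v f x)) (at x)"
    using D by (simp add: eq)
  show "dirderiv (c *\<^sub>C v) f x = c * dirderiv v f x"
    by (simp add: eq D)
  show "dirderiv (v + w) f x = dirderiv v f x + dirderiv w f x"
    using has_derivative_bounded_linear[OF D(1)] by (simp add: eq linear_simps)
qed

lemma dirderiv_unique:
  assumes "(f has_derivative D) (at x)" "\<And>c v. D (c *\<^sub>C v) = c * D v"
  shows "dirderiv v f x = D v"
  unfolding dirderiv_def
  by (intro DERIV_imp_deriv has_field_derivative_along_line) (use assms in auto)

lemma dirderiv_zero [simp]: "dirderiv 0 f x = 0"
  by (simp add: dirderiv_def)

lemma dirderiv_minus_dir:
  assumes "holo f X" "x \<in> X"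
  shows "dirderiv (- v) f x = - dirderiv v f x"
  using holo_has_derivative(2)[OF assms, of "-1" v] by simp

lemma dirderiv_sum_dir:
  assumes "holo f X" "x \<in> X"
  shows "dirderiv (\<Sum>i\<in>I. v i) f x = (\<Sum>i\<in>I. dirderiv (v i) f x)"
  by (induction I rule: infinite_finite_induct) (auto simp: holo_has_derivative(3)[OF assms])

lemma has_field_derivative_line:
  assumes "holo f X" "x + s *\<^sub>C v \<in> X"
  shows "((\<lambda>s. f (x + s *\<^sub>C v)) has_field_derivative dirderiv v f (x + s *\<^sub>C v)) (at s)"
  using holo_has_derivative(1,2)[OF assms] by (rule has_field_derivative_along_line)

lemma holomorphic_on_line:
  assumes "holo f X" "\<And>s. s \<in> T \<Longrightarrow> x + s *\<^sub>C v \<in> X"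
  shows "(\<lambda>s. f (x + s *\<^sub>C v)) holomorphic_on T"
  unfolding holomorphic_on_def field_differentiable_def
  using has_field_derivative_line[OF assms] has_field_derivative_at_within by blast

lemma dirderiv_cong:
  assumes "open X" "x \<in> X" "\<And>x. x \<in> X \<Longrightarrow> f x = g x"
  shows "dirderiv v f x = dirderiv v g x"
  unfolding dirderiv_def
proof (rule deriv_cong_ev)
  have "((\<lambda>s. x + s *\<^sub>C v) \<longlongrightarrow> x + 0 *\<^sub>C v) (nhds 0)"
    using bounded_linear.tendsto[OF bounded_linear_scaleC_left filterlim_ident]
    by (intro tendsto_intros)
  then have "\<forall>\<^sub>F s in nhds 0. x + s *\<^sub>C v \<in> X"
    using assms(1,2) by (simp add: topological_tendstoD)
  then show "\<forall>\<^sub>F s in nhds 0. f (x + s *\<^sub>C v) = g (x + s *\<^sub>C v)"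
    by eventually_elim (rule assms)
qed simp

text \<open>Substitution of an affine map needs no differentiability: both sides are the same
  one-variable derivative.\<close>

lemma dirderiv_affine:
  assumes "\<And>s. g (x + s *\<^sub>C v) = g x + s *\<^sub>C w"
  shows "dirderiv v (\<lambda>x. f (g x)) x = dirderiv w f (g x)"
  unfolding dirderiv_def assms by simp

section \<open>Cauchy estimates, and holomorphy and symmetry of derivatives\<close>

lemma norm_dirderiv_le:
  assumes "holo f X" "0 < r" "\<And>s. cmod s \<le> r \<Longrightarrow> x + s *\<^sub>C v \<in> X"
    and "\<And>s. cmod s = r \<Longrightarrow> cmod (f (x + s *\<^sub>C v)) \<le> B"
  shows "cmod (dirderiv v f x) \<le> B / r"
proof -
  have hol: "(\<lambda>s. f (x + s *\<^sub>C v)) holomorphic_on cball 0 r"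
    using assms by (intro holomorphic_on_line[OF assms(1)]) auto
  have "cmod ((deriv ^^ 1) (\<lambda>s. f (x + s *\<^sub>C v)) 0) \<le> fact 1 * B / r ^ 1"
    by (rule Cauchy_inequality)
      (use assms hol in \<open>auto intro: holomorphic_on_subset holomorphic_on_imp_continuous_on\<close>)
  then show ?thesis by (simp add: dirderiv_def)
qed

text \<open>Cauchy's inequality on the circle of radius \<open>r\<close> bounds the coefficients by
  \<open>B / r ^ k\<close>. At the point 1 the tail is then dominated by a geometric series of ratio
  \<open>1 / r\<close>, and \<open>2 \<le> r\<close> bounds its sum by twice the first term.\<close>

lemma taylor_remainder_bound:
  assumes "g holomorphic_on ball 0 R" "2 \<le> r" "r < R"
    and "\<And>s. cmod s < R \<Longrightarrow> cmod (g s) \<le> B"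
  shows "cmod (g 1 - (\<Sum>k<m. (deriv ^^ k) g 0 / fact k)) \<le> 2 * B / r ^ m"
proof -
  define a where "a k = (deriv ^^ k) g 0 / fact k" for k
  have B: "B \<ge> 0" using assms(4)[of 0] assms(2,3) norm_ge_zero[of "g 0"] by (simp del: norm_ge_zero)
  have bound: "cmod (a k) \<le> B / r ^ k" for k
  proof -
    have "cmod ((deriv ^^ k) g 0) \<le> fact k * B / r ^ k"
      by (rule Cauchy_inequality)
        (use assms in \<open>auto intro!: holomorphic_on_imp_continuous_on intro: holomorphic_on_subset\<close>)
    then show ?thesis by (simp add: a_def norm_divide field_simps)
  qed
  have "(\<lambda>k. a k * (1 - 0) ^ k) sums g 1"
    unfolding a_def by (rule holomorphic_power_series[OF assms(1)]) (use assms in auto)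
  then have sums: "a sums g 1" by simp
  have *: "(\<lambda>k. a (k + m)) sums (g 1 - (\<Sum>k<m. a k))"
    using sums_split_initial_segment[OF sums] by simp
  have geo: "(\<lambda>k. B / r ^ m * (1 / r) ^ k) sums (B / r ^ m * (1 / (1 - 1 / r)))"
    by (intro sums_mult geometric_sums) (use assms in auto)
  have "cmod (g 1 - (\<Sum>k<m. a k)) \<le> B / r ^ m * (1 / (1 - 1 / r))"
  proof (rule norm_sums_le[OF * geo])
    show "norm (a (k + m)) \<le> B / r ^ m * (1 / r) ^ k" for k
      using bound[of "k + m"] by (simp add: power_add power_divide field_simps)
  qed
  also have "\<dots> \<le> B / r ^ m * 2"
    by (intro mult_left_mono) (use assms B in \<open>auto simp: field_simps\<close>)
  finally show ?thesis unfolding a_def by (simp add: mult.commute)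
qed

text \<open>The one-variable Taylor bound along the line through \<open>y\<close> and
  \<open>y + h\<close>, to second order, with \<open>r = \<rho> / (2 * norm h)\<close>. The constant
  depends only on the radius and the bound for \<open>f\<close>, so the estimate is uniform in the
  centre; this uniformity is what lets derivatives be differentiated below.\<close>

lemma holo_remainder_bound:
  assumes hf: "holo f X" and sub: "ball y \<rho> \<subseteq> X" and \<rho>: "0 < \<rho>" and h: "norm h \<le> \<rho> / 4"
    and bd: "\<And>x. x \<in> ball y \<rho> \<Longrightarrow> cmod (f x) \<le> B"
  shows "cmod (f (y + h) - f y - dirderiv h f y) \<le> 8 * B / \<rho>\<^sup>2 * (norm h)\<^sup>2"
proof (cases "h = 0")
  case True
  then show ?thesis by simp
next
  case False
  let ?g = "\<lambda>s. f (y + s *\<^sub>C h)"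
  have mem: "y + s *\<^sub>C h \<in> ball y \<rho>" if "cmod s < \<rho> / norm h" for s
    using that False by (simp add: dist_norm norm_scaleC field_simps)
  have "cmod (?g 1 - (\<Sum>k<2. (deriv ^^ k) ?g 0 / fact k)) \<le> 2 * B / (\<rho> / (2 * norm h)) ^ 2"
  proof (rule taylor_remainder_bound)
    show "?g holomorphic_on ball 0 (\<rho> / norm h)"
      by (rule holomorphic_on_line[OF hf]) (use mem sub in auto)
  qed (use False h \<rho> mem bd in \<open>auto simp: field_simps\<close>)
  then show ?thesis
    by (simp add: numeral_2_eq_2 dirderiv_def field_simps)
qed

lemma holo_locally_bounded:
  assumes "holo f X" "open X" "x \<in> X"
  obtains \<rho> B where "0 < \<rho>" "0 \<le> B" "ball x \<rho> \<subseteq> X" "\<And>y. y \<in> ball x \<rho> \<Longrightarrow> cmod (f y) \<le> B"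
proof -
  have "isCont f x"
    using holo_continuous_on[OF assms(1)] assms(2,3) continuous_on_eq_continuous_at by blast
  then obtain d where d: "d > 0" "\<And>y. dist y x < d \<Longrightarrow> dist (f y) (f x) < 1"
    unfolding continuous_at_eps_delta by (meson zero_less_one)
  obtain e where e: "e > 0" "ball x e \<subseteq> X" using assms(2,3) openE by blast
  show ?thesis
  proof (rule that[of "min d e" "cmod (f x) + 1"])
    show "cmod (f y) \<le> cmod (f x) + 1" if "y \<in> ball x (min d e)" for y
      using d(2)[of y] that norm_triangle_ineq2[of "f y" "f x"] by (auto simp: dist_norm norm_minus_commute)
  qed (use d e in auto)
qed

text \<open>The difference quotients with step \<open>1 / (n + 1)\<close> are continuous, and by the
  quadratic remainder they converge locally uniformly with error of order
  \<open>1 / (n + 1)\<close>.\<close>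

lemma continuous_dirderiv:
  assumes hf: "holo f X" and X: "open X"
  shows "continuous_on X (dirderiv h f)"
proof (rule continuous_at_imp_continuous_on, intro ballI)
  fix x assume x: "x \<in> X"
  obtain \<rho> B where \<rho>: "0 < \<rho>" "0 \<le> B" "ball x \<rho> \<subseteq> X" "\<And>y. y \<in> ball x \<rho> \<Longrightarrow> cmod (f y) \<le> B"
    using holo_locally_bounded[OF hf X x] by blast
  define F where "F n y = of_nat (Suc n) * (f (y + (1 / of_nat (Suc n)) *\<^sub>C h) - f y)" for n y
  define K where "K = 8 * B / (\<rho>/2)\<^sup>2 * (norm h)\<^sup>2"
  have sub: "ball y (\<rho>/2) \<subseteq> ball x \<rho>" if "y \<in> ball x (\<rho>/2)" for y
  proof
    fix z assume "z \<in> ball y (\<rho>/2)"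
    with that dist_triangle[of x z y] show "z \<in> ball x \<rho>" by simp
  qed
  have lim0: "(\<lambda>n. norm h / real (Suc n)) \<longlonglongrightarrow> 0"
    by (rule LIMSEQ_Suc[OF lim_const_over_n]) 
  have ev: "\<forall>\<^sub>F n in sequentially. norm h / real (Suc n) < \<rho> / 8"
    by (rule order_tendstoD(2)[OF lim0]) (use \<rho> in auto)
  have bound: "cmod (F n y - dirderiv h f y) \<le> K / real (Suc n)"
    if n: "norm h / real (Suc n) < \<rho> / 8" and y: "y \<in> ball x (\<rho>/2)" for n y
  proof -
    let ?c = "1 / of_nat (Suc n) :: complex"
    have "cmod (f (y + ?c *\<^sub>C h) - f y - dirderiv (?c *\<^sub>C h) f y)
        \<le> 8 * B / (\<rho>/2)\<^sup>2 * (norm (?c *\<^sub>C h))\<^sup>2"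
      by (rule holo_remainder_bound[OF hf])
        (use sub[OF y] \<rho> n in \<open>auto simp: norm_scaleC norm_divide simp del: of_nat_Suc\<close>)
    also have "dirderiv (?c *\<^sub>C h) f y = ?c * dirderiv h f y"
      using sub[OF y] \<rho> y by (intro holo_has_derivative(2)[OF hf]) auto
    also have "8 * B / (\<rho>/2)\<^sup>2 * (norm (?c *\<^sub>C h))\<^sup>2 = K * (1 / real (Suc n))\<^sup>2"
      by (simp add: K_def norm_scaleC norm_divide power_mult_distrib power_divide del: of_nat_Suc)
    finally have "cmod (of_nat (Suc n)) * cmod (f (y + ?c *\<^sub>C h) - f y - ?c * dirderiv h f y)
        \<le> real (Suc n) * (K * (1 / real (Suc n))\<^sup>2)"
      unfolding norm_of_nat by (rule mult_left_mono) simp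
    also have "\<dots> = K / real (Suc n)" by (simp add: power2_eq_square del: of_nat_Suc)
    also have "cmod (of_nat (Suc n)) * cmod (f (y + ?c *\<^sub>C h) - f y - ?c * dirderiv h f y)
        = cmod (F n y - dirderiv h f y)"
      unfolding F_def norm_mult[symmetric]
      by (simp add: right_diff_distrib del: of_nat_Suc)
    finally show ?thesis .
  qed
  have ul: "uniform_limit (ball x (\<rho>/2)) F (dirderiv h f) sequentially"
  proof (rule uniform_limitI)
    fix e :: real assume "e > 0"
    have "(\<lambda>n. K / real (Suc n)) \<longlonglongrightarrow> 0" by (rule LIMSEQ_Suc[OF lim_const_over_n])
    then have "\<forall>\<^sub>F n in sequentially. K / real (Suc n) < e"
      using \<open>e > 0\<close> by (rule order_tendstoD(2))
    with ev show "\<forall>\<^sub>F n in sequentially. \<forall>y\<in>ball x (\<rho>/2). dist (F n y) (dirderiv h f y) < e"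
      by eventually_elim (use bound in \<open>fastforce simp: dist_norm\<close>)
  qed
  have "continuous_on (ball x (\<rho>/2)) (dirderiv h f)"
  proof (rule uniform_limit_theorem[OF _ ul])
    have cf: "continuous_on (ball x \<rho>) f"
      using holo_continuous_on[OF hf] \<rho>(3) continuous_on_subset by blast
    show "\<forall>\<^sub>F n in sequentially. continuous_on (ball x (\<rho>/2)) (F n)"
      using ev
    proof eventually_elim
      case (elim n)
      have "(\<lambda>y. y + (1 / of_nat (Suc n)) *\<^sub>C h) ` ball x (\<rho>/2) \<subseteq> ball x \<rho>"
      proof clarify
        fix y assume "y \<in> ball x (\<rho>/2)"
        then have "dist x y < \<rho>/2" by simp
        moreover have "dist y (y + (1 / of_nat (Suc n)) *\<^sub>C h) < \<rho>/8"
          using elim by (simp add: dist_norm norm_scaleC norm_divide del: of_nat_Suc)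
        ultimately show "y + (1 / of_nat (Suc n)) *\<^sub>C h \<in> ball x \<rho>"
          using dist_triangle[of x "y + (1 / of_nat (Suc n)) *\<^sub>C h" y] \<rho> by simp
      qed
      then have "continuous_on (ball x (\<rho>/2)) (\<lambda>y. f (y + (1 / of_nat (Suc n)) *\<^sub>C h))"
        by (intro continuous_on_compose2[OF cf] continuous_intros) auto
      moreover have "continuous_on (ball x (\<rho>/2)) f"
        by (rule continuous_on_subset[OF cf]) (use \<rho> in auto)
      ultimately show ?case unfolding F_def by (intro continuous_intros)
    qed
  qed simp
  moreover have "x \<in> ball x (\<rho>/2)" using \<rho> by simp
  ultimately show "isCont (dirderiv h f) x"
    by (simp only: continuous_on_eq_continuous_at[OF open_ball])
qed

text \<open>Writes a derivative as an integral of values of \<open>f\<close>, so that estimates for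
  \<open>f\<close> on a circle carry over to its derivative.\<close>

lemma dirderiv_cauchy_integral:
  assumes hf: "holo f X" and "0 < \<delta>" and sub: "\<And>u. cmod u \<le> \<delta> \<Longrightarrow> x + u *\<^sub>C v \<in> X" and X: "open X"
  shows "((\<lambda>u. f (x + u *\<^sub>C v) / u\<^sup>2) has_contour_integral 2 * of_real pi * \<i> * dirderiv v f x)
    (circlepath 0 \<delta>)"
proof -
  have c: "continuous_on (cball 0 \<delta>) (\<lambda>u. f (x + u *\<^sub>C v))"
    and h: "(\<lambda>u. f (x + u *\<^sub>C v)) holomorphic_on ball 0 \<delta>"
    using sub by (auto intro!: holomorphic_on_line[OF hf] holomorphic_on_imp_continuous_on)
  have 0: "0 \<in> ball 0 \<delta>" using assms by simp
  show ?thesis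
    using has_contour_integral_integral[OF Cauchy_derivative_integral_circlepath(1)[OF c h 0]]
      Cauchy_contour_integral_circlepath_2[OF c h 0]
    by (simp add: dirderiv_def)
qed

text \<open>Differentiation under the Cauchy integral. The candidate for the derivative of
  \<open>dirderiv v f\<close> in direction \<open>h\<close> is the Cauchy integral of
  \<open>dirderiv h f\<close> along \<open>v\<close>, which exists by continuity. The quadratic
  remainder of \<open>f\<close>, uniform on the circle, integrates to a quadratic remainder for
  \<open>dirderiv v f\<close>. The integral formula for \<open>D\<close> is kept in the conclusion
  because it yields the symmetry of second derivatives.\<close>

lemma holo_dirderiv_aux:
  assumes hf: "holo f X" and X: "open X" and x: "x \<in> X"
  shows "\<exists>D. (dirderiv v f has_derivative D) (at x) \<and> (\<forall>c h. D (c *\<^sub>C h) = c * D h) \<and>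
    (\<forall>w. \<exists>\<delta>>0. (\<forall>u. cmod u \<le> \<delta> \<longrightarrow> x + u *\<^sub>C v \<in> X) \<and>
    ((\<lambda>u. dirderiv w f (x + u *\<^sub>C v) / u\<^sup>2) has_contour_integral 2 * of_real pi * \<i> * D w) (circlepath 0 \<delta>))"
proof -
  obtain r B where r: "0 < r" "0 \<le> B" "ball x r \<subseteq> X" "\<And>y. y \<in> ball x r \<Longrightarrow> cmod (f y) \<le> B"
    using holo_locally_bounded[OF hf X x] by blast
  \<comment> \<open>\<open>\<delta>\<close> keeps the circle within distance \<open>\<rho>\<close>
    of \<open>x\<close>; balls of radius \<open>\<rho>\<close> about its points then stay where
    \<open>f\<close> is bounded. The summand 1 in the denominator allows
    \<open>v = 0\<close>.\<close>
  define \<rho> where "\<rho> = r / 4"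
  define \<delta> where "\<delta> = \<rho> / (norm v + 1)"
  have \<rho>: "0 < \<rho>" using r by (simp add: \<rho>_def)
  have \<delta>: "0 < \<delta>" using \<rho> by (simp add: \<delta>_def add_nonneg_pos)
  have small: "norm (u *\<^sub>C v) \<le> \<rho>" if "cmod u \<le> \<delta>" for u
  proof -
    have "cmod u * norm v \<le> \<delta> * (norm v + 1)"
      using that \<delta> by (intro mult_mono) auto
    moreover have "\<delta> * (norm v + 1) = \<rho>"
      unfolding \<delta>_def by (metis add.commute add_pos_nonneg divide_self_if mult.commute nonzero_eq_divide_eq norm_ge_zero order_less_irrefl zero_less_one)
    ultimately show ?thesis by (simp add: norm_scaleC)
  qed
  have sub: "ball (x + u *\<^sub>C v) \<rho> \<subseteq> ball x r" if "cmod u \<le> \<delta>" for u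
  proof
    fix z assume "z \<in> ball (x + u *\<^sub>C v) \<rho>"
    then show "z \<in> ball x r"
      using dist_triangle[of x z "x + u *\<^sub>C v"] small[OF that] \<rho> by (simp add: \<rho>_def dist_norm)
  qed
  have inX: "x + u *\<^sub>C v \<in> X" if "cmod u \<le> \<delta>" for u
    using sub[OF that] r(3) \<rho> by (meson centre_in_ball subsetD)
  have inX': "x + h + u *\<^sub>C v \<in> X" if "cmod u \<le> \<delta>" "norm h \<le> \<rho> / 4" for u h
  proof -
    have "x + h + u *\<^sub>C v \<in> ball (x + u *\<^sub>C v) \<rho>" using that \<rho> by (simp add: dist_norm)
    then show ?thesis using sub[OF that(1)] r(3) by blast
  qed
  define I where "I w = contour_integral (circlepath 0 \<delta>) (\<lambda>u. dirderiv w f (x + u *\<^sub>C v) / u\<^sup>2)" for w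
  have I: "((\<lambda>u. dirderiv w f (x + u *\<^sub>C v) / u\<^sup>2) has_contour_integral I w) (circlepath 0 \<delta>)" for w
    unfolding I_def
  proof (intro has_contour_integral_integral contour_integrable_continuous_circlepath continuous_intros)
    show "continuous_on (path_image (circlepath 0 \<delta>)) (\<lambda>u. dirderiv w f (x + u *\<^sub>C v))"
      by (rule continuous_on_compose2[OF continuous_dirderiv[OF hf X]])
        (use inX \<delta> in \<open>auto intro!: continuous_intros\<close>)
  qed (use \<delta> in auto)
  have I_add: "I (w + w') = I w + I w'" for w w'
  proof (rule has_contour_integral_unique[OF I])
    show "((\<lambda>u. dirderiv (w + w') f (x + u *\<^sub>C v) / u\<^sup>2) has_contour_integral I w + I w') (circlepath 0 \<delta>)"
      by (rule has_contour_integral_eq[OF has_contour_integral_add[OF I[of w] I[of w']]])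
        (use inX \<delta> in \<open>auto simp: holo_has_derivative(3)[OF hf] add_divide_distrib\<close>)
  qed
  have I_scale: "I (c *\<^sub>C w) = c * I w" for c w
  proof (rule has_contour_integral_unique[OF I])
    show "((\<lambda>u. dirderiv (c *\<^sub>C w) f (x + u *\<^sub>C v) / u\<^sup>2) has_contour_integral c * I w) (circlepath 0 \<delta>)"
      by (rule has_contour_integral_eq[OF has_contour_integral_lmul[OF I[of w], of c]])
        (use inX \<delta> in \<open>auto simp: holo_has_derivative(2)[OF hf]\<close>)
  qed
  define K where "K = 8 * B / \<rho>\<^sup>2 / \<delta>\<^sup>2 * (2 * pi * \<delta>)"
  have K: "K \<ge> 0" using r \<delta> by (simp add: K_def)
  define c where "c = 2 * of_real pi * \<i>"
  have c0: "c \<noteq> 0" by (simp add: c_def)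
  have main: "cmod (c * dirderiv v f (x + h) - c * dirderiv v f x - I h) \<le> K * (norm h)\<^sup>2"
    if h: "norm h \<le> \<rho> / 4" for h
  proof -
    have i1: "((\<lambda>u. f (x + h + u *\<^sub>C v) / u\<^sup>2) has_contour_integral c * dirderiv v f (x + h)) (circlepath 0 \<delta>)"
      unfolding c_def by (rule dirderiv_cauchy_integral[OF hf \<delta> _ X]) (use inX' h in auto)
    have i2: "((\<lambda>u. f (x + u *\<^sub>C v) / u\<^sup>2) has_contour_integral c * dirderiv v f x) (circlepath 0 \<delta>)"
      unfolding c_def by (rule dirderiv_cauchy_integral[OF hf \<delta> _ X]) (use inX in auto)
    have "cmod (c * dirderiv v f (x + h) - c * dirderiv v f x - I h)
        \<le> 8 * B / \<rho>\<^sup>2 / \<delta>\<^sup>2 * (norm h)\<^sup>2 * (2 * pi * \<delta>)"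
    proof (rule has_contour_integral_bound_circlepath[OF has_contour_integral_diff[OF has_contour_integral_diff[OF i1 i2] I]])
      fix u :: complex assume u: "cmod (u - 0) = \<delta>"
      then have u': "cmod u \<le> \<delta>" by simp
      have "cmod (f (x + u *\<^sub>C v + h) - f (x + u *\<^sub>C v) - dirderiv h f (x + u *\<^sub>C v))
          \<le> 8 * B / \<rho>\<^sup>2 * (norm h)\<^sup>2"
        by (rule holo_remainder_bound[OF hf _ \<rho> h]) (use sub[OF u'] r(3,4) in auto)
      then have "cmod (f (x + u *\<^sub>C v + h) - f (x + u *\<^sub>C v) - dirderiv h f (x + u *\<^sub>C v)) / \<delta>\<^sup>2
          \<le> 8 * B / \<rho>\<^sup>2 * (norm h)\<^sup>2 / \<delta>\<^sup>2"
        by (rule divide_right_mono) simp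
      moreover have "f (x + h + u *\<^sub>C v) / u\<^sup>2 - f (x + u *\<^sub>C v) / u\<^sup>2 - dirderiv h f (x + u *\<^sub>C v) / u\<^sup>2
        = (f (x + u *\<^sub>C v + h) - f (x + u *\<^sub>C v) - dirderiv h f (x + u *\<^sub>C v)) / u\<^sup>2"
        by (simp add: diff_divide_distrib add_ac)
      ultimately show "cmod (f (x + h + u *\<^sub>C v) / u\<^sup>2 - f (x + u *\<^sub>C v) / u\<^sup>2 - dirderiv h f (x + u *\<^sub>C v) / u\<^sup>2)
          \<le> 8 * B / \<rho>\<^sup>2 / \<delta>\<^sup>2 * (norm h)\<^sup>2"
        using u by (simp add: norm_divide norm_power mult_ac)
    qed (use r \<delta> in auto)
    then show ?thesis by (simp add: K_def mult_ac)
  qed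
  have bl: "bounded_linear I"
  proof
    show "I (r *\<^sub>R w) = r *\<^sub>R I w" for r w
      using I_scale[of "of_real r" w] by (simp add: scaleC_of_real scaleR_conv_of_real)
    show "\<exists>K. \<forall>w. norm (I w) \<le> norm w * K"
    proof (intro exI allI)
      fix w
      have "cmod (I w) \<le> (4 * B / \<rho>) / \<delta>\<^sup>2 * norm w * (2 * pi * \<delta>)"
      proof (rule has_contour_integral_bound_circlepath[OF I])
        fix u :: complex assume u: "cmod (u - 0) = \<delta>"
        then have u': "cmod u \<le> \<delta>" by simp
        have "cmod (dirderiv w f (x + u *\<^sub>C v)) \<le> 4 * B / \<rho> * norm w"
        proof (cases "w = 0")
          case False
          have "x + u *\<^sub>C v + s *\<^sub>C w \<in> ball x r" if "cmod s \<le> \<rho> / (4 * norm w)" for s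
          proof -
            have "x + u *\<^sub>C v + s *\<^sub>C w \<in> ball (x + u *\<^sub>C v) \<rho>"
              using that False \<rho> by (simp add: dist_norm norm_scaleC field_simps)
            then show ?thesis using sub[OF u'] by blast
          qed
          then have "cmod (dirderiv w f (x + u *\<^sub>C v)) \<le> B / (\<rho> / (4 * norm w))"
            by (intro norm_dirderiv_le[OF hf]) (use r \<rho> False in auto)
          then show ?thesis by (simp add: mult_ac)
        qed simp
        then have "cmod (dirderiv w f (x + u *\<^sub>C v)) / \<delta>\<^sup>2 \<le> 4 * B / \<rho> * norm w / \<delta>\<^sup>2"
          by (rule divide_right_mono) simp
        then show "cmod (dirderiv w f (x + u *\<^sub>C v) / u\<^sup>2) \<le> 4 * B / \<rho> / \<delta>\<^sup>2 * norm w"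
          using u by (simp add: norm_divide norm_power mult_ac)
      qed (use r \<rho> \<delta> in auto)
      then show "cmod (I w) \<le> norm w * ((4 * B / \<rho>) / \<delta>\<^sup>2 * (2 * pi * \<delta>))"
        by (simp add: mult_ac)
    qed
  qed (rule I_add)
  have deriv: "((\<lambda>y. c * dirderiv v f y) has_derivative I) (at x)"
    unfolding has_derivative_at
  proof (intro conjI bl)
    show "(\<lambda>h. norm (c * dirderiv v f (x + h) - c * dirderiv v f x - I h) / norm h) \<midarrow>0\<rightarrow> 0"
    proof (rule tendsto_sandwich[of "\<lambda>_. 0" _ _ "\<lambda>h. K * norm h"])
      have "\<forall>\<^sub>F h in at 0. norm (h::'a) < \<rho> / 4"
        using \<rho> unfolding eventually_at by (intro exI[of _ "\<rho>/4"]) (auto simp: dist_norm)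
      then show "\<forall>\<^sub>F h in at 0. norm (c * dirderiv v f (x + h) - c * dirderiv v f x - I h) / norm h \<le> K * norm h"
      proof eventually_elim
        case (elim h)
        then show ?case
          using main[of h] by (cases "h = 0") (auto simp: field_simps power2_eq_square)
      qed
      show "(\<lambda>h::'a. K * norm h) \<midarrow>0\<rightarrow> 0"
        by (intro tendsto_mult_right_zero tendsto_norm_zero tendsto_ident_at)
    qed auto
  qed
  have "((\<lambda>y. (1 / c) * (c * dirderiv v f y)) has_derivative (\<lambda>h. (1 / c) * I h)) (at x)"
    by (rule has_derivative_mult_right[OF deriv])
  then have *: "(dirderiv v f has_derivative (\<lambda>h. (1 / c) * I h)) (at x)"
    using c0 by simp
  show ?thesis
  proof (intro exI[of _ "\<lambda>h. (1 / c) * I h"] conjI allI)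
    show "\<exists>\<delta>>0. (\<forall>u. cmod u \<le> \<delta> \<longrightarrow> x + u *\<^sub>C v \<in> X) \<and>
         ((\<lambda>u. dirderiv w f (x + u *\<^sub>C v) / u\<^sup>2) has_contour_integral
          2 * complex_of_real pi * \<i> * (1 / c * I w)) (circlepath 0 \<delta>)" for w
      using I[of w] c0 \<delta> inX by (intro exI[of _ \<delta>]) (simp add: c_def)
  qed (use * in \<open>auto simp: I_scale\<close>)
qed

lemma holo_dirderiv:
  assumes "holo f X" "open X"
  shows "holo (dirderiv v f) X"
  using holo_dirderiv_aux[OF assms] unfolding holo_on_def by blast

text \<open>Both iterated derivatives are given by one and the same Cauchy integral: that of
  \<open>dirderiv w f\<close> on a circle in direction \<open>v\<close>.\<close>

lemma dirderiv_commute: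
  assumes hf: "holo f X" and X: "open X" and x: "x \<in> X"
  shows "dirderiv w (dirderiv v f) x = dirderiv v (dirderiv w f) x"
proof -
  obtain D where D: "(dirderiv v f has_derivative D) (at x)" "\<And>c h. D (c *\<^sub>C h) = c * D h"
    and "\<exists>\<delta>>0. (\<forall>u. cmod u \<le> \<delta> \<longrightarrow> x + u *\<^sub>C v \<in> X) \<and> ((\<lambda>u. dirderiv w f (x + u *\<^sub>C v) / u\<^sup>2) has_contour_integral
      2 * of_real pi * \<i> * D w) (circlepath 0 \<delta>)"
    using holo_dirderiv_aux[OF assms] by blast
  then obtain \<delta> where \<delta>: "\<delta> > 0" "\<And>u. cmod u \<le> \<delta> \<Longrightarrow> x + u *\<^sub>C v \<in> X"
    "((\<lambda>u. dirderiv w f (x + u *\<^sub>C v) / u\<^sup>2) has_contour_integral 2 * of_real pi * \<i> * D w) (circlepath 0 \<delta>)"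
    by blast
  have "((\<lambda>u. dirderiv w f (x + u *\<^sub>C v) / u\<^sup>2) has_contour_integral
      2 * of_real pi * \<i> * dirderiv v (dirderiv w f) x) (circlepath 0 \<delta>)"
    by (rule dirderiv_cauchy_integral[OF holo_dirderiv[OF hf X] \<delta>(1,2) X])
  from has_contour_integral_unique[OF this \<delta>(3)] have "dirderiv v (dirderiv w f) x = D w" by simp
  with dirderiv_unique[OF D] show ?thesis by simp
qed

section \<open>Sums and products of holomorphic functions\<close>

lemma holo_const [simp, intro]: "holo (\<lambda>x. c) X"
  unfolding holo_on_def by (auto intro!: exI[of _ "\<lambda>_. 0"])

lemma dirderiv_const [simp]: "dirderiv v (\<lambda>x. c) = (\<lambda>x. 0)"
  by (simp add: dirderiv_def fun_eq_iff)

lemma holo_add_aux: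
  assumes "holo f X" "holo g X" "x \<in> X"
  shows "((\<lambda>x. f x + g x) has_derivative (\<lambda>v. dirderiv v f x + dirderiv v g x)) (at x)"
    and "((\<lambda>x. f x * g x) has_derivative (\<lambda>v. f x * dirderiv v g x + dirderiv v f x * g x)) (at x)"
  using holo_has_derivative(1)[OF assms(1,3)] holo_has_derivative(1)[OF assms(2,3)]
  by (auto intro!: derivative_eq_intros)

lemma holo_add [intro]:
  assumes "holo f X" "holo g X" shows "holo (\<lambda>x. f x + g x) X"
  unfolding holo_on_def
  using holo_add_aux(1)[OF assms] holo_has_derivative(2)[OF assms(1)] holo_has_derivative(2)[OF assms(2)]
  by (intro ballI exI conjI) (auto simp: algebra_simps)

lemma holo_mult [intro]:
  assumes "holo f X" "holo g X" shows "holo (\<lambda>x. f x * g x) X"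
  unfolding holo_on_def
  using holo_add_aux(2)[OF assms] holo_has_derivative(2)[OF assms(1)] holo_has_derivative(2)[OF assms(2)]
  by (intro ballI exI conjI) (auto simp: algebra_simps)

lemma dirderiv_add:
  assumes "holo f X" "holo g X" "x \<in> X"
  shows "dirderiv v (\<lambda>x. f x + g x) x = dirderiv v f x + dirderiv v g x"
  by (rule dirderiv_unique[OF holo_add_aux(1)[OF assms]])
    (simp add: algebra_simps holo_has_derivative(2)[OF assms(1,3)] holo_has_derivative(2)[OF assms(2,3)])

lemma dirderiv_mult:
  assumes "holo f X" "holo g X" "x \<in> X"
  shows "dirderiv v (\<lambda>x. f x * g x) x = f x * dirderiv v g x + dirderiv v f x * g x"
  by (rule dirderiv_unique[OF holo_add_aux(2)[OF assms]])
    (simp add: algebra_simps holo_has_derivative(2)[OF assms(1,3)] holo_has_derivative(2)[OF assms(2,3)])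

lemma holo_cmult [intro]: "holo f X \<Longrightarrow> holo (\<lambda>x. c * f x) X"
  by auto

lemma dirderiv_cmult: "holo f X \<Longrightarrow> x \<in> X \<Longrightarrow> dirderiv v (\<lambda>x. c * f x) x = c * dirderiv v f x"
  using dirderiv_mult[OF holo_const, of f X x v c] by simp

lemma holo_minus [intro]: "holo f X \<Longrightarrow> holo (\<lambda>x. - f x) X"
  using holo_cmult[of f X "-1"] by simp

lemma holo_diff [intro]: "holo f X \<Longrightarrow> holo g X \<Longrightarrow> holo (\<lambda>x. f x - g x) X"
  using holo_add[of f X "\<lambda>x. - g x"] by auto

lemma dirderiv_minus: "holo f X \<Longrightarrow> x \<in> X \<Longrightarrow> dirderiv v (\<lambda>x. - f x) x = - dirderiv v f x"
  using dirderiv_cmult[of f X x v "-1"] by simp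

lemma dirderiv_diff:
  assumes "holo f X" "holo g X" "x \<in> X"
  shows "dirderiv v (\<lambda>x. f x - g x) x = dirderiv v f x - dirderiv v g x"
  using dirderiv_add[OF assms(1) holo_minus[OF assms(2)] assms(3)] dirderiv_minus[OF assms(2,3)] by simp

lemma holo_sum [intro]: "(\<And>i. i \<in> I \<Longrightarrow> holo (f i) X) \<Longrightarrow> holo (\<lambda>x. \<Sum>i\<in>I. f i x) X"
  by (induction I rule: infinite_finite_induct) auto

lemma holo_prod [intro]: "(\<And>i. i \<in> I \<Longrightarrow> holo (f i) X) \<Longrightarrow> holo (\<lambda>x. \<Prod>i\<in>I. f i x) X"
  by (induction I rule: infinite_finite_induct) auto

lemma dirderiv_sum:
  assumes "\<And>i. i \<in> I \<Longrightarrow> holo (f i) X" "x \<in> X"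
  shows "dirderiv v (\<lambda>x. \<Sum>i\<in>I. f i x) x = (\<Sum>i\<in>I. dirderiv v (f i) x)"
  using assms(1)
proof (induction I rule: infinite_finite_induct)
  case (insert i I)
  then have "holo (f i) X" "holo (\<lambda>x. \<Sum>i\<in>I. f i x) X" by auto
  from dirderiv_add[OF this assms(2), of v] insert show ?case by simp
qed simp_all

lemma holo_divide_const [intro]: "holo f X \<Longrightarrow> holo (\<lambda>x. f x / c) X"
  using holo_cmult[of f X "1 / c"] by simp

section \<open>Substitutions and holomorphic maps\<close>

lemma holo_compose:
  assumes "holo f X" "holo_map g Y" "\<And>y. y \<in> Y \<Longrightarrow> g y \<in> X"
  shows "holo (\<lambda>y. f (g y)) Y"
  unfolding holo_on_def
proof
  fix y assume y: "y \<in> Y"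
  then obtain D where D: "(g has_derivative D) (at y)" "\<forall>c v. D (c *\<^sub>C v) = c *\<^sub>C D v"
    using assms(2) unfolding holo_map_def by blast
  have "((\<lambda>y. f (g y)) has_derivative (\<lambda>v. dirderiv (D v) f (g y))) (at y)"
    by (rule has_derivative_compose[OF D(1) holo_has_derivative(1)[OF assms(1) assms(3)[OF y]]])
  then show "\<exists>D. ((\<lambda>y. f (g y)) has_derivative D) (at y) \<and> (\<forall>c v. D (c *\<^sub>C v) = c * D v)"
    by (intro exI conjI) (auto simp: D(2) holo_has_derivative(2)[OF assms(1) assms(3)[OF y]])
qed

lemma dirderiv_compose:
  assumes "holo f X" "g y \<in> X" "(g has_derivative D) (at y)" "\<And>c v. D (c *\<^sub>C v) = c *\<^sub>C D v"
  shows "dirderiv v (\<lambda>y. f (g y)) y = dirderiv (D v) f (g y)"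
  by (rule dirderiv_unique[OF has_derivative_compose[OF assms(3) holo_has_derivative(1)[OF assms(1,2)]]])
    (simp add: assms(4) holo_has_derivative(2)[OF assms(1,2)])

lemma holo_map_compose:
  assumes "holo_map f X" "holo_map g Y" "\<And>y. y \<in> Y \<Longrightarrow> g y \<in> X"
  shows "holo_map (\<lambda>y. f (g y)) Y"
  unfolding holo_map_def
proof
  fix y assume y: "y \<in> Y"
  then obtain D E where "(g has_derivative D) (at y)" "\<forall>c v. D (c *\<^sub>C v) = c *\<^sub>C D v"
    "(f has_derivative E) (at (g y))" "\<forall>c v. E (c *\<^sub>C v) = c *\<^sub>C E v"
    using assms unfolding holo_map_def by meson
  then show "\<exists>D. ((\<lambda>y. f (g y)) has_derivative D) (at y) \<and> (\<forall>c v. D (c *\<^sub>C v) = c *\<^sub>C D v)"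
    by (intro exI[of _ "\<lambda>v. E (D v)"] conjI) (auto intro: has_derivative_compose)
qed

lemma holo_map_linear:
  assumes "bounded_linear g" "\<And>c v. g (c *\<^sub>C v) = c *\<^sub>C g v"
  shows "holo_map g X"
  unfolding holo_map_def using assms bounded_linear_imp_has_derivative by blast

lemma holo_map_const [intro, simp]: "holo_map (\<lambda>x. c) X"
  unfolding holo_map_def by (auto intro!: exI[of _ "\<lambda>_. 0"])

lemma holo_map_add [intro]:
  assumes "holo_map f X" "holo_map g X"
  shows "holo_map (\<lambda>x. f x + g x) X"
  unfolding holo_map_def
proof
  fix y assume y: "y \<in> X"
  then obtain D E where "(g has_derivative D) (at y)" "\<forall>c v. D (c *\<^sub>C v) = c *\<^sub>C D v"
    "(f has_derivative E) (at y)" "\<forall>c v. E (c *\<^sub>C v) = c *\<^sub>C E v"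
    using assms unfolding holo_map_def by meson
  then show "\<exists>D. ((\<lambda>x. f x + g x) has_derivative D) (at y) \<and> (\<forall>c v. D (c *\<^sub>C v) = c *\<^sub>C D v)"
    by (intro exI[of _ "\<lambda>v. E v + D v"] conjI) (auto intro!: derivative_intros simp: scaleC_add_right)
qed

lemma holo_map_sum [intro]:
  "(\<And>i. i \<in> I \<Longrightarrow> holo_map (f i) X) \<Longrightarrow> holo_map (\<lambda>x. \<Sum>i\<in>I. f i x) X"
  by (induction I rule: infinite_finite_induct) auto

lemma holo_map_Pair [intro]:
  assumes "holo_map f X" "holo_map g X"
  shows "holo_map (\<lambda>x. (f x, g x)) X"
  unfolding holo_map_def
proof
  fix y assume y: "y \<in> X"
  then obtain D E where "(g has_derivative D) (at y)" "\<forall>c v. D (c *\<^sub>C v) = c *\<^sub>C D v"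
    "(f has_derivative E) (at y)" "\<forall>c v. E (c *\<^sub>C v) = c *\<^sub>C E v"
    using assms unfolding holo_map_def by meson
  then show "\<exists>D. ((\<lambda>x. (f x, g x)) has_derivative D) (at y) \<and> (\<forall>c v. D (c *\<^sub>C v) = c *\<^sub>C D v)"
    by (intro exI[of _ "\<lambda>v. (E v, D v)"] conjI) (auto intro!: has_derivative_Pair)
qed

lemma holo_map_id [intro, simp]: "holo_map (\<lambda>x. x) X"
  by (rule holo_map_linear) (auto intro: bounded_linear_ident)

lemma holo_map_fst [intro]: "holo_map f X \<Longrightarrow> holo_map (\<lambda>x. fst (f x)) X"
  by (rule holo_map_compose[of fst UNIV]) (auto intro!: holo_map_linear bounded_linear_fst)

lemma holo_map_snd [intro]: "holo_map f X \<Longrightarrow> holo_map (\<lambda>x. snd (f x)) X"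
  by (rule holo_map_compose[of snd UNIV]) (auto intro!: holo_map_linear bounded_linear_snd)

lemma holo_map_scaleC [intro]: "holo_map f X \<Longrightarrow> holo_map (\<lambda>x. c *\<^sub>C f x) X"
  by (rule holo_map_compose[of "scaleC c" UNIV])
    (auto intro!: holo_map_linear bounded_linear_scaleC_right simp: scaleC_scaleC mult.commute)

lemma holo_map_minus [intro]: "holo_map f X \<Longrightarrow> holo_map (\<lambda>x. - f x) X"
  using holo_map_scaleC[of f X "-1"] by simp

lemma holo_map_diff [intro]: "holo_map f X \<Longrightarrow> holo_map g X \<Longrightarrow> holo_map (\<lambda>x. f x - g x) X"
  using holo_map_add[of f X "\<lambda>x. - g x"] by auto

lemma holo_nth [intro]: "holo_map f X \<Longrightarrow> holo (\<lambda>x. f x $ i) X"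
  unfolding holo_map_complex[symmetric]
  by (rule holo_map_compose[of "\<lambda>x. x $ i" UNIV]) (auto intro!: holo_map_linear)

lemma bounded_linear_scaleC_axis: "bounded_linear (\<lambda>c. c *\<^sub>C (axis i 1 :: complex^'n))"
  by (rule bounded_linear_scaleC_left)

lemma vec_eq_sum_axis: "(\<Sum>i\<in>UNIV. (x $ i) *\<^sub>C axis i 1) = (x :: complex^'n)"
  by (simp add: vec_eq_iff axis_def if_distrib [of "(*) _"] cong: if_cong)

lemma holo_map_vec:
  fixes g :: "'a::complex_space \<Rightarrow> complex^'n"
  assumes "\<And>i. holo (\<lambda>x. g x $ i) X"
  shows "holo_map g X"
proof -
  have "holo_map (\<lambda>x. \<Sum>i\<in>UNIV. (g x $ i) *\<^sub>C (axis i 1 :: complex^'n)) X"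
  proof (intro holo_map_sum)
    fix i :: 'n
    show "holo_map (\<lambda>x. (g x $ i) *\<^sub>C (axis i 1 :: complex^'n)) X"
      by (rule holo_map_compose[of "\<lambda>c. c *\<^sub>C (axis i 1 :: complex^'n)" UNIV])
        (use assms[of i] in \<open>auto simp: holo_map_complex scaleC_scaleC[symmetric] intro!: holo_map_linear bounded_linear_scaleC_axis\<close>)
  qed
  then show ?thesis by (simp add: vec_eq_sum_axis)
qed

lemma has_derivative_vec:
  fixes g :: "'a::complex_space \<Rightarrow> complex^'n"
  assumes "\<And>i. holo (\<lambda>x. g x $ i) X" "x \<in> X"
  shows "(g has_derivative (\<lambda>v. \<chi> i. dirderiv v (\<lambda>x. g x $ i) x)) (at x)"
    and "(\<chi> i. dirderiv (c *\<^sub>C v) (\<lambda>x. g x $ i) x) = c *\<^sub>C (\<chi> i. dirderiv v (\<lambda>x. g x $ i) x)"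
proof -
  have "((\<lambda>x. \<Sum>i\<in>UNIV. (g x $ i) *\<^sub>C (axis i 1 :: complex^'n)) has_derivative
      (\<lambda>v. \<Sum>i\<in>UNIV. dirderiv v (\<lambda>x. g x $ i) x *\<^sub>C axis i 1)) (at x)"
    by (intro has_derivative_sum bounded_linear.has_derivative[OF bounded_linear_scaleC_axis]
        holo_has_derivative(1)[OF assms])
  moreover have "(\<Sum>i\<in>UNIV. dirderiv v (\<lambda>x. g x $ i) x *\<^sub>C axis i 1) = (\<chi> i. dirderiv v (\<lambda>x. g x $ i) x)" for v
    by (simp add: vec_eq_iff axis_def if_distrib [of "(*) _"] cong: if_cong)
  ultimately show "(g has_derivative (\<lambda>v. \<chi> i. dirderiv v (\<lambda>x. g x $ i) x)) (at x)"
    by (simp add: vec_eq_sum_axis)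
  show "(\<chi> i. dirderiv (c *\<^sub>C v) (\<lambda>x. g x $ i) x) = c *\<^sub>C (\<chi> i. dirderiv v (\<lambda>x. g x $ i) x)"
    by (simp add: vec_eq_iff holo_has_derivative(2)[OF assms])
qed

section \<open>Exponentials of operators on holomorphic functions\<close>

text \<open>Functions are total, with arbitrary values off \<open>X\<close>; \<open>cong\<close>
  says that on \<open>X\<close> the operator does not see these values. Linearity is asked only for
  functions holomorphic on \<open>X\<close>, because \<open>dirderiv\<close> is not additive in
  general.\<close>

locale hol_op =
  fixes X :: "'a::complex_space set" and A :: "('a \<Rightarrow> complex) \<Rightarrow> 'a \<Rightarrow> complex"
  assumes open_X: "open X"
    and holo: "holo f X \<Longrightarrow> holo (A f) X"
    and cong: "holo f X \<Longrightarrow> (\<And>x. x \<in> X \<Longrightarrow> f x = g x) \<Longrightarrow> x \<in> X \<Longrightarrow> A f x = A g x"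
    and add: "holo f X \<Longrightarrow> holo g X \<Longrightarrow> x \<in> X \<Longrightarrow> A (\<lambda>x. f x + g x) x = A f x + A g x"
    and cmult: "holo f X \<Longrightarrow> x \<in> X \<Longrightarrow> A (\<lambda>x. c * f x) x = c * A f x"

text \<open>The coefficient of \<open>t ^ \<nu>\<close> in \<open>exp (t A)\<close> applied to the
  formal series with coefficients \<open>F k\<close>, for an arbitrary operator.\<close>

definition expo :: "(('a \<Rightarrow> complex) \<Rightarrow> 'a \<Rightarrow> complex) \<Rightarrow> (nat \<Rightarrow> 'a \<Rightarrow> complex) \<Rightarrow> nat \<Rightarrow> 'a \<Rightarrow> complex"
  where "expo A F \<nu> x = (\<Sum>k\<le>\<nu>. (A ^^ k) (F (\<nu> - k)) x / fact k)"

text \<open>Multiplication of a formal series by \<open>t\<close>.\<close>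

definition shift :: "(nat \<Rightarrow> 'a \<Rightarrow> complex) \<Rightarrow> nat \<Rightarrow> 'a \<Rightarrow> complex"
  where "shift F \<nu> x = (case \<nu> of 0 \<Rightarrow> 0 | Suc m \<Rightarrow> F m x)"

lemma shift_simps [simp]: "shift F 0 x = 0" "shift F (Suc m) x = F m x"
  by (simp_all add: shift_def)

lemma holo_shift: "(\<And>k. holo (F k) X) \<Longrightarrow> holo (shift F k) X"
  by (cases k) (simp_all add: shift_def[abs_def])

lemma expo_local: "(\<And>k. k \<le> \<nu> \<Longrightarrow> F k = G k) \<Longrightarrow> expo A F \<nu> x = expo A G \<nu> x"
  by (simp add: expo_def)

lemma hol_op_holo_cong: "hol_op X A \<Longrightarrow> holo g X \<Longrightarrow> (\<And>x. x \<in> X \<Longrightarrow> f x = g x) \<Longrightarrow> x \<in> X \<Longrightarrow> A f x = A g x"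
  by (metis hol_op.cong)

lemma hol_op_dirderiv: "open X \<Longrightarrow> hol_op X (dirderiv v)"
  by (rule hol_op.intro) (auto simp: holo_dirderiv dirderiv_add dirderiv_cmult intro: dirderiv_cong)

lemma hol_op_mult:
  assumes "open X" "holo h X" "hol_op X A"
  shows "hol_op X (\<lambda>f x. h x * A f x)"
  by (rule hol_op.intro) (use assms in \<open>auto simp: hol_op.holo hol_op.add hol_op.cmult algebra_simps intro: hol_op.cong\<close>)

lemma hol_op_compose:
  assumes "hol_op X A" "hol_op X B"
  shows "hol_op X (\<lambda>f. A (B f))"
proof (rule hol_op.intro)
  interpret A: hol_op X A by fact
  interpret B: hol_op X B by fact
  show "open X" by (rule A.open_X)
  fix f x c
  assume f: "holo f X"
  then show "holo (A (B f)) X" by (intro A.holo B.holo)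
  { fix g assume "\<And>x. x \<in> X \<Longrightarrow> f x = g x" "x \<in> X"
    then show "A (B f) x = A (B g) x"
      by (intro A.cong B.holo f) (auto intro: B.cong[OF f]) }
  { fix g assume g: "holo g X" and x: "x \<in> X"
    have "A (B (\<lambda>x. f x + g x)) x = A (\<lambda>x. B f x + B g x) x"
      by (rule A.cong) (use f g x in \<open>auto intro!: B.holo B.add\<close>)
    also have "\<dots> = A (B f) x + A (B g) x"
      by (rule A.add) (use f g x in \<open>auto intro!: B.holo\<close>)
    finally show "A (B (\<lambda>x. f x + g x)) x = A (B f) x + A (B g) x" . }
  { assume x: "x \<in> X"
    have "A (B (\<lambda>x. c * f x)) x = A (\<lambda>x. c * B f x) x"
      by (rule A.cong) (use f x in \<open>auto intro!: B.holo B.cmult\<close>)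
    also have "\<dots> = c * A (B f) x"
      by (rule A.cmult) (use f x in \<open>auto intro!: B.holo\<close>)
    finally show "A (B (\<lambda>x. c * f x)) x = c * A (B f) x" . }
qed

lemma hol_op_plus:
  assumes "hol_op X A" "hol_op X B"
  shows "hol_op X (\<lambda>f x. A f x + B f x)"
  by (rule hol_op.intro)
    (use assms in \<open>auto simp: hol_op.open_X hol_op.holo hol_op.add hol_op.cmult algebra_simps
       intro!: arg_cong2[of _ _ _ _ "(+)"] intro: hol_op.cong\<close>)

lemma hol_op_zero: "open X \<Longrightarrow> hol_op X (\<lambda>f x. 0)"
  by (rule hol_op.intro) auto

lemma hol_op_sum:
  assumes "open X" "\<And>i. i \<in> I \<Longrightarrow> hol_op X (A i)"
  shows "hol_op X (\<lambda>f x. \<Sum>i\<in>I. A i f x)"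
  using assms(2)
  by (induction I rule: infinite_finite_induct) (auto simp: hol_op_zero assms(1) intro: hol_op_plus)

context hol_op
begin

lemma hol_op_self: "hol_op X A"
  by unfold_locales

lemma hol_op_pow: "hol_op X (A ^^ k)"
proof (induction k)
  case 0
  show ?case by (rule hol_op.intro) (auto simp: open_X)
next
  case (Suc k)
  then show ?case using hol_op_compose[OF hol_op_self Suc] by (simp add: o_def)
qed

lemma zero: "x \<in> X \<Longrightarrow> A (\<lambda>x. 0) x = 0"
  using cmult[of "\<lambda>x. 0" x 0] by simp

lemma sum: "finite I \<Longrightarrow> (\<And>i. i \<in> I \<Longrightarrow> holo (f i) X) \<Longrightarrow> x \<in> X \<Longrightarrow> A (\<lambda>x. \<Sum>i\<in>I. f i x) x = (\<Sum>i\<in>I. A (f i) x)"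
proof (induction I arbitrary: x rule: finite_induct)
  case empty
  then show ?case using zero by simp
next
  case (insert i I)
  have "A (\<lambda>x. f i x + (\<Sum>i\<in>I. f i x)) x = A (f i) x + A (\<lambda>x. \<Sum>i\<in>I. f i x) x"
    using insert by (intro add) auto
  then show ?case using insert by simp
qed

lemma expo_holo: "(\<And>k. holo (F k) X) \<Longrightarrow> holo (expo A F \<nu>) X"
  unfolding expo_def[abs_def] by (intro holo_sum holo_divide_const hol_op.holo[OF hol_op_pow])

lemma expo_cong:
  assumes "\<And>k. holo (F k) X" "\<And>k x. x \<in> X \<Longrightarrow> F k x = G k x" "x \<in> X"
  shows "expo A F \<nu> x = expo A G \<nu> x"
  unfolding expo_def
  by (intro sum.cong refl arg_cong2[of _ _ _ _ "(/)"] hol_op.cong[OF hol_op_pow] assms)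

lemma expo_add:
  assumes "\<And>k. holo (F k) X" "\<And>k. holo (G k) X" "x \<in> X"
  shows "expo A (\<lambda>k x. F k x + G k x) \<nu> x = expo A F \<nu> x + expo A G \<nu> x"
  by (simp add: expo_def hol_op.add[OF hol_op_pow assms] add_divide_distrib sum.distrib)

lemma expo_cmult:
  assumes "\<And>k. holo (F k) X" "x \<in> X"
  shows "expo A (\<lambda>k x. c * F k x) \<nu> x = c * expo A F \<nu> x"
  by (simp add: expo_def hol_op.cmult[OF hol_op_pow assms] sum_distrib_left)

lemma expo_zero: "x \<in> X \<Longrightarrow> expo A (\<lambda>k x. 0) \<nu> x = 0"
  using expo_cmult[of "\<lambda>k x. 0" x 0 \<nu>] by simp

lemma expo_minus:
  assumes "\<And>k. holo (F k) X" "x \<in> X"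
  shows "expo A (\<lambda>k x. - F k x) \<nu> x = - expo A F \<nu> x"
  using expo_cmult[OF assms, of "-1"] by simp

lemma expo_sum:
  assumes "finite I" "\<And>i k. i \<in> I \<Longrightarrow> holo (F i k) X" "x \<in> X"
  shows "expo A (\<lambda>k x. \<Sum>i\<in>I. F i k x) \<nu> x = (\<Sum>i\<in>I. expo A (F i) \<nu> x)"
  using assms(1,2)
proof (induction I rule: finite_induct)
  case empty
  then show ?case using expo_zero[OF assms(3)] by simp
next
  case (insert i I)
  have "expo A (\<lambda>k x. F i k x + (\<Sum>i\<in>I. F i k x)) \<nu> x
      = expo A (F i) \<nu> x + expo A (\<lambda>k x. \<Sum>i\<in>I. F i k x) \<nu> x"
    using insert assms by (intro expo_add) auto
  then show ?case using insert by simp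
qed

lemma expo_shift:
  assumes "\<And>k. holo (F k) X" "x \<in> X"
  shows "expo A (shift F) \<nu> x = shift (expo A F) \<nu> x"
proof (cases \<nu>)
  case 0
  then show ?thesis by (simp add: expo_def)
next
  case (Suc m)
  have "(A ^^ Suc m) (shift F 0) x = 0"
    using hol_op.zero[OF hol_op_pow assms(2), of "Suc m"] by (simp add: shift_def[abs_def])
  moreover have "shift F (Suc m - k) = F (m - k)" if "k \<le> m" for k
    using that by (simp add: fun_eq_iff Suc_diff_le)
  ultimately show ?thesis by (simp add: expo_def Suc)
qed

lemma pow_commute:
  assumes B: "hol_op X B" and "\<And>f x. holo f X \<Longrightarrow> x \<in> X \<Longrightarrow> A (B f) x = B (A f) x"
    and "holo f X" "x \<in> X"
  shows "(A ^^ k) (B f) x = B ((A ^^ k) f) x"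
  using assms(4)
proof (induction k arbitrary: x)
  case (Suc k)
  interpret B: hol_op X B by fact
  have h: "holo ((A ^^ k) f) X" by (rule hol_op.holo[OF hol_op_pow assms(3)])
  have "A ((A ^^ k) (B f)) x = A (B ((A ^^ k) f)) x"
    by (rule hol_op_holo_cong[OF hol_op_self]) (use Suc h B.holo in auto)
  also have "\<dots> = B (A ((A ^^ k) f)) x" by (rule assms(2)[OF h Suc.prems])
  finally show ?case by simp
qed simp

lemma expo_commute:
  assumes B: "hol_op X B" and "\<And>f x. holo f X \<Longrightarrow> x \<in> X \<Longrightarrow> A (B f) x = B (A f) x"
    and F: "\<And>k. holo (F k) X" and x: "x \<in> X"
  shows "expo A (\<lambda>k. B (F k)) \<nu> x = B (expo A F \<nu>) x"
proof -
  interpret B: hol_op X B by fact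
  have h: "holo ((A ^^ k) (F j)) X" for k j by (rule hol_op.holo[OF hol_op_pow F])
  have "B (expo A F \<nu>) x = B (\<lambda>x. \<Sum>k\<le>\<nu>. (1 / fact k) * (A ^^ k) (F (\<nu> - k)) x) x"
    by (simp add: expo_def[abs_def])
  also have "\<dots> = (\<Sum>k\<le>\<nu>. B (\<lambda>x. (1 / fact k) * (A ^^ k) (F (\<nu> - k)) x) x)"
    by (rule B.sum) (use h x in auto)
  also have "\<dots> = (\<Sum>k\<le>\<nu>. (1 / fact k) * B ((A ^^ k) (F (\<nu> - k))) x)"
    by (intro sum.cong refl B.cmult h x)
  finally show ?thesis
    by (simp add: expo_def pow_commute[OF B assms(2) F x])
qed

text \<open>The commutator of \<open>A\<close> with multiplication by \<open>l\<close> is \<open>L\<close>; hence that of \<open>exp (t A)\<close> is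
  \<open>t L exp (t A)\<close>.\<close>

lemma expo_mult:
  assumes l: "holo l X" and L: "hol_op X L"
    and com: "\<And>f x. holo f X \<Longrightarrow> x \<in> X \<Longrightarrow> A (L f) x = L (A f) x"
    and Al: "\<And>f x. holo f X \<Longrightarrow> x \<in> X \<Longrightarrow> A (\<lambda>x. l x * f x) x = l x * A f x + L f x"
    and F: "\<And>k. holo (F k) X" and x: "x \<in> X"
  shows "expo A (\<lambda>k x. l x * F k x) \<nu> x = l x * expo A F \<nu> x + shift (expo A (\<lambda>k. L (F k))) \<nu> x"
proof -
  interpret L: hol_op X L by fact
  \<comment> \<open>Since \<open>L\<close> commutes with \<open>A\<close>, each of the
    \<open>k + 1\<close> factors contributes the same commutator term. Division by
    \<open>fact (Suc k)\<close> leaves \<open>1 / fact k\<close>, so these terms form the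
    exponential again, one order lower: this is the \<open>shift\<close>.\<close>
  have pow: "(A ^^ Suc k) (\<lambda>x. l x * f x) x = l x * (A ^^ Suc k) f x + of_nat (Suc k) * (A ^^ k) (L f) x"
    if f: "holo f X" and x: "x \<in> X" for f k x
    using x
  proof (induction k arbitrary: x)
    case 0
    then show ?case using Al[OF f] by simp
  next
    case (Suc k)
    have h: "holo ((A ^^ k) f) X" "holo ((A ^^ k) (L f)) X" for k
      using hol_op.holo[OF hol_op_pow] f L.holo by blast+
    have "A ((A ^^ Suc k) (\<lambda>x. l x * f x)) x
        = A (\<lambda>x. l x * (A ^^ Suc k) f x + of_nat (Suc k) * (A ^^ k) (L f) x) x"
      by (rule hol_op_holo_cong[OF hol_op_self]) (use Suc l h(1)[of "Suc k"] h(2)[of k] in \<open>auto simp del: funpow.simps\<close>)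
    also have "\<dots> = A (\<lambda>x. l x * (A ^^ Suc k) f x) x + A (\<lambda>x. of_nat (Suc k) * (A ^^ k) (L f) x) x"
      by (rule add) (use Suc l h(1)[of "Suc k"] h(2)[of k] in \<open>auto simp del: funpow.simps\<close>)
    also have "A (\<lambda>x. of_nat (Suc k) * (A ^^ k) (L f) x) x = of_nat (Suc k) * A ((A ^^ k) (L f)) x"
      by (rule cmult) (use Suc h(2)[of k] in auto)
    also have "A (\<lambda>x. l x * (A ^^ Suc k) f x) x = l x * A ((A ^^ Suc k) f) x + L ((A ^^ Suc k) f) x"
      by (rule Al[OF h(1) Suc.prems])
    also have "L ((A ^^ Suc k) f) x = (A ^^ Suc k) (L f) x"
      using pow_commute[OF L com f Suc.prems, of "Suc k"] by simp
    finally show ?case by (simp add: algebra_simps)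
  qed
  show ?thesis
  proof (cases \<nu>)
    case 0
    then show ?thesis by (simp add: expo_def)
  next
    case (Suc m)
    have "expo A (\<lambda>k x. l x * F k x) (Suc m) x
        = l x * F (Suc m) x + (\<Sum>k\<le>m. (A ^^ Suc k) (\<lambda>x. l x * F (m - k) x) x / fact (Suc k))"
      unfolding expo_def sum.atMost_Suc_shift by simp
    also have "(\<Sum>k\<le>m. (A ^^ Suc k) (\<lambda>x. l x * F (m - k) x) x / fact (Suc k))
        = (\<Sum>k\<le>m. l x * ((A ^^ Suc k) (F (m - k)) x / fact (Suc k)) + (A ^^ k) (L (F (m - k))) x / fact k)"
    proof (rule sum.cong[OF refl])
      fix k
      have "(of_nat (Suc k) :: complex) \<noteq> 0" by (metis of_nat_neq_0)
      then have "of_nat (Suc k) * y / fact (Suc k) = y / fact k" for y :: complex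
        by (simp add: fact_Suc del: of_nat_Suc)
      then show "(A ^^ Suc k) (\<lambda>x. l x * F (m - k) x) x / fact (Suc k)
        = l x * ((A ^^ Suc k) (F (m - k)) x / fact (Suc k)) + (A ^^ k) (L (F (m - k))) x / fact k"
        unfolding pow[OF F x] add_divide_distrib by simp
    qed
    also have "l x * F (Suc m) x + \<dots> = l x * (F (Suc m) x + (\<Sum>k\<le>m. (A ^^ Suc k) (F (m - k)) x / fact (Suc k)))
       + expo A (\<lambda>k. L (F k)) m x"
      by (simp add: sum.distrib sum_distrib_left expo_def algebra_simps)
    also have "F (Suc m) x + (\<Sum>k\<le>m. (A ^^ Suc k) (F (m - k)) x / fact (Suc k)) = expo A F (Suc m) x"
      unfolding expo_def sum.atMost_Suc_shift by simp
    finally show ?thesis by (simp add: Suc)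
  qed
qed

lemma expo_annihilated:
  assumes "\<And>k x. x \<in> X \<Longrightarrow> A (F k) x = 0" "\<And>k. holo (F k) X" "x \<in> X"
  shows "expo A F \<nu> x = F \<nu> x"
proof -
  have "(A ^^ Suc k) (F j) x = 0" if "x \<in> X" for k j x
    using that
  proof (induction k arbitrary: x)
    case (Suc k)
    have "A ((A ^^ Suc k) (F j)) x = A (\<lambda>x. 0) x"
      by (rule hol_op_holo_cong[OF hol_op_self]) (use Suc in auto)
    then show ?case using zero[OF Suc.prems] by simp
  qed (use assms(1) in simp)
  from this[OF assms(3)] have "expo A F \<nu> x = (\<Sum>k\<le>\<nu>. if k = 0 then F \<nu> x else 0)"
    unfolding expo_def by (intro sum.cong refl) (metis diff_zero div_by_1 divide_eq_0_iff fact_0 funpow_0 not0_implies_Suc)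
  then show ?thesis by simp
qed

end

text \<open>Pascal's rule in the form needed for the induction step of the binomial theorem for
  commuting operators.\<close>

lemma binomial_convolution_Suc:
  fixes g :: "nat \<Rightarrow> nat \<Rightarrow> complex" and n :: nat
  shows "(\<Sum>j\<le>Suc n. of_nat (Suc n choose j) * g j (Suc n - j))
    = (\<Sum>j\<le>n. of_nat (n choose j) * g (Suc j) (n - j)) + (\<Sum>j\<le>n. of_nat (n choose j) * g j (Suc (n - j)))"
proof -
  have "(\<Sum>j\<le>n. of_nat (n choose j) * g j (Suc (n - j))) = (\<Sum>j\<le>n. of_nat (n choose j) * g j (Suc n - j))"
    by (intro sum.cong refl) (simp add: Suc_diff_le)
  also have "\<dots> = (\<Sum>j\<le>Suc n. of_nat (n choose j) * g j (Suc n - j))" by simp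
  also have "\<dots> = g 0 (Suc n) + (\<Sum>j\<le>n. of_nat (n choose Suc j) * g (Suc j) (n - j))"
    unfolding sum.atMost_Suc_shift by simp
  finally show ?thesis
    unfolding sum.atMost_Suc_shift by (simp add: algebra_simps sum.distrib)
qed

lemma hol_op_binomial:
  fixes n :: nat
  assumes A: "hol_op X A" and B: "hol_op X B"
    and com: "\<And>f x. holo f X \<Longrightarrow> x \<in> X \<Longrightarrow> A (B f) x = B (A f) x"
    and f: "holo f X" and x: "x \<in> X"
  shows "((\<lambda>f x. A f x + B f x) ^^ n) f x = (\<Sum>j\<le>n. of_nat (n choose j) * (A ^^ j) ((B ^^ (n - j)) f) x)"
  using x
proof (induction n arbitrary: x)
  case (Suc n)
  interpret A: hol_op X A by fact
  interpret B: hol_op X B by fact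
  interpret AB: hol_op X "\<lambda>f x. A f x + B f x" by (rule hol_op_plus[OF A B])
  have h: "holo ((A ^^ j) ((B ^^ k) f)) X" for j k
    by (intro hol_op.holo[OF A.hol_op_pow] hol_op.holo[OF B.hol_op_pow] f)
  have hB: "holo ((B ^^ k) f) X" for k by (intro hol_op.holo[OF B.hol_op_pow] f)
  let ?S = "\<lambda>x. \<Sum>j\<le>n. of_nat (n choose j) * (A ^^ j) ((B ^^ (n - j)) f) x"
  have "((\<lambda>f x. A f x + B f x) ^^ Suc n) f x = A ?S x + B ?S x"
    using AB.cong[of "((\<lambda>f x. A f x + B f x) ^^ n) f" ?S x] Suc hol_op.holo[OF AB.hol_op_pow f] by simp
  also have "A ?S x = (\<Sum>j\<le>n. of_nat (n choose j) * (A ^^ Suc j) ((B ^^ (n - j)) f) x)"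
    using A.sum[of "{..n}" "\<lambda>j x. of_nat (n choose j) * (A ^^ j) ((B ^^ (n - j)) f) x" x] h Suc.prems
    by (simp add: A.cmult[OF h] holo_cmult)
  also have "B ?S x = (\<Sum>j\<le>n. of_nat (n choose j) * B ((A ^^ j) ((B ^^ (n - j)) f)) x)"
    using B.sum[of "{..n}" "\<lambda>j x. of_nat (n choose j) * (A ^^ j) ((B ^^ (n - j)) f) x" x] h Suc.prems
    by (simp add: B.cmult[OF h] holo_cmult)
  also have "\<dots> = (\<Sum>j\<le>n. of_nat (n choose j) * (A ^^ j) ((B ^^ Suc (n - j)) f) x)"
    by (simp add: A.pow_commute[OF B com hB Suc.prems])
  finally show ?case
    using binomial_convolution_Suc[of n "\<lambda>j k. (A ^^ j) ((B ^^ k) f) x"] by simp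
qed simp

text \<open>After the binomial theorem, \<open>n choose j\<close> over \<open>n!\<close> becomes
  \<open>1 / (j! (n - j)!)\<close>, and the sum over \<open>n\<close> and \<open>j\<close> is the
  Cauchy product of the two exponentials.\<close>

lemma expo_plus:
  assumes A: "hol_op X A" and B: "hol_op X B"
    and com: "\<And>f x. holo f X \<Longrightarrow> x \<in> X \<Longrightarrow> A (B f) x = B (A f) x"
    and F: "\<And>k. holo (F k) X" and x: "x \<in> X"
  shows "expo (\<lambda>f x. A f x + B f x) F \<nu> x = expo A (expo B F) \<nu> x"
proof -
  interpret A: hol_op X A by fact
  interpret B: hol_op X B by fact
  define g where "g j k = (A ^^ j) ((B ^^ k) (F (\<nu> - (j + k)))) x / (fact j * fact k)" for j k
  have h: "holo ((B ^^ k) (F j)) X" for k j by (intro hol_op.holo[OF B.hol_op_pow] F)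
  have "expo (\<lambda>f x. A f x + B f x) F \<nu> x
     = (\<Sum>n\<le>\<nu>. \<Sum>j\<le>n. of_nat (n choose j) * (A ^^ j) ((B ^^ (n - j)) (F (\<nu> - n))) x / fact n)"
    unfolding expo_def by (simp add: hol_op_binomial[OF A B com F x] sum_divide_distrib)
  also have "\<dots> = (\<Sum>n\<le>\<nu>. \<Sum>j\<le>n. g j (n - j))"
  proof (intro sum.cong refl)
    fix n j :: nat assume "j \<in> {..n}"
    then have j: "j \<le> n" by simp
    have "(of_nat (n choose j) :: complex) / fact n = 1 / (fact j * fact (n - j))"
      using binomial_fact[OF j, where 'a = complex] by simp
    then have "of_nat (n choose j) * y / fact n = y / (fact j * fact (n - j))" for y :: complex
      by (metis mult.commute mult.right_neutral times_divide_eq_right)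
    then show "of_nat (n choose j) * (A ^^ j) ((B ^^ (n - j)) (F (\<nu> - n))) x / fact n = g j (n - j)"
      using j by (simp add: g_def)
  qed
  also have "\<dots> = (\<Sum>(i,j)\<in>{(i,j). i + j \<le> \<nu>}. g i j)"
    by (rule sum.triangle_reindex_eq[symmetric])
  also have "{(i,j). i + j \<le> \<nu>} = Sigma {..\<nu>} (\<lambda>j. {..\<nu> - j})" by auto
  also have "(\<Sum>(i,j)\<in>\<dots>. g i j) = (\<Sum>j\<le>\<nu>. \<Sum>k\<le>\<nu> - j. g j k)"
    by (rule sum.Sigma[symmetric]) auto
  also have "\<dots> = expo A (expo B F) \<nu> x"
    unfolding expo_def[of A]
  proof (intro sum.cong refl)
    fix j assume "j \<in> {..\<nu>}"
    have "(A ^^ j) (expo B F (\<nu> - j)) x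
        = (\<Sum>k\<le>\<nu> - j. (A ^^ j) (\<lambda>x. (1 / fact k) * (B ^^ k) (F (\<nu> - j - k)) x) x)"
      unfolding expo_def[abs_def]
      using hol_op.sum[OF A.hol_op_pow, of "{..\<nu> - j}" "\<lambda>k x. (1 / fact k) * (B ^^ k) (F (\<nu> - j - k)) x" x j] h x
      by (simp add: holo_divide_const)
    also have "\<dots> = (\<Sum>k\<le>\<nu> - j. (1 / fact k) * (A ^^ j) ((B ^^ k) (F (\<nu> - j - k))) x)"
      by (intro sum.cong refl hol_op.cmult[OF A.hol_op_pow] h x)
    finally show "(\<Sum>k\<le>\<nu> - j. g j k) = (A ^^ j) (expo B F (\<nu> - j)) x / fact j"
      by (simp add: g_def sum_divide_distrib mult.commute)
  qed
  finally show ?thesis .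
qed

text \<open>A second order operator with constant coefficients. Leaving both families of directions
  free gives \<open>\<langle>\<partial>\<^sub>\<zeta>, \<partial>\<^sub>z\<rangle>\<close> together
  with all its transforms under affine substitutions and its variants in doubled variables.\<close>

definition pairop :: "('n::finite \<Rightarrow> 'a::complex_space) \<Rightarrow> ('n \<Rightarrow> 'a) \<Rightarrow> ('a \<Rightarrow> complex) \<Rightarrow> 'a \<Rightarrow> complex"
  where "pairop p q f x = (\<Sum>i\<in>UNIV. dirderiv (q i) (dirderiv (p i) f) x)"

lemma hol_op_pairop: "open X \<Longrightarrow> hol_op X (pairop p q)"
  unfolding pairop_def[abs_def]
  by (intro hol_op_sum hol_op_compose[OF hol_op_dirderiv hol_op_dirderiv])

lemma pairop_dirderiv_commute:
  assumes "open X" "holo f X" "x \<in> X"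
  shows "pairop p q (dirderiv v f) x = dirderiv v (pairop p q f) x"
proof -
  note h = holo_dirderiv[OF _ assms(1)]
  have "dirderiv (q i) (dirderiv (p i) (dirderiv v f)) x = dirderiv v (dirderiv (q i) (dirderiv (p i) f)) x" for i
  proof -
    have "dirderiv (q i) (dirderiv (p i) (dirderiv v f)) x = dirderiv (q i) (dirderiv v (dirderiv (p i) f)) x"
      by (rule dirderiv_cong[OF assms(1,3)]) (rule dirderiv_commute[OF assms(2,1)])
    also have "\<dots> = dirderiv v (dirderiv (q i) (dirderiv (p i) f)) x"
      by (rule dirderiv_commute[OF h[OF assms(2)] assms(1,3)])
    finally show ?thesis .
  qed
  then have "pairop p q (dirderiv v f) x = (\<Sum>i\<in>UNIV. dirderiv v (dirderiv (q i) (dirderiv (p i) f)) x)"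
    by (simp add: pairop_def)
  also have "\<dots> = dirderiv v (pairop p q f) x"
    unfolding pairop_def[of p q, abs_def] by (rule dirderiv_sum[OF h[OF h[OF assms(2)]] assms(3), symmetric])
  finally show ?thesis .
qed

lemma pairop_commute:
  assumes "open X" "holo f X" "x \<in> X"
  shows "pairop p q (pairop p' q' f) x = pairop p' q' (pairop p q f) x"
proof -
  note h = holo_dirderiv[OF _ assms(1)]
  have "pairop p q (pairop p' q' f) x = (\<Sum>i\<in>UNIV. pairop p q (dirderiv (q' i) (dirderiv (p' i) f)) x)"
    unfolding pairop_def[of p' q', abs_def]
    by (rule hol_op.sum[OF hol_op_pairop[OF assms(1)] finite h[OF h[OF assms(2)]] assms(3)])
  also have "\<dots> = (\<Sum>i\<in>UNIV. dirderiv (q' i) (pairop p q (dirderiv (p' i) f)) x)"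
    by (intro sum.cong refl pairop_dirderiv_commute[OF assms(1) h[OF assms(2)] assms(3)])
  also have "\<dots> = (\<Sum>i\<in>UNIV. dirderiv (q' i) (dirderiv (p' i) (pairop p q f)) x)"
    by (intro sum.cong refl dirderiv_cong[OF assms(1,3)] pairop_dirderiv_commute[OF assms(1,2)])
  also have "\<dots> = pairop p' q' (pairop p q f) x"
    by (rule pairop_def[symmetric])
  finally show ?thesis .
qed

lemma pairop_affine:
  assumes "\<And>x s i. g (x + s *\<^sub>C p i) = g x + s *\<^sub>C p' i" "\<And>x s i. g (x + s *\<^sub>C q i) = g x + s *\<^sub>C q' i"
  shows "pairop p q (\<lambda>x. f (g x)) = (\<lambda>x. pairop p' q' f (g x))"
proof -
  have "dirderiv (q i) (dirderiv (p i) (\<lambda>x. f (g x))) x = dirderiv (q' i) (dirderiv (p' i) f) (g x)" for i x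
  proof -
    have "dirderiv (p i) (\<lambda>x. f (g x)) = (\<lambda>x. dirderiv (p' i) f (g x))"
      by (rule ext, rule dirderiv_affine) (rule assms)
    moreover have "dirderiv (q i) (\<lambda>x. dirderiv (p' i) f (g x)) x = dirderiv (q' i) (dirderiv (p' i) f) (g x)"
      by (rule dirderiv_affine) (rule assms)
    ultimately show ?thesis by (simp only:)
  qed
  then show ?thesis unfolding pairop_def by (intro ext sum.cong refl)
qed

lemma pairop_pow_affine:
  assumes "\<And>x s i. g (x + s *\<^sub>C p i) = g x + s *\<^sub>C p' i" "\<And>x s i. g (x + s *\<^sub>C q i) = g x + s *\<^sub>C q' i"
  shows "(pairop p q ^^ k) (\<lambda>x. f (g x)) = (\<lambda>x. (pairop p' q' ^^ k) f (g x))"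
proof (induction k)
  case (Suc k)
  then show ?case
    by (simp add: pairop_affine[OF assms, where f = "(pairop p' q' ^^ k) f"])
qed simp

lemma expo_pairop_affine:
  assumes "\<And>x s i. g (x + s *\<^sub>C p i) = g x + s *\<^sub>C p' i" "\<And>x s i. g (x + s *\<^sub>C q i) = g x + s *\<^sub>C q' i"
  shows "expo (pairop p q) (\<lambda>k x. F k (g x)) \<nu> x = expo (pairop p' q') F \<nu> (g x)"
proof -
  have "(pairop p q ^^ k) (\<lambda>x. F j (g x)) x = (pairop p' q' ^^ k) (F j) (g x)" for j k
    by (subst pairop_pow_affine[where g = g and p' = p' and q' = q', OF assms]) (rule refl)
  then show ?thesis unfolding expo_def by simp
qed

lemma expo_dirderiv:
  assumes "open X" "\<And>k. holo (F k) X" "x \<in> X"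
  shows "expo (pairop p q) (\<lambda>k. dirderiv v (F k)) \<nu> x = dirderiv v (expo (pairop p q) F \<nu>) x"
  by (rule hol_op.expo_commute[OF hol_op_pairop hol_op_dirderiv])
    (use assms pairop_dirderiv_commute in auto)

text \<open>The derivatives of \<open>l\<close> along the directions are the constants
  \<open>a i\<close> and \<open>b i\<close>. So the commutator with \<open>l\<close> is a first
  order operator with constant coefficients, which commutes with the second order one.\<close>

lemma expo_pairop_mult:
  fixes a b :: "'n::finite \<Rightarrow> complex"
  assumes X: "open X" and l: "holo l X"
    and a: "\<And>i x. x \<in> X \<Longrightarrow> dirderiv (p i) l x = a i"
    and b: "\<And>i x. x \<in> X \<Longrightarrow> dirderiv (q i) l x = b i"
    and F: "\<And>k. holo (F k) X" and x: "x \<in> X"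
  shows "expo (pairop p q) (\<lambda>k x. l x * F k x) \<nu> x = l x * expo (pairop p q) F \<nu> x
    + shift (expo (pairop p q) (\<lambda>k x. \<Sum>i\<in>UNIV. a i * dirderiv (q i) (F k) x + b i * dirderiv (p i) (F k) x)) \<nu> x"
proof (rule hol_op.expo_mult[OF hol_op_pairop[OF X] l _ _ _ F x])
  note h = holo_dirderiv[OF _ X]
  show "hol_op X (\<lambda>f x. \<Sum>i\<in>UNIV. a i * dirderiv (q i) f x + b i * dirderiv (p i) f x)"
    by (intro hol_op_sum hol_op_plus hol_op_mult[OF X holo_const hol_op_dirderiv] X)
  fix f x assume f: "holo f X" and x: "x \<in> X"
  show "pairop p q (\<lambda>x. \<Sum>i\<in>UNIV. a i * dirderiv (q i) f x + b i * dirderiv (p i) f x) x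
      = (\<Sum>i\<in>UNIV. a i * dirderiv (q i) (pairop p q f) x + b i * dirderiv (p i) (pairop p q f) x)"
  proof -
    interpret hol_op X "pairop p q" by (rule hol_op_pairop[OF X])
    have "pairop p q (\<lambda>x. \<Sum>i\<in>UNIV. a i * dirderiv (q i) f x + b i * dirderiv (p i) f x) x
      = (\<Sum>i\<in>UNIV. pairop p q (\<lambda>x. a i * dirderiv (q i) f x + b i * dirderiv (p i) f x) x)"
      by (rule sum) (auto intro!: holo_add holo_cmult h f x)
    also have "\<dots> = (\<Sum>i\<in>UNIV. a i * pairop p q (dirderiv (q i) f) x + b i * pairop p q (dirderiv (p i) f) x)"
      by (intro sum.cong refl) (simp only: add[OF holo_cmult[OF h[OF f]] holo_cmult[OF h[OF f]] x] cmult[OF h[OF f] x])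
    finally show ?thesis by (simp add: pairop_dirderiv_commute[OF X f x])
  qed
  have "dirderiv (q i) (dirderiv (p i) (\<lambda>x. l x * f x)) x
    = l x * dirderiv (q i) (dirderiv (p i) f) x + (a i * dirderiv (q i) f x + b i * dirderiv (p i) f x)" for i
  proof -
    have "dirderiv (q i) (dirderiv (p i) (\<lambda>x. l x * f x)) x
      = dirderiv (q i) (\<lambda>x. l x * dirderiv (p i) f x + a i * f x) x"
      by (rule dirderiv_cong[OF X x]) (simp add: dirderiv_mult[OF l f] a)
    also have "\<dots> = dirderiv (q i) (\<lambda>x. l x * dirderiv (p i) f x) x + dirderiv (q i) (\<lambda>x. a i * f x) x"
      by (rule dirderiv_add[OF holo_mult[OF l h[OF f]] holo_cmult[OF f] x])
    finally show ?thesis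
      by (simp add: dirderiv_mult[OF l h[OF f] x] dirderiv_cmult[OF f x] b[OF x])
  qed
  then show "pairop p q (\<lambda>x. l x * f x) x = l x * pairop p q f x
      + (\<Sum>i\<in>UNIV. a i * dirderiv (q i) f x + b i * dirderiv (p i) f x)"
    by (simp only: pairop_def sum.distrib sum_distrib_left)
qed

lemma expo_op_cong:
  assumes "hol_op X A" "hol_op X B" "\<And>f x. holo f X \<Longrightarrow> x \<in> X \<Longrightarrow> A f x = B f x"
    and "\<And>k. holo (F k) X" "x \<in> X"
  shows "expo A F \<nu> x = expo B F \<nu> x"
proof -
  have "(A ^^ k) f x = (B ^^ k) f x" if "holo f X" "x \<in> X" for k f x
    using that(2)
  proof (induction k arbitrary: x)
    case (Suc k)
    have h: "holo ((A ^^ k) f) X" "holo ((B ^^ k) f) X"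
      using hol_op.holo[OF hol_op.hol_op_pow] assms(1,2) that(1) by blast+
    have "A ((A ^^ k) f) x = B ((A ^^ k) f) x" by (rule assms(3)[OF h(1) Suc.prems])
    also have "\<dots> = B ((B ^^ k) f) x" by (rule hol_op.cong[OF assms(2) h(1) Suc.IH Suc.prems])
    finally show ?case by simp
  qed simp
  from this[OF assms(4,5)] show ?thesis by (simp add: expo_def)
qed

text \<open>The product of power series in \<open>t\<close> with pointwise multiplication of the
  coefficients.\<close>

definition conv :: "(nat \<Rightarrow> 'a \<Rightarrow> complex) \<Rightarrow> (nat \<Rightarrow> 'a \<Rightarrow> complex) \<Rightarrow> nat \<Rightarrow> 'a \<Rightarrow> complex"
  where "conv u F k x = (\<Sum>j\<le>k. u j x * F (k - j) x)"

lemma conv_commute: "conv u F k x = conv F u k x"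
  unfolding conv_def
  by (rule sum.reindex_bij_witness[of _ "\<lambda>j. k - j" "\<lambda>j. k - j"]) (auto simp: mult.commute)

lemma holo_conv: "(\<And>k. holo (u k) X) \<Longrightarrow> (\<And>k. holo (F k) X) \<Longrightarrow> holo (conv u F k) X"
  unfolding conv_def[abs_def] by (intro holo_sum holo_mult)

text \<open>Functions that are constant along all directions of the operator pass through it like
  scalars; what remains is to exchange the sums over \<open>j + k \<le> \<nu>\<close>.\<close>

lemma expo_conv:
  assumes X: "open X" and u: "\<And>k. holo (u k) X" and F: "\<And>k. holo (F k) X" and x: "x \<in> X"
    and p: "\<And>i k x. x \<in> X \<Longrightarrow> dirderiv (p i) (u k) x = 0"
    and q: "\<And>i k x. x \<in> X \<Longrightarrow> dirderiv (q i) (u k) x = 0"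
  shows "expo (pairop p q) (conv u F) \<nu> x = conv u (expo (pairop p q) F) \<nu> x"
proof -
  let ?A = "pairop p q"
  interpret hol_op X ?A by (rule hol_op_pairop[OF X])
  have mult: "?A (\<lambda>x. u j x * f x) x = u j x * ?A f x" if f: "holo f X" and x: "x \<in> X" for j f x
  proof -
    have "dirderiv (q i) (dirderiv (p i) (\<lambda>x. u j x * f x)) x = u j x * dirderiv (q i) (dirderiv (p i) f) x" for i
    proof -
      have "dirderiv (q i) (dirderiv (p i) (\<lambda>x. u j x * f x)) x = dirderiv (q i) (\<lambda>x. u j x * dirderiv (p i) f x) x"
        by (rule dirderiv_cong[OF X x]) (simp add: dirderiv_mult[OF u f] p)
      then show ?thesis by (simp add: dirderiv_mult[OF u holo_dirderiv[OF f X] x] q x)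
    qed
    then show ?thesis by (simp add: pairop_def sum_distrib_left)
  qed
  have pow: "(?A ^^ k) (\<lambda>x. u j x * f x) x = u j x * (?A ^^ k) f x" if f: "holo f X" and x: "x \<in> X" for j k f x
    using x
  proof (induction k arbitrary: x)
    case (Suc k)
    have h: "holo ((?A ^^ k) f) X" by (rule hol_op.holo[OF hol_op_pow f])
    have "?A ((?A ^^ k) (\<lambda>x. u j x * f x)) x = ?A (\<lambda>x. u j x * (?A ^^ k) f x) x"
      by (rule hol_op_holo_cong[OF hol_op_self]) (use Suc h u in auto)
    then show ?case using mult[OF h Suc.prems] by simp
  qed simp
  have "expo ?A (conv u F) \<nu> x = (\<Sum>k\<le>\<nu>. \<Sum>j\<le>\<nu> - k. u j x * (?A ^^ k) (F (\<nu> - k - j)) x / fact k)"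
    unfolding expo_def
  proof (intro sum.cong refl)
    fix k
    have "(?A ^^ k) (conv u F (\<nu> - k)) x = (\<Sum>j\<le>\<nu> - k. (?A ^^ k) (\<lambda>x. u j x * F (\<nu> - k - j) x) x)"
      unfolding conv_def[abs_def] by (rule hol_op.sum[OF hol_op_pow]) (use u F x in auto)
    then show "(?A ^^ k) (conv u F (\<nu> - k)) x / fact k
        = (\<Sum>j\<le>\<nu> - k. u j x * (?A ^^ k) (F (\<nu> - k - j)) x / fact k)"
      by (simp add: pow[OF F x] sum_divide_distrib)
  qed
  also have "\<dots> = (\<Sum>k\<le>\<nu>. \<Sum>j | j \<in> {..\<nu>} \<and> k + j \<le> \<nu>. u j x * (?A ^^ k) (F (\<nu> - k - j)) x / fact k)"
    by (intro sum.cong refl) auto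
  also have "\<dots> = (\<Sum>j\<le>\<nu>. \<Sum>k | k \<in> {..\<nu>} \<and> k + j \<le> \<nu>. u j x * (?A ^^ k) (F (\<nu> - k - j)) x / fact k)"
    by (rule sum.swap_restrict) auto
  also have "\<dots> = (\<Sum>j\<le>\<nu>. \<Sum>k\<le>\<nu> - j. u j x * (?A ^^ k) (F (\<nu> - j - k)) x / fact k)"
    by (intro sum.cong refl) (auto simp: add.commute)
  finally show ?thesis
    by (simp add: conv_def expo_def sum_distrib_left)
qed


section \<open>Adjoint, product and pull-back as operator exponentials\<close>

type_synonym 'n pt = "(complex^'n) \<times> (complex^'n)"

definition base_dir :: "'n::finite \<Rightarrow> 'n pt" where "base_dir i = (axis i 1, 0)"
definition fibre_dir :: "'n::finite \<Rightarrow> 'n pt" where "fibre_dir i = (0, axis i 1)"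
definition antipode :: "'n::finite pt \<Rightarrow> 'n pt" where "antipode y = (fst y, - snd y)"

text \<open>Adjoint, product and pull-back act at fixed \<open>\<eta>\<close>, so their algebra can
  be done slice by slice.\<close>

definition slice :: "'n fseries \<Rightarrow> complex \<Rightarrow> nat \<Rightarrow> 'n pt \<Rightarrow> complex"
  where "slice P \<eta> k y = P k (fst y) (snd y) \<eta>"

definition local_adj :: "(nat \<Rightarrow> 'n::finite pt \<Rightarrow> complex) \<Rightarrow> nat \<Rightarrow> 'n pt \<Rightarrow> complex"
  where "local_adj F = expo (pairop base_dir fibre_dir) (\<lambda>k y. F k (antipode y))"

abbreviation (input) base_dir2 :: "'n::finite \<Rightarrow> 'n pt \<times> 'n pt" where "base_dir2 i \<equiv> (0, base_dir i)"
abbreviation (input) fibre_dir2 :: "'n::finite \<Rightarrow> 'n pt \<times> 'n pt" where "fibre_dir2 i \<equiv> (0, fibre_dir i)"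

text \<open>The doubled point consists of the parameter \<open>(z, \<zeta>)\<close> and the
  auxiliary variable \<open>(z', \<zeta>')\<close>, the latter set to 0 at the end. Making the
  parameter a coordinate turns derivatives of a product in \<open>(z, \<zeta>)\<close> into
  derivatives along the first factor, which commute with the exponential.\<close>

definition local_comp ::
  "(nat \<Rightarrow> 'n::finite pt \<Rightarrow> complex) \<Rightarrow> (nat \<Rightarrow> 'n pt \<Rightarrow> complex) \<Rightarrow> nat \<Rightarrow> 'n pt \<Rightarrow> complex"
  where "local_comp Q P \<nu> y = expo (pairop base_dir2 fibre_dir2)
    (conv (\<lambda>k x. Q k (fst (fst x), snd (fst x) + snd (snd x)))
          (\<lambda>k x. P k (fst (fst x) + fst (snd x), snd (fst x)))) \<nu> (y, 0)"

definition pull_map ::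
  "(complex^'n \<Rightarrow> complex^'n) \<Rightarrow> (complex^'n \<Rightarrow> complex^'n \<Rightarrow> complex^'n^'n) \<Rightarrow> 'n pt \<times> 'n pt \<Rightarrow> 'n pt"
  where "pull_map \<Phi> J x = (\<Phi> (fst (fst x)),
    snd (snd x) + transpose (J (\<Phi> (fst (fst x)) + fst (snd x)) (\<Phi> (fst (fst x)))) *v snd (fst x))"

definition local_pull ::
  "(complex^'n \<Rightarrow> complex^'n) \<Rightarrow> (complex^'n \<Rightarrow> complex^'n \<Rightarrow> complex^'n^'n) \<Rightarrow>
     (nat \<Rightarrow> 'n::finite pt \<Rightarrow> complex) \<Rightarrow> nat \<Rightarrow> 'n pt \<Rightarrow> complex"
  where "local_pull \<Phi> J P \<nu> y =
    expo (pairop base_dir2 fibre_dir2) (\<lambda>k x. P k (pull_map \<Phi> J x)) \<nu> (y, 0)"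

lemma pair_deriv_eq_pairop:
  "(\<lambda>y. pair_deriv F (fst y) (snd y)) = pairop base_dir fibre_dir (\<lambda>y. F (fst y) (snd y))"
  by (simp add: pair_deriv_def pairop_def dirderiv_def fun_eq_iff base_dir_def fibre_dir_def scaleC_vec_eq)

lemma exp_pair_eq_expo:
  "exp_pair F \<nu> z \<zeta> = expo (pairop base_dir fibre_dir) (\<lambda>k y. F k (fst y) (snd y)) \<nu> (z, \<zeta>)"
proof -
  have "(\<lambda>y. (pair_deriv ^^ k) f (fst y) (snd y)) = (pairop base_dir fibre_dir ^^ k) (\<lambda>y. f (fst y) (snd y))" for k f
  proof (induction k)
    case (Suc k)
    have "(\<lambda>y. (pair_deriv ^^ Suc k) f (fst y) (snd y))
        = pairop base_dir fibre_dir (\<lambda>y. (pair_deriv ^^ k) f (fst y) (snd y))"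
      using pair_deriv_eq_pairop[of "(pair_deriv ^^ k) f"] by simp
    also have "\<dots> = (pairop base_dir fibre_dir ^^ Suc k) (\<lambda>y. f (fst y) (snd y))"
      unfolding Suc by simp
    finally show ?case .
  qed simp
  from fun_cong[OF this, of _ _ "(z, \<zeta>)"]
  have "(pair_deriv ^^ k) f z \<zeta> = (pairop base_dir fibre_dir ^^ k) (\<lambda>y. f (fst y) (snd y)) (z, \<zeta>)" for k f
    by simp
  then show ?thesis by (simp add: exp_pair_def expo_def)
qed

lemma exp_pair_param:
  "exp_pair (\<lambda>k z' \<zeta>'. G k (y, (z', \<zeta>'))) \<nu> 0 0 = expo (pairop base_dir2 fibre_dir2) G \<nu> (y, 0)"
proof -
  have "expo (pairop base_dir fibre_dir) (\<lambda>k x. G k (y, x)) \<nu> 0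
      = expo (pairop base_dir2 fibre_dir2) G \<nu> (y, 0)"
    by (rule expo_pairop_affine[where F = G and g = "Pair y"]) auto
  then show ?thesis by (simp add: exp_pair_eq_expo zero_prod_def)
qed

lemma adj_eq_local: "adj P \<nu> z \<zeta> \<eta> = local_adj (slice P \<eta>) \<nu> (z, \<zeta>)"
  by (simp add: adj_def local_adj_def exp_pair_eq_expo slice_def antipode_def)

lemma slice_adj: "slice (adj P) \<eta> = local_adj (slice P \<eta>)"
  by (intro ext) (simp add: slice_def[of "adj P"] adj_eq_local)

lemma symb_comp_eq_local: "symb_comp Q P \<nu> z \<zeta> \<eta> = local_comp (slice Q \<eta>) (slice P \<eta>) \<nu> (z, \<zeta>)"
  unfolding symb_comp_def local_comp_def
  using exp_pair_param[of "conv (\<lambda>k x. slice Q \<eta> k (fst (fst x), snd (fst x) + snd (snd x)))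
          (\<lambda>k x. slice P \<eta> k (fst (fst x) + fst (snd x), snd (fst x)))" "(z, \<zeta>)" \<nu>]
  by (simp add: slice_def conv_def)

lemma slice_comp: "slice (symb_comp Q P) \<eta> = local_comp (slice Q \<eta>) (slice P \<eta>)"
  by (intro ext) (simp add: slice_def[of "symb_comp Q P"] symb_comp_eq_local)

lemma symb_pullback_eq_local:
  "symb_pullback \<Phi> J P \<nu> w \<mu> \<eta> = local_pull \<Phi> J (slice P \<eta>) \<nu> (w, \<mu>)"
  unfolding symb_pullback_def local_pull_def
  using exp_pair_param[of "\<lambda>k x. slice P \<eta> k (pull_map \<Phi> J x)" "(w, \<mu>)" \<nu>]
  by (simp add: slice_def pull_map_def)

lemma slice_pullback: "slice (symb_pullback \<Phi> J P) \<eta> = local_pull \<Phi> J (slice P \<eta>)"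
  by (intro ext) (simp add: slice_def[of "symb_pullback \<Phi> J P"] symb_pullback_eq_local)

section \<open>The adjoint as an involution that reverses products\<close>

lemma antipode_antipode [simp]: "antipode (antipode y) = y"
  by (simp add: antipode_def)

lemma fst_antipode [simp]: "fst (antipode y) = fst y"
  and snd_antipode [simp]: "snd (antipode y) = - snd y"
  by (simp_all add: antipode_def)

lemma holo_map_antipode: "holo_map f X \<Longrightarrow> holo_map (\<lambda>x. antipode (f x)) X"
  unfolding antipode_def by (intro holo_map_Pair holo_map_minus holo_map_fst holo_map_snd)

lemmas holo_map_intros = holo_map_const holo_map_id holo_map_fst holo_map_snd holo_map_Pair
  holo_map_add holo_map_diff holo_map_minus holo_map_scaleC holo_map_antipode

lemma open_antipode: "open X \<Longrightarrow> open (antipode -` X)"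
  by (intro open_vimage) (auto simp: antipode_def[abs_def] intro!: continuous_intros)

lemma antipode_dirs:
  "antipode (x + s *\<^sub>C base_dir i) = antipode x + s *\<^sub>C base_dir i"
  "antipode (x + s *\<^sub>C fibre_dir i) = antipode x + s *\<^sub>C - fibre_dir i"
  by (auto simp: antipode_def base_dir_def fibre_dir_def prod_eq_iff)

text \<open>The sign change reverses the fibre directions and so conjugates the exponential into the
  one with the opposite operator.\<close>

lemma local_adj_antipode:
  "local_adj F \<nu> (antipode y) = expo (pairop base_dir (\<lambda>i. - fibre_dir i)) F \<nu> y"
  unfolding local_adj_def
  using expo_pairop_affine[where F = F and g = antipode and p = base_dir and q = fibre_dir
      and p' = base_dir and q' = "\<lambda>i. - fibre_dir i", OF antipode_dirs]
  by simp

lemma pairop_minus_right: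
  assumes "open X" "holo f X" "x \<in> X"
  shows "pairop p (\<lambda>i. - q i) f x = - pairop p q f x"
  using dirderiv_minus_dir[OF holo_dirderiv[OF assms(2,1)] assms(3)]
  by (simp add: pairop_def sum_negf)

lemma local_adj_holo:
  assumes X: "open X" and F: "\<And>k. holo (F k) X"
  shows "holo (local_adj F \<nu>) (antipode -` X)"
  unfolding local_adj_def
  by (rule hol_op.expo_holo[OF hol_op_pairop[OF open_antipode[OF X]]])
    (rule holo_compose[OF F holo_map_antipode[OF holo_map_id]], simp)

lemma local_adj_adj:
  assumes X: "open X" and F: "\<And>k. holo (F k) X" and y: "y \<in> X"
  shows "local_adj (local_adj F) \<nu> y = F \<nu> y"
proof -
  let ?A = "pairop base_dir fibre_dir" and ?B = "pairop base_dir (\<lambda>i. - fibre_dir i)"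
  have AB: "hol_op X ?A" "hol_op X ?B" by (rule hol_op_pairop[OF X])+
  have "local_adj (local_adj F) \<nu> y = expo ?A (expo ?B F) \<nu> y"
    unfolding local_adj_def[of "local_adj F"] local_adj_antipode ..
  also have "\<dots> = expo (\<lambda>f x. ?A f x + ?B f x) F \<nu> y"
    by (rule expo_plus[where A = ?A and B = ?B, OF AB pairop_commute[OF X] F y, symmetric])
  also have "\<dots> = F \<nu> y"
  proof (rule hol_op.expo_annihilated[OF hol_op_plus[OF AB] _ F y])
    fix k x assume "x \<in> X"
    from pairop_minus_right[OF X F[of k] this, of base_dir fibre_dir] show "?A (F k) x + ?B (F k) x = 0" by simp
  qed
  finally show ?thesis .
qed

text \<open>Second derivatives are bilinear in the directions. The case of interest is the diagonal
  map, which sends each direction to the sum of its copies in the two factors.\<close>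

lemma pairop_sum_dirs:
  assumes X: "open X" and f: "holo f X" and x: "x \<in> X"
  shows "pairop (\<lambda>i. p1 i + p2 i) (\<lambda>i. q1 i + q2 i) f x
    = pairop p1 q1 f x + pairop p1 q2 f x + pairop p2 q1 f x + pairop p2 q2 f x"
proof -
  note h = holo_dirderiv[OF f X]
  have "dirderiv (q1 i + q2 i) (dirderiv (p1 i + p2 i) f) x
     = dirderiv (q1 i) (dirderiv (p1 i) f) x + dirderiv (q2 i) (dirderiv (p1 i) f) x
       + dirderiv (q1 i) (dirderiv (p2 i) f) x + dirderiv (q2 i) (dirderiv (p2 i) f) x" for i
  proof -
    have "dirderiv v (dirderiv (p1 i + p2 i) f) x = dirderiv v (dirderiv (p1 i) f) x + dirderiv v (dirderiv (p2 i) f) x" for v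
    proof -
      have "dirderiv v (dirderiv (p1 i + p2 i) f) x = dirderiv v (\<lambda>x. dirderiv (p1 i) f x + dirderiv (p2 i) f x) x"
        by (rule dirderiv_cong[OF X x]) (rule holo_has_derivative(3)[OF f])
      then show ?thesis by (simp add: dirderiv_add[OF h h x])
    qed
    then show ?thesis by (simp only: holo_has_derivative(3)[OF h x] add_ac)
  qed
  then show ?thesis by (simp only: pairop_def sum.distrib)
qed

text \<open>Doubling the variables, with \<open>Q\<close> in the first and \<open>P\<close> in the second copy, makes both sides
  restrictions to the diagonal of the exponential of the same sum of commuting operators.\<close>

lemma local_adj_comp:
  assumes X: "open X" and Q: "\<And>k. holo (Q k) X" and P: "\<And>k. holo (P k) X" and y: "antipode y \<in> X"
  shows "local_adj (local_comp Q P) \<nu> y = local_comp (local_adj P) (local_adj Q) \<nu> y"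
proof -
  let ?X = "antipode -` X"
  define Y where "Y = ?X \<times> ?X"
  have Y: "open Y" unfolding Y_def by (intro open_Times open_antipode X)
  have yY: "(y, y) \<in> Y" using y by (simp add: Y_def)
  define p1 :: "'a \<Rightarrow> 'a pt \<times> 'a pt" where "p1 i = (base_dir i, 0)" for i
  define q1 :: "'a \<Rightarrow> 'a pt \<times> 'a pt" where "q1 i = (fibre_dir i, 0)" for i
  define p2 :: "'a \<Rightarrow> 'a pt \<times> 'a pt" where "p2 i = (0, base_dir i)" for i
  define q2 :: "'a \<Rightarrow> 'a pt \<times> 'a pt" where "q2 i = (0, fibre_dir i)" for i
  define U where "U k x = Q k (antipode (fst x))" for k and x :: "'a pt \<times> 'a pt"
  define V where "V k x = P k (antipode (snd x))" for k and x :: "'a pt \<times> 'a pt"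
  have hU: "holo (U k) Y" for k
    unfolding U_def[abs_def]
    by (rule holo_compose[OF Q, of "\<lambda>x. antipode (fst x)"])
      (intro holo_map_intros, auto simp: Y_def)
  have hV: "holo (V k) Y" for k
    unfolding V_def[abs_def]
    by (rule holo_compose[OF P, of "\<lambda>x. antipode (snd x)"])
      (intro holo_map_intros, auto simp: Y_def)
  define K where "K = conv U V"
  have hK: "holo (K k) Y" for k unfolding K_def by (rule holo_conv[OF hU hV])
  let ?D12 = "pairop p2 q1" and ?D12' = "pairop p2 (\<lambda>i. - q1 i)" and ?D21 = "pairop p1 q2"
    and ?D11 = "pairop p1 q1" and ?D22 = "pairop p2 q2"
    and ?D = "pairop (\<lambda>i. p1 i + p2 i) (\<lambda>i. q1 i + q2 i)"
  note op = hol_op_pairop[OF Y]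
  let ?E = "\<lambda>f x. ?D11 f x + ?D22 f x"
  have opE: "hol_op Y ?E" by (rule hol_op_plus[OF op op])
  have op': "hol_op Y ?D11" "hol_op Y ?D22" "hol_op Y ?D21" by (rule op)+
  \<comment> \<open>In the product \<open>Q\<close> is differentiated in its fibre variable and
    \<open>P\<close> in its base variable. The sign change built into \<open>U\<close> reverses the
    fibre direction of the first copy.\<close>
  have comp1: "local_comp Q P k (antipode y) = expo ?D12' K k (y, y)" for k y
  proof -
    define g where "g x = ((fst (fst x), - snd (fst x) - snd (snd x)), (fst (fst x) + fst (snd x), - snd (fst x)))"
      for x :: "'a pt \<times> 'a pt"
    have "local_comp Q P k (antipode y) = expo (pairop base_dir2 fibre_dir2) (\<lambda>k x. K k (g x)) k (antipode y, 0)"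
      unfolding local_comp_def by (simp add: K_def conv_def[abs_def] U_def V_def g_def antipode_def add.commute)
    also have "\<dots> = expo ?D12' K k (g (antipode y, 0))"
      by (rule expo_pairop_affine[where F = K and g = g])
        (simp_all add: g_def p2_def q1_def base_dir_def fibre_dir_def)
    finally show ?thesis by (simp add: g_def antipode_def)
  qed
  have "local_adj (local_comp Q P) \<nu> y = expo (pairop base_dir fibre_dir) (\<lambda>k y. expo ?D12' K k (y, y)) \<nu> y"
    by (simp add: local_adj_def comp1)
  also have "\<dots> = expo ?D (expo ?D12' K) \<nu> (y, y)"
    by (rule expo_pairop_affine[where F = "expo ?D12' K" and g = "\<lambda>y. (y, y)"])
      (simp_all add: p1_def p2_def q1_def q2_def)
  also have "\<dots> = expo (\<lambda>f x. ?D f x + ?D12' f x) K \<nu> (y, y)"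
    by (rule expo_plus[where A = ?D and B = ?D12', OF op op pairop_commute[OF Y] hK yY, symmetric])
  \<comment> \<open>Restriction to the diagonal contributes two pure and two mixed terms. The mixed
    term that differentiates \<open>P\<close> in the base and \<open>Q\<close> in the fibre cancels
    against \<open>?D12'\<close>; the opposite mixed term survives, and this reverses the order of
    the factors.\<close>
  also have "\<dots> = expo (\<lambda>f x. ?D21 f x + (?D11 f x + ?D22 f x)) K \<nu> (y, y)"
  proof (rule expo_op_cong[OF hol_op_plus[OF op op] hol_op_plus[OF op hol_op_plus[OF op op]] _ hK yY])
    fix f x assume f: "holo f Y" and x: "x \<in> Y"
    show "?D f x + ?D12' f x = ?D21 f x + (?D11 f x + ?D22 f x)"
      unfolding pairop_sum_dirs[OF Y f x] pairop_minus_right[OF Y f x, of p2 q1] by simp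
  qed
  also have "\<dots> = expo ?D21 (expo (\<lambda>f x. ?D11 f x + ?D22 f x) K) \<nu> (y, y)"
  proof (rule expo_plus[where A = ?D21 and B = ?E and X = Y and F = K and x = "(y, y)"])
    fix f x assume f: "holo f Y" and x: "x \<in> Y"
    have "?D21 (?E f) x = ?D21 (?D11 f) x + ?D21 (?D22 f) x"
      by (rule hol_op.add[OF op'(3) hol_op.holo[OF op'(1) f] hol_op.holo[OF op'(2) f] x])
    then show "?D21 (?E f) x = ?E (?D21 f) x"
      using pairop_commute[OF Y f x, of p1 q2 p1 q1] pairop_commute[OF Y f x, of p1 q2 p2 q2] by simp
  qed (rule op' opE hK yY)+
  also have "\<dots> = expo ?D21 (expo ?D11 (expo ?D22 K)) \<nu> (y, y)"
  proof (rule hol_op.expo_cong[OF op'(3) hol_op.expo_holo[OF opE hK] _ yY])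
    fix k x assume "x \<in> Y"
    then show "expo ?E K k x = expo ?D11 (expo ?D22 K) k x"
      by (intro expo_plus[where A = ?D11 and B = ?D22 and X = Y and F = K and x = x] op' hK pairop_commute[OF Y])
  qed
  \<comment> \<open>Each pure operator sees only one copy, so it acts on one factor alone and turns
    it into its adjoint.\<close>
  also have "\<dots> = expo ?D21 (conv (expo ?D22 V) (expo ?D11 U)) \<nu> (y, y)"
  proof (rule hol_op.expo_cong[OF op'(3) hol_op.expo_holo[OF op'(1) hol_op.expo_holo[OF op'(2) hK]] _ yY])
    fix k x assume x: "x \<in> Y"
    note h22 = hol_op.expo_holo[OF op'(2) hV]
    have dU: "dirderiv (0, v) (U k) x = 0" for k v x
      by (simp add: U_def[abs_def] dirderiv_def)
    have eV: "expo ?D22 V k x = expo (pairop base_dir fibre_dir) (\<lambda>k y. P k (antipode y)) k (snd x)" for k x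
      unfolding V_def[abs_def]
      by (rule expo_pairop_affine[where F = "\<lambda>k y. P k (antipode y)" and g = snd]) (simp_all add: p2_def q2_def)
    have dV: "dirderiv (v, 0) (expo ?D22 V k) x = 0" for k v x
      by (simp add: eV[abs_def] dirderiv_def)
    have "expo ?D11 (expo ?D22 K) k x = expo ?D11 (conv (expo ?D22 V) U) k x"
    proof (rule hol_op.expo_cong[OF op'(1) hol_op.expo_holo[OF op'(2) hK] _ x])
      fix k x assume x: "x \<in> Y"
      have "expo ?D22 K k x = conv U (expo ?D22 V) k x"
        unfolding K_def by (rule expo_conv[OF Y hU hV x]) (simp_all add: p2_def q2_def dU)
      then show "expo ?D22 K k x = conv (expo ?D22 V) U k x" by (simp add: conv_commute)
    qed
    also have "\<dots> = conv (expo ?D22 V) (expo ?D11 U) k x"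
      by (rule expo_conv[OF Y h22 hU x]) (simp_all add: p1_def q1_def dV)
    finally show "expo ?D11 (expo ?D22 K) k x = conv (expo ?D22 V) (expo ?D11 U) k x" .
  qed
  also have "\<dots> = local_comp (local_adj P) (local_adj Q) \<nu> y"
  proof -
    define g where "g x = ((fst (fst x) + fst (snd x), snd (fst x)), (fst (fst x), snd (fst x) + snd (snd x)))"
      for x :: "'a pt \<times> 'a pt"
    have eV: "expo ?D22 V k x = local_adj P k (snd x)" for k x
      unfolding V_def[abs_def] local_adj_def
      by (rule expo_pairop_affine[where F = "\<lambda>k y. P k (antipode y)" and g = snd]) (simp_all add: p2_def q2_def)
    have eU: "expo ?D11 U k x = local_adj Q k (fst x)" for k x
      unfolding U_def[abs_def] local_adj_def
      by (rule expo_pairop_affine[where F = "\<lambda>k y. Q k (antipode y)" and g = fst]) (simp_all add: p1_def q1_def)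
    have "local_comp (local_adj P) (local_adj Q) \<nu> y
        = expo (pairop base_dir2 fibre_dir2) (\<lambda>k x. conv (expo ?D22 V) (expo ?D11 U) k (g x)) \<nu> (y, 0)"
      unfolding local_comp_def by (simp add: conv_def[abs_def] eU eV g_def)
    also have "\<dots> = expo ?D21 (conv (expo ?D22 V) (expo ?D11 U)) \<nu> (g (y, 0))"
      by (rule expo_pairop_affine[where F = "conv (expo ?D22 V) (expo ?D11 U)" and g = g])
        (simp_all add: g_def p1_def q2_def base_dir_def fibre_dir_def)
    finally show ?thesis by (simp add: g_def)
  qed
  finally show ?thesis .
qed

section \<open>Conic geometry and Cauchy estimates\<close>

lemma cmod_le_maxnorm: "cmod (x $ i) \<le> maxnorm x"
  unfolding maxnorm_def by (intro Max_ge) auto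

lemma maxnorm_le: "(\<And>i. cmod (x $ i) \<le> B) \<Longrightarrow> maxnorm x \<le> B"
  unfolding maxnorm_def by (intro Max.boundedI) auto

lemma maxnorm_nonneg: "0 \<le> maxnorm x"
  using cmod_le_maxnorm[of x undefined] norm_ge_zero order_trans by blast

lemma maxnorm_zero [simp]: "maxnorm 0 = 0"
  by (intro antisym maxnorm_nonneg maxnorm_le) simp

lemma maxnorm_minus [simp]: "maxnorm (- x) = maxnorm x"
  by (simp add: maxnorm_def)

lemma maxnorm_triangle: "maxnorm (x + y) \<le> maxnorm x + maxnorm y"
proof (rule maxnorm_le)
  fix i
  show "cmod ((x + y) $ i) \<le> maxnorm x + maxnorm y"
    using norm_triangle_ineq[of "x $ i" "y $ i"] cmod_le_maxnorm[of x i] cmod_le_maxnorm[of y i] by simp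
qed

lemma maxnorm_triangle_diff: "maxnorm (x + y) \<ge> maxnorm x - maxnorm y"
  using maxnorm_triangle[of "x + y" "- y"] by simp

lemma maxnorm_scale: "maxnorm (c *s x) = cmod c * maxnorm x"
proof (rule antisym)
  show "maxnorm (c *s x) \<le> cmod c * maxnorm x"
    by (rule maxnorm_le) (simp add: norm_mult mult_left_mono cmod_le_maxnorm)
  have "maxnorm x \<in> range (\<lambda>i. cmod (x $ i))"
    unfolding maxnorm_def by (rule Max_in) auto
  then obtain i where i: "maxnorm x = cmod (x $ i)" by auto
  show "cmod c * maxnorm x \<le> maxnorm (c *s x)"
    using cmod_le_maxnorm[of "c *s x" i] by (simp add: i norm_mult)
qed

lemma maxnorm_le_norm: "maxnorm x \<le> norm x"
  by (rule maxnorm_le) (rule Finite_Cartesian_Product.norm_nth_le)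

lemma maxnorm_axis: "maxnorm (axis i (1::complex)) \<le> 1"
  by (rule maxnorm_le) (simp add: axis_def)

text \<open>A point of a thickening is only a limit of points
  \<open>(w + w', \<mu> + \<mu>')\<close>. An approximation within half of
  \<open>maxnorm \<zeta>\<close> gives \<open>maxnorm \<zeta> \<le> 2 * maxnorm (\<mu> + \<mu>')
  \<le> 4 * maxnorm \<mu>\<close>, so an opening \<open>a\<close> relative to \<open>\<zeta>\<close>
  is an opening \<open>4 * a\<close> relative to \<open>\<mu>\<close>. Keeping the same
  approximation error shows that the displaced point is again a limit.\<close>

lemma thicken_thicken:
  assumes y: "(z, \<zeta>) \<in> thicken \<rho>' \<Omega>" and \<zeta>: "\<zeta> \<noteq> 0"
    and z': "maxnorm z' \<le> a" and \<zeta>': "maxnorm \<zeta>' \<le> a * maxnorm \<zeta>"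
    and a: "0 \<le> a" "\<rho>' + 4 * a \<le> \<rho>" "0 \<le> \<rho>'" "\<rho>' \<le> 1"
  shows "(z + z', \<zeta> + \<zeta>') \<in> thicken \<rho> \<Omega>"
  unfolding thicken_def closure_approachable
proof (intro allI impI)
  fix e :: real assume e: "e > 0"
  have \<zeta>0: "maxnorm \<zeta> > 0"
  proof (rule ccontr)
    assume "\<not> ?thesis"
    then have "cmod (\<zeta> $ i) = 0" for i
      using cmod_le_maxnorm[of \<zeta> i] norm_ge_zero[of "\<zeta> $ i"] \<open>\<not> 0 < maxnorm \<zeta>\<close> by linarith
    then show False using \<zeta> by (simp add: vec_eq_iff)
  qed
  obtain w \<mu> w' \<mu>' where w: "(w, \<mu>) \<in> \<Omega>" "maxnorm w' \<le> \<rho>'" "maxnorm \<mu>' \<le> \<rho>' * maxnorm \<mu>"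
    and d: "dist (w + w', \<mu> + \<mu>') (z, \<zeta>) < min e (maxnorm \<zeta> / 2)"
    using y[unfolded thicken_def closure_approachable, rule_format, of "min e (maxnorm \<zeta> / 2)"] e \<zeta>0
    by auto
  have "maxnorm (\<zeta> - (\<mu> + \<mu>')) \<le> dist (\<mu> + \<mu>') \<zeta>"
    using maxnorm_le_norm[of "\<zeta> - (\<mu> + \<mu>')"] by (simp add: dist_norm norm_minus_commute)
  also have "\<dots> \<le> dist (w + w', \<mu> + \<mu>') (z, \<zeta>)"
    using dist_snd_le[of "(w + w', \<mu> + \<mu>')" "(z, \<zeta>)"] by simp
  finally have "maxnorm (\<zeta> - (\<mu> + \<mu>')) \<le> maxnorm \<zeta> / 2" using d by simp
  then have "maxnorm \<zeta> \<le> 2 * maxnorm (\<mu> + \<mu>')"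
    using maxnorm_triangle[of "\<zeta> - (\<mu> + \<mu>')" "\<mu> + \<mu>'"] by simp
  also have "maxnorm (\<mu> + \<mu>') \<le> (1 + \<rho>') * maxnorm \<mu>"
    using maxnorm_triangle[of \<mu> \<mu>'] w(3) by (simp add: algebra_simps)
  also have "\<dots> \<le> 2 * maxnorm \<mu>"
    by (intro mult_right_mono maxnorm_nonneg) (use a in auto)
  finally have "a * maxnorm \<zeta> \<le> a * (4 * maxnorm \<mu>)"
    using a(1) by (intro mult_left_mono) auto
  then have "maxnorm (\<mu>' + \<zeta>') \<le> \<rho>' * maxnorm \<mu> + 4 * a * maxnorm \<mu>"
    using maxnorm_triangle[of \<mu>' \<zeta>'] w(3) \<zeta>' by simp
  also have "\<dots> = (\<rho>' + 4 * a) * maxnorm \<mu>" by (simp add: algebra_simps)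
  also have "\<dots> \<le> \<rho> * maxnorm \<mu>"
    by (intro mult_right_mono maxnorm_nonneg a)
  finally have 2: "maxnorm (\<mu>' + \<zeta>') \<le> \<rho> * maxnorm \<mu>" .
  have 1: "maxnorm (w' + z') \<le> \<rho>"
    using maxnorm_triangle[of w' z'] w(2) z' a by simp
  show "\<exists>y\<in>\<Union>(z, \<zeta>)\<in>\<Omega>. {(z + z', \<zeta> + \<zeta>') |z' \<zeta>'. maxnorm z' \<le> \<rho> \<and> maxnorm \<zeta>' \<le> \<rho> * maxnorm \<zeta>}.
      dist y (z + z', \<zeta> + \<zeta>') < e"
  proof (rule bexI[of _ "(w + (w' + z'), \<mu> + (\<mu>' + \<zeta>'))"])
    have "dist (w + (w' + z'), \<mu> + (\<mu>' + \<zeta>')) (z + z', \<zeta> + \<zeta>') = dist (w + w', \<mu> + \<mu>') (z, \<zeta>)"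
      by (simp add: dist_prod_def dist_norm algebra_simps)
    then show "dist (w + (w' + z'), \<mu> + (\<mu>' + \<zeta>')) (z + z', \<zeta> + \<zeta>') < e" using d by simp
  qed (use w 1 2 in blast)
qed

lemma symb_domD:
  assumes "(z, \<zeta>) \<in> symb_dom \<Omega> d \<rho>"
  shows "(z, \<zeta>) \<in> thicken \<rho> \<Omega>" "d * (1 - \<rho>) \<le> maxnorm \<zeta>"
  using assms by (auto simp: symb_dom_def truncate_below_def)

text \<open>The radius \<open>\<rho> / 8\<close> satisfies
  \<open>\<rho> / 2 + 4 * (\<rho> / 8) = \<rho>\<close>, and
  \<open>(1 - \<rho> / 8) * (1 - \<rho> / 2)\<close> is at least \<open>1 - \<rho>\<close>, so the
  lower bound on the fibre variable survives as well. This is the room for Cauchy's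
  inequality.\<close>

lemma symb_dom_polydisc:
  assumes y: "(z, \<zeta>) \<in> symb_dom \<Omega> d (\<rho> / 2)" and d: "0 < d" and \<rho>: "0 < \<rho>" "\<rho> < 1"
    and z': "maxnorm z' \<le> \<rho> / 8" and \<zeta>': "maxnorm \<zeta>' \<le> \<rho> / 8 * maxnorm \<zeta>"
  shows "(z + z', \<zeta> + \<zeta>') \<in> symb_dom \<Omega> d \<rho>"
proof -
  have \<zeta>: "d * (1 - \<rho> / 2) \<le> maxnorm \<zeta>" and t: "(z, \<zeta>) \<in> thicken (\<rho> / 2) \<Omega>"
    using symb_domD[OF y] by auto
  have "0 < d * (1 - \<rho> / 2)" using d \<rho> by simp
  with \<zeta> have "\<zeta> \<noteq> 0" by auto
  then have 1: "(z + z', \<zeta> + \<zeta>') \<in> thicken \<rho> \<Omega>"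
    by (intro thicken_thicken[OF t _ z' \<zeta>']) (use \<rho> in auto)
  have "d * (1 - \<rho>) \<le> (1 - \<rho> / 8) * (d * (1 - \<rho> / 2))"
  proof -
    have "1 - \<rho> \<le> (1 - \<rho> / 8) * (1 - \<rho> / 2)" using \<rho> by (simp add: algebra_simps)
    then have "d * (1 - \<rho>) \<le> d * ((1 - \<rho> / 8) * (1 - \<rho> / 2))" using d by (intro mult_left_mono) auto
    then show ?thesis by (simp add: mult_ac)
  qed
  also have "\<dots> \<le> (1 - \<rho> / 8) * maxnorm \<zeta>" using \<zeta> \<rho> by (intro mult_left_mono) auto
  also have "\<dots> \<le> maxnorm (\<zeta> + \<zeta>')"
    using maxnorm_triangle_diff[of \<zeta> \<zeta>'] \<zeta>' by (simp add: algebra_simps)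
  finally show ?thesis using 1 by (simp add: symb_dom_def truncate_below_def)
qed

lemma symb_dom_mono:
  assumes "\<rho>' \<le> \<rho>" "d * (1 - \<rho>) \<le> d' * (1 - \<rho>')"
  shows "symb_dom \<Omega> d' \<rho>' \<subseteq> symb_dom \<Omega> d \<rho>"
proof -
  have "thicken \<rho>' \<Omega> \<subseteq> thicken \<rho> \<Omega>"
    unfolding thicken_def
  proof (intro closure_mono UN_mono order_refl, clarify)
    fix z \<zeta> z' \<zeta>' :: "complex^'a" assume "maxnorm z' \<le> \<rho>'" "maxnorm \<zeta>' \<le> \<rho>' * maxnorm \<zeta>"
    moreover have "\<rho>' * maxnorm \<zeta> \<le> \<rho> * maxnorm \<zeta>" using assms(1) maxnorm_nonneg by (rule mult_right_mono)
    ultimately show "\<exists>z'' \<zeta>''. (z + z', \<zeta> + \<zeta>') = (z + z'', \<zeta> + \<zeta>'') \<and> maxnorm z'' \<le> \<rho> \<and> maxnorm \<zeta>'' \<le> \<rho> * maxnorm \<zeta>"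
      using assms(1) by (intro exI[of _ z'] exI[of _ \<zeta>']) auto
  qed
  then show ?thesis using assms(2) by (auto simp: symb_dom_def truncate_below_def)
qed

text \<open>Two symbols come with domains of their own; the larger \<open>d\<close> and the smaller
  \<open>\<rho>\<close> serve both.\<close>

lemma symb_dom_common:
  assumes "0 < d1" "0 < \<rho>1" "\<rho>1 < 1" "0 < d2" "0 < \<rho>2" "\<rho>2 < 1"
  obtains d \<rho> where "0 < d" "0 < \<rho>" "\<rho> < (1::real)"
    "symb_dom \<Omega> d \<rho> \<subseteq> symb_dom \<Omega> d1 \<rho>1" "symb_dom \<Omega> d \<rho> \<subseteq> symb_dom \<Omega> d2 \<rho>2"
proof (rule that[of "max d1 d2" "min \<rho>1 \<rho>2"])
  show "symb_dom \<Omega> (max d1 d2) (min \<rho>1 \<rho>2) \<subseteq> symb_dom \<Omega> d1 \<rho>1"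
    by (rule symb_dom_mono) (use assms in \<open>auto intro!: mult_mono\<close>)
  show "symb_dom \<Omega> (max d1 d2) (min \<rho>1 \<rho>2) \<subseteq> symb_dom \<Omega> d2 \<rho>2"
    by (rule symb_dom_mono) (use assms in \<open>auto intro!: mult_mono\<close>)
qed (use assms in auto)

lemma bounded_linear_antipode: "bounded_linear (antipode :: 'n::finite pt \<Rightarrow> 'n pt)"
  unfolding antipode_def[abs_def]
  by (intro bounded_linear_Pair bounded_linear_fst bounded_linear_minus bounded_linear_snd)

text \<open>The antipode is linear and preserves \<open>maxnorm\<close>, which gives one inclusion;
  being an involution, it gives the other one from the same statement for the antipodal set.\<close>

lemma thicken_antipodal: "thicken \<rho> (antipodal \<Omega>) = antipode -` thicken \<rho> \<Omega>"
proof -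
  let ?A = "\<lambda>\<Omega>. \<Union>(z, \<zeta>)\<in>\<Omega>. {(z + z', \<zeta> + \<zeta>') |z' \<zeta>'. maxnorm z' \<le> \<rho> \<and> maxnorm \<zeta>' \<le> \<rho> * maxnorm \<zeta>}"
  have sub: "antipode ` ?A \<Omega> \<subseteq> ?A (antipodal \<Omega>)" for \<Omega> :: "'a pt set"
  proof
    fix y assume "y \<in> antipode ` ?A \<Omega>"
    then obtain z \<zeta> z' \<zeta>' where *: "(z, \<zeta>) \<in> \<Omega>" "maxnorm z' \<le> \<rho>" "maxnorm \<zeta>' \<le> \<rho> * maxnorm \<zeta>"
      and y: "y = antipode (z + z', \<zeta> + \<zeta>')" by blast
    show "y \<in> ?A (antipodal \<Omega>)"
      using * by (intro UN_I[of "(z, - \<zeta>)"]) (auto simp: y antipodal_def antipode_def intro!: exI[of _ "- \<zeta>'"])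
  qed
  have im: "antipode ` thicken \<rho> \<Omega> \<subseteq> thicken \<rho> (antipodal \<Omega>)" for \<Omega> :: "'a pt set"
    unfolding thicken_def
    using closure_bounded_linear_image_subset[OF bounded_linear_antipode] closure_mono[OF sub] by blast
  have aa: "antipodal (antipodal \<Omega>) = \<Omega>" by (auto simp: antipodal_def)
  show ?thesis
  proof (intro set_eqI iffI)
    fix y assume "y \<in> thicken \<rho> (antipodal \<Omega>)"
    then show "y \<in> antipode -` thicken \<rho> \<Omega>" using im[of "antipodal \<Omega>"] by (auto simp: aa)
  next
    fix y assume "y \<in> antipode -` thicken \<rho> \<Omega>"
    then have "antipode (antipode y) \<in> thicken \<rho> (antipodal \<Omega>)" using im[of \<Omega>] by blast
    then show "y \<in> thicken \<rho> (antipodal \<Omega>)" by simp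
  qed
qed

lemma symb_dom_antipodal: "symb_dom (antipodal \<Omega>) d \<rho> = antipode -` symb_dom \<Omega> d \<rho>"
  by (auto simp: symb_dom_def truncate_below_def thicken_antipodal antipode_def)

text \<open>Base and fibre have separate radii, because in the conic geometry the admissible fibre
  radius grows with \<open>maxnorm \<zeta>\<close>.\<close>

definition polydisc :: "'n::finite pt \<Rightarrow> real \<Rightarrow> real \<Rightarrow> 'n pt set" where
  "polydisc y a b = {x. maxnorm (fst x - fst y) \<le> a \<and> maxnorm (snd x - snd y) \<le> b}"

lemma polydisc_base:
  assumes "x \<in> polydisc y a b" "cmod s \<le> a'"
  shows "x + s *\<^sub>C base_dir i \<in> polydisc y (a + a') b"
proof -
  have "maxnorm (s *s axis i 1 :: complex^'a) \<le> a' * 1"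
    unfolding maxnorm_scale by (intro mult_mono assms maxnorm_axis maxnorm_nonneg) (use assms norm_ge_zero order_trans in blast)
  then show ?thesis
    using assms maxnorm_triangle[of "fst x - fst y" "s *s axis i 1"]
    by (simp add: polydisc_def base_dir_def scaleC_vec_eq algebra_simps)
qed

lemma polydisc_fibre:
  assumes "x \<in> polydisc y a b" "cmod s \<le> b'"
  shows "x + s *\<^sub>C fibre_dir i \<in> polydisc y a (b + b')"
proof -
  have "maxnorm (s *s axis i 1 :: complex^'a) \<le> b' * 1"
    unfolding maxnorm_scale by (intro mult_mono assms maxnorm_axis maxnorm_nonneg) (use assms norm_ge_zero order_trans in blast)
  then show ?thesis
    using assms maxnorm_triangle[of "snd x - snd y" "s *s axis i 1"]
    by (simp add: polydisc_def fibre_dir_def scaleC_vec_eq algebra_simps)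
qed

lemma polydisc_mono: "a \<le> a' \<Longrightarrow> b \<le> b' \<Longrightarrow> polydisc y a b \<subseteq> polydisc y a' b'"
  by (auto simp: polydisc_def)

text \<open>Cauchy's inequality, giving up \<open>1 / k\<close> of both radii in each of the \<open>k\<close> steps.\<close>

lemma pairop_pow_bound:
  fixes y :: "'n::finite pt"
  assumes X: "open X" and f: "holo f X" and ab: "0 < a" "0 < b" and sub: "polydisc y a b \<subseteq> X"
    and B: "\<And>x. x \<in> polydisc y a b \<Longrightarrow> cmod (f x) \<le> B"
  shows "cmod ((pairop base_dir fibre_dir ^^ k) f y) \<le> (of_nat CARD('n) * (of_nat k)\<^sup>2 / (a * b)) ^ k * B"
proof (cases "k = 0")
  case True
  have "y \<in> polydisc y a b" using ab by (simp add: polydisc_def)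
  then show ?thesis using True B by simp
next
  case k: False
  let ?D = "pairop base_dir fibre_dir :: ('n pt \<Rightarrow> complex) \<Rightarrow> _"
  \<comment> \<open>One step costs a factor \<open>k / a\<close> for the base derivative,
    \<open>k / b\<close> for the fibre derivative, and the number of summands of the
    operator.\<close>
  let ?K = "of_nat CARD('n) * (of_nat k)\<^sup>2 / (a * b) :: real"
  let ?P = "\<lambda>j. polydisc y ((1 - of_nat j / of_nat k) * a) ((1 - of_nat j / of_nat k) * b)"
  have PX: "?P j \<subseteq> X" for j
    by (rule order_trans[OF polydisc_mono sub]) (use ab in \<open>auto simp: mult_le_cancel_right1\<close>)
  have "\<forall>x\<in>?P j. cmod ((?D ^^ j) f x) \<le> ?K ^ j * B" if "j \<le> k" for j
    using that
  proof (induction j)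
    case 0
    then show ?case using B by simp
  next
    case (Suc j)
    let ?g = "(?D ^^ j) f"
    have g: "holo ?g X" by (rule hol_op.holo[OF hol_op.hol_op_pow[OF hol_op_pairop[OF X]] f])
    have IH: "cmod (?g x) \<le> ?K ^ j * B" if "x \<in> ?P j" for x using Suc that by simp
    show ?case
    proof
      fix x assume x: "x \<in> ?P (Suc j)"
      have eq: "(1 - real (Suc j) / real k) * c + c / real k = (1 - real j / real k) * c" for c
        using k by (simp add: field_simps)
      have 1: "x + s *\<^sub>C fibre_dir i + u *\<^sub>C base_dir i \<in> ?P j" if "cmod s \<le> b / k" "cmod u \<le> a / k" for s u i
        using polydisc_base[OF polydisc_fibre[OF x that(1)] that(2), of i i] by (simp only: eq)
      have 2: "x + s *\<^sub>C fibre_dir i \<in> X" if "cmod s \<le> b / k" for s i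
        using 1[OF that, of 0 i] PX[of j] ab k by auto
      have "cmod (dirderiv (fibre_dir i) (dirderiv (base_dir i) ?g) x) \<le> (?K ^ j * B) / (a / k) / (b / k)" for i
      proof (rule norm_dirderiv_le[OF holo_dirderiv[OF g X]])
        fix s :: complex assume "cmod s = b / k"
        then have s: "cmod s \<le> b / k" by simp
        show "cmod (dirderiv (base_dir i) ?g (x + s *\<^sub>C fibre_dir i)) \<le> (?K ^ j * B) / (a / k)"
          by (rule norm_dirderiv_le[OF g]) (use 1[OF s] PX[of j] ab k IH in \<open>auto intro!: IH\<close>)
      qed (use 2 ab k in auto)
      then have "cmod (?D ?g x) \<le> of_nat CARD('n) * ((?K ^ j * B) / (a / k) / (b / k))"
        unfolding pairop_def by (intro order_trans[OF norm_sum] sum_bounded_above)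
      also have "\<dots> = ?K ^ Suc j * B" by (simp add: power2_eq_square)
      finally show "cmod ((?D ^^ Suc j) f x) \<le> ?K ^ Suc j * B" by simp
    qed
  qed
  moreover have "y \<in> ?P k" using k by (simp add: polydisc_def)
  ultimately show ?thesis by blast
qed

text \<open>The left side over \<open>fact k\<close> is a single term of the exponential series at
  \<open>k\<close>.\<close>

lemma power_self_le_exp_fact: "(real k) ^ k \<le> exp (real k) * fact k"
proof -
  have "(real k) ^ k / fact k \<le> exp (real k)"
  proof -
    have "(\<Sum>n\<in>{k}. (real k) ^ n /\<^sub>R fact n) \<le> (\<Sum>n. (real k) ^ n /\<^sub>R fact n)"
      by (rule sum_le_suminf) (auto simp: summable_exp)
    then show ?thesis by (simp add: exp_def divide_inverse mult.commute)
  qed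
  then show ?thesis by (simp add: field_simps)
qed

text \<open>Here \<open>\<epsilon>\<close> stands for the modulus of \<open>\<eta>\<close> and
  \<open>\<zeta>\<close> for the norm of the fibre variable. Derivatives produce powers of
  \<open>1 / \<zeta>\<close> but none of \<open>1 / \<epsilon>\<close>; as
  \<open>\<epsilon> \<le> 1\<close>, the missing powers may be inserted.\<close>

lemma expo_pairop_bound:
  fixes y :: "'n::finite pt"
  assumes X: "open X" and F: "\<And>k. holo (F k) X" and a: "0 < a" "a < 1" and \<zeta>: "0 < \<zeta>" and \<epsilon>: "0 < \<epsilon>" "\<epsilon> \<le> 1"
    and sub: "polydisc y a (a * \<zeta>) \<subseteq> X" and A: "0 < A" and C: "0 < C"
    and bound: "\<And>k x. x \<in> polydisc y a (a * \<zeta>) \<Longrightarrow> cmod (F k x) \<le> C * fact k * A ^ k * E / (\<epsilon> * ((1 - a) * \<zeta>)) ^ k"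
  shows "cmod (expo (pairop base_dir fibre_dir) F m y)
    \<le> C * fact m * (of_nat CARD('n) * (exp 1)\<^sup>2 / a\<^sup>2 + A / (1 - a)) ^ m * E / (\<epsilon> * \<zeta>) ^ m"
proof -
  define N where "N = real CARD('n)"
  define b where "b = N * (exp 1)\<^sup>2 / a\<^sup>2"
  define c where "c = A / (1 - a)"
  have bc: "0 \<le> b" "0 \<le> c" using a A by (auto simp: b_def c_def N_def)
  have y: "y \<in> polydisc y a (a * \<zeta>)" using a \<zeta> by (simp add: polydisc_def)
  have E: "0 \<le> E"
  proof -
    have "0 \<le> C * E" using order_trans[OF norm_ge_zero bound[OF y, of 0]] by simp
    then show ?thesis using C by (simp add: zero_le_mult_iff)
  qed
  have term_bound: "cmod ((pairop base_dir fibre_dir ^^ k) (F (m - k)) y / fact k)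
      \<le> C * E / (\<epsilon> * \<zeta>) ^ m * fact m * (of_nat (m choose k) * b ^ k * c ^ (m - k))" if k: "k \<le> m" for k
  proof -
    let ?B = "C * fact (m - k) * A ^ (m - k) * E / (\<epsilon> * ((1 - a) * \<zeta>)) ^ (m - k)"
    have B0: "0 \<le> ?B" using C A E a \<zeta> \<epsilon> by simp
    have B: "?B = C * fact (m - k) * c ^ (m - k) * E / (\<epsilon> * \<zeta>) ^ (m - k)"
      by (simp add: c_def power_divide power_mult_distrib mult_ac)
    have "cmod ((pairop base_dir fibre_dir ^^ k) (F (m - k)) y) \<le> (N * (real k)\<^sup>2 / (a * (a * \<zeta>))) ^ k * ?B"
      unfolding N_def by (rule pairop_pow_bound[OF X F]) (use a \<zeta> sub bound in auto)
    then have "cmod ((pairop base_dir fibre_dir ^^ k) (F (m - k)) y / fact k)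
        \<le> (N * (real k)\<^sup>2 / (a * (a * \<zeta>))) ^ k * ?B / fact k"
      unfolding norm_divide norm_fact by (rule divide_right_mono) simp
    also have "\<dots> = (N / a\<^sup>2 / \<zeta>) ^ k * (((real k) ^ k)\<^sup>2 / fact k) * ?B"
      by (simp add: power_mult_distrib power_divide power2_eq_square mult_ac)
    also have "\<dots> \<le> (N / a\<^sup>2 / \<zeta>) ^ k * ((exp 1 ^ k)\<^sup>2 * fact k) * ?B"
    proof (intro mult_right_mono mult_left_mono B0)
      have "((real k) ^ k)\<^sup>2 \<le> (exp 1 ^ k * fact k)\<^sup>2"
        using power_self_le_exp_fact[of k] by (intro power_mono) (simp_all add: exp_of_nat_mult[symmetric])
      then show "((real k) ^ k)\<^sup>2 / fact k \<le> (exp 1 ^ k)\<^sup>2 * fact k"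
        by (simp add: field_simps power2_eq_square)
    qed (use \<zeta> in \<open>auto simp: N_def\<close>)
    also have "\<dots> = (b / \<zeta>) ^ k * fact k * ?B"
      by (simp add: b_def power_mult_distrib power_divide power2_eq_square mult_ac)
    also have "\<dots> \<le> (b / (\<epsilon> * \<zeta>)) ^ k * fact k * ?B"
    proof (intro mult_right_mono B0 power_mono)
      have "\<epsilon> * \<zeta> \<le> 1 * \<zeta>" using \<epsilon> \<zeta> by (intro mult_right_mono) auto
      then show "b / \<zeta> \<le> b / (\<epsilon> * \<zeta>)" using bc \<epsilon> \<zeta> by (intro divide_left_mono) auto
    qed (use bc \<zeta> in auto)
    also have "\<dots> = C * E * (b ^ k * c ^ (m - k)) * (fact k * fact (m - k)) / ((\<epsilon> * \<zeta>) ^ k * (\<epsilon> * \<zeta>) ^ (m - k))"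
      unfolding B by (simp add: power_divide mult_ac)
    also have "(\<epsilon> * \<zeta>) ^ k * (\<epsilon> * \<zeta>) ^ (m - k) = (\<epsilon> * \<zeta>) ^ m"
      using k by (simp flip: power_add)
    \<comment> \<open>A deliberately crude step: the product of the two factorials is at most
      \<open>fact m\<close>, and the extra binomial coefficient turns the sum over \<open>k\<close>
      into the expansion of \<open>(b + c) ^ m\<close>.\<close>
    also have "C * E * (b ^ k * c ^ (m - k)) * (fact k * fact (m - k)) / (\<epsilon> * \<zeta>) ^ m
        \<le> C * E * (b ^ k * c ^ (m - k)) * (fact m * of_nat (m choose k)) / (\<epsilon> * \<zeta>) ^ m"
    proof (intro divide_right_mono mult_left_mono)
      have eq: "fact k * fact (m - k) * (m choose k) = fact m"
        by (rule binomial_fact_lemma[OF k])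
      have pos: "1 \<le> m choose k" using k by (simp add: Suc_le_eq)
      have "fact k * fact (m - k) \<le> fact k * fact (m - k) * (m choose k)" using pos by simp
      also have "\<dots> \<le> fact m * (m choose k)" using pos unfolding eq by simp
      finally have "real (fact k * fact (m - k)) \<le> real (fact m * (m choose k))" by (rule of_nat_mono)
      then show "fact k * fact (m - k) \<le> (fact m :: real) * of_nat (m choose k)" by simp
    qed (use C E bc \<epsilon> \<zeta> in auto)
    finally show ?thesis by (simp add: mult_ac)
  qed
  have "cmod (expo (pairop base_dir fibre_dir) F m y)
      \<le> (\<Sum>k\<le>m. C * E / (\<epsilon> * \<zeta>) ^ m * fact m * (of_nat (m choose k) * b ^ k * c ^ (m - k)))"
    unfolding expo_def by (rule order_trans[OF norm_sum sum_mono]) (use term_bound in auto)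
  also have "\<dots> = C * E / (\<epsilon> * \<zeta>) ^ m * fact m * (b + c) ^ m"
    by (simp add: binomial_ring sum_distrib_left)
  finally show ?thesis by (simp add: b_def c_def N_def mult_ac)
qed

section \<open>The adjoint on the symbol classes\<close>

text \<open>Only the coefficients up to \<open>\<nu>\<close> enter the coefficient of
  \<open>t ^ \<nu>\<close> of a result. Replacing the later ones by 0 gives a series whose
  coefficients are all holomorphic on one common open set.\<close>

definition trunc :: "nat \<Rightarrow> (nat \<Rightarrow> 'a \<Rightarrow> complex) \<Rightarrow> nat \<Rightarrow> 'a \<Rightarrow> complex" where
  "trunc \<nu> F k = (if k \<le> \<nu> then F k else (\<lambda>x. 0))"

lemma trunc_le [simp]: "k \<le> \<nu> \<Longrightarrow> trunc \<nu> F k = F k"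
  by (simp add: trunc_def)

lemma holo_trunc: "(\<And>k. k \<le> \<nu> \<Longrightarrow> holo (F k) X) \<Longrightarrow> holo (trunc \<nu> F k) X"
  by (simp add: trunc_def)

lemma expo_trunc: "expo A F \<nu> x = expo A (trunc \<nu> F) \<nu> x"
  by (rule expo_local) simp

lemma local_adj_local: "(\<And>k. k \<le> \<nu> \<Longrightarrow> F k = G k) \<Longrightarrow> local_adj F \<nu> = local_adj G \<nu>"
  unfolding local_adj_def by (intro ext expo_local) simp

lemma local_comp_local:
  assumes "\<And>k. k \<le> \<nu> \<Longrightarrow> F k = F' k" "\<And>k. k \<le> \<nu> \<Longrightarrow> G k = G' k"
  shows "local_comp F G \<nu> = local_comp F' G' \<nu>"
  unfolding local_comp_def conv_def[abs_def]
proof (intro ext expo_local sum.cong refl)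
  fix k j x assume "k \<le> \<nu>" "j \<in> {..k}"
  then have "F j = F' j" "G (k - j) = G' (k - j)" by (auto intro: assms)
  then show "F j (fst (fst x), snd (fst x) + snd (snd x)) * G (k - j) (fst (fst x) + fst (snd x), snd (fst x))
      = F' j (fst (fst x), snd (fst x) + snd (snd x)) * G' (k - j) (fst (fst x) + fst (snd x), snd (fst x))"
    by simp
qed

lemma local_pull_local: "(\<And>k. k \<le> \<nu> \<Longrightarrow> F k = G k) \<Longrightarrow> local_pull \<Phi> J F \<nu> = local_pull \<Phi> J G \<nu>"
  unfolding local_pull_def by (intro ext expo_local) simp

text \<open>The series \<open>P\<close> multiplied by \<open>t / (1 - t)\<close>. In this form the
  bound defining the null class is the ordinary growth bound.\<close>

definition psum :: "'n fseries \<Rightarrow> 'n fseries" where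
  "psum P m z \<zeta> \<eta> = (\<Sum>\<nu><m. P \<nu> z \<zeta> \<eta>)"

text \<open>The series \<open>G\<close> of partial sums is characterised by
  \<open>G = t (G + F)\<close>, and the exponential commutes with sums and with multiplication by
  \<open>t\<close>.\<close>

lemma expo_psum:
  assumes A: "hol_op X A" and F: "\<And>k. holo (F k) X" and x: "x \<in> X"
  shows "expo A (\<lambda>m x. \<Sum>\<nu><m. F \<nu> x) m x = (\<Sum>\<nu><m. expo A F \<nu> x)"
proof (induction m)
  case 0
  show ?case by (simp add: expo_def)
next
  case (Suc m)
  interpret hol_op X A by fact
  let ?G = "\<lambda>m x. \<Sum>\<nu><m. F \<nu> x"
  have "?G m = shift (\<lambda>k x. ?G k x + F k x) m" for m
    by (cases m) (simp_all add: fun_eq_iff)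
  then have "?G = shift (\<lambda>k x. ?G k x + F k x)" by blast
  then have "expo A ?G (Suc m) x = expo A (shift (\<lambda>k x. ?G k x + F k x)) (Suc m) x"
    by (rule arg_cong)
  also have "\<dots> = expo A (\<lambda>k x. ?G k x + F k x) m x"
    using expo_shift[of "\<lambda>k x. ?G k x + F k x" x "Suc m"] F x by (simp add: holo_add holo_sum)
  also have "\<dots> = expo A ?G m x + expo A F m x"
    by (rule expo_add) (use F x in auto)
  finally show ?case using Suc by simp
qed

text \<open>Holomorphy of the coefficients and the derivative in \<open>\<eta>\<close> concern all
  three variables jointly, so here the slices are not enough.\<close>

definition tri :: "'n fseries \<Rightarrow> nat \<Rightarrow> (complex^'n) \<times> (complex^'n) \<times> complex \<Rightarrow> complex" where
  "tri P \<nu> x = P \<nu> (fst x) (fst (snd x)) (snd (snd x))"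

definition symb_dom3 ::
  "'n::finite pt set \<Rightarrow> complex set \<Rightarrow> real \<Rightarrow> real \<Rightarrow> ((complex^'n) \<times> (complex^'n) \<times> complex) set" where
  "symb_dom3 \<Omega> S d \<rho> = {x. (fst x, fst (snd x)) \<in> symb_dom \<Omega> d \<rho> \<and> snd (snd x) \<in> S}"

lemma coeffs_holo_iff:
  "coeffs_holo \<Omega> S d \<rho> P \<longleftrightarrow> (\<forall>\<nu>. \<exists>W. open W \<and> symb_dom3 \<Omega> S d \<rho> \<subseteq> W \<and> holo (tri P \<nu>) W)"
proof -
  have "(\<lambda>(z, \<zeta>, \<eta>). P \<nu> z \<zeta> \<eta>) = tri P \<nu>" for \<nu> by (auto simp: tri_def fun_eq_iff)
  moreover have "{(z, \<zeta>, \<eta>). (z, \<zeta>) \<in> symb_dom \<Omega> d \<rho> \<and> \<eta> \<in> S} = symb_dom3 \<Omega> S d \<rho>"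
    by (auto simp: symb_dom3_def)
  ultimately show ?thesis by (simp add: coeffs_holo_def holo_near_def scale3_eq)
qed

lemma coeffs_holo_upto:
  assumes "coeffs_holo \<Omega> S d \<rho> P"
  obtains W where "open W" "symb_dom3 \<Omega> S d \<rho> \<subseteq> W" "\<And>k. k \<le> \<nu> \<Longrightarrow> holo (tri P k) W"
proof -
  obtain W where W: "\<And>k. open (W k)" "\<And>k. symb_dom3 \<Omega> S d \<rho> \<subseteq> W k" "\<And>k. holo (tri P k) (W k)"
    using assms unfolding coeffs_holo_iff by metis
  show ?thesis
  proof (rule that[of "\<Inter>k\<le>\<nu>. W k"])
    show "holo (tri P k) (\<Inter>k\<le>\<nu>. W k)" if "k \<le> \<nu>" for k
      by (rule holo_on_subset[OF W(3)[of k]]) (use that in auto)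
  qed (use W in auto)
qed

lemma holo_slice:
  assumes "\<And>k. k \<le> \<nu> \<Longrightarrow> holo (tri P k) W" "k \<le> \<nu>"
  shows "holo (slice P \<eta> k) {y. (fst y, snd y, \<eta>) \<in> W}"
proof -
  have "holo (\<lambda>y. tri P k (fst y, snd y, \<eta>)) {y. (fst y, snd y, \<eta>) \<in> W}"
    by (rule holo_compose[OF assms(1)[OF assms(2)]]) (intro holo_map_intros, simp)
  then show ?thesis by (simp add: tri_def slice_def[abs_def])
qed

lemma coeffs_holo_slice:
  assumes "coeffs_holo \<Omega> S d \<rho> P" "\<eta> \<in> S"
  obtains X where "open X" "symb_dom \<Omega> d \<rho> \<subseteq> X" "\<And>k. k \<le> \<nu> \<Longrightarrow> holo (slice P \<eta> k) X"
proof -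
  obtain W where W: "open W" "symb_dom3 \<Omega> S d \<rho> \<subseteq> W" "\<And>k. k \<le> \<nu> \<Longrightarrow> holo (tri P k) W"
    using coeffs_holo_upto[OF assms(1)] by metis
  show ?thesis
  proof (rule that)
    have "open ((\<lambda>y. (fst y, snd y, \<eta>)) -` W)"
      by (intro open_vimage W continuous_intros)
    then show "open {y. (fst y, snd y, \<eta>) \<in> W}" by (simp add: vimage_def)
    show "holo (slice P \<eta> k) {y. (fst y, snd y, \<eta>) \<in> W}" if "k \<le> \<nu>" for k
      by (rule holo_slice[OF W(3) that])
    show "symb_dom \<Omega> d \<rho> \<subseteq> {y. (fst y, snd y, \<eta>) \<in> W}"
      using W(2) assms(2) by (auto simp: symb_dom3_def)
  qed
qed

lemma coeffs_holo_mono: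
  assumes "coeffs_holo \<Omega> S d \<rho> P" "symb_dom \<Omega> d' \<rho>' \<subseteq> symb_dom \<Omega> d \<rho>"
  shows "coeffs_holo \<Omega> S d' \<rho>' P"
proof -
  have "symb_dom3 \<Omega> S d' \<rho>' \<subseteq> symb_dom3 \<Omega> S d \<rho>" using assms(2) by (auto simp: symb_dom3_def)
  then show ?thesis using assms(1) unfolding coeffs_holo_iff by (meson order_trans)
qed

lemma coeffs_holo_psum:
  assumes "coeffs_holo \<Omega> S d \<rho> P"
  shows "coeffs_holo \<Omega> S d \<rho> (psum P)"
  unfolding coeffs_holo_iff
proof
  fix \<nu>
  obtain W where W: "open W" "symb_dom3 \<Omega> S d \<rho> \<subseteq> W" "\<And>k. k \<le> \<nu> \<Longrightarrow> holo (tri P k) W"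
    using coeffs_holo_upto[OF assms] by metis
  have "tri (psum P) \<nu> = (\<lambda>x. \<Sum>k<\<nu>. tri P k x)" by (simp add: tri_def psum_def fun_eq_iff)
  moreover have "holo (\<lambda>x. \<Sum>k<\<nu>. tri P k x) W" by (rule holo_sum) (use W in auto)
  ultimately show "\<exists>W. open W \<and> symb_dom3 \<Omega> S d \<rho> \<subseteq> W \<and> holo (tri (psum P) \<nu>) W" using W by auto
qed

definition base_dir3 :: "'n::finite \<Rightarrow> (complex^'n) \<times> (complex^'n) \<times> complex" where
  "base_dir3 i = (axis i 1, 0, 0)"
definition fibre_dir3 :: "'n::finite \<Rightarrow> (complex^'n) \<times> (complex^'n) \<times> complex" where
  "fibre_dir3 i = (0, axis i 1, 0)"
definition antipode3 :: "(complex^'n) \<times> (complex^'n) \<times> complex \<Rightarrow> (complex^'n::finite) \<times> (complex^'n) \<times> complex" where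
  "antipode3 x = (fst x, - fst (snd x), snd (snd x))"

lemma tri_adj: "tri (adj P) \<nu> x = expo (pairop base_dir3 fibre_dir3) (\<lambda>k x. tri P k (antipode3 x)) \<nu> x"
proof -
  define g :: "'a pt \<Rightarrow> _" where "g y = (fst y, snd y, snd (snd x))" for y
  have "tri (adj P) \<nu> x
      = expo (pairop base_dir fibre_dir) (\<lambda>k y. tri P k (antipode3 (g y))) \<nu> (fst x, fst (snd x))"
    by (simp add: tri_def adj_eq_local local_adj_def slice_def antipode3_def g_def)
  also have "\<dots> = expo (pairop base_dir3 fibre_dir3) (\<lambda>k x. tri P k (antipode3 x)) \<nu> (g (fst x, fst (snd x)))"
    by (rule expo_pairop_affine[where F = "\<lambda>k x. tri P k (antipode3 x)" and g = g])
      (simp_all add: g_def base_dir_def fibre_dir_def base_dir3_def fibre_dir3_def)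
  finally show ?thesis by (simp add: g_def)
qed

lemma holo_map_antipode3: "holo_map antipode3 X"
  unfolding antipode3_def[abs_def] by (intro holo_map_intros)

lemma open_antipode3: "open W \<Longrightarrow> open (antipode3 -` W)"
  by (intro open_vimage) (auto simp: antipode3_def[abs_def] intro!: continuous_intros)

lemma symb_dom3_antipodal: "symb_dom3 (antipodal \<Omega>) S d \<rho> = antipode3 -` symb_dom3 \<Omega> S d \<rho>"
  by (auto simp: symb_dom3_def symb_dom_antipodal antipode_def antipode3_def)

lemma holo_tri_adj:
  assumes "open W" "\<And>k. k \<le> \<nu> \<Longrightarrow> holo (tri P k) W"
  shows "holo (tri (adj P) \<nu>) (antipode3 -` W)"
proof -
  have "holo (expo (pairop base_dir3 fibre_dir3) (trunc \<nu> (\<lambda>k x. tri P k (antipode3 x))) \<nu>) (antipode3 -` W)"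
    by (rule hol_op.expo_holo[OF hol_op_pairop[OF open_antipode3[OF assms(1)]]], rule holo_trunc,
        rule holo_compose[OF assms(2) holo_map_antipode3]) auto
  moreover have "tri (adj P) \<nu> = expo (pairop base_dir3 fibre_dir3) (trunc \<nu> (\<lambda>k x. tri P k (antipode3 x))) \<nu>"
    by (intro ext) (simp add: tri_adj flip: expo_trunc)
  ultimately show ?thesis by simp
qed

lemma coeffs_holo_adj:
  assumes "coeffs_holo \<Omega> S d \<rho> P"
  shows "coeffs_holo (antipodal \<Omega>) S d \<rho> (adj P)"
  unfolding coeffs_holo_iff
proof
  fix \<nu>
  obtain W where W: "open W" "symb_dom3 \<Omega> S d \<rho> \<subseteq> W" "\<And>k. k \<le> \<nu> \<Longrightarrow> holo (tri P k) W"
    using coeffs_holo_upto[OF assms] by metis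
  show "\<exists>W. open W \<and> symb_dom3 (antipodal \<Omega>) S d \<rho> \<subseteq> W \<and> holo (tri (adj P) \<nu>) W"
    using W open_antipode3[OF W(1)] holo_tri_adj[OF W(1,3)]
    by (intro exI[of _ "antipode3 -` W"]) (auto simp: symb_dom3_antipodal)
qed

text \<open>The estimate shared by both classes: for \<open>P\<close> itself in one, for its partial
  sums in the other.\<close>

definition growth_bound :: "'n::finite pt set \<Rightarrow> complex set \<Rightarrow> real \<Rightarrow> real \<Rightarrow> 'n fseries \<Rightarrow> bool" where
  "growth_bound \<Omega> S d \<rho> G \<longleftrightarrow> (\<exists>A>0. \<forall>Z h. relcompact_in Z S \<and> h > 0 \<longrightarrow>
     (\<exists>C>0. \<forall>m. \<forall>(z, \<zeta>)\<in>symb_dom \<Omega> d \<rho>. \<forall>\<eta>\<in>Z.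
        cmod (G m z \<zeta> \<eta>) \<le> C * fact m * A ^ m * exp (h * maxnorm \<zeta>) / maxnorm (\<eta> *s \<zeta>) ^ m))"

lemma Ncl_iff: "P \<in> Ncl \<Omega> S \<longleftrightarrow> (\<exists>d>0. \<exists>\<rho>. 0 < \<rho> \<and> \<rho> < 1 \<and> coeffs_holo \<Omega> S d \<rho> P \<and> growth_bound \<Omega> S d \<rho> (psum P))"
  by (simp add: Ncl_def growth_bound_def psum_def)

lemma Scl_iff: "P \<in> Scl \<Omega> S \<longleftrightarrow>
    (\<exists>d>0. \<exists>\<rho>. 0 < \<rho> \<and> \<rho> < 1 \<and> coeffs_holo \<Omega> S d \<rho> P \<and> growth_bound \<Omega> S d \<rho> P) \<and> deriv_eta P \<in> Ncl \<Omega> S"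
  by (simp add: Scl_def growth_bound_def)

lemma growth_bound_mono:
  assumes "growth_bound \<Omega> S d \<rho> P" "symb_dom \<Omega> d' \<rho>' \<subseteq> symb_dom \<Omega> d \<rho>"
  shows "growth_bound \<Omega> S d' \<rho>' P"
proof -
  from assms(1) obtain A where A: "A > 0" and *: "\<forall>Z h. relcompact_in Z S \<and> h > 0 \<longrightarrow>
     (\<exists>C>0. \<forall>m. \<forall>(z, \<zeta>)\<in>symb_dom \<Omega> d \<rho>. \<forall>\<eta>\<in>Z.
        cmod (P m z \<zeta> \<eta>) \<le> C * fact m * A ^ m * exp (h * maxnorm \<zeta>) / maxnorm (\<eta> *s \<zeta>) ^ m)"
    unfolding growth_bound_def by blast
  show ?thesis unfolding growth_bound_def
  proof (rule exI[of _ A], intro conjI A allI impI)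
    fix Z h assume "relcompact_in Z S \<and> h > (0::real)"
    with * obtain C where "C > 0" "\<forall>m. \<forall>(z, \<zeta>)\<in>symb_dom \<Omega> d \<rho>. \<forall>\<eta>\<in>Z.
        cmod (P m z \<zeta> \<eta>) \<le> C * fact m * A ^ m * exp (h * maxnorm \<zeta>) / maxnorm (\<eta> *s \<zeta>) ^ m"
      by blast
    then show "\<exists>C>0. \<forall>m. \<forall>(z, \<zeta>)\<in>symb_dom \<Omega> d' \<rho>'. \<forall>\<eta>\<in>Z.
        cmod (P m z \<zeta> \<eta>) \<le> C * fact m * A ^ m * exp (h * maxnorm \<zeta>) / maxnorm (\<eta> *s \<zeta>) ^ m"
      using assms(2) by (intro exI[of _ C]) blast
  qed
qed

lemma growth_bound_cong:
  assumes "growth_bound \<Omega> S d \<rho> P"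
    and "\<And>m z \<zeta> \<eta>. (z, \<zeta>) \<in> symb_dom \<Omega> d \<rho> \<Longrightarrow> \<eta> \<in> S \<Longrightarrow> P m z \<zeta> \<eta> = Q m z \<zeta> \<eta>"
  shows "growth_bound \<Omega> S d \<rho> Q"
proof -
  from assms(1) obtain A where A: "A > 0" and *: "\<forall>Z h. relcompact_in Z S \<and> h > 0 \<longrightarrow>
     (\<exists>C>0. \<forall>m. \<forall>(z, \<zeta>)\<in>symb_dom \<Omega> d \<rho>. \<forall>\<eta>\<in>Z.
        cmod (P m z \<zeta> \<eta>) \<le> C * fact m * A ^ m * exp (h * maxnorm \<zeta>) / maxnorm (\<eta> *s \<zeta>) ^ m)"
    unfolding growth_bound_def by blast
  show ?thesis unfolding growth_bound_def
  proof (rule exI[of _ A], intro conjI A allI impI)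
    fix Z h assume Zh: "relcompact_in Z S \<and> h > (0::real)"
    with * obtain C where C: "C > 0" "\<forall>m. \<forall>(z, \<zeta>)\<in>symb_dom \<Omega> d \<rho>. \<forall>\<eta>\<in>Z.
        cmod (P m z \<zeta> \<eta>) \<le> C * fact m * A ^ m * exp (h * maxnorm \<zeta>) / maxnorm (\<eta> *s \<zeta>) ^ m"
      by blast
    have "Z \<subseteq> S" using Zh closure_subset[of Z] by (auto simp: relcompact_in_def)
    then show "\<exists>C>0. \<forall>m. \<forall>(z, \<zeta>)\<in>symb_dom \<Omega> d \<rho>. \<forall>\<eta>\<in>Z.
        cmod (Q m z \<zeta> \<eta>) \<le> C * fact m * A ^ m * exp (h * maxnorm \<zeta>) / maxnorm (\<eta> *s \<zeta>) ^ m"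
      using C assms(2) by (intro exI[of _ C]) (fastforce simp: subset_iff)
  qed
qed

text \<open>For a point of the domain with \<open>\<rho> / 2\<close>, the polydisc of relative
  radius \<open>\<rho> / 8\<close> lies in the domain with \<open>\<rho>\<close>. On it the fibre
  norm changes by at most the factors \<open>1 - a\<close> and 2, which the constants
  absorb.\<close>

lemma growth_bound_adj:
  fixes G :: "'n::finite fseries"
  assumes G: "coeffs_holo \<Omega> S d \<rho> G" and bd: "growth_bound \<Omega> S d \<rho> G"
    and d: "0 < d" and \<rho>: "0 < \<rho>" "\<rho> < 1" and S: "\<And>\<eta>. \<eta> \<in> S \<Longrightarrow> 0 < cmod \<eta> \<and> cmod \<eta> \<le> 1"
  shows "growth_bound (antipodal \<Omega>) S d (\<rho> / 2) (adj G)"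
proof -
  from bd obtain A where A: "A > 0" and *: "\<And>Z h. relcompact_in Z S \<Longrightarrow> h > 0 \<Longrightarrow>
     (\<exists>C>0. \<forall>m. \<forall>(z, \<zeta>)\<in>symb_dom \<Omega> d \<rho>. \<forall>\<eta>\<in>Z.
        cmod (G m z \<zeta> \<eta>) \<le> C * fact m * A ^ m * exp (h * maxnorm \<zeta>) / maxnorm (\<eta> *s \<zeta>) ^ m)"
    unfolding growth_bound_def by blast
  define a where "a = \<rho> / 8"
  have a: "0 < a" "a < 1" using \<rho> by (auto simp: a_def)
  \<comment> \<open>The new constant is built from \<open>A\<close>, \<open>\<rho>\<close> and the
    dimension only; it has to be fixed before \<open>Z\<close> and \<open>h\<close> are
    given.\<close>
  define A' where "A' = of_nat CARD('n) * (exp 1)\<^sup>2 / a\<^sup>2 + A / (1 - a)"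
  have A': "A' > 0" unfolding A'_def using a A by (intro add_nonneg_pos) auto
  show ?thesis unfolding growth_bound_def
  proof (rule exI[of _ A'], intro conjI A' allI impI)
    fix Z h assume "relcompact_in Z S \<and> h > (0::real)"
    then have Z: "relcompact_in Z S" and h: "h > 0" by auto
    then have ZS: "Z \<subseteq> S" using closure_subset[of Z] by (auto simp: relcompact_in_def)
    \<comment> \<open>The fibre norm may double on the polydisc, so the bound for \<open>G\<close>
      is taken with half the exponential rate.\<close>
    from *[OF Z, of "h / 2"] h obtain C where C: "C > 0" and bound: "\<And>m z \<zeta> \<eta>. (z, \<zeta>)\<in>symb_dom \<Omega> d \<rho> \<Longrightarrow> \<eta> \<in> Z \<Longrightarrow>
        cmod (G m z \<zeta> \<eta>) \<le> C * fact m * A ^ m * exp (h / 2 * maxnorm \<zeta>) / maxnorm (\<eta> *s \<zeta>) ^ m"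
      by fastforce
    have "cmod (adj G m z \<zeta> \<eta>) \<le> C * fact m * A' ^ m * exp (h * maxnorm \<zeta>) / maxnorm (\<eta> *s \<zeta>) ^ m"
      if y: "(z, \<zeta>) \<in> symb_dom (antipodal \<Omega>) d (\<rho> / 2)" and \<eta>: "\<eta> \<in> Z" for m z \<zeta> \<eta>
    proof -
      have \<eta>S: "\<eta> \<in> S" using \<eta> ZS by auto
      have y': "(z, - \<zeta>) \<in> symb_dom \<Omega> d (\<rho> / 2)" using y by (simp add: symb_dom_antipodal antipode_def)
      have "0 < d * (1 - \<rho> / 2)" using d \<rho> by simp
      with symb_domD(2)[OF y] have \<zeta>: "0 < maxnorm \<zeta>" by simp
      obtain X where X: "open X" "symb_dom \<Omega> d \<rho> \<subseteq> X" "\<And>k. k \<le> m \<Longrightarrow> holo (slice G \<eta> k) X"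
        using coeffs_holo_slice[OF G \<eta>S] by metis
      define F where "F = trunc m (\<lambda>k y. slice G \<eta> k (antipode y))"
      have F: "holo (F k) (antipode -` X)" for k
        unfolding F_def
        by (rule holo_trunc, rule holo_compose[OF X(3) holo_map_antipode[OF holo_map_id]]) auto
      have inside: "(fst x, - snd x) \<in> symb_dom \<Omega> d \<rho>" and lower: "(1 - a) * maxnorm \<zeta> \<le> maxnorm (snd x)"
        and upper: "maxnorm (snd x) \<le> 2 * maxnorm \<zeta>"
        if x: "x \<in> polydisc (z, \<zeta>) a (a * maxnorm \<zeta>)" for x
      proof -
        have x1: "maxnorm (fst x - z) \<le> a" and x2: "maxnorm (snd x - \<zeta>) \<le> a * maxnorm \<zeta>"
          using x by (auto simp: polydisc_def)
        have x3: "maxnorm (\<zeta> - snd x) \<le> a * maxnorm \<zeta>"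
          using x2 maxnorm_minus[of "snd x - \<zeta>"] by simp
        show "(fst x, - snd x) \<in> symb_dom \<Omega> d \<rho>"
          using symb_dom_polydisc[OF y' d \<rho>, of "fst x - z" "\<zeta> - snd x"] x1 x3 by (simp add: a_def)
        show "(1 - a) * maxnorm \<zeta> \<le> maxnorm (snd x)"
          using maxnorm_triangle_diff[of \<zeta> "snd x - \<zeta>"] x2 by (simp add: algebra_simps)
        have "maxnorm (snd x) \<le> maxnorm \<zeta> + a * maxnorm \<zeta>"
          using maxnorm_triangle[of \<zeta> "snd x - \<zeta>"] x2 by simp
        also have "a * maxnorm \<zeta> \<le> 1 * maxnorm \<zeta>" using a \<zeta> by (intro mult_right_mono) auto
        finally show "maxnorm (snd x) \<le> 2 * maxnorm \<zeta>" by simp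
      qed
      have "adj G m z \<zeta> \<eta> = expo (pairop base_dir fibre_dir) F m (z, \<zeta>)"
        unfolding adj_eq_local local_adj_def F_def by (rule expo_trunc)
      moreover have "cmod (expo (pairop base_dir fibre_dir) F m (z, \<zeta>))
          \<le> C * fact m * A' ^ m * exp (h * maxnorm \<zeta>) / (cmod \<eta> * maxnorm \<zeta>) ^ m"
        unfolding A'_def
      proof (rule expo_pairop_bound[OF open_antipode[OF X(1)] F a \<zeta> _ _ _ A C])
        show "polydisc (z, \<zeta>) a (a * maxnorm \<zeta>) \<subseteq> antipode -` X"
        proof
          fix x assume "x \<in> polydisc (z, \<zeta>) a (a * maxnorm \<zeta>)"
          then have "(fst x, - snd x) \<in> X" using inside X(2) by blast
          then show "x \<in> antipode -` X" by (simp add: antipode_def)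
        qed
        fix k x assume x: "x \<in> polydisc (z, \<zeta>) a (a * maxnorm \<zeta>)"
        show "cmod (F k x) \<le> C * fact k * A ^ k * exp (h * maxnorm \<zeta>) / (cmod \<eta> * ((1 - a) * maxnorm \<zeta>)) ^ k"
        proof (cases "k \<le> m")
          case True
          then have "cmod (F k x) \<le> C * fact k * A ^ k * exp (h / 2 * maxnorm (snd x)) / (cmod \<eta> * maxnorm (snd x)) ^ k"
            using bound[OF inside[OF x] \<eta>, of k] by (simp add: F_def slice_def maxnorm_scale)
          also have "\<dots> \<le> C * fact k * A ^ k * exp (h * maxnorm \<zeta>) / (cmod \<eta> * ((1 - a) * maxnorm \<zeta>)) ^ k"
          proof (intro frac_le mult_left_mono power_mono)
            show "exp (h / 2 * maxnorm (snd x)) \<le> exp (h * maxnorm \<zeta>)"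
              using mult_left_mono[OF upper[OF x], of "h / 2"] h by simp
          qed (use S[OF \<eta>S] a A C \<zeta> lower[OF x] in auto)
          finally show ?thesis .
        next
          case False
          then show ?thesis using C A a \<zeta> by (simp add: F_def trunc_def)
        qed
      qed (use S[OF \<eta>S] in auto)
      ultimately show ?thesis by (simp add: maxnorm_scale)
    qed
    then show "\<exists>C>0. \<forall>m. \<forall>(z, \<zeta>)\<in>symb_dom (antipodal \<Omega>) d (\<rho> / 2). \<forall>\<eta>\<in>Z.
        cmod (adj G m z \<zeta> \<eta>) \<le> C * fact m * A' ^ m * exp (h * maxnorm \<zeta>) / maxnorm (\<eta> *s \<zeta>) ^ m"
      using C by (intro exI[of _ C]) auto
  qed
qed

lemma adj_psum:
  assumes P: "coeffs_holo \<Omega> S d \<rho> P" and y: "(z, \<zeta>) \<in> symb_dom (antipodal \<Omega>) d \<rho>" and \<eta>: "\<eta> \<in> S"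
  shows "adj (psum P) m z \<zeta> \<eta> = psum (adj P) m z \<zeta> \<eta>"
proof -
  obtain X where X: "open X" "symb_dom \<Omega> d \<rho> \<subseteq> X" "\<And>k. k \<le> m \<Longrightarrow> holo (slice P \<eta> k) X"
    using coeffs_holo_slice[OF P \<eta>] by metis
  let ?A = "pairop base_dir fibre_dir"
  let ?F = "trunc m (\<lambda>k y. slice P \<eta> k (antipode y))"
  have F: "holo (?F k) (antipode -` X)" for k
    by (rule holo_trunc, rule holo_compose[OF X(3) holo_map_antipode[OF holo_map_id]]) auto
  have "adj (psum P) m z \<zeta> \<eta> = expo ?A (\<lambda>j x. \<Sum>k<j. ?F k x) m (z, \<zeta>)"
    unfolding adj_eq_local local_adj_def
    by (rule expo_local) (simp add: slice_def[abs_def] psum_def)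
  also have "\<dots> = (\<Sum>\<nu><m. expo ?A ?F \<nu> (z, \<zeta>))"
    by (rule expo_psum[OF hol_op_pairop[OF open_antipode[OF X(1)]] F])
      (use X(2) y in \<open>auto simp: symb_dom_antipodal\<close>)
  also have "\<dots> = (\<Sum>\<nu><m. adj P \<nu> z \<zeta> \<eta>)"
    unfolding adj_eq_local local_adj_def by (intro sum.cong refl expo_local) simp
  finally show ?thesis by (simp add: psum_def)
qed

lemma symb_dom_half: "0 < d \<Longrightarrow> 0 < \<rho> \<Longrightarrow> symb_dom \<Omega> d (\<rho> / 2) \<subseteq> symb_dom \<Omega> d \<rho>"
  by (rule symb_dom_mono) auto

lemma adj_Ncl:
  assumes P: "P \<in> Ncl \<Omega> S" and S: "\<And>\<eta>. \<eta> \<in> S \<Longrightarrow> 0 < cmod \<eta> \<and> cmod \<eta> \<le> 1"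
  shows "adj P \<in> Ncl (antipodal \<Omega>) S"
proof -
  obtain d \<rho> where d: "0 < d" and \<rho>: "0 < \<rho>" "\<rho> < 1" and h: "coeffs_holo \<Omega> S d \<rho> P"
    and b: "growth_bound \<Omega> S d \<rho> (psum P)"
    using P unfolding Ncl_iff by blast
  have "coeffs_holo (antipodal \<Omega>) S d (\<rho> / 2) (adj P)"
    by (rule coeffs_holo_mono[OF coeffs_holo_adj[OF h] symb_dom_half[OF d \<rho>(1)]])
  moreover have "growth_bound (antipodal \<Omega>) S d (\<rho> / 2) (psum (adj P))"
    by (rule growth_bound_cong[OF growth_bound_adj[OF coeffs_holo_psum[OF h] b d \<rho> S]])
      (use symb_dom_half[OF d \<rho>(1)] in \<open>auto intro!: adj_psum[OF h]\<close>)
  moreover have "0 < \<rho> / 2" "\<rho> / 2 < 1" using \<rho> by auto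
  ultimately show ?thesis unfolding Ncl_iff using d by blast
qed

text \<open>Agreement on the domain itself would not carry holomorphy over to \<open>Q\<close>, so
  agreement on an open neighbourhood is asked, which may depend on \<open>\<nu>\<close>. The purpose
  is to pass from the adjoint of the \<open>\<eta>\<close>-derivative to the
  \<open>\<eta>\<close>-derivative of the adjoint, which agree near the domain.\<close>

lemma Ncl_cong:
  assumes P: "P \<in> Ncl \<Omega> S" and d1: "0 < d1" "0 < \<rho>1" "\<rho>1 < 1"
    and eq: "\<And>\<nu>. \<exists>W. open W \<and> symb_dom3 \<Omega> S d1 \<rho>1 \<subseteq> W \<and> (\<forall>x\<in>W. tri P \<nu> x = tri Q \<nu> x)"
  shows "Q \<in> Ncl \<Omega> S"
proof -
  obtain d2 \<rho>2 where d2: "0 < d2" "0 < \<rho>2" "\<rho>2 < 1" and h: "coeffs_holo \<Omega> S d2 \<rho>2 P"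
    and b: "growth_bound \<Omega> S d2 \<rho>2 (psum P)"
    using P unfolding Ncl_iff by blast
  obtain d \<rho> where d: "0 < d" "0 < \<rho>" "\<rho> < 1"
    and sub: "symb_dom \<Omega> d \<rho> \<subseteq> symb_dom \<Omega> d1 \<rho>1" "symb_dom \<Omega> d \<rho> \<subseteq> symb_dom \<Omega> d2 \<rho>2"
    by (rule symb_dom_common[OF d1 d2])
  have "coeffs_holo \<Omega> S d \<rho> Q"
    unfolding coeffs_holo_iff
  proof
    fix \<nu>
    obtain W1 where W1: "open W1" "symb_dom3 \<Omega> S d1 \<rho>1 \<subseteq> W1" "\<And>x. x \<in> W1 \<Longrightarrow> tri P \<nu> x = tri Q \<nu> x"
      using eq[of \<nu>] by blast
    obtain W2 where W2: "open W2" "symb_dom3 \<Omega> S d2 \<rho>2 \<subseteq> W2" "holo (tri P \<nu>) W2"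
      using h[unfolded coeffs_holo_iff, rule_format, of \<nu>] by blast
    have "holo (tri Q \<nu>) (W1 \<inter> W2)"
    proof (rule holo_cong[OF open_Int[OF W1(1) W2(1)]])
      show "holo (tri P \<nu>) (W1 \<inter> W2)" by (rule holo_on_subset[OF W2(3)]) simp
    qed (use W1(3) in simp)
    moreover have "symb_dom3 \<Omega> S d \<rho> \<subseteq> W1 \<inter> W2"
      using W1(2) W2(2) sub by (auto simp: symb_dom3_def subset_iff)
    ultimately show "\<exists>W. open W \<and> symb_dom3 \<Omega> S d \<rho> \<subseteq> W \<and> holo (tri Q \<nu>) W"
      using W1(1) W2(1) by blast
  qed
  moreover have "growth_bound \<Omega> S d \<rho> (psum Q)"
  proof (rule growth_bound_cong[OF growth_bound_mono[OF b sub(2)]])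
    fix m z \<zeta> \<eta> assume "(z, \<zeta>) \<in> symb_dom \<Omega> d \<rho>" "\<eta> \<in> S"
    then have "(z, \<zeta>, \<eta>) \<in> symb_dom3 \<Omega> S d1 \<rho>1" using sub(1) by (auto simp: symb_dom3_def)
    then have "tri P \<nu> (z, \<zeta>, \<eta>) = tri Q \<nu> (z, \<zeta>, \<eta>)" for \<nu> using eq[of \<nu>] by blast
    then show "psum P m z \<zeta> \<eta> = psum Q m z \<zeta> \<eta>" by (simp add: psum_def tri_def)
  qed
  ultimately show ?thesis unfolding Ncl_iff using d by blast
qed

lemma tri_deriv_eta: "tri (deriv_eta P) \<nu> = dirderiv (0, 0, 1) (tri P \<nu>)"
proof
  fix x
  have "deriv f a = deriv (\<lambda>s. f (a + s)) 0" for f :: "complex \<Rightarrow> complex" and a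
    using deriv_shift_0[of f a] by (simp add: o_def)
  from this[of "P \<nu> (fst x) (fst (snd x))" "snd (snd x)"]
  show "tri (deriv_eta P) \<nu> x = dirderiv (0, 0, 1) (tri P \<nu>) x"
    by (simp add: tri_def deriv_eta_def dirderiv_def)
qed

text \<open>The sign change leaves \<open>\<eta>\<close> alone, and constant coefficient operators
  commute on holomorphic functions.\<close>

lemma tri_deriv_eta_adj:
  assumes W: "open W" "\<And>k. k \<le> \<nu> \<Longrightarrow> holo (tri P k) W" and x: "antipode3 x \<in> W"
  shows "tri (adj (deriv_eta P)) \<nu> x = tri (deriv_eta (adj P)) \<nu> x"
proof -
  let ?A = "pairop base_dir3 fibre_dir3"
  let ?F = "trunc \<nu> (\<lambda>k x. tri P k (antipode3 x))"
  have F: "holo (?F k) (antipode3 -` W)" for k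
    by (rule holo_trunc, rule holo_compose[OF W(2) holo_map_antipode3]) auto
  have d: "dirderiv (0, 0, 1) (?F k) = (\<lambda>x. tri (deriv_eta P) k (antipode3 x))" if "k \<le> \<nu>" for k
  proof
    fix x
    have "dirderiv (0, 0, 1) (\<lambda>x. tri P k (antipode3 x)) x = dirderiv (0, 0, 1) (tri P k) (antipode3 x)"
      by (rule dirderiv_affine) (simp add: antipode3_def)
    then show "dirderiv (0, 0, 1) (?F k) x = tri (deriv_eta P) k (antipode3 x)"
      using that by (simp add: tri_deriv_eta)
  qed
  have "tri (adj (deriv_eta P)) \<nu> x = expo ?A (\<lambda>k. dirderiv (0, 0, 1) (?F k)) \<nu> x"
    unfolding tri_adj by (rule expo_local) (rule d[symmetric])
  also have "\<dots> = dirderiv (0, 0, 1) (expo ?A ?F \<nu>) x"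
    by (rule expo_dirderiv[OF open_antipode3[OF W(1)] F]) (use x in simp)
  also have "expo ?A ?F \<nu> = tri (adj P) \<nu>"
    by (intro ext) (simp add: tri_adj flip: expo_trunc)
  finally show ?thesis by (simp add: tri_deriv_eta)
qed

lemma adj_Scl:
  assumes P: "P \<in> Scl \<Omega> S" and S: "\<And>\<eta>. \<eta> \<in> S \<Longrightarrow> 0 < cmod \<eta> \<and> cmod \<eta> \<le> 1"
  shows "adj P \<in> Scl (antipodal \<Omega>) S"
proof -
  obtain d \<rho> where d: "0 < d" and \<rho>: "0 < \<rho>" "\<rho> < 1" and h: "coeffs_holo \<Omega> S d \<rho> P"
    and b: "growth_bound \<Omega> S d \<rho> P" and e: "deriv_eta P \<in> Ncl \<Omega> S"
    using P unfolding Scl_iff by blast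
  have "coeffs_holo (antipodal \<Omega>) S d (\<rho> / 2) (adj P)"
    by (rule coeffs_holo_mono[OF coeffs_holo_adj[OF h] symb_dom_half[OF d \<rho>(1)]])
  moreover have "growth_bound (antipodal \<Omega>) S d (\<rho> / 2) (adj P)"
    by (rule growth_bound_adj[OF h b d \<rho> S])
  moreover have "deriv_eta (adj P) \<in> Ncl (antipodal \<Omega>) S"
  proof (rule Ncl_cong[OF adj_Ncl[OF e S] d \<rho>])
    fix \<nu>
    obtain W where W: "open W" "symb_dom3 \<Omega> S d \<rho> \<subseteq> W" "\<And>k. k \<le> \<nu> \<Longrightarrow> holo (tri P k) W"
      using coeffs_holo_upto[OF h] by metis
    show "\<exists>W. open W \<and> symb_dom3 (antipodal \<Omega>) S d \<rho> \<subseteq> W \<and>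
        (\<forall>x\<in>W. tri (adj (deriv_eta P)) \<nu> x = tri (deriv_eta (adj P)) \<nu> x)"
      by (rule exI[of _ "antipode3 -` W"])
        (use W open_antipode3[OF W(1)] tri_deriv_eta_adj[OF W(1,3)] in \<open>auto simp: symb_dom3_antipodal\<close>)
  qed
  moreover have "0 < \<rho> / 2" "\<rho> / 2 < 1" using \<rho> by auto
  ultimately show ?thesis unfolding Scl_iff using d by blast
qed

lemma symb_eq_adj_adj:
  assumes P: "P \<in> Scl \<Omega> S"
  shows "symb_eq \<Omega> S (adj (adj P)) P"
proof -
  obtain d \<rho> where d: "0 < d" and \<rho>: "0 < \<rho>" "\<rho> < 1" and h: "coeffs_holo \<Omega> S d \<rho> P"
    using P unfolding Scl_iff by blast
  have "adj (adj P) \<nu> z \<zeta> \<eta> = P \<nu> z \<zeta> \<eta>" if y: "(z, \<zeta>) \<in> symb_dom \<Omega> d \<rho>" and \<eta>: "\<eta> \<in> S" for \<nu> z \<zeta> \<eta>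
  proof -
    obtain X where X: "open X" "symb_dom \<Omega> d \<rho> \<subseteq> X" "\<And>k. k \<le> \<nu> \<Longrightarrow> holo (slice P \<eta> k) X"
      using coeffs_holo_slice[OF h \<eta>] by metis
    let ?F = "trunc \<nu> (slice P \<eta>)"
    have "adj (adj P) \<nu> z \<zeta> \<eta> = local_adj (local_adj ?F) \<nu> (z, \<zeta>)"
      unfolding adj_eq_local slice_adj
      by (rule fun_cong[OF local_adj_local], rule local_adj_local) simp
    also have "\<dots> = ?F \<nu> (z, \<zeta>)"
      by (rule local_adj_adj[OF X(1) holo_trunc[OF X(3)]]) (use y X(2) in auto)
    finally show ?thesis by (simp add: slice_def)
  qed
  then show ?thesis unfolding symb_eq_def using d \<rho> by blast
qed

lemma symb_eq_adj_comp:
  assumes P: "P \<in> Scl \<Omega> S" and Q: "Q \<in> Scl \<Omega> S"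
  shows "symb_eq (antipodal \<Omega>) S (adj (symb_comp Q P)) (symb_comp (adj P) (adj Q))"
proof -
  obtain d1 \<rho>1 where d1: "0 < d1" "0 < \<rho>1" "\<rho>1 < 1" and h1: "coeffs_holo \<Omega> S d1 \<rho>1 P"
    using P unfolding Scl_iff by blast
  obtain d2 \<rho>2 where d2: "0 < d2" "0 < \<rho>2" "\<rho>2 < 1" and h2: "coeffs_holo \<Omega> S d2 \<rho>2 Q"
    using Q unfolding Scl_iff by blast
  obtain d \<rho> where d: "0 < d" "0 < \<rho>" "\<rho> < 1"
    and sub: "symb_dom \<Omega> d \<rho> \<subseteq> symb_dom \<Omega> d1 \<rho>1" "symb_dom \<Omega> d \<rho> \<subseteq> symb_dom \<Omega> d2 \<rho>2"
    by (rule symb_dom_common[OF d1 d2])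
  have "adj (symb_comp Q P) \<nu> z \<zeta> \<eta> = symb_comp (adj P) (adj Q) \<nu> z \<zeta> \<eta>"
    if y: "(z, \<zeta>) \<in> symb_dom (antipodal \<Omega>) d \<rho>" and \<eta>: "\<eta> \<in> S" for \<nu> z \<zeta> \<eta>
  proof -
    obtain X1 where X1: "open X1" "symb_dom \<Omega> d1 \<rho>1 \<subseteq> X1" "\<And>k. k \<le> \<nu> \<Longrightarrow> holo (slice P \<eta> k) X1"
      using coeffs_holo_slice[OF h1 \<eta>] by metis
    obtain X2 where X2: "open X2" "symb_dom \<Omega> d2 \<rho>2 \<subseteq> X2" "\<And>k. k \<le> \<nu> \<Longrightarrow> holo (slice Q \<eta> k) X2"
      using coeffs_holo_slice[OF h2 \<eta>] by metis
    let ?P = "trunc \<nu> (slice P \<eta>)" and ?Q = "trunc \<nu> (slice Q \<eta>)"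
    have "adj (symb_comp Q P) \<nu> z \<zeta> \<eta> = local_adj (local_comp ?Q ?P) \<nu> (z, \<zeta>)"
      unfolding adj_eq_local slice_comp
      by (rule fun_cong[OF local_adj_local], rule local_comp_local) simp_all
    also have "\<dots> = local_comp (local_adj ?P) (local_adj ?Q) \<nu> (z, \<zeta>)"
    proof (rule local_adj_comp[of "X1 \<inter> X2"])
      show "holo (?P k) (X1 \<inter> X2)" for k by (rule holo_trunc, rule holo_on_subset[OF X1(3)]) auto
      show "holo (?Q k) (X1 \<inter> X2)" for k by (rule holo_trunc, rule holo_on_subset[OF X2(3)]) auto
      show "antipode (z, \<zeta>) \<in> X1 \<inter> X2"
        using y sub X1(2) X2(2) by (auto simp: symb_dom_antipodal)
    qed (use X1 X2 in auto)
    also have "\<dots> = symb_comp (adj P) (adj Q) \<nu> z \<zeta> \<eta>"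
      unfolding symb_comp_eq_local slice_adj
      by (rule fun_cong[OF local_comp_local]; rule local_adj_local) simp_all
    finally show ?thesis .
  qed
  then show ?thesis unfolding symb_eq_def using d by blast
qed

section \<open>Order of vanishing and polynomial approximation\<close>

text \<open>Vanishing to order at least \<open>M\<close> at \<open>x0\<close>, expressed by growth
  rather than by Taylor coefficients. Products and holomorphic substitutions are then immediate, and
  derivatives follow from Cauchy's inequality.\<close>

definition vord :: "nat \<Rightarrow> ('a::complex_space \<Rightarrow> complex) \<Rightarrow> 'a \<Rightarrow> bool" where
  "vord M f x0 \<longleftrightarrow> (\<exists>r>0. \<exists>C\<ge>0. holo f (ball x0 r) \<and> (\<forall>x\<in>ball x0 r. cmod (f x) \<le> C * norm (x - x0) ^ M))"

lemma vordE:
  assumes "vord M f x0"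
  obtains r C where "r > 0" "C \<ge> 0" "holo f (ball x0 r)" "\<And>x. x \<in> ball x0 r \<Longrightarrow> cmod (f x) \<le> C * norm (x - x0) ^ M"
  using assms unfolding vord_def by blast

lemma vord_0:
  assumes "holo f X" "open X" "x0 \<in> X"
  shows "vord 0 f x0"
proof -
  obtain \<rho> B where "0 < \<rho>" "0 \<le> B" "ball x0 \<rho> \<subseteq> X" "\<And>y. y \<in> ball x0 \<rho> \<Longrightarrow> cmod (f y) \<le> B"
    using holo_locally_bounded[OF assms] by blast
  then show ?thesis
    unfolding vord_def using holo_on_subset[OF assms(1)]
    by (intro exI[of _ \<rho>] conjI exI[of _ B]) auto
qed

lemma vord_eq_0:
  assumes "vord M f x0" "0 < M"
  shows "f x0 = 0"
proof -
  obtain r C where *: "r > 0" "C \<ge> 0" "holo f (ball x0 r)" "\<And>x. x \<in> ball x0 r \<Longrightarrow> cmod (f x) \<le> C * norm (x - x0) ^ M"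
    using vordE[OF assms(1)] by blast
  from *(4)[of x0] *(1) assms(2) show ?thesis by (simp add: zero_power)
qed

lemma vord_mono:
  assumes "vord M f x0" "N \<le> M"
  shows "vord N f x0"
proof -
  obtain r C where *: "r > 0" "C \<ge> 0" "holo f (ball x0 r)" "\<And>x. x \<in> ball x0 r \<Longrightarrow> cmod (f x) \<le> C * norm (x - x0) ^ M"
    using vordE[OF assms(1)] by blast
  have "cmod (f x) \<le> C * norm (x - x0) ^ N" if "x \<in> ball x0 (min r 1)" for x
  proof -
    have "norm (x - x0) \<le> 1" using that by (simp add: dist_norm norm_minus_commute)
    then have "norm (x - x0) ^ M \<le> norm (x - x0) ^ N" by (intro power_decreasing assms) auto
    then have "C * norm (x - x0) ^ M \<le> C * norm (x - x0) ^ N" using *(2) by (rule mult_left_mono)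
    with *(4)[of x] that show ?thesis by simp
  qed
  moreover have "holo f (ball x0 (min r 1))" by (rule holo_on_subset[OF *(3)]) auto
  ultimately show ?thesis
    unfolding vord_def using *(1,2) by (intro exI[of _ "min r 1"] conjI exI[of _ C]) auto
qed

lemma vord_add:
  assumes "vord M f x0" "vord M g x0"
  shows "vord M (\<lambda>x. f x + g x) x0"
proof -
  obtain r C where 1: "r > 0" "C \<ge> 0" "holo f (ball x0 r)" "\<And>x. x \<in> ball x0 r \<Longrightarrow> cmod (f x) \<le> C * norm (x - x0) ^ M"
    using vordE[OF assms(1)] by blast
  obtain s D where 2: "s > 0" "D \<ge> 0" "holo g (ball x0 s)" "\<And>x. x \<in> ball x0 s \<Longrightarrow> cmod (g x) \<le> D * norm (x - x0) ^ M"
    using vordE[OF assms(2)] by blast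
  have sub: "ball x0 (min r s) \<subseteq> ball x0 r" "ball x0 (min r s) \<subseteq> ball x0 s" by auto
  have "holo (\<lambda>x. f x + g x) (ball x0 (min r s))"
    by (intro holo_add holo_on_subset[OF 1(3) sub(1)] holo_on_subset[OF 2(3) sub(2)])
  moreover have "cmod (f x + g x) \<le> (C + D) * norm (x - x0) ^ M" if "x \<in> ball x0 (min r s)" for x
    using 1(4)[of x] 2(4)[of x] sub that norm_triangle_ineq[of "f x" "g x"] by (simp add: distrib_right)
  ultimately show ?thesis
    unfolding vord_def using 1 2 by (intro exI[of _ "min r s"] conjI exI[of _ "C + D"]) auto
qed

lemma vord_mult:
  assumes "vord M f x0" "vord N g x0"
  shows "vord (M + N) (\<lambda>x. f x * g x) x0"
proof -
  obtain r C where 1: "r > 0" "C \<ge> 0" "holo f (ball x0 r)" "\<And>x. x \<in> ball x0 r \<Longrightarrow> cmod (f x) \<le> C * norm (x - x0) ^ M"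
    using vordE[OF assms(1)] by blast
  obtain s D where 2: "s > 0" "D \<ge> 0" "holo g (ball x0 s)" "\<And>x. x \<in> ball x0 s \<Longrightarrow> cmod (g x) \<le> D * norm (x - x0) ^ N"
    using vordE[OF assms(2)] by blast
  have sub: "ball x0 (min r s) \<subseteq> ball x0 r" "ball x0 (min r s) \<subseteq> ball x0 s" by auto
  have "holo (\<lambda>x. f x * g x) (ball x0 (min r s))"
    by (intro holo_mult holo_on_subset[OF 1(3) sub(1)] holo_on_subset[OF 2(3) sub(2)])
  moreover have "cmod (f x * g x) \<le> (C * D) * norm (x - x0) ^ (M + N)" if x: "x \<in> ball x0 (min r s)" for x
  proof -
    have "cmod (f x) * cmod (g x) \<le> (C * norm (x - x0) ^ M) * (D * norm (x - x0) ^ N)"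
      by (intro mult_mono) (use 1 2 sub x in auto)
    then show ?thesis by (simp add: norm_mult power_add mult_ac)
  qed
  ultimately show ?thesis
    unfolding vord_def using 1 2 by (intro exI[of _ "min r s"] conjI exI[of _ "C * D"]) auto
qed

lemma vord_const0: "vord M (\<lambda>x. 0) x0"
  unfolding vord_def by (intro exI[of _ 1] conjI exI[of _ 0]) auto

lemma vord_const: "vord 0 (\<lambda>x. c) x0"
  by (rule vord_0[of _ UNIV]) auto

lemma vord_cmult: "vord M f x0 \<Longrightarrow> vord M (\<lambda>x. c * f x) x0"
  using vord_mult[OF vord_const, of M f x0 c] by simp

lemma vord_sum: "(\<And>i. i \<in> I \<Longrightarrow> vord M (f i) x0) \<Longrightarrow> vord M (\<lambda>x. \<Sum>i\<in>I. f i x) x0"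
  by (induction I rule: infinite_finite_induct) (auto intro: vord_const0 vord_add)

text \<open>Cauchy's inequality at \<open>x\<close> on a disc whose radius is the distance to
  \<open>x0\<close>: on it \<open>f\<close> is of order \<open>norm (x - x0) ^ M\<close>, and
  dividing by the radius loses one power.\<close>

lemma vord_dirderiv:
  assumes "vord M f x0"
  shows "vord (M - 1) (dirderiv v f) x0"
proof (cases M)
  case 0
  obtain r C where "r > 0" "holo f (ball x0 r)"
    using vordE[OF assms] by metis
  then show ?thesis using 0 by (auto intro!: vord_0[of _ "ball x0 r"] holo_dirderiv)
next
  case (Suc m)
  obtain r C where *: "r > 0" "C \<ge> 0" "holo f (ball x0 r)" "\<And>x. x \<in> ball x0 r \<Longrightarrow> cmod (f x) \<le> C * norm (x - x0) ^ M"
    using vordE[OF assms] by blast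
  define c where "c = 1 + norm v"
  have c: "1 \<le> c" "0 < c" by (auto simp: c_def add_pos_nonneg)
  have bound: "cmod (dirderiv v f x) \<le> C * (norm (x - x0) + \<epsilon> * c) ^ M / \<epsilon>"
    if "0 < \<epsilon>" "norm (x - x0) + \<epsilon> * c < r" for x \<epsilon>
  proof -
    have n: "norm (x + s *\<^sub>C v - x0) \<le> norm (x - x0) + \<epsilon> * c" if "cmod s \<le> \<epsilon>" for s
    proof -
      have "cmod s * norm v \<le> \<epsilon> * c" by (intro mult_mono) (use that \<open>0 < \<epsilon>\<close> in \<open>auto simp: c_def\<close>)
      then show ?thesis
        using norm_triangle_ineq[of "x - x0" "s *\<^sub>C v"] by (simp add: norm_scaleC algebra_simps)
    qed
    have mem: "x + s *\<^sub>C v \<in> ball x0 r" if "cmod s \<le> \<epsilon>" for s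
      using n[OF that] \<open>norm (x - x0) + \<epsilon> * c < r\<close> by (simp add: dist_norm norm_minus_commute)
    show ?thesis
    proof (rule norm_dirderiv_le[OF *(3) \<open>0 < \<epsilon>\<close> mem])
      fix s assume "cmod s = \<epsilon>"
      then have s: "cmod s \<le> \<epsilon>" by simp
      have "cmod (f (x + s *\<^sub>C v)) \<le> C * norm (x + s *\<^sub>C v - x0) ^ M" by (rule *(4)[OF mem[OF s]])
      also have "\<dots> \<le> C * (norm (x - x0) + \<epsilon> * c) ^ M"
        using n[OF s] *(2) by (intro mult_left_mono power_mono) auto
      finally show "cmod (f (x + s *\<^sub>C v)) \<le> C * (norm (x - x0) + \<epsilon> * c) ^ M" .
    qed
  qed
  \<comment> \<open>A disc of radius \<open>norm (x - x0)\<close> in direction \<open>v\<close>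
    reaches out to at most \<open>(1 + c) * norm (x - x0)\<close>, which has to stay below
    \<open>r\<close>.\<close>
  define r' where "r' = r / (1 + c)"
  have r': "0 < r'" "r' \<le> r" using *(1) c by (auto simp: r'_def field_simps)
  have "cmod (dirderiv v f x) \<le> (C * (1 + c) ^ M) * norm (x - x0) ^ m" if x: "x \<in> ball x0 r'" for x
  proof (cases "x = x0")
    case False
    let ?e = "norm (x - x0)"
    have "?e < r'" using x by (simp add: dist_norm norm_minus_commute)
    then have "?e * (1 + c) < r" using c by (simp add: r'_def field_simps)
    then have "cmod (dirderiv v f x) \<le> C * (?e + ?e * c) ^ M / ?e"
      using False by (intro bound) (auto simp: algebra_simps)
    also have "?e + ?e * c = ?e * (1 + c)" by (simp add: algebra_simps)
    also have "C * (?e * (1 + c)) ^ M / ?e = C * (1 + c) ^ M * ?e ^ m"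
      using False by (simp add: Suc power_mult_distrib)
    finally show ?thesis .
  next
    case True
    \<comment> \<open>At the centre itself every small radius is available: a fixed one suffices if
      one derivative exhausts the order, otherwise the radius tends to 0.\<close>
    have le: "cmod (dirderiv v f x0) \<le> C * c ^ M * \<epsilon> ^ m" if "0 < \<epsilon>" "\<epsilon> < r'" for \<epsilon>
    proof -
      have "\<epsilon> * c \<le> \<epsilon> * (1 + c)" using that c by simp
      also have "\<dots> < r" using that c by (simp add: r'_def field_simps)
      finally have "cmod (dirderiv v f x0) \<le> C * (norm (x0 - x0) + \<epsilon> * c) ^ M / \<epsilon>"
        by (intro bound) (use that in auto)
      then show ?thesis using that by (simp add: Suc power_mult_distrib mult_ac)
    qed
    show ?thesis
    proof (cases "m = 0")
      case True
      have "cmod (dirderiv v f x0) \<le> C * c ^ M" using le[of "r' / 2"] r' True by simp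
      also have "\<dots> \<le> C * (1 + c) ^ M" using c * by (intro mult_left_mono power_mono) auto
      finally show ?thesis using True \<open>x = x0\<close> by simp
    next
      case False
      have "((\<lambda>\<epsilon>. C * c ^ M * \<epsilon> ^ m) \<longlongrightarrow> C * c ^ M * 0 ^ m) (at_right 0)"
        by (intro tendsto_intros)
      moreover have "\<forall>\<^sub>F \<epsilon> in at_right 0. cmod (dirderiv v f x0) \<le> C * c ^ M * \<epsilon> ^ m"
        using eventually_at_right_less[of 0] eventually_at_right_real[OF r'(1)]
        by eventually_elim (use le in auto)
      ultimately have "cmod (dirderiv v f x0) \<le> C * c ^ M * 0 ^ m"
        by (intro tendsto_lowerbound[of "\<lambda>\<epsilon>. C * c ^ M * \<epsilon> ^ m"]) auto
      then show ?thesis using False \<open>x = x0\<close> by (simp add: zero_power)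
    qed
  qed
  moreover have "holo (dirderiv v f) (ball x0 r')"
    by (rule holo_on_subset[OF holo_dirderiv[OF *(3)]]) (use r' in auto)
  ultimately show ?thesis
    unfolding vord_def using r' *(2) c Suc by (intro exI[of _ r'] conjI exI[of _ "C * (1 + c) ^ M"]) auto
qed

text \<open>Differentiability at \<open>y0\<close> makes \<open>g\<close> Lipschitz there, and this
  bounds the distance to \<open>g y0\<close> by a multiple of the distance to
  \<open>y0\<close>.\<close>

lemma vord_compose:
  assumes f: "vord M f (g y0)" and g: "holo_map g Y" and Y: "open Y" "y0 \<in> Y"
  shows "vord M (\<lambda>y. f (g y)) y0"
proof -
  obtain r C where *: "r > 0" "C \<ge> 0" "holo f (ball (g y0) r)"
    "\<And>x. x \<in> ball (g y0) r \<Longrightarrow> cmod (f x) \<le> C * norm (x - g y0) ^ M"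
    using vordE[OF f] by blast
  obtain D where D: "(g has_derivative D) (at y0)" using g Y(2) unfolding holo_map_def by blast
  then obtain K where K: "\<And>x. norm (D x) \<le> norm x * K"
    using has_derivative_bounded_linear bounded_linear.bounded by blast
  from D obtain d where d: "d > 0" "\<And>y. norm (y - y0) < d \<Longrightarrow> norm (g y - g y0 - D (y - y0)) \<le> 1 * norm (y - y0)"
    unfolding has_derivative_at_alt by (meson zero_less_one)
  define L where "L = 1 + \<bar>K\<bar>"
  have lip: "norm (g y - g y0) \<le> L * norm (y - y0)" if "norm (y - y0) < d" for y
  proof -
    have "norm (g y - g y0) \<le> norm (g y - g y0 - D (y - y0)) + norm (D (y - y0))"
      using norm_triangle_ineq[of "g y - g y0 - D (y - y0)" "D (y - y0)"] by simp
    also have "\<dots> \<le> norm (y - y0) + norm (y - y0) * \<bar>K\<bar>"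
      using d(2)[OF that] K[of "y - y0"] mult_left_mono[OF abs_ge_self norm_ge_zero, of "y - y0" K] by simp
    finally show ?thesis by (simp add: L_def algebra_simps)
  qed
  obtain e where e: "e > 0" "ball y0 e \<subseteq> Y" using Y openE by blast
  define s where "s = min (min d e) (r / L)"
  have L: "L > 0" by (simp add: L_def)
  have s: "s > 0" using d e * L by (simp add: s_def)
  have n: "norm (y - y0) < d" "L * norm (y - y0) < r" if "y \<in> ball y0 s" for y
    using that L by (auto simp: s_def dist_norm norm_minus_commute field_simps)
  have gb: "g y \<in> ball (g y0) r" if "y \<in> ball y0 s" for y
    using lip[of y] n[OF that] by (simp add: dist_norm norm_minus_commute)
  have "holo (\<lambda>y. f (g y)) (ball y0 s)"
    by (rule holo_compose[OF *(3) holo_map_subset[OF g] gb]) (use e in \<open>auto simp: s_def\<close>)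
  moreover have "cmod (f (g y)) \<le> (C * L ^ M) * norm (y - y0) ^ M" if y: "y \<in> ball y0 s" for y
  proof -
    have "C * norm (g y - g y0) ^ M \<le> C * (L * norm (y - y0)) ^ M"
      using lip[of y] n[OF y] *(2) by (intro mult_left_mono power_mono) auto
    with *(4)[OF gb[OF y]] show ?thesis by (simp add: power_mult_distrib mult_ac)
  qed
  ultimately show ?thesis
    unfolding vord_def using s *(2) L by (intro exI[of _ s] conjI exI[of _ "C * L ^ M"]) auto
qed

lemma vord_pairop: "vord M f x0 \<Longrightarrow> vord (M - 2) (pairop p q f) x0"
  unfolding pairop_def[abs_def]
  using vord_dirderiv[OF vord_dirderiv] by (intro vord_sum) (simp add: numeral_2_eq_2)

text \<open>The filtration preserved by \<open>exp (t \<langle>\<partial>\<^sub>\<zeta>, \<partial>\<^sub>z\<rangle>)\<close>: each power of \<open>t\<close> costs two derivatives.\<close>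

lemma vord_expo:
  assumes "\<And>k. vord (M - 2 * k) (F k) x0"
  shows "vord (M - 2 * \<nu>) (expo (pairop p q) F \<nu>) x0"
proof -
  have pow: "vord (N - 2 * k) ((pairop p q ^^ k) f) x0" if "vord N f x0" for N k f
  proof (induction k)
    case (Suc k)
    then show ?case using vord_pairop[OF Suc] by (simp add: algebra_simps)
  qed (use that in simp)
  have "vord (M - 2 * \<nu>) (\<lambda>x. (1 / fact k) * (pairop p q ^^ k) (F (\<nu> - k)) x) x0" if "k \<le> \<nu>" for k
    using vord_mono[OF pow[OF assms[of "\<nu> - k"], of k], of "M - 2 * \<nu>"] that by (intro vord_cmult) auto
  then have "vord (M - 2 * \<nu>) (\<lambda>x. \<Sum>k\<le>\<nu>. (1 / fact k) * (pairop p q ^^ k) (F (\<nu> - k)) x) x0"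
    by (intro vord_sum) simp
  then show ?thesis by (simp add: expo_def[abs_def])
qed

text \<open>Polynomials in the functions \<open>l i\<close>, generated by multiplication with one
  coordinate at a time: this is the form of the inductions on symbols.\<close>

inductive_set polyfun :: "('m \<Rightarrow> 'a \<Rightarrow> complex) \<Rightarrow> ('a \<Rightarrow> complex) set" for l where
  const: "(\<lambda>x. c) \<in> polyfun l"
| add: "f \<in> polyfun l \<Longrightarrow> g \<in> polyfun l \<Longrightarrow> (\<lambda>x. f x + g x) \<in> polyfun l"
| coord: "f \<in> polyfun l \<Longrightarrow> (\<lambda>x. l i x * f x) \<in> polyfun l"

lemma polyfun_cmult: "f \<in> polyfun l \<Longrightarrow> (\<lambda>x. c * f x) \<in> polyfun l"
proof (induction rule: polyfun.induct)
  case (const c')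
  then show ?case using polyfun.const[of "c * c'" l] by simp
next
  case (add f g)
  then show ?case using polyfun.add[OF add.IH] by (simp add: distrib_left)
next
  case (coord f i)
  then show ?case using polyfun.coord[OF coord.IH] by (simp add: mult.left_commute)
qed

lemma polyfun_sum: "finite I \<Longrightarrow> (\<And>i. i \<in> I \<Longrightarrow> f i \<in> polyfun l) \<Longrightarrow> (\<lambda>x. \<Sum>i\<in>I. f i x) \<in> polyfun l"
  by (induction I rule: finite_induct) (auto intro: polyfun.intros)

lemma holo_polyfun:
  assumes "f \<in> polyfun l" "\<And>i. holo (l i) X"
  shows "holo f X"
  using assms(1) by induction (auto intro: assms(2))

lemma higher_deriv_sum_cmult:
  assumes "open S" "z \<in> S" "finite I" "\<And>i. i \<in> I \<Longrightarrow> f i holomorphic_on S"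
  shows "(deriv ^^ k) (\<lambda>s. \<Sum>i\<in>I. c i * f i s) z = (\<Sum>i\<in>I. c i * (deriv ^^ k) (f i) z)"
  using assms(3,4)
proof (induction I rule: finite_induct)
  case empty
  show ?case by (simp add: higher_deriv_const)
next
  case (insert i I)
  have "(deriv ^^ k) (\<lambda>s. c i * f i s + (\<Sum>i\<in>I. c i * f i s)) z
      = (deriv ^^ k) (\<lambda>s. c i * f i s) z + (deriv ^^ k) (\<lambda>s. \<Sum>i\<in>I. c i * f i s) z"
    by (rule higher_deriv_add[of _ S]) (use insert assms in \<open>auto intro!: holomorphic_intros\<close>)
  moreover have "(deriv ^^ k) (\<lambda>s. c i * f i s) z = c i * (deriv ^^ k) (f i) z"
    by (rule higher_deriv_cmult[of _ S]) (use insert assms in auto)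
  ultimately show ?case using insert by simp
qed

text \<open>A frame with its dual linear coordinates. One Taylor theorem then serves the base space
  and the cotangent space.\<close>

locale coordinates =
  fixes l :: "'m::finite \<Rightarrow> 'a::complex_space \<Rightarrow> complex" and b :: "'m \<Rightarrow> 'a"
  assumes bounded_linear_l: "bounded_linear (l i)"
    and expand: "(\<Sum>i\<in>UNIV. l i x *\<^sub>C b i) = x"
begin

text \<open>Differentiating along \<open>h\<close> once gives \<open>\<Sum>\<^sub>i l i h\<close>
  times the derivative in direction \<open>b i\<close>, to which the induction applies. The result
  is recorded as a polynomial in the point \<open>x0 + h\<close> rather than in the increment, by
  \<open>l i h = l i (x0 + h) - l i x0\<close>.\<close>

lemma taylor_coefficient:
  assumes X: "open X" "x0 \<in> X" and f: "holo f X"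
  shows "\<exists>p\<in>polyfun l. \<forall>h. (deriv ^^ k) (\<lambda>s. f (x0 + s *\<^sub>C h)) 0 = p (x0 + h)"
  using f
proof (induction k arbitrary: f)
  case 0
  show ?case by (rule bexI[OF _ polyfun.const[of "f x0"]]) simp
next
  case (Suc k)
  have "\<forall>i. \<exists>p\<in>polyfun l. \<forall>h. (deriv ^^ k) (\<lambda>s. dirderiv (b i) f (x0 + s *\<^sub>C h)) 0 = p (x0 + h)"
    using Suc.IH[OF holo_dirderiv[OF Suc.prems X(1)]] by blast
  then obtain p where p: "\<And>i. p i \<in> polyfun l"
    "\<And>i h. (deriv ^^ k) (\<lambda>s. dirderiv (b i) f (x0 + s *\<^sub>C h)) 0 = p i (x0 + h)"
    by metis
  show ?case
  proof (rule bexI)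
    show "(\<lambda>x. \<Sum>i\<in>UNIV. l i x * p i x + (- l i x0) * p i x) \<in> polyfun l"
      by (intro polyfun_sum polyfun.add polyfun.coord polyfun_cmult p(1)) simp
    show "\<forall>h. (deriv ^^ Suc k) (\<lambda>s. f (x0 + s *\<^sub>C h)) 0
        = (\<Sum>i\<in>UNIV. l i (x0 + h) * p i (x0 + h) + (- l i x0) * p i (x0 + h))"
    proof
      fix h
      define T where "T = {s. x0 + s *\<^sub>C h \<in> X}"
      have "T = (\<lambda>s. x0 + s *\<^sub>C h) -` X" by (auto simp: T_def)
      moreover have "open ((\<lambda>s. x0 + s *\<^sub>C h) -` X)"
        by (rule open_vimage[OF X(1)]) (intro continuous_intros)
      ultimately have T: "open T" "0 \<in> T" using X(2) by (auto simp: T_def)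
      have "deriv (\<lambda>s. f (x0 + s *\<^sub>C h)) s = (\<Sum>i\<in>UNIV. l i h * dirderiv (b i) f (x0 + s *\<^sub>C h))"
        if s: "s \<in> T" for s
      proof -
        have sX: "x0 + s *\<^sub>C h \<in> X" using s by (simp add: T_def)
        have "deriv (\<lambda>s. f (x0 + s *\<^sub>C h)) s = dirderiv h f (x0 + s *\<^sub>C h)"
          by (rule DERIV_imp_deriv[OF has_field_derivative_line[OF Suc.prems sX]])
        also have "\<dots> = dirderiv (\<Sum>i\<in>UNIV. l i h *\<^sub>C b i) f (x0 + s *\<^sub>C h)" by (simp add: expand)
        also have "\<dots> = (\<Sum>i\<in>UNIV. l i h * dirderiv (b i) f (x0 + s *\<^sub>C h))"
          by (simp add: dirderiv_sum_dir[OF Suc.prems sX] holo_has_derivative(2)[OF Suc.prems sX])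
        finally show ?thesis .
      qed
      then have ev: "\<forall>\<^sub>F s in nhds 0. deriv (\<lambda>s. f (x0 + s *\<^sub>C h)) s
          = (\<Sum>i\<in>UNIV. l i h * dirderiv (b i) f (x0 + s *\<^sub>C h))"
        using T by (auto simp: eventually_nhds)
      have "(deriv ^^ Suc k) (\<lambda>s. f (x0 + s *\<^sub>C h)) 0 = (deriv ^^ k) (deriv (\<lambda>s. f (x0 + s *\<^sub>C h))) 0"
        by (simp add: funpow_swap1)
      also have "\<dots> = (deriv ^^ k) (\<lambda>s. \<Sum>i\<in>UNIV. l i h * dirderiv (b i) f (x0 + s *\<^sub>C h)) 0"
        by (rule higher_deriv_cong_ev[OF ev refl])
      also have "\<dots> = (\<Sum>i\<in>UNIV. l i h * (deriv ^^ k) (\<lambda>s. dirderiv (b i) f (x0 + s *\<^sub>C h)) 0)"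
        by (rule higher_deriv_sum_cmult[OF T]) (auto simp: T_def intro!: holomorphic_on_line[OF holo_dirderiv[OF Suc.prems X(1)]])
      also have "\<dots> = (\<Sum>i\<in>UNIV. l i h * p i (x0 + h))" by (simp add: p)
      also have "\<dots> = (\<Sum>i\<in>UNIV. l i (x0 + h) * p i (x0 + h) + (- l i x0) * p i (x0 + h))"
        by (intro sum.cong refl)
          (simp add: linear_add[OF bounded_linear.linear[OF bounded_linear_l]] algebra_simps)
      finally show "(deriv ^^ Suc k) (\<lambda>s. f (x0 + s *\<^sub>C h)) 0
        = (\<Sum>i\<in>UNIV. l i (x0 + h) * p i (x0 + h) + (- l i x0) * p i (x0 + h))" .
    qed
  qed
qed

text \<open>The Taylor polynomial of degree below \<open>M\<close>, with the remainder estimated on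
  the line from \<open>x0\<close> to \<open>x\<close>. There the function is holomorphic on a disc
  of radius \<open>\<rho> / norm h\<close>, of which half is used.\<close>

lemma polynomial_approximation:
  assumes X: "open X" "x0 \<in> X" and f: "holo f X" and l: "\<And>i. holo (l i) UNIV"
  obtains p where "p \<in> polyfun l" "vord M (\<lambda>x. f x - p x) x0"
proof -
  obtain p where p: "\<And>k. p k \<in> polyfun l" "\<And>k h. (deriv ^^ k) (\<lambda>s. f (x0 + s *\<^sub>C h)) 0 = p k (x0 + h)"
    using taylor_coefficient[OF X f] by metis
  define q where "q x = (\<Sum>k<M. (1 / fact k) * p k x)" for x
  have q: "q \<in> polyfun l" unfolding q_def[abs_def] by (intro polyfun_sum polyfun_cmult p) simp
  obtain \<rho> B where \<rho>: "0 < \<rho>" "0 \<le> B" "ball x0 \<rho> \<subseteq> X" "\<And>y. y \<in> ball x0 \<rho> \<Longrightarrow> cmod (f y) \<le> B"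
    using holo_locally_bounded[OF f X] by blast
  have bound: "cmod (f x - q x) \<le> (2 * B * (2 / \<rho>) ^ M) * norm (x - x0) ^ M" if x: "x \<in> ball x0 (\<rho> / 4)" for x
  proof (cases "M = 0 \<or> x \<noteq> x0")
    case True
    show ?thesis
    proof (cases "x = x0")
      case True
      with \<open>M = 0 \<or> x \<noteq> x0\<close> show ?thesis using \<rho>(4)[of x0] \<rho>(1,2) by (simp add: q_def)
    next
      case False
      define h where "h = x - x0"
      have h: "0 < norm h" "norm h < \<rho> / 4" using False x by (auto simp: h_def dist_norm norm_minus_commute)
      let ?g = "\<lambda>s. f (x0 + s *\<^sub>C h)"
      have mem: "x0 + s *\<^sub>C h \<in> ball x0 \<rho>" if "cmod s < \<rho> / norm h" for s
        using that h by (simp add: dist_norm norm_scaleC field_simps)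
      have "cmod (?g 1 - (\<Sum>k<M. (deriv ^^ k) ?g 0 / fact k)) \<le> 2 * B / (\<rho> / (2 * norm h)) ^ M"
      proof (rule taylor_remainder_bound)
        show "?g holomorphic_on ball 0 (\<rho> / norm h)"
          by (rule holomorphic_on_line[OF f]) (use mem \<rho> in auto)
      qed (use h \<rho> mem in \<open>auto simp: field_simps\<close>)
      moreover have "2 * B / (\<rho> / (2 * norm h)) ^ M = (2 * B * (2 / \<rho>) ^ M) * norm h ^ M"
        by (simp add: power_divide power_mult_distrib)
      ultimately show ?thesis by (simp add: p(2) q_def h_def)
    qed
  next
    case False
    \<comment> \<open>For \<open>h = 0\<close> all derivatives of positive order vanish, and the
      constant term is present because \<open>M > 0\<close>.\<close>
    then have x: "x = x0" and M: "M = Suc (M - 1)" by auto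
    have "p k x0 = (if k = 0 then f x0 else 0)" for k
      using p(2)[of k 0] by (simp add: higher_deriv_const)
    then have "q x0 = (\<Sum>k<M. if k = 0 then f x0 else 0)"
      unfolding q_def by (intro sum.cong) auto
    also have "\<dots> = f x0" using False by simp
    finally show ?thesis using x \<rho> by simp
  qed
  have "holo (\<lambda>x. f x - q x) (ball x0 (\<rho> / 4))"
    by (intro holo_diff holo_on_subset[OF f] holo_polyfun[OF q] holo_on_subset[OF l]) (use \<rho> in auto)
  then have "vord M (\<lambda>x. f x - q x) x0"
    unfolding vord_def using bound \<rho>
    by (intro exI[of _ "\<rho> / 4"] conjI exI[of _ "2 * B * (2 / \<rho>) ^ M"]) auto
  with q show ?thesis by (rule that)
qed

end

lemma coordinates_vec: "coordinates (\<lambda>i (x::complex^'n). x $ i) (\<lambda>i. axis i 1)"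
  by (rule coordinates.intro) (auto simp: vec_eq_sum_axis)

definition pt_coord :: "'n + 'n \<Rightarrow> 'n::finite pt \<Rightarrow> complex" where
  "pt_coord i y = (case i of Inl j \<Rightarrow> fst y $ j | Inr j \<Rightarrow> snd y $ j)"

lemma sum_over_sum_type: "(\<Sum>i\<in>UNIV. f i) = (\<Sum>j\<in>UNIV. f (Inl j)) + (\<Sum>j\<in>UNIV. f (Inr j))"
  for f :: "'n::finite + 'm::finite \<Rightarrow> 'b::comm_monoid_add"
proof -
  have "(\<Sum>i\<in>UNIV. f i) = (\<Sum>i\<in>Inl ` UNIV \<union> Inr ` UNIV. f i)" by (simp add: UNIV_sum)
  also have "\<dots> = (\<Sum>i\<in>Inl ` UNIV. f i) + (\<Sum>i\<in>Inr ` UNIV. f i)"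
    by (rule sum.union_disjoint) auto
  finally show ?thesis by (simp add: sum.reindex)
qed

lemma pt_eq_sum_dirs:
  "(\<Sum>j\<in>UNIV. fst y $ j *\<^sub>C base_dir j) + (\<Sum>j\<in>UNIV. snd y $ j *\<^sub>C fibre_dir j) = y"
  by (simp add: prod_eq_iff fst_sum snd_sum base_dir_def fibre_dir_def vec_eq_sum_axis)

lemma bounded_linear_pt_coord: "bounded_linear (pt_coord i)"
  unfolding pt_coord_def[abs_def]
  by (cases i) (auto intro!: bounded_linear_compose[OF bounded_linear_vec_nth] bounded_linear_fst bounded_linear_snd)

lemma coordinates_pt: "coordinates pt_coord (\<lambda>i. case i of Inl j \<Rightarrow> base_dir j | Inr j \<Rightarrow> fibre_dir j)"
  by (rule coordinates.intro[OF bounded_linear_pt_coord])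
    (simp add: sum_over_sum_type pt_coord_def pt_eq_sum_dirs)

lemma holo_pt_coord: "holo (pt_coord i) X"
  unfolding pt_coord_def[abs_def]
  by (cases i) (auto intro!: holo_nth holo_map_fst holo_map_snd)

section \<open>Chain rule, Jacobi's formula and rules for the adjoint\<close>

lemma dirderiv_linear:
  assumes "bounded_linear l" "\<And>c v. l (c *\<^sub>C v) = c * l v"
  shows "dirderiv v l x = l v"
  by (rule dirderiv_unique[OF bounded_linear_imp_has_derivative[OF assms(1)] assms(2)])

lemma dirderiv_coordinate:
  "dirderiv v (\<lambda>y. fst y $ i) y = fst v $ i" "dirderiv v (\<lambda>y. snd y $ i) y = snd v $ i"
  for v y :: "'n::finite pt"
  by (rule dirderiv_linear;
      auto intro!: bounded_linear_compose[OF bounded_linear_vec_nth] bounded_linear_fst bounded_linear_snd)+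

lemma dirderiv_vec_coordinate: "dirderiv v (\<lambda>w. w $ i) w = v $ i" for v w :: "complex^'n"
  by (rule dirderiv_linear) auto

lemma chain_rule_vec:
  fixes h :: "'a::complex_space \<Rightarrow> complex^'n"
  assumes h: "\<And>l. holo (\<lambda>x. h x $ l) X" and x: "x \<in> X" and f: "holo f T" "h x \<in> T"
  shows "dirderiv v (\<lambda>x. f (h x)) x = (\<Sum>l\<in>UNIV. dirderiv v (\<lambda>x. h x $ l) x * dirderiv (axis l 1) f (h x))"
proof -
  let ?d = "\<chi> l. dirderiv v (\<lambda>x. h x $ l) x"
  have "dirderiv v (\<lambda>x. f (h x)) x = dirderiv ?d f (h x)"
    by (rule dirderiv_compose[OF f has_derivative_vec(1)[OF h x] has_derivative_vec(2)[OF h x]])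
  also have "\<dots> = dirderiv (\<Sum>l\<in>UNIV. ?d $ l *\<^sub>C axis l 1) f (h x)" by (simp only: vec_eq_sum_axis)
  finally show ?thesis by (simp add: dirderiv_sum_dir[OF f] holo_has_derivative(2)[OF f])
qed

lemma chain_rule_pt:
  fixes h :: "'a::complex_space \<Rightarrow> 'n::finite pt"
  assumes h: "\<And>l. holo (\<lambda>x. fst (h x) $ l) X" "\<And>l. holo (\<lambda>x. snd (h x) $ l) X"
    and x: "x \<in> X" and f: "holo f T" "h x \<in> T"
  shows "dirderiv v (\<lambda>x. f (h x)) x
    = (\<Sum>l\<in>UNIV. dirderiv v (\<lambda>x. fst (h x) $ l) x * dirderiv (base_dir l) f (h x))
      + (\<Sum>l\<in>UNIV. dirderiv v (\<lambda>x. snd (h x) $ l) x * dirderiv (fibre_dir l) f (h x))"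
proof -
  let ?d = "\<lambda>v. (\<chi> l. dirderiv v (\<lambda>x. fst (h x) $ l) x, \<chi> l. dirderiv v (\<lambda>x. snd (h x) $ l) x)"
  have "((\<lambda>x. (fst (h x), snd (h x))) has_derivative ?d) (at x)"
    by (rule has_derivative_Pair[OF has_derivative_vec(1)[OF h(1) x] has_derivative_vec(1)[OF h(2) x]])
  then have d: "(h has_derivative ?d) (at x)" by simp
  have "dirderiv v (\<lambda>x. f (h x)) x = dirderiv (?d v) f (h x)"
    by (rule dirderiv_compose[OF f d]) (simp add: has_derivative_vec(2)[OF h(1) x] has_derivative_vec(2)[OF h(2) x])
  also have "\<dots> = dirderiv ((\<Sum>j\<in>UNIV. fst (?d v) $ j *\<^sub>C base_dir j) + (\<Sum>j\<in>UNIV. snd (?d v) $ j *\<^sub>C fibre_dir j)) f (h x)"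
    by (simp only: pt_eq_sum_dirs)
  finally show ?thesis
    by (simp add: holo_has_derivative(3)[OF f] dirderiv_sum_dir[OF f] holo_has_derivative(2)[OF f])
qed

section \<open>Derivatives of determinants\<close>

lemma dirderiv_prod:
  assumes "finite I" "\<And>i. i \<in> I \<Longrightarrow> holo (f i) X" "x \<in> X"
  shows "dirderiv v (\<lambda>x. \<Prod>i\<in>I. f i x) x = (\<Sum>i\<in>I. dirderiv v (f i) x * (\<Prod>j\<in>I - {i}. f j x))"
  using assms(1,2)
proof (induction I rule: finite_induct)
  case empty
  show ?case by simp
next
  case (insert a I)
  have "dirderiv v (\<lambda>x. f a x * (\<Prod>i\<in>I. f i x)) x
      = f a x * dirderiv v (\<lambda>x. \<Prod>i\<in>I. f i x) x + dirderiv v (f a) x * (\<Prod>i\<in>I. f i x)"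
    by (rule dirderiv_mult) (use insert assms(3) in auto)
  also have "\<dots> = (\<Sum>i\<in>I. dirderiv v (f i) x * (f a x * (\<Prod>j\<in>I - {i}. f j x))) + dirderiv v (f a) x * (\<Prod>i\<in>I. f i x)"
    using insert by (simp add: sum_distrib_left mult_ac)
  also have "(\<Sum>i\<in>I. dirderiv v (f i) x * (f a x * (\<Prod>j\<in>I - {i}. f j x)))
      = (\<Sum>i\<in>I. dirderiv v (f i) x * (\<Prod>j\<in>insert a I - {i}. f j x))"
  proof (intro sum.cong refl)
    fix i assume "i \<in> I"
    then have "insert a I - {i} = insert a (I - {i})" using insert by auto
    then show "dirderiv v (f i) x * (f a x * (\<Prod>j\<in>I - {i}. f j x)) = dirderiv v (f i) x * (\<Prod>j\<in>insert a I - {i}. f j x)"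
      using insert by simp
  qed
  finally show ?case using insert by (simp add: insert_Diff_if add.commute)
qed

lemma holo_det:
  fixes M :: "'a::complex_space \<Rightarrow> complex^'n^'n"
  assumes "\<And>i j. holo (\<lambda>x. M x $ i $ j) X"
  shows "holo (\<lambda>x. det (M x)) X"
  unfolding det_def by (intro holo_sum holo_mult holo_const holo_prod assms)

text \<open>A permutation other than the identity moves at least two indices. With one factor
  differentiated, another off-diagonal entry of the identity matrix remains, so its term
  vanishes.\<close>

lemma dirderiv_det_at_identity:
  fixes M :: "'a::complex_space \<Rightarrow> complex^'n^'n"
  assumes M: "\<And>i j. holo (\<lambda>x. M x $ i $ j) X" and x: "x \<in> X" and one: "M x = mat 1"
  shows "dirderiv v (\<lambda>x. det (M x)) x = (\<Sum>i\<in>UNIV. dirderiv v (\<lambda>x. M x $ i $ i) x)"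
proof -
  let ?P = "{p. p permutes (UNIV :: 'n set)}"
  have fin: "finite ?P" by (rule finite_permutations) simp
  let ?d = "\<lambda>p. \<Sum>i\<in>UNIV. dirderiv v (\<lambda>x. M x $ i $ p i) x * (\<Prod>j\<in>UNIV - {i}. M x $ j $ p j)"
  have "dirderiv v (\<lambda>x. det (M x)) x = (\<Sum>p\<in>?P. of_int (sign p) * ?d p)"
  proof -
    have "dirderiv v (\<lambda>x. det (M x)) x
        = (\<Sum>p\<in>?P. dirderiv v (\<lambda>x. of_int (sign p) * (\<Prod>i\<in>UNIV. M x $ i $ p i)) x)"
      unfolding det_def by (rule dirderiv_sum[OF _ x]) (intro holo_mult holo_const holo_prod M)
    also have "\<dots> = (\<Sum>p\<in>?P. of_int (sign p) * ?d p)"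
    proof (intro sum.cong refl)
      fix p
      have "dirderiv v (\<lambda>x. of_int (sign p) * (\<Prod>i\<in>UNIV. M x $ i $ p i)) x
          = of_int (sign p) * dirderiv v (\<lambda>x. \<Prod>i\<in>UNIV. M x $ i $ p i) x"
        by (rule dirderiv_cmult[OF _ x]) (intro holo_prod M)
      then show "dirderiv v (\<lambda>x. of_int (sign p) * (\<Prod>i\<in>UNIV. M x $ i $ p i)) x = of_int (sign p) * ?d p"
        by (simp add: dirderiv_prod[OF finite M x])
    qed
    finally show ?thesis .
  qed
  also have "\<dots> = (\<Sum>p\<in>?P. if p = id then \<Sum>i\<in>UNIV. dirderiv v (\<lambda>x. M x $ i $ i) x else 0)"
  proof (intro sum.cong refl)
    fix p assume "p \<in> ?P"
    then have p: "p permutes UNIV" by simp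
    show "of_int (sign p) * ?d p = (if p = id then \<Sum>i\<in>UNIV. dirderiv v (\<lambda>x. M x $ i $ i) x else 0)"
    proof (cases "p = id")
      case True
      then show ?thesis by (simp add: one mat_def)
    next
      case False
      have z: "(\<Prod>j\<in>UNIV - {i}. M x $ j $ p j) = 0" for i
      proof -
        have "\<exists>j. j \<noteq> i \<and> p j \<noteq> j"
        proof (rule ccontr)
          assume *: "\<not> ?thesis"
          then have "p i = i" using permutes_inj[OF p] by (metis injD)
          with * have "p = id" by (auto simp: fun_eq_iff)
          with False show False by simp
        qed
        then obtain j where "j \<noteq> i" "p j \<noteq> j" by blast
        then have "M x $ j $ p j = 0" by (simp add: one mat_def)
        with \<open>j \<noteq> i\<close> show ?thesis by (intro prod_zero) auto
      qed
      have "?d p = 0" by (simp only: z mult_zero_right sum.neutral_const)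
      then show ?thesis using False by simp
    qed
  qed
  also have "\<dots> = (\<Sum>i\<in>UNIV. dirderiv v (\<lambda>x. M x $ i $ i) x)"
    using fin by (simp add: permutes_id)
  finally show ?thesis .
qed

text \<open>Multiplication by the constant matrix \<open>B\<close> reduces to a matrix that is the
  identity at \<open>x\<close>; multiplicativity of the determinant then gives the factor
  \<open>det (M x)\<close> back.\<close>

lemma jacobi_formula:
  fixes M :: "'a::complex_space \<Rightarrow> complex^'n^'n"
  assumes M: "\<And>i j. holo (\<lambda>x. M x $ i $ j) X" and x: "x \<in> X" and B: "B ** M x = mat 1"
  shows "dirderiv v (\<lambda>x. det (M x)) x
    = det (M x) * (\<Sum>i\<in>UNIV. \<Sum>k\<in>UNIV. B $ i $ k * dirderiv v (\<lambda>x. M x $ k $ i) x)"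
proof -
  have BM: "holo (\<lambda>x. (B ** M x) $ i $ j) X" for i j
    by (simp add: matrix_matrix_mult_def) (intro holo_sum holo_cmult M)
  have unit: "det B * det (M x) = 1"
    using det_mul[of B "M x"] by (simp add: B)
  have "det B * dirderiv v (\<lambda>x. det (M x)) x = dirderiv v (\<lambda>x. det B * det (M x)) x"
    by (rule dirderiv_cmult[OF holo_det[OF M] x, symmetric])
  also have "\<dots> = (\<Sum>i\<in>UNIV. dirderiv v (\<lambda>x. (B ** M x) $ i $ i) x)"
    using dirderiv_det_at_identity[OF BM x B] by (simp add: det_mul)
  also have "\<dots> = (\<Sum>i\<in>UNIV. \<Sum>k\<in>UNIV. B $ i $ k * dirderiv v (\<lambda>x. M x $ k $ i) x)"
    by (intro sum.cong refl)
      (simp add: matrix_matrix_mult_def dirderiv_sum[OF holo_cmult[OF M] x] dirderiv_cmult[OF M x])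
  finally have "det (M x) * (det B * dirderiv v (\<lambda>x. det (M x)) x)
      = det (M x) * (\<Sum>i\<in>UNIV. \<Sum>k\<in>UNIV. B $ i $ k * dirderiv v (\<lambda>x. M x $ k $ i) x)" by simp
  moreover have "det (M x) * (det B * y) = y" for y
    using unit by (metis mult.assoc mult.commute mult_1)
  ultimately show ?thesis by simp
qed

section \<open>Multiplication rules for the exponential and the adjoint\<close>

lemma expo_mult_fst:
  assumes X: "open X" and F: "\<And>k. holo (F k) X" and y: "y \<in> X"
  shows "expo (pairop base_dir fibre_dir) (\<lambda>k y. fst y $ i * F k y) \<nu> y
    = fst y $ i * expo (pairop base_dir fibre_dir) F \<nu> y
      + shift (\<lambda>\<nu>. dirderiv (fibre_dir i) (expo (pairop base_dir fibre_dir) F \<nu>)) \<nu> y"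
proof -
  let ?A = "pairop base_dir fibre_dir"
  have "expo ?A (\<lambda>k y. fst y $ i * F k y) \<nu> y = fst y $ i * expo ?A F \<nu> y
    + shift (expo ?A (\<lambda>k x. \<Sum>j\<in>UNIV. axis j 1 $ i * dirderiv (fibre_dir j) (F k) x + 0 * dirderiv (base_dir j) (F k) x)) \<nu> y"
    by (rule expo_pairop_mult[OF X _ _ _ F y])
      (auto simp: dirderiv_coordinate base_dir_def fibre_dir_def intro!: holo_nth holo_map_fst)
  also have "(\<lambda>k x. \<Sum>j\<in>UNIV. axis j 1 $ i * dirderiv (fibre_dir j) (F k) x + 0 * dirderiv (base_dir j) (F k) x)
      = (\<lambda>k. dirderiv (fibre_dir i) (F k))"
    by (simp add: fun_eq_iff axis_def if_distrib[of "\<lambda>c. c * _"] cong: if_cong)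
  also have "shift (expo ?A (\<lambda>k. dirderiv (fibre_dir i) (F k))) \<nu> y
      = shift (\<lambda>\<nu>. dirderiv (fibre_dir i) (expo ?A F \<nu>)) \<nu> y"
    by (cases \<nu>) (simp_all add: expo_dirderiv[OF X F y])
  finally show ?thesis .
qed

lemma expo_mult_snd:
  assumes X: "open X" and F: "\<And>k. holo (F k) X" and y: "y \<in> X"
  shows "expo (pairop base_dir fibre_dir) (\<lambda>k y. snd y $ i * F k y) \<nu> y
    = snd y $ i * expo (pairop base_dir fibre_dir) F \<nu> y
      + shift (\<lambda>\<nu>. dirderiv (base_dir i) (expo (pairop base_dir fibre_dir) F \<nu>)) \<nu> y"
proof -
  let ?A = "pairop base_dir fibre_dir"
  have "expo ?A (\<lambda>k y. snd y $ i * F k y) \<nu> y = snd y $ i * expo ?A F \<nu> y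
    + shift (expo ?A (\<lambda>k x. \<Sum>j\<in>UNIV. 0 * dirderiv (fibre_dir j) (F k) x + axis j 1 $ i * dirderiv (base_dir j) (F k) x)) \<nu> y"
    by (rule expo_pairop_mult[OF X _ _ _ F y])
      (auto simp: dirderiv_coordinate base_dir_def fibre_dir_def intro!: holo_nth holo_map_snd)
  also have "(\<lambda>k x. \<Sum>j\<in>UNIV. 0 * dirderiv (fibre_dir j) (F k) x + axis j 1 $ i * dirderiv (base_dir j) (F k) x)
      = (\<lambda>k. dirderiv (base_dir i) (F k))"
    by (simp add: fun_eq_iff axis_def if_distrib[of "\<lambda>c. c * _"] cong: if_cong)
  also have "shift (expo ?A (\<lambda>k. dirderiv (base_dir i) (F k))) \<nu> y
      = shift (\<lambda>\<nu>. dirderiv (base_dir i) (expo ?A F \<nu>)) \<nu> y"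
    by (cases \<nu>) (simp_all add: expo_dirderiv[OF X F y])
  finally show ?thesis .
qed

context
  fixes X :: "'n::finite pt set" and F :: "nat \<Rightarrow> 'n pt \<Rightarrow> complex"
  assumes X: "open X" and F: "\<And>k. holo (F k) X"
begin

lemma holo_antipode_series: "holo (\<lambda>y. F k (antipode y)) (antipode -` X)"
  by (rule holo_compose[OF F holo_map_antipode[OF holo_map_id]]) simp

lemma local_adj_cong:
  assumes "\<And>k y. y \<in> X \<Longrightarrow> F k y = G k y" "antipode y \<in> X"
  shows "local_adj F \<nu> y = local_adj G \<nu> y"
  unfolding local_adj_def
  by (rule hol_op.expo_cong[OF hol_op_pairop[OF open_antipode[OF X]] holo_antipode_series])
    (use assms in auto)

lemma local_adj_cmult:
  assumes "antipode y \<in> X"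
  shows "local_adj (\<lambda>k y. c * F k y) \<nu> y = c * local_adj F \<nu> y"
  unfolding local_adj_def
  by (rule hol_op.expo_cmult[OF hol_op_pairop[OF open_antipode[OF X]] holo_antipode_series]) (use assms in simp)

lemma local_adj_shift:
  assumes "antipode y \<in> X"
  shows "local_adj (shift F) \<nu> y = shift (local_adj F) \<nu> y"
proof -
  have "(\<lambda>k y. shift F k (antipode y)) = shift (\<lambda>k y. F k (antipode y))"
    by (auto simp: fun_eq_iff shift_def split: nat.splits)
  then show ?thesis
    unfolding local_adj_def
    using hol_op.expo_shift[OF hol_op_pairop[OF open_antipode[OF X]] holo_antipode_series] assms by simp
qed

text \<open>The product rule with a coordinate function: \<open>z\<^sub>i F\<close> is
  \<open>z\<^sub>i\<close> composed with \<open>F\<close>, so its adjoint is the adjoint of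
  \<open>F\<close> composed with \<open>z\<^sub>i\<close> on the right, and such a composition adds
  \<open>t\<close> times the derivative in \<open>\<zeta>\<^sub>i\<close>.\<close>

lemma local_adj_mult_fst:
  assumes "antipode y \<in> X"
  shows "local_adj (\<lambda>k y. fst y $ i * F k y) \<nu> y
    = fst y $ i * local_adj F \<nu> y + shift (\<lambda>\<nu>. dirderiv (fibre_dir i) (local_adj F \<nu>)) \<nu> y"
  using expo_mult_fst[OF open_antipode[OF X] holo_antipode_series, where y = y and i = i and \<nu> = \<nu>] assms
  by (simp add: local_adj_def)

text \<open>Here \<open>\<zeta>\<^sub>i F\<close> is \<open>F\<close> composed with
  \<open>\<zeta>\<^sub>i\<close>, whose adjoint is \<open>-\<zeta>\<^sub>i\<close>. The bracket is
  the composition of \<open>\<zeta>\<^sub>i\<close> with the adjoint of \<open>F\<close>.\<close>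

lemma local_adj_mult_snd:
  assumes "antipode y \<in> X"
  shows "local_adj (\<lambda>k y. snd y $ i * F k y) \<nu> y
    = - (snd y $ i * local_adj F \<nu> y + shift (\<lambda>\<nu>. dirderiv (base_dir i) (local_adj F \<nu>)) \<nu> y)"
proof -
  have "local_adj (\<lambda>k y. snd y $ i * F k y) \<nu> y
      = expo (pairop base_dir fibre_dir) (\<lambda>k y. - (snd y $ i * F k (antipode y))) \<nu> y"
    by (simp add: local_adj_def)
  also have "\<dots> = - expo (pairop base_dir fibre_dir) (\<lambda>k y. snd y $ i * F k (antipode y)) \<nu> y"
    by (rule hol_op.expo_minus[OF hol_op_pairop[OF open_antipode[OF X]]])
      (use assms in \<open>auto intro!: holo_mult holo_antipode_series holo_nth holo_map_snd\<close>)
  finally show ?thesis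
    using expo_mult_snd[OF open_antipode[OF X] holo_antipode_series, where y = y and i = i and \<nu> = \<nu>] assms
    by (simp add: local_adj_def)
qed

text \<open>The derivative commutes with the exponential; the sign comes from the reversal of the
  fibre variable.\<close>

lemma local_adj_dirderiv_fibre:
  assumes "antipode y \<in> X"
  shows "local_adj (\<lambda>k. dirderiv (fibre_dir i) (F k)) \<nu> y = - dirderiv (fibre_dir i) (local_adj F \<nu>) y"
proof -
  have op: "hol_op (antipode -` X) (pairop base_dir fibre_dir)" by (rule hol_op_pairop[OF open_antipode[OF X]])
  have h: "holo (dirderiv (fibre_dir i) (\<lambda>y. F k (antipode y))) (antipode -` X)" for k
    by (rule holo_dirderiv[OF holo_antipode_series open_antipode[OF X]])
  have eq: "- dirderiv (fibre_dir i) (\<lambda>y. F k (antipode y)) y = dirderiv (fibre_dir i) (F k) (antipode y)"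
    if "y \<in> antipode -` X" for k y
  proof -
    have "dirderiv (fibre_dir i) (\<lambda>y. F k (antipode y)) y = dirderiv (- fibre_dir i) (F k) (antipode y)"
      by (rule dirderiv_affine) (rule antipode_dirs)
    then show ?thesis using dirderiv_minus_dir[OF F] that by simp
  qed
  have "local_adj (\<lambda>k. dirderiv (fibre_dir i) (F k)) \<nu> y
      = expo (pairop base_dir fibre_dir) (\<lambda>k y. - dirderiv (fibre_dir i) (\<lambda>y. F k (antipode y)) y) \<nu> y"
    unfolding local_adj_def
    by (rule hol_op.expo_cong[OF op, symmetric]) (use assms eq in \<open>auto intro!: holo_minus h\<close>)
  also have "\<dots> = - expo (pairop base_dir fibre_dir) (\<lambda>k. dirderiv (fibre_dir i) (\<lambda>y. F k (antipode y))) \<nu> y"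
    by (rule hol_op.expo_minus[OF op h]) (use assms in simp)
  also have "expo (pairop base_dir fibre_dir) (\<lambda>k. dirderiv (fibre_dir i) (\<lambda>y. F k (antipode y))) \<nu> y
      = dirderiv (fibre_dir i) (local_adj F \<nu>) y"
    unfolding local_adj_def
    by (rule expo_dirderiv[OF open_antipode[OF X] holo_antipode_series]) (use assms in simp)
  finally show ?thesis .
qed

end

lemma local_adj_add:
  assumes "open X" "\<And>k. holo (F k) X" "\<And>k. holo (G k) X" "antipode y \<in> X"
  shows "local_adj (\<lambda>k y. F k y + G k y) \<nu> y = local_adj F \<nu> y + local_adj G \<nu> y"
  unfolding local_adj_def
  by (rule hol_op.expo_add[OF hol_op_pairop[OF open_antipode[OF assms(1)]]
      holo_antipode_series[OF assms(1,2)] holo_antipode_series[OF assms(1,3)]]) (use assms in simp)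

lemma local_adj_sum:
  assumes "open X" "finite I" "\<And>i k. i \<in> I \<Longrightarrow> holo (F i k) X" "antipode y \<in> X"
  shows "local_adj (\<lambda>k y. \<Sum>i\<in>I. F i k y) \<nu> y = (\<Sum>i\<in>I. local_adj (F i) \<nu> y)"
  unfolding local_adj_def
  by (rule hol_op.expo_sum[OF hol_op_pairop[OF open_antipode[OF assms(1)]] assms(2)
      holo_antipode_series[OF assms(1,3)]]) (use assms in auto)

text \<open>Each summand of the operator contains a fibre derivative, and since derivatives commute
  it may be taken first.\<close>

lemma local_adj_base:
  assumes "open X" "\<And>k. holo (F k) X" "\<And>k y. F k y = G k (fst y)" "antipode y \<in> X"
  shows "local_adj F \<nu> y = F \<nu> y"
proof -
  have eq: "F k (antipode y) = F k y" for k y by (simp add: assms(3))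
  have "local_adj F \<nu> y = F \<nu> (antipode y)"
    unfolding local_adj_def
  proof (rule hol_op.expo_annihilated[OF hol_op_pairop[OF open_antipode[OF assms(1)]]
        _ holo_antipode_series[OF assms(1,2)]])
    fix k x assume x: "x \<in> antipode -` X"
    note A = open_antipode[OF assms(1)] and h = holo_antipode_series[OF assms(1,2)]
    have "dirderiv (fibre_dir i) (\<lambda>y. F k (antipode y)) = (\<lambda>x. 0)" for i
      by (simp add: fun_eq_iff dirderiv_def assms(3) fibre_dir_def)
    moreover have "dirderiv (fibre_dir i) (dirderiv (base_dir i) (\<lambda>y. F k (antipode y))) x
        = dirderiv (base_dir i) (dirderiv (fibre_dir i) (\<lambda>y. F k (antipode y))) x" for i
      by (rule dirderiv_commute[OF h A x])
    ultimately show "pairop base_dir fibre_dir (\<lambda>y. F k (antipode y)) x = 0"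
      by (simp add: pairop_def)
  qed (use assms in simp)
  then show ?thesis by (simp add: eq)
qed

lemma vord_local_adj:
  assumes "\<And>k. vord (M - 2 * k) (F k) (antipode y)"
  shows "vord (M - 2 * \<nu>) (local_adj F \<nu>) y"
  unfolding local_adj_def
  by (rule vord_expo, rule vord_compose[OF assms holo_map_antipode[OF holo_map_id, of UNIV]]) auto

section \<open>Pull-back under a coordinate change\<close>

text \<open>The matrix \<open>J\<close> is not unique. The arguments use only its holomorphy and the
  difference identity on a neighbourhood \<open>N\<close> of the diagonal.\<close>

locale coord_pullback =
  fixes W U :: "(complex^'n::finite) set" and \<Phi> \<Psi> :: "complex^'n \<Rightarrow> complex^'n"
    and J :: "complex^'n \<Rightarrow> complex^'n \<Rightarrow> complex^'n^'n" and N :: "((complex^'n) \<times> (complex^'n)) set"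
  assumes open_W: "open W" and open_U: "open U"
    and Phi_in: "w \<in> W \<Longrightarrow> \<Phi> w \<in> U" and Psi_in: "z \<in> U \<Longrightarrow> \<Psi> z \<in> W"
    and Psi_Phi: "w \<in> W \<Longrightarrow> \<Psi> (\<Phi> w) = w" and Phi_Psi: "z \<in> U \<Longrightarrow> \<Phi> (\<Psi> z) = z"
    and holo_Phi: "holo_map \<Phi> W" and holo_Psi: "holo_map \<Psi> U"
    and open_N: "open N" and N_sub: "N \<subseteq> U \<times> U" and N_diag: "z \<in> U \<Longrightarrow> (z, z) \<in> N"
    and holo_J: "holo (\<lambda>p. J (fst p) (snd p) $ i $ j) N"
    and J_eq: "(z', z) \<in> N \<Longrightarrow> \<Psi> z' - \<Psi> z = J z' z *v (z' - z)"
begin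

text \<open>Points of the doubled space are \<open>((w, \<mu>), (z', \<zeta>'))\<close>. The pull-back map \<open>pm\<close> has components
  \<open>\<Phi> w\<close> and \<open>\<zeta>' + g\<close>, and \<open>v i j\<close> is \<open>\<partial>w\<^sub>j / \<partial>z\<^sub>i\<close> as a function of \<open>w\<close>.\<close>

definition WW :: "'n pt set" where "WW = {y. fst y \<in> W}"

definition shifted :: "'n pt \<times> 'n pt \<Rightarrow> complex^'n" where
  "shifted x = \<Phi> (fst (fst x)) + fst (snd x)"

definition Y :: "('n pt \<times> 'n pt) set" where
  "Y = {x. fst (fst x) \<in> W \<and> (shifted x, \<Phi> (fst (fst x))) \<in> N}"

definition Jx :: "'n \<Rightarrow> 'n \<Rightarrow> 'n pt \<times> 'n pt \<Rightarrow> complex" where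
  "Jx j i x = J (shifted x) (\<Phi> (fst (fst x))) $ j $ i"

definition g :: "'n \<Rightarrow> 'n pt \<times> 'n pt \<Rightarrow> complex" where
  "g i x = (\<Sum>j\<in>UNIV. Jx j i x * snd (fst x) $ j)"

definition dPsi :: "'n \<Rightarrow> 'n \<Rightarrow> complex^'n \<Rightarrow> complex" where
  "dPsi i j z = dirderiv (axis i 1) (\<lambda>z. \<Psi> z $ j) z"

definition dPhi :: "'n \<Rightarrow> 'n \<Rightarrow> complex^'n \<Rightarrow> complex" where
  "dPhi j k w = dirderiv (axis j 1) (\<lambda>w. \<Phi> w $ k) w"

definition v :: "'n \<Rightarrow> 'n \<Rightarrow> complex^'n \<Rightarrow> complex" where
  "v i j w = dPsi i j (\<Phi> w)"

definition E :: "(nat \<Rightarrow> 'n pt \<times> 'n pt \<Rightarrow> complex) \<Rightarrow> nat \<Rightarrow> 'n pt \<Rightarrow> complex" where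
  "E H \<nu> y = expo (pairop base_dir2 fibre_dir2) H \<nu> (y, 0)"

abbreviation pm :: "'n pt \<times> 'n pt \<Rightarrow> 'n pt" where "pm \<equiv> pull_map \<Phi> J"

lemma dir_simps [simp]:
  "fst (base_dir i) = axis i 1" "snd (base_dir i) = 0" "fst (fibre_dir i) = 0" "snd (fibre_dir i) = axis i 1"
  by (simp_all add: base_dir_def fibre_dir_def)

lemma axis_nth: "axis i (1::complex) $ j = (if j = i then 1 else 0)"
  by (simp add: axis_def)

lemma fst_pm: "fst (pm x) = \<Phi> (fst (fst x))"
  by (simp add: pull_map_def)

lemma snd_pm: "snd (pm x) $ i = snd (snd x) $ i + g i x"
  by (simp add: pull_map_def g_def Jx_def shifted_def matrix_vector_mult_def transpose_def)

lemma open_WW: "open WW"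
proof -
  have "WW = fst -` W" by (auto simp: WW_def)
  then show ?thesis using open_vimage_fst[OF open_W] by simp
qed

lemma holo_Phi_comp: "holo_map (\<lambda>x. \<Phi> (fst (fst x))) {x. fst (fst x) \<in> W}"
  by (rule holo_map_compose[OF holo_Phi]) (intro holo_map_intros, simp)

lemma open_Y: "open Y"
proof -
  let ?A = "{x :: 'n pt \<times> 'n pt. fst (fst x) \<in> W}"
  have "?A = (\<lambda>x. fst (fst x)) -` W" by auto
  then have A: "open ?A" using open_vimage[OF open_W, of "\<lambda>x. fst (fst x)"] by (simp add: continuous_on_fst continuous_on_id)
  have "holo_map (\<lambda>x. (shifted x, \<Phi> (fst (fst x)))) ?A"
    unfolding shifted_def by (intro holo_map_intros holo_Phi_comp)
  from continuous_open_preimage[OF holo_map_continuous_on[OF this] A open_N]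
  show ?thesis by (simp add: Y_def Int_def vimage_def conj_commute)
qed

lemma Y_base: "y \<in> WW \<Longrightarrow> (y, 0) \<in> Y"
  by (simp add: WW_def Y_def shifted_def N_diag Phi_in)

lemma Y_D:
  assumes "x \<in> Y"
  shows "fst (fst x) \<in> W" "shifted x \<in> U" "\<Phi> (fst (fst x)) \<in> U" "(shifted x, \<Phi> (fst (fst x))) \<in> N"
  using assms N_sub by (auto simp: Y_def)

lemma holo_map_Phi_Y: "holo_map (\<lambda>x. \<Phi> (fst (fst x))) Y"
  by (rule holo_map_subset[OF holo_Phi_comp]) (auto simp: Y_def)

lemma holo_map_shifted: "holo_map shifted Y"
  unfolding shifted_def[abs_def] by (intro holo_map_intros holo_map_Phi_Y)

lemma holo_Jx: "holo (Jx j i) Y"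
proof -
  have "holo (\<lambda>x. J (fst (shifted x, \<Phi> (fst (fst x)))) (snd (shifted x, \<Phi> (fst (fst x)))) $ j $ i) Y"
    by (rule holo_compose[OF holo_J, of "\<lambda>x. (shifted x, \<Phi> (fst (fst x)))"])
      (auto intro!: holo_map_Pair holo_map_shifted holo_map_Phi_Y simp: Y_D(4))
  then show ?thesis by (simp add: Jx_def[abs_def])
qed

lemma holo_mu: "holo (\<lambda>x. snd (fst x) $ j) X"
  and holo_w: "holo (\<lambda>x. fst (fst x) $ j) X"
  and holo_z': "holo (\<lambda>x. fst (snd x) $ j) X"
  and holo_zeta': "holo (\<lambda>x. snd (snd x) $ j) X"
  by (intro holo_nth holo_map_intros)+

lemma holo_g: "holo (g i) Y"
  unfolding g_def[abs_def] by (intro holo_sum holo_mult holo_Jx holo_mu)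

lemma holo_Psi_nth: "holo (\<lambda>z. \<Psi> z $ j) U"
  by (rule holo_nth[OF holo_Psi])

lemma holo_Phi_nth: "holo (\<lambda>w. \<Phi> w $ j) W"
  by (rule holo_nth[OF holo_Phi])

lemma holo_dPsi: "holo (dPsi i j) U"
  unfolding dPsi_def[abs_def] by (rule holo_dirderiv[OF holo_Psi_nth open_U])

lemma holo_dPhi: "holo (dPhi i j) W"
  unfolding dPhi_def[abs_def] by (rule holo_dirderiv[OF holo_Phi_nth open_W])

lemma holo_v: "holo (v i j) W"
  unfolding v_def[abs_def] by (rule holo_compose[OF holo_dPsi holo_Phi Phi_in])

lemma holo_v_Y: "holo (\<lambda>x. v i j (fst (fst x))) Y"
  by (rule holo_compose[OF holo_v]) (auto intro!: holo_map_intros simp: Y_D)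

lemma holo_Psi_shifted: "holo (\<lambda>x. \<Psi> (shifted x) $ j) Y"
  by (rule holo_compose[OF holo_Psi_nth holo_map_shifted]) (rule Y_D(2))

lemma holo_map_pm: "holo_map pm Y"
proof -
  have "holo_map (\<lambda>x. snd (pm x)) Y"
    by (rule holo_map_vec) (simp only: snd_pm, intro holo_add holo_zeta' holo_g)
  then have "holo_map (\<lambda>x. (fst (pm x), snd (pm x))) Y"
    by (intro holo_map_Pair) (simp_all add: fst_pm holo_map_Phi_Y)
  then show ?thesis by simp
qed

section \<open>The difference identity and its derivatives\<close>

lemma dPsi_dPhi:
  assumes w: "w \<in> W"
  shows "(\<Sum>j\<in>UNIV. v i j w * dPhi j k w) = (if i = k then 1 else 0)"
proof -
  have z: "\<Phi> w \<in> U" by (rule Phi_in[OF w])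
  have "(\<Sum>j\<in>UNIV. v i j w * dPhi j k w) = dirderiv (axis i 1) (\<lambda>z. \<Phi> (\<Psi> z) $ k) (\<Phi> w)"
    using chain_rule_vec[OF holo_Psi_nth z holo_Phi_nth, of "axis i 1" k] w
    by (simp add: v_def dPsi_def dPhi_def Psi_Phi)
  also have "\<dots> = dirderiv (axis i 1) (\<lambda>z. z $ k) (\<Phi> w)"
    by (rule dirderiv_cong[OF open_U z]) (simp add: Phi_Psi)
  finally show ?thesis by (simp add: dirderiv_vec_coordinate axis_def)
qed

lemma dPhi_dPsi:
  assumes w: "w \<in> W"
  shows "(\<Sum>k\<in>UNIV. dPhi j k w * v k l w) = (if j = l then 1 else 0)"
proof -
  have "(\<Sum>k\<in>UNIV. dPhi j k w * v k l w) = dirderiv (axis j 1) (\<lambda>w. \<Psi> (\<Phi> w) $ l) w"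
    using chain_rule_vec[OF holo_Phi_nth w holo_Psi_nth Phi_in[OF w], of "axis j 1" l]
    by (simp add: v_def dPsi_def dPhi_def)
  also have "\<dots> = dirderiv (axis j 1) (\<lambda>w. w $ l) w"
    by (rule dirderiv_cong[OF open_W w]) (simp add: Psi_Phi)
  finally show ?thesis by (simp add: dirderiv_vec_coordinate axis_def)
qed

lemma dirderiv_coords2:
  "dirderiv u (\<lambda>x. fst (fst x) $ j) x = fst (fst u) $ j"
  "dirderiv u (\<lambda>x. snd (fst x) $ j) x = snd (fst u) $ j"
  "dirderiv u (\<lambda>x. fst (snd x) $ j) x = fst (snd u) $ j"
  "dirderiv u (\<lambda>x. snd (snd x) $ j) x = snd (snd u) $ j"
  for u x :: "'n pt \<times> 'n pt"
  by (rule dirderiv_linear;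
      auto intro!: bounded_linear_compose[OF bounded_linear_vec_nth]
        bounded_linear_compose[OF bounded_linear_fst] bounded_linear_compose[OF bounded_linear_snd]
        bounded_linear_fst bounded_linear_snd)+

lemma difference_identity:
  assumes "x \<in> Y"
  shows "(\<Sum>l\<in>UNIV. fst (snd x) $ l * Jx j l x) = \<Psi> (shifted x) $ j - fst (fst x) $ j"
proof -
  have "\<Psi> (shifted x) - \<Psi> (\<Phi> (fst (fst x))) = J (shifted x) (\<Phi> (fst (fst x))) *v (shifted x - \<Phi> (fst (fst x)))"
    by (rule J_eq[OF Y_D(4)[OF assms]])
  then have "(\<Psi> (shifted x) - fst (fst x)) $ j = (J (shifted x) (\<Phi> (fst (fst x))) *v fst (snd x)) $ j"
    using Psi_Phi[OF Y_D(1)[OF assms]] by (simp add: shifted_def)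
  then show ?thesis by (simp add: matrix_vector_mult_def Jx_def mult.commute)
qed

text \<open>Contraction with \<open>z'\<close> removes the choice of \<open>J\<close>: what remains
  is the phase \<open>\<langle>\<mu>, \<Psi> (\<Phi> w + z') - w\<rangle>\<close>. Its derivatives
  supply the identities for \<open>g\<close> needed below.\<close>

lemma difference_identity_mu:
  assumes x: "x \<in> Y"
  shows "(\<Sum>l\<in>UNIV. fst (snd x) $ l * g l x)
    = (\<Sum>j\<in>UNIV. snd (fst x) $ j * (\<Psi> (shifted x) $ j - fst (fst x) $ j))"
proof -
  have "(\<Sum>l\<in>UNIV. fst (snd x) $ l * g l x)
      = (\<Sum>l\<in>UNIV. \<Sum>j\<in>UNIV. snd (fst x) $ j * (fst (snd x) $ l * Jx j l x))"
    by (simp add: g_def sum_distrib_left mult_ac)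
  also have "\<dots> = (\<Sum>j\<in>UNIV. snd (fst x) $ j * (\<Sum>l\<in>UNIV. fst (snd x) $ l * Jx j l x))"
    by (subst sum.swap) (simp add: sum_distrib_left)
  finally show ?thesis by (simp add: difference_identity[OF x])
qed

lemma dirderiv_difference_identity_mu:
  assumes x: "x \<in> Y" and u: "snd (fst u) = 0"
  shows "(\<Sum>l\<in>UNIV. fst (snd x) $ l * dirderiv u (g l) x + fst (snd u) $ l * g l x)
    = (\<Sum>j\<in>UNIV. snd (fst x) $ j * (dirderiv u (\<lambda>x. \<Psi> (shifted x) $ j) x - fst (fst u) $ j))"
proof -
  have "dirderiv u (\<lambda>x. \<Sum>l\<in>UNIV. fst (snd x) $ l * g l x) x
     = dirderiv u (\<lambda>x. \<Sum>j\<in>UNIV. snd (fst x) $ j * (\<Psi> (shifted x) $ j - fst (fst x) $ j)) x"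
    by (rule dirderiv_cong[OF open_Y x difference_identity_mu])
  moreover have "dirderiv u (\<lambda>x. \<Sum>l\<in>UNIV. fst (snd x) $ l * g l x) x
      = (\<Sum>l\<in>UNIV. dirderiv u (\<lambda>x. fst (snd x) $ l * g l x) x)"
    by (rule dirderiv_sum[OF _ x]) (intro holo_mult holo_z' holo_g)
  moreover have "dirderiv u (\<lambda>x. fst (snd x) $ l * g l x) x
      = fst (snd x) $ l * dirderiv u (g l) x + fst (snd u) $ l * g l x" for l
    by (simp add: dirderiv_mult[OF holo_z' holo_g x] dirderiv_coords2)
  moreover have "dirderiv u (\<lambda>x. \<Sum>j\<in>UNIV. snd (fst x) $ j * (\<Psi> (shifted x) $ j - fst (fst x) $ j)) x
      = (\<Sum>j\<in>UNIV. dirderiv u (\<lambda>x. snd (fst x) $ j * (\<Psi> (shifted x) $ j - fst (fst x) $ j)) x)"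
    by (rule dirderiv_sum[OF _ x]) (intro holo_mult holo_diff holo_mu holo_w holo_Psi_shifted)
  moreover have "dirderiv u (\<lambda>x. snd (fst x) $ j * (\<Psi> (shifted x) $ j - fst (fst x) $ j)) x
      = snd (fst x) $ j * (dirderiv u (\<lambda>x. \<Psi> (shifted x) $ j) x - fst (fst u) $ j)" for j
    by (simp add: dirderiv_mult[OF holo_mu holo_diff[OF holo_Psi_shifted holo_w] x]
        dirderiv_diff[OF holo_Psi_shifted holo_w x] dirderiv_coords2 u)
  ultimately show ?thesis by simp
qed

lemma dirderiv_z'_Psi_shifted:
  "dirderiv (0, base_dir i) (\<lambda>x. \<Psi> (shifted x) $ j) x = dPsi i j (shifted x)"
  unfolding dPsi_def by (rule dirderiv_affine) (simp add: shifted_def base_dir_def)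

text \<open>The vector field with coefficients \<open>v i a\<close> is the derivative in
  \<open>z\<^sub>i\<close> for \<open>z = \<Phi> w\<close>. On functions of
  \<open>\<Phi> w + z'\<close> alone it agrees with the derivative in
  \<open>z'\<^sub>i\<close>.\<close>

lemma dirderiv_w_Psi_shifted:
  assumes x: "x \<in> Y"
  shows "(\<Sum>a\<in>UNIV. v i a (fst (fst x)) * dirderiv (base_dir a, 0) (\<lambda>x. \<Psi> (shifted x) $ j) x) = dPsi i j (shifted x)"
proof -
  note w = Y_D(1)[OF x]
  have hs: "holo (\<lambda>x. shifted x $ k) Y" for k by (rule holo_nth[OF holo_map_shifted])
  have hP: "holo (\<lambda>x. \<Phi> (fst (fst x)) $ k) Y" for k by (rule holo_nth[OF holo_map_Phi_Y])
  have dP: "dirderiv (base_dir a, 0) (\<lambda>x. \<Phi> (fst (fst x)) $ k) x = dPhi a k (fst (fst x))" for a k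
    unfolding dPhi_def by (rule dirderiv_affine) (simp add: base_dir_def)
  have d: "dirderiv (base_dir a, 0) (\<lambda>x. shifted x $ k) x = dPhi a k (fst (fst x))" for a k
    by (simp add: shifted_def dirderiv_add[OF hP holo_z' x] dP dirderiv_coords2)
  have "dirderiv (base_dir a, 0) (\<lambda>x. \<Psi> (shifted x) $ j) x
      = (\<Sum>k\<in>UNIV. dPhi a k (fst (fst x)) * dPsi k j (shifted x))" for a
    using chain_rule_vec[OF hs x holo_Psi_nth Y_D(2)[OF x], of "(base_dir a, 0)" j]
    by (simp add: d dPsi_def)
  then have "(\<Sum>a\<in>UNIV. v i a (fst (fst x)) * dirderiv (base_dir a, 0) (\<lambda>x. \<Psi> (shifted x) $ j) x)
      = (\<Sum>a\<in>UNIV. \<Sum>k\<in>UNIV. (v i a (fst (fst x)) * dPhi a k (fst (fst x))) * dPsi k j (shifted x))"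
    by (simp add: sum_distrib_left mult.assoc)
  also have "\<dots> = (\<Sum>k\<in>UNIV. (\<Sum>a\<in>UNIV. v i a (fst (fst x)) * dPhi a k (fst (fst x))) * dPsi k j (shifted x))"
    by (subst sum.swap) (simp add: sum_distrib_right)
  also have "\<dots> = dPsi i j (shifted x)"
    by (simp add: dPsi_dPhi[OF w] if_distrib[of "\<lambda>c. c * _"] cong: if_cong)
  finally show ?thesis .
qed

text \<open>The derivatives in \<open>z\<^sub>i\<close>, taken through \<open>w\<close>, and in
  \<open>z'\<^sub>i\<close> agree on functions of \<open>\<Phi> w + z'\<close>;
  \<open>Kx i l\<close> measures their difference on \<open>g l\<close>, in which \<open>J\<close>
  and \<open>\<mu>\<close> occur separately.\<close>

definition Kx :: "'n \<Rightarrow> 'n \<Rightarrow> 'n pt \<times> 'n pt \<Rightarrow> complex" where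
  "Kx i l x = (\<Sum>a\<in>UNIV. v i a (fst (fst x)) * dirderiv (base_dir a, 0) (g l) x) - dirderiv (0, base_dir i) (g l) x"

lemma holo_Kx: "holo (Kx i l) Y"
  unfolding Kx_def[abs_def]
  by (intro holo_diff holo_sum holo_mult holo_v_Y holo_dirderiv[OF holo_g open_Y])

text \<open>The derivative of the phase identity in the direction \<open>z'\<^sub>i\<close>; on its
  left side the product rule also hits the factor \<open>z'\<^sub>i\<close> and so isolates
  \<open>g i\<close>.\<close>

lemma g_identity_z':
  assumes x: "x \<in> Y"
  shows "g i x + (\<Sum>l\<in>UNIV. fst (snd x) $ l * dirderiv (0, base_dir i) (g l) x)
    = (\<Sum>j\<in>UNIV. snd (fst x) $ j * dPsi i j (shifted x))"
proof -
  have "(\<Sum>l\<in>UNIV. (axis i 1 :: complex^'n) $ l * g l x) = g i x"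
    by (simp add: axis_nth if_distrib[of "\<lambda>c. c * _"] cong: if_cong)
  then show ?thesis
    using dirderiv_difference_identity_mu[OF x, of "(0, base_dir i)"]
    by (simp add: sum.distrib dirderiv_z'_Psi_shifted add.commute)
qed

text \<open>The phase identity is differentiated through \<open>w\<close> and in \<open>z'\<close>,
  and the two results are subtracted, so that the derivatives of \<open>\<Psi>\<close> at the
  shifted point cancel. What is left of \<open>g i\<close> is its value at \<open>z' = 0\<close>
  plus terms with an explicit factor \<open>z'\<^sub>l\<close>, which the restricted exponential can
  process.\<close>

lemma g_expansion:
  assumes x: "x \<in> Y"
  shows "g i x = (\<Sum>j\<in>UNIV. snd (fst x) $ j * v i j (fst (fst x))) + (\<Sum>l\<in>UNIV. fst (snd x) $ l * Kx i l x)"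
proof -
  let ?w = "fst (fst x)"
  have "(\<Sum>l\<in>UNIV. fst (snd x) $ l * dirderiv (base_dir a, 0) (g l) x)
      = (\<Sum>j\<in>UNIV. snd (fst x) $ j * (dirderiv (base_dir a, 0) (\<lambda>x. \<Psi> (shifted x) $ j) x - axis a 1 $ j))" for a
    using dirderiv_difference_identity_mu[OF x, of "(base_dir a, 0)"] by simp
  then have "(\<Sum>a\<in>UNIV. v i a ?w * (\<Sum>l\<in>UNIV. fst (snd x) $ l * dirderiv (base_dir a, 0) (g l) x))
      = (\<Sum>a\<in>UNIV. \<Sum>j\<in>UNIV. snd (fst x) $ j *
          (v i a ?w * dirderiv (base_dir a, 0) (\<lambda>x. \<Psi> (shifted x) $ j) x - v i a ?w * axis a 1 $ j))"
    by (simp add: sum_distrib_left algebra_simps)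
  also have "\<dots> = (\<Sum>j\<in>UNIV. snd (fst x) $ j *
      ((\<Sum>a\<in>UNIV. v i a ?w * dirderiv (base_dir a, 0) (\<lambda>x. \<Psi> (shifted x) $ j) x) - (\<Sum>a\<in>UNIV. v i a ?w * axis a 1 $ j)))"
    by (subst sum.swap) (simp add: sum_distrib_left[symmetric] sum_subtractf)
  also have "\<dots> = (\<Sum>j\<in>UNIV. snd (fst x) $ j * (dPsi i j (shifted x) - v i j ?w))"
    by (simp add: dirderiv_w_Psi_shifted[OF x] axis_def if_distrib[of "(*) _"] cong: if_cong)
  finally have 1: "(\<Sum>a\<in>UNIV. v i a ?w * (\<Sum>l\<in>UNIV. fst (snd x) $ l * dirderiv (base_dir a, 0) (g l) x))
      = (\<Sum>j\<in>UNIV. snd (fst x) $ j * dPsi i j (shifted x)) - (\<Sum>j\<in>UNIV. snd (fst x) $ j * v i j ?w)"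
    by (simp add: right_diff_distrib sum_subtractf)
  have "(\<Sum>a\<in>UNIV. v i a ?w * (\<Sum>l\<in>UNIV. fst (snd x) $ l * dirderiv (base_dir a, 0) (g l) x))
      = (\<Sum>l\<in>UNIV. fst (snd x) $ l * (\<Sum>a\<in>UNIV. v i a ?w * dirderiv (base_dir a, 0) (g l) x))"
    unfolding sum_distrib_left by (subst sum.swap) (simp add: mult_ac)
  then have "(\<Sum>l\<in>UNIV. fst (snd x) $ l * Kx i l x)
      = (\<Sum>a\<in>UNIV. v i a ?w * (\<Sum>l\<in>UNIV. fst (snd x) $ l * dirderiv (base_dir a, 0) (g l) x))
        - (\<Sum>l\<in>UNIV. fst (snd x) $ l * dirderiv (0, base_dir i) (g l) x)"
    by (simp add: Kx_def right_diff_distrib sum_subtractf)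
  \<comment> \<open>\<open>p\<close> is the term with the derivatives of \<open>\<Psi>\<close> at
    the shifted point, common to both identities; it is eliminated.\<close>
  moreover have "a = q + k" if "s = p - q" "a + t = p" "k = s - t" for a q k s p t :: complex
    using that by algebra
  ultimately show ?thesis using 1 g_identity_z'[OF x, of i] by blast
qed

lemma fibre_invariant_g: "g i (x + s *\<^sub>C (0, fibre_dir j)) = g i x"
  by (simp add: g_def Jx_def shifted_def fibre_dir_def)

lemma dirderiv_zeta'_g: "dirderiv (0, fibre_dir j) (g i) x = 0"
  by (simp add: dirderiv_def fibre_invariant_g del: scaleC_Pair)

lemma dirderiv_zeta'_dirderiv_g:
  assumes "x \<in> Y"
  shows "dirderiv (0, fibre_dir j) (dirderiv u (g i)) x = 0"
proof -
  have "dirderiv (0, fibre_dir j) (g i) = (\<lambda>x. 0)" by (simp add: fun_eq_iff dirderiv_zeta'_g)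
  then show ?thesis
    using dirderiv_commute[OF holo_g open_Y assms, of "(0, fibre_dir j)" u i] by simp
qed

lemma dirderiv_zeta'_Jx: "dirderiv (0, fibre_dir j) (Jx a b) x = 0"
  by (simp add: dirderiv_def Jx_def shifted_def fibre_dir_def)

lemma dirderiv_zeta'_Kx:
  assumes x: "x \<in> Y"
  shows "dirderiv (0, fibre_dir j) (Kx i l) x = 0"
proof -
  note hd = holo_dirderiv[OF holo_g open_Y]
  have dv: "dirderiv (0, fibre_dir j) (\<lambda>x. v i a (fst (fst x))) x = 0" for a
    by (simp add: dirderiv_def)
  have "dirderiv (0, fibre_dir j) (\<lambda>x. v i a (fst (fst x)) * dirderiv (base_dir a, 0) (g l) x) x = 0" for a
    by (simp add: dirderiv_mult[OF holo_v_Y hd x] dv dirderiv_zeta'_dirderiv_g[OF x])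
  then have "dirderiv (0, fibre_dir j) (\<lambda>x. \<Sum>a\<in>UNIV. v i a (fst (fst x)) * dirderiv (base_dir a, 0) (g l) x) x = 0"
    by (simp add: dirderiv_sum[OF holo_mult[OF holo_v_Y hd] x])
  then show ?thesis
    unfolding Kx_def[abs_def]
    by (simp add: dirderiv_diff[OF holo_sum[OF holo_mult[OF holo_v_Y hd]] hd x] dirderiv_zeta'_dirderiv_g[OF x])
qed

lemma dirderiv_mu_g:
  assumes x: "x \<in> Y"
  shows "dirderiv (fibre_dir j, 0) (g l) x = Jx j l x"
proof -
  have dJ: "dirderiv (fibre_dir j, 0) (Jx a l) x = 0" for a
    by (simp add: dirderiv_def Jx_def shifted_def fibre_dir_def)
  have "dirderiv (fibre_dir j, 0) (\<lambda>x. Jx a l x * snd (fst x) $ a) x = Jx a l x * axis j 1 $ a" for a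
    by (simp add: dirderiv_mult[OF holo_Jx holo_mu x] dJ dirderiv_coords2)
  then show ?thesis
    unfolding g_def[abs_def]
    by (simp add: dirderiv_sum[OF holo_mult[OF holo_Jx holo_mu] x] axis_nth if_distrib[of "(*) _"] cong: if_cong)
qed

section \<open>Chain rule through the pull-back map\<close>

context
  fixes R :: "'n pt \<Rightarrow> complex" and T :: "'n pt set"
  assumes R: "holo R T"
begin

lemma dirderiv_pm:
  assumes x: "x \<in> Y" and T: "pm x \<in> T"
  shows "dirderiv u (\<lambda>x. R (pm x)) x
    = (\<Sum>l\<in>UNIV. dirderiv u (\<lambda>x. \<Phi> (fst (fst x)) $ l) x * dirderiv (base_dir l) R (pm x))
      + (\<Sum>l\<in>UNIV. (snd (snd u) $ l + dirderiv u (g l) x) * dirderiv (fibre_dir l) R (pm x))"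
proof -
  have 1: "holo (\<lambda>x. fst (pm x) $ l) Y" "holo (\<lambda>x. snd (pm x) $ l) Y" for l
    by (intro holo_nth holo_map_fst holo_map_snd holo_map_pm)+
  have 2: "dirderiv u (\<lambda>x. snd (pm x) $ l) x = snd (snd u) $ l + dirderiv u (g l) x" for l
    by (simp add: snd_pm dirderiv_add[OF holo_zeta' holo_g x] dirderiv_coords2)
  show ?thesis
    using chain_rule_pt[where h = pm, OF 1 x R T, of u] by (simp add: 2 fst_pm)
qed

lemma dirderiv_pm_zeta':
  assumes x: "x \<in> Y" "pm x \<in> T"
  shows "dirderiv (0, fibre_dir j) (\<lambda>x. R (pm x)) x = dirderiv (fibre_dir j) R (pm x)"
proof -
  have "dirderiv (0, fibre_dir j) (\<lambda>x. \<Phi> (fst (fst x)) $ l) x = 0" for l by (simp add: dirderiv_def)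
  then show ?thesis
    by (simp add: dirderiv_pm[OF x] dirderiv_zeta'_g axis_nth
        if_distrib[of "\<lambda>c. c * _"] cong: if_cong)
qed

lemma dirderiv_pm_z':
  assumes x: "x \<in> Y" "pm x \<in> T"
  shows "dirderiv (0, base_dir j) (\<lambda>x. R (pm x)) x
    = (\<Sum>l\<in>UNIV. dirderiv (0, base_dir j) (g l) x * dirderiv (fibre_dir l) R (pm x))"
proof -
  have "dirderiv (0, base_dir j) (\<lambda>x. \<Phi> (fst (fst x)) $ l) x = 0" for l by (simp add: dirderiv_def)
  moreover have "snd (base_dir j :: 'n pt) = 0" by (simp add: base_dir_def)
  ultimately show ?thesis by (simp add: dirderiv_pm[OF x])
qed

lemma dirderiv_pm_mu:
  assumes x: "x \<in> Y" "pm x \<in> T"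
  shows "dirderiv (fibre_dir j, 0) (\<lambda>x. R (pm x)) x = (\<Sum>l\<in>UNIV. Jx j l x * dirderiv (fibre_dir l) R (pm x))"
proof -
  have "dirderiv (fibre_dir j, 0) (\<lambda>x. \<Phi> (fst (fst x)) $ l) x = 0" for l
    by (simp add: dirderiv_def fibre_dir_def)
  then show ?thesis by (simp add: dirderiv_pm[OF x] dirderiv_mu_g[OF x(1)])
qed

text \<open>The contraction of \<open>v\<close> with the Jacobian matrix is the identity, so the
  base part reduces to the single derivative in \<open>z\<^sub>i\<close>; the rest comes from the
  dependence of \<open>g\<close> on \<open>w\<close>.\<close>

lemma dirderiv_pm_w:
  assumes x: "x \<in> Y" "pm x \<in> T"
  shows "(\<Sum>a\<in>UNIV. v i a (fst (fst x)) * dirderiv (base_dir a, 0) (\<lambda>x. R (pm x)) x)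
    = dirderiv (base_dir i) R (pm x)
      + (\<Sum>l\<in>UNIV. (\<Sum>a\<in>UNIV. v i a (fst (fst x)) * dirderiv (base_dir a, 0) (g l) x) * dirderiv (fibre_dir l) R (pm x))"
proof -
  let ?w = "fst (fst x)"
  have dP: "dirderiv (base_dir a, 0) (\<lambda>x. \<Phi> (fst (fst x)) $ k) x = dPhi a k ?w" for a k
    unfolding dPhi_def by (rule dirderiv_affine) (simp add: base_dir_def)
  have "(\<Sum>a\<in>UNIV. v i a ?w * dirderiv (base_dir a, 0) (\<lambda>x. R (pm x)) x)
    = (\<Sum>a\<in>UNIV. \<Sum>l\<in>UNIV. (v i a ?w * dPhi a l ?w) * dirderiv (base_dir l) R (pm x))
      + (\<Sum>a\<in>UNIV. \<Sum>l\<in>UNIV. (v i a ?w * dirderiv (base_dir a, 0) (g l) x) * dirderiv (fibre_dir l) R (pm x))"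
    by (simp add: dirderiv_pm[OF x] dP distrib_left sum.distrib sum_distrib_left mult.assoc)
  also have "(\<Sum>a\<in>UNIV. \<Sum>l\<in>UNIV. (v i a ?w * dPhi a l ?w) * dirderiv (base_dir l) R (pm x))
      = (\<Sum>l\<in>UNIV. (\<Sum>a\<in>UNIV. v i a ?w * dPhi a l ?w) * dirderiv (base_dir l) R (pm x))"
    by (subst sum.swap) (simp add: sum_distrib_right)
  also have "\<dots> = dirderiv (base_dir i) R (pm x)"
    by (simp add: dPsi_dPhi[OF Y_D(1)[OF x(1)]] if_distrib[of "\<lambda>c. c * _"] cong: if_cong)
  also have "(\<Sum>a\<in>UNIV. \<Sum>l\<in>UNIV. (v i a ?w * dirderiv (base_dir a, 0) (g l) x) * dirderiv (fibre_dir l) R (pm x))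
      = (\<Sum>l\<in>UNIV. (\<Sum>a\<in>UNIV. v i a ?w * dirderiv (base_dir a, 0) (g l) x) * dirderiv (fibre_dir l) R (pm x))"
    by (subst sum.swap) (simp add: sum_distrib_right)
  finally show ?thesis .
qed

end

end

section \<open>Calculus of the exponential restricted to zero auxiliary variables\<close>

context coord_pullback
begin

lemma op_E: "hol_op Y (pairop base_dir2 fibre_dir2)"
  by (rule hol_op_pairop[OF open_Y])

lemma local_pull_eq_E: "local_pull \<Phi> J F \<nu> y = E (\<lambda>k x. F k (pm x)) \<nu> y"
  by (simp add: local_pull_def E_def)

lemma holo_pm: "holo f UNIV \<Longrightarrow> holo (\<lambda>x. f (pm x)) Y"
  by (rule holo_compose[OF _ holo_map_pm]) auto

context
  fixes H :: "nat \<Rightarrow> 'n pt \<times> 'n pt \<Rightarrow> complex"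
  assumes H: "\<And>k. holo (H k) Y"
begin

lemma E_holo: "holo (E H \<nu>) WW"
  unfolding E_def[abs_def]
  by (rule holo_compose[OF hol_op.expo_holo[OF op_E H]]) (auto intro!: holo_map_Pair Y_base)

lemma E_cong:
  assumes "y \<in> WW" "\<And>k x. x \<in> Y \<Longrightarrow> H k x = H' k x"
  shows "E H \<nu> y = E H' \<nu> y"
  unfolding E_def by (rule hol_op.expo_cong[OF op_E H assms(2) Y_base[OF assms(1)]])

lemma E_shift: "y \<in> WW \<Longrightarrow> E (shift H) \<nu> y = shift (E H) \<nu> y"
  using hol_op.expo_shift[OF op_E H Y_base, where \<nu> = \<nu>]
  by (cases \<nu>) (simp_all add: E_def)

lemma E_cmult: "y \<in> WW \<Longrightarrow> E (\<lambda>k x. c * H k x) \<nu> y = c * E H \<nu> y"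
  unfolding E_def by (rule hol_op.expo_cmult[OF op_E H Y_base])

lemma E_minus: "y \<in> WW \<Longrightarrow> E (\<lambda>k x. - H k x) \<nu> y = - E H \<nu> y"
  unfolding E_def by (rule hol_op.expo_minus[OF op_E H Y_base])

text \<open>At the point of restriction \<open>z'\<^sub>i\<close> is 0, so only the commutator
  survives: a factor \<open>z'\<^sub>i\<close> becomes \<open>t\<close> times the derivative in
  \<open>\<zeta>'\<^sub>i\<close>. Read backwards, the rule trades a fibre derivative for a
  factor.\<close>

lemma E_mult_z':
  assumes y: "y \<in> WW"
  shows "E (\<lambda>k x. fst (snd x) $ i * H k x) \<nu> y = shift (E (\<lambda>k. dirderiv (0, fibre_dir i) (H k))) \<nu> y"
proof -
  let ?A = "pairop base_dir2 fibre_dir2"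
  have "expo ?A (\<lambda>k x. fst (snd x) $ i * H k x) \<nu> (y, 0) = fst (snd (y, 0 :: 'n pt)) $ i * expo ?A H \<nu> (y, 0)
    + shift (expo ?A (\<lambda>k x. \<Sum>j\<in>UNIV. axis j 1 $ i * dirderiv (0, fibre_dir j) (H k) x + 0 * dirderiv (0, base_dir j) (H k) x)) \<nu> (y, 0)"
    by (rule expo_pairop_mult[where l = "\<lambda>x. fst (snd x) $ i" and a = "\<lambda>j. axis j 1 $ i" and b = "\<lambda>j. 0"
          and F = H and X = Y])
      (simp_all add: dirderiv_coords2 open_Y holo_z' H Y_base y)
  also have "(\<lambda>k x. \<Sum>j\<in>UNIV. axis j 1 $ i * dirderiv (0, fibre_dir j) (H k) x + 0 * dirderiv (0, base_dir j) (H k) x)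
      = (\<lambda>k. dirderiv (0, fibre_dir i) (H k))"
    by (simp add: fun_eq_iff axis_nth if_distrib[of "\<lambda>c. c * _"] cong: if_cong)
  finally show ?thesis by (cases \<nu>) (simp_all add: E_def)
qed

lemma E_mult_zeta':
  assumes y: "y \<in> WW"
  shows "E (\<lambda>k x. snd (snd x) $ i * H k x) \<nu> y = shift (E (\<lambda>k. dirderiv (0, base_dir i) (H k))) \<nu> y"
proof -
  let ?A = "pairop base_dir2 fibre_dir2"
  have "expo ?A (\<lambda>k x. snd (snd x) $ i * H k x) \<nu> (y, 0) = snd (snd (y, 0 :: 'n pt)) $ i * expo ?A H \<nu> (y, 0)
    + shift (expo ?A (\<lambda>k x. \<Sum>j\<in>UNIV. 0 * dirderiv (0, fibre_dir j) (H k) x + axis j 1 $ i * dirderiv (0, base_dir j) (H k) x)) \<nu> (y, 0)"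
    by (rule expo_pairop_mult[where l = "\<lambda>x. snd (snd x) $ i" and a = "\<lambda>j. 0" and b = "\<lambda>j. axis j 1 $ i"
          and F = H and X = Y])
      (simp_all add: dirderiv_coords2 open_Y holo_zeta' H Y_base y)
  also have "(\<lambda>k x. \<Sum>j\<in>UNIV. 0 * dirderiv (0, fibre_dir j) (H k) x + axis j 1 $ i * dirderiv (0, base_dir j) (H k) x)
      = (\<lambda>k. dirderiv (0, base_dir i) (H k))"
    by (simp add: fun_eq_iff axis_nth if_distrib[of "\<lambda>c. c * _"] cong: if_cong)
  finally show ?thesis by (cases \<nu>) (simp_all add: E_def)
qed

text \<open>Functions of the parameter are constant in all directions of the operator.\<close>

lemma E_mult_param:
  assumes y: "y \<in> WW" and c: "holo c WW"
  shows "E (\<lambda>k x. c (fst x) * H k x) \<nu> y = c y * E H \<nu> y"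
proof -
  let ?A = "pairop base_dir2 fibre_dir2"
  have c': "holo (\<lambda>x. c (fst x)) Y"
    by (rule holo_compose[OF c]) (auto intro!: holo_map_intros simp: Y_def WW_def)
  have "expo ?A (\<lambda>k x. c (fst x) * H k x) \<nu> (y, 0) = c (fst (y, 0 :: 'n pt)) * expo ?A H \<nu> (y, 0)
    + shift (expo ?A (\<lambda>k x. \<Sum>j\<in>UNIV. 0 * dirderiv (0, fibre_dir j) (H k) x + 0 * dirderiv (0, base_dir j) (H k) x)) \<nu> (y, 0)"
    by (rule expo_pairop_mult[where l = "\<lambda>x. c (fst x)" and a = "\<lambda>j. 0" and b = "\<lambda>j. 0" and F = H and X = Y])
      (simp_all add: dirderiv_def open_Y c' H Y_base y)
  also have "shift (expo ?A (\<lambda>k x. \<Sum>j\<in>UNIV. 0 * dirderiv (0, fibre_dir j) (H k) x + 0 * dirderiv (0, base_dir j) (H k) x)) \<nu> (y, 0) = 0"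
    by (cases \<nu>) (simp_all add: hol_op.expo_zero[OF op_E Y_base[OF y]])
  finally show ?thesis by (simp add: E_def)
qed

lemma dirderiv_E:
  assumes y: "y \<in> WW"
  shows "dirderiv u (E H \<nu>) y = E (\<lambda>k. dirderiv (u, 0) (H k)) \<nu> y"
proof -
  have "dirderiv u (\<lambda>y. expo (pairop base_dir2 fibre_dir2) H \<nu> (y, 0)) y
      = dirderiv (u, 0) (expo (pairop base_dir2 fibre_dir2) H \<nu>) (y, 0)"
    by (rule dirderiv_affine) simp
  then show ?thesis
    using expo_dirderiv[OF open_Y H Y_base[OF y], where p = base_dir2 and q = fibre_dir2 and v = "(u, 0)" and \<nu> = \<nu>]
    by (simp add: E_def[abs_def])
qed

end

lemma E_add:
  assumes "\<And>k. holo (H k) Y" "\<And>k. holo (H' k) Y" "y \<in> WW"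
  shows "E (\<lambda>k x. H k x + H' k x) \<nu> y = E H \<nu> y + E H' \<nu> y"
  unfolding E_def by (rule hol_op.expo_add[OF op_E assms(1,2) Y_base[OF assms(3)]])

lemma E_sum:
  assumes "finite I" "\<And>i k. i \<in> I \<Longrightarrow> holo (H i k) Y" "y \<in> WW"
  shows "E (\<lambda>k x. \<Sum>i\<in>I. H i k x) \<nu> y = (\<Sum>i\<in>I. E (H i) \<nu> y)"
  unfolding E_def by (rule hol_op.expo_sum[OF op_E assms(1,2) Y_base[OF assms(3)]])

lemma shift_add: "shift F \<nu> y + shift G \<nu> y = shift (\<lambda>k x. F k x + G k x) \<nu> y"
  and shift_sum: "(\<Sum>i\<in>I. shift (S i) \<nu> y) = shift (\<lambda>k x. \<Sum>i\<in>I. S i k x) \<nu> y"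
  and shift_cmult: "c * shift F \<nu> y = shift (\<lambda>k x. c * F k x) \<nu> y"
  by (cases \<nu>; simp)+

lemma shift_cong: "(\<And>k. F k y = G k y) \<Longrightarrow> shift F \<nu> y = shift G \<nu> y"
  by (cases \<nu>) simp_all

text \<open>The pull-back of \<open>\<zeta>\<^sub>i \<circ> R\<close> is the product of the pull-backs.\<close>

lemma pull_zeta_comp:
  assumes R: "\<And>k. holo (R k) UNIV" and y: "y \<in> WW"
  shows "E (\<lambda>k x. snd (pm x) $ i * R k (pm x)) \<nu> y
      + shift (E (\<lambda>k x. dirderiv (base_dir i) (R k) (pm x))) \<nu> y
    = (\<Sum>j\<in>UNIV. snd y $ j * v i j (fst y)) * E (\<lambda>k x. R k (pm x)) \<nu> y
      + shift (\<lambda>k y. \<Sum>a\<in>UNIV. v i a (fst y) * dirderiv (base_dir a) (E (\<lambda>k x. R k (pm x)) k) y) \<nu> y"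
proof -
  define F where "F k x = R k (pm x)" for k x
  have F: "holo (F k) Y" for k unfolding F_def by (rule holo_pm[OF R])
  note dF = holo_dirderiv[OF F open_Y]
  define c where "c y = (\<Sum>j\<in>UNIV. snd y $ j * v i j (fst y))" for y
  have vW: "holo (\<lambda>y. v i j (fst y)) WW" for j
    by (rule holo_compose[OF holo_v]) (auto intro!: holo_map_intros simp: WW_def)
  have c: "holo c WW" unfolding c_def[abs_def]
    by (intro holo_sum holo_mult holo_nth holo_map_intros vW)
  have c': "holo (\<lambda>x. c (fst x)) Y"
    by (rule holo_compose[OF c]) (auto intro!: holo_map_intros simp: Y_def WW_def)
  have dKF: "dirderiv (0, fibre_dir l) (\<lambda>x. Kx i l x * F k x) x = Kx i l x * dirderiv (0, fibre_dir l) (F k) x"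
    if "x \<in> Y" for k l x
    by (simp add: dirderiv_mult[OF holo_Kx F that] dirderiv_zeta'_Kx[OF that])
  \<comment> \<open>By \<open>g_expansion\<close> the factor splits into
    \<open>\<zeta>'\<^sub>i\<close>, a function of the parameter and terms with a factor
    \<open>z'\<^sub>l\<close>; each has its own rule.\<close>
  have "E (\<lambda>k x. snd (pm x) $ i * F k x) \<nu> y
      = E (\<lambda>k x. snd (snd x) $ i * F k x + (c (fst x) * F k x + (\<Sum>l\<in>UNIV. fst (snd x) $ l * (Kx i l x * F k x)))) \<nu> y"
  proof (rule E_cong[OF _ y])
    fix k x assume x: "x \<in> Y"
    have "snd (pm x) $ i = snd (snd x) $ i + (c (fst x) + (\<Sum>l\<in>UNIV. fst (snd x) $ l * Kx i l x))"
      by (simp add: snd_pm g_expansion[OF x] c_def)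
    then show "snd (pm x) $ i * F k x
        = snd (snd x) $ i * F k x + (c (fst x) * F k x + (\<Sum>l\<in>UNIV. fst (snd x) $ l * (Kx i l x * F k x)))"
      by (simp add: algebra_simps sum_distrib_left)
  qed (intro holo_mult holo_nth holo_map_snd holo_map_pm F)
  also have "\<dots> = E (\<lambda>k x. snd (snd x) $ i * F k x) \<nu> y
      + (E (\<lambda>k x. c (fst x) * F k x) \<nu> y + (\<Sum>l\<in>UNIV. E (\<lambda>k x. fst (snd x) $ l * (Kx i l x * F k x)) \<nu> y))"
    by (simp add: E_add E_sum holo_add holo_mult holo_sum holo_zeta' holo_z' holo_Kx F c' y)
  also have "\<dots> = shift (E (\<lambda>k. dirderiv (0, base_dir i) (F k))) \<nu> y
      + (c y * E F \<nu> y + (\<Sum>l\<in>UNIV. shift (E (\<lambda>k. dirderiv (0, fibre_dir l) (\<lambda>x. Kx i l x * F k x))) \<nu> y))"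
    by (simp add: E_mult_zeta'[OF F y] E_mult_param[OF F y c] E_mult_z'[OF holo_mult[OF holo_Kx F] y])
  finally have 1: "E (\<lambda>k x. snd (pm x) $ i * F k x) \<nu> y = \<dots>" .
  \<comment> \<open>The derivative along the vector field gives the derivative of \<open>R\<close>
    in \<open>z\<^sub>i\<close> plus a term with the derivatives of \<open>g\<close>. The latter is
    the derivative in \<open>z'\<^sub>i\<close> plus the \<open>Kx\<close> term, by the very
    definition of \<open>Kx\<close>; the \<open>Kx\<close> term is a derivative in
    \<open>\<zeta>'\<^sub>l\<close> because \<open>Kx\<close> does not depend on
    \<open>\<zeta>'\<close>.\<close>
  have 2: "shift (\<lambda>k y. \<Sum>a\<in>UNIV. v i a (fst y) * dirderiv (base_dir a) (E F k) y) \<nu> y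
      = shift (E (\<lambda>k. dirderiv (0, base_dir i) (F k))) \<nu> y
        + ((\<Sum>l\<in>UNIV. shift (E (\<lambda>k. dirderiv (0, fibre_dir l) (\<lambda>x. Kx i l x * F k x))) \<nu> y)
        + shift (E (\<lambda>k x. dirderiv (base_dir i) (R k) (pm x))) \<nu> y)"
    unfolding shift_sum shift_add
  proof (rule shift_cong)
    fix k
    have hR: "holo (\<lambda>x. dirderiv (base_dir i) (R k) (pm x)) Y" for k
      by (rule holo_pm[OF holo_dirderiv[OF R open_UNIV]])
    have "(\<Sum>a\<in>UNIV. v i a (fst y) * dirderiv (base_dir a) (E F k) y)
        = (\<Sum>a\<in>UNIV. E (\<lambda>k x. v i a (fst (fst x)) * dirderiv (base_dir a, 0) (F k) x) k y)"
      by (simp add: dirderiv_E[OF F y] E_mult_param[OF dF y vW])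
    also have "\<dots> = E (\<lambda>k x. \<Sum>a\<in>UNIV. v i a (fst (fst x)) * dirderiv (base_dir a, 0) (F k) x) k y"
      by (rule E_sum[symmetric, OF _ _ y]) (auto intro!: holo_mult holo_v_Y dF)
    also have "\<dots> = E (\<lambda>k x. dirderiv (0, base_dir i) (F k) x
        + ((\<Sum>l\<in>UNIV. dirderiv (0, fibre_dir l) (\<lambda>x. Kx i l x * F k x) x) + dirderiv (base_dir i) (R k) (pm x))) k y"
    proof (rule E_cong[OF _ y])
      show "holo (\<lambda>x. \<Sum>a\<in>UNIV. v i a (fst (fst x)) * dirderiv (base_dir a, 0) (F k) x) Y" for k
        by (intro holo_sum holo_mult holo_v_Y dF)
      fix k x assume x: "x \<in> Y"
      note xT = x UNIV_I
      show "(\<Sum>a\<in>UNIV. v i a (fst (fst x)) * dirderiv (base_dir a, 0) (F k) x)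
          = dirderiv (0, base_dir i) (F k) x
          + ((\<Sum>l\<in>UNIV. dirderiv (0, fibre_dir l) (\<lambda>x. Kx i l x * F k x) x) + dirderiv (base_dir i) (R k) (pm x))"
        by (simp only: dKF[OF x])
          (simp add: F_def[abs_def] dirderiv_pm_w[OF R xT] dirderiv_pm_z'[OF R xT] dirderiv_pm_zeta'[OF R xT]
            Kx_def left_diff_distrib sum_subtractf)
    qed
    also have "\<dots> = E (\<lambda>k. dirderiv (0, base_dir i) (F k)) k y
        + ((\<Sum>l\<in>UNIV. E (\<lambda>k. dirderiv (0, fibre_dir l) (\<lambda>x. Kx i l x * F k x)) k y)
          + E (\<lambda>k x. dirderiv (base_dir i) (R k) (pm x)) k y)"
    proof -
      have h: "holo (\<lambda>x. dirderiv (0, fibre_dir l) (\<lambda>x. Kx i l x * F k x) x) Y" for k l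
        by (rule holo_dirderiv[OF holo_mult[OF holo_Kx F] open_Y])
      show ?thesis
        by (subst E_add; (subst E_add)?; (subst E_sum)?; (intro holo_add holo_sum h dF hR y finite)?; simp)
    qed
    finally show "(\<Sum>a\<in>UNIV. v i a (fst y) * dirderiv (base_dir a) (E F k) y)
      = E (\<lambda>k. dirderiv (0, base_dir i) (F k)) k y
        + ((\<Sum>l\<in>UNIV. E (\<lambda>k. dirderiv (0, fibre_dir l) (\<lambda>x. Kx i l x * F k x)) k y)
          + E (\<lambda>k x. dirderiv (base_dir i) (R k) (pm x)) k y)" .
  qed
  show ?thesis
    using 1 2 by (simp add: F_def[abs_def] c_def algebra_simps)
qed

text \<open>The pull-back of \<open>\<zeta>\<^sub>i R = R \<circ> \<zeta>\<^sub>i\<close>.\<close>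

lemma pull_mult_zeta:
  assumes R: "\<And>k. holo (R k) UNIV" and y: "y \<in> WW"
  shows "E (\<lambda>k x. snd (pm x) $ i * R k (pm x)) \<nu> y
    = (\<Sum>j\<in>UNIV. snd y $ j * E (\<lambda>k x. dPsi i j (shifted x) * R k (pm x)) \<nu> y)"
proof -
  define F where "F k x = R k (pm x)" for k x
  have F: "holo (F k) Y" for k unfolding F_def by (rule holo_pm[OF R])
  note dF = holo_dirderiv[OF F open_Y] and dg = holo_dirderiv[OF holo_g open_Y]
  have hP: "holo (\<lambda>x. dPsi i j (shifted x)) Y" for j
    by (rule holo_compose[OF holo_dPsi holo_map_shifted Y_D(2)])
  let ?d = "\<lambda>l. dirderiv (0, base_dir i) (g l)"
  \<comment> \<open>\<open>F\<close> depends on \<open>z'\<close> only through \<open>g\<close>, so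
    its derivative in \<open>z'\<^sub>i\<close> can be written with derivatives in
    \<open>\<zeta>'\<close>. These are traded for factors \<open>z'\<^sub>l\<close>, and the factors
    complete \<open>g i\<close> to the left side of \<open>g_identity_z'\<close>.\<close>
  have dz: "dirderiv (0, base_dir i) (F k) x = (\<Sum>l\<in>UNIV. dirderiv (0, fibre_dir l) (\<lambda>x. ?d l x * F k x) x)"
    if x: "x \<in> Y" for k x
    by (simp add: dirderiv_mult[OF dg F x] dirderiv_zeta'_dirderiv_g[OF x])
      (simp add: F_def[abs_def] dirderiv_pm_z'[OF R x UNIV_I] dirderiv_pm_zeta'[OF R x UNIV_I])
  have "E (\<lambda>k x. snd (snd x) $ i * F k x) \<nu> y = shift (E (\<lambda>k. dirderiv (0, base_dir i) (F k))) \<nu> y"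
    by (rule E_mult_zeta'[OF F y])
  also have "\<dots> = shift (\<lambda>k y. \<Sum>l\<in>UNIV. E (\<lambda>k. dirderiv (0, fibre_dir l) (\<lambda>x. ?d l x * F k x)) k y) \<nu> y"
  proof (rule shift_cong)
    fix k
    have h: "holo (dirderiv (0, fibre_dir l) (\<lambda>x. ?d l x * F k x)) Y" for k l
      by (rule holo_dirderiv[OF holo_mult[OF dg F] open_Y])
    have "E (\<lambda>k. dirderiv (0, base_dir i) (F k)) k y
        = E (\<lambda>k x. \<Sum>l\<in>UNIV. dirderiv (0, fibre_dir l) (\<lambda>x. ?d l x * F k x) x) k y"
      by (rule E_cong[OF dF y dz])
    also have "\<dots> = (\<Sum>l\<in>UNIV. E (\<lambda>k. dirderiv (0, fibre_dir l) (\<lambda>x. ?d l x * F k x)) k y)"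
      by (rule E_sum[OF finite h y])
    finally show "E (\<lambda>k. dirderiv (0, base_dir i) (F k)) k y = \<dots>" .
  qed
  also have "\<dots> = (\<Sum>l\<in>UNIV. E (\<lambda>k x. fst (snd x) $ l * (?d l x * F k x)) \<nu> y)"
    by (simp add: E_mult_z'[OF holo_mult[OF dg F] y] shift_sum)
  also have "\<dots> = E (\<lambda>k x. \<Sum>l\<in>UNIV. fst (snd x) $ l * (?d l x * F k x)) \<nu> y"
    by (rule E_sum[symmetric, OF finite _ y]) (intro holo_mult holo_z' dg F)
  finally have 1: "E (\<lambda>k x. snd (snd x) $ i * F k x) \<nu> y = \<dots>" .
  have "E (\<lambda>k x. snd (pm x) $ i * F k x) \<nu> y = E (\<lambda>k x. snd (snd x) $ i * F k x + g i x * F k x) \<nu> y"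
    by (simp add: snd_pm distrib_right)
  also have "\<dots> = E (\<lambda>k x. \<Sum>l\<in>UNIV. fst (snd x) $ l * (?d l x * F k x)) \<nu> y + E (\<lambda>k x. g i x * F k x) \<nu> y"
    unfolding 1[symmetric] by (rule E_add[OF holo_mult[OF holo_zeta' F] holo_mult[OF holo_g F] y])
  also have "\<dots> = E (\<lambda>k x. (\<Sum>l\<in>UNIV. fst (snd x) $ l * (?d l x * F k x)) + g i x * F k x) \<nu> y"
    by (rule E_add[symmetric, OF _ _ y]) (intro holo_sum holo_mult holo_z' dg F holo_g)+
  also have "\<dots> = E (\<lambda>k x. \<Sum>j\<in>UNIV. snd (fst x) $ j * (dPsi i j (shifted x) * F k x)) \<nu> y"
  proof (rule E_cong[OF _ y])
    fix k x assume x: "x \<in> Y"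
    have "(\<Sum>l\<in>UNIV. fst (snd x) $ l * (?d l x * F k x)) + g i x * F k x
        = (g i x + (\<Sum>l\<in>UNIV. fst (snd x) $ l * ?d l x)) * F k x"
      by (simp add: distrib_right sum_distrib_right mult.assoc add.commute)
    then show "(\<Sum>l\<in>UNIV. fst (snd x) $ l * (?d l x * F k x)) + g i x * F k x
        = (\<Sum>j\<in>UNIV. snd (fst x) $ j * (dPsi i j (shifted x) * F k x))"
      by (simp add: g_identity_z'[OF x] sum_distrib_right mult.assoc)
  qed (intro holo_add holo_sum holo_mult holo_z' dg F holo_g)
  also have "\<dots> = (\<Sum>j\<in>UNIV. E (\<lambda>k x. snd (fst x) $ j * (dPsi i j (shifted x) * F k x)) \<nu> y)"
    by (rule E_sum[OF finite _ y]) (intro holo_mult holo_mu hP F)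
  also have "\<dots> = (\<Sum>j\<in>UNIV. snd y $ j * E (\<lambda>k x. dPsi i j (shifted x) * F k x) \<nu> y)"
  proof (intro sum.cong refl)
    fix j
    have "holo (\<lambda>y :: 'n pt. snd y $ j) WW" by (intro holo_nth holo_map_intros)
    from E_mult_param[OF holo_mult[OF hP F] y this]
    show "E (\<lambda>k x. snd (fst x) $ j * (dPsi i j (shifted x) * F k x)) \<nu> y
        = snd y $ j * E (\<lambda>k x. dPsi i j (shifted x) * F k x) \<nu> y" .
  qed
  finally show ?thesis by (simp add: F_def)
qed

end

section \<open>The Piola identity and right multiplication by functions on the base\<close>

context coord_pullback
begin

definition jac :: "complex^'n \<Rightarrow> complex" where "jac w = det (cjacobian \<Phi> w)"

lemma cjacobian_nth: "cjacobian \<Phi> w $ k $ j = dPhi j k w"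
  by (simp add: cjacobian_def dPhi_def dirderiv_def scaleC_vec_eq)

lemma holo_jac: "holo jac W"
  unfolding jac_def[abs_def] by (rule holo_det) (simp add: cjacobian_nth holo_dPhi)

text \<open>Jacobi's formula gives the derivative of the determinant, and differentiating the
  inverse relation of \<open>v\<close> and the Jacobian matrix gives the divergence of
  \<open>v\<close>. Both are the same triple sum of \<open>v\<close>, \<open>v\<close> and second
  derivatives of \<open>\<Phi>\<close>, with opposite signs; they are matched by the symmetry of
  second derivatives.\<close>

lemma piola_identity:
  assumes w: "w \<in> W"
  shows "(\<Sum>j\<in>UNIV. dirderiv (axis j 1) (\<lambda>w. v i j w * jac w) w) = 0"
proof -
  define h where "h j l k = dirderiv (axis j 1) (dPhi l k) w" for j l k
  define dv where "dv j l = dirderiv (axis j 1) (v i l) w" for j l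
  have sym: "h j l k = h l j k" for j l k
    unfolding h_def dPhi_def[abs_def] by (rule dirderiv_commute[OF holo_Phi_nth open_W w])
  have djac: "dirderiv (axis j 1) jac w = jac w * (\<Sum>l\<in>UNIV. \<Sum>k\<in>UNIV. v k l w * h j l k)" for j
  proof -
    have "(\<chi> l k. v k l w) ** cjacobian \<Phi> w = mat 1"
      by (simp add: vec_eq_iff matrix_matrix_mult_def cjacobian_nth mat_def mult.commute[of "v _ _ w"]
          dPhi_dPsi[OF w])
    from jacobi_formula[of "cjacobian \<Phi>", OF _ w this, of "axis j 1"]
    show ?thesis
      by (simp add: cjacobian_nth holo_dPhi h_def jac_def[abs_def])
  qed
  have dinv: "(\<Sum>l\<in>UNIV. dv j l * dPhi l k w) = - (\<Sum>l\<in>UNIV. v i l w * h j l k)" for j k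
  proof -
    have "dirderiv (axis j 1) (\<lambda>w. \<Sum>l\<in>UNIV. v i l w * dPhi l k w) w
        = dirderiv (axis j 1) (\<lambda>w. if i = k then 1 else 0) w"
      by (rule dirderiv_cong[OF open_W w dPsi_dPhi])
    moreover have "dirderiv (axis j 1) (\<lambda>w. \<Sum>l\<in>UNIV. v i l w * dPhi l k w) w
        = (\<Sum>l\<in>UNIV. v i l w * h j l k + dv j l * dPhi l k w)"
      by (simp add: dirderiv_sum[OF holo_mult[OF holo_v holo_dPhi] w] dirderiv_mult[OF holo_v holo_dPhi w] h_def dv_def)
    ultimately show ?thesis by (simp add: sum.distrib add_eq_0_iff)
  qed
  have "(\<Sum>j\<in>UNIV. dv j j) = (\<Sum>j\<in>UNIV. \<Sum>l\<in>UNIV. dv j l * (\<Sum>k\<in>UNIV. dPhi l k w * v k j w))"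
    by (simp add: dPhi_dPsi[OF w] if_distrib[of "(*) _"] cong: if_cong)
  also have "\<dots> = (\<Sum>j\<in>UNIV. \<Sum>k\<in>UNIV. v k j w * (\<Sum>l\<in>UNIV. dv j l * dPhi l k w))"
  proof (rule sum.cong[OF refl])
    fix j
    show "(\<Sum>l\<in>UNIV. dv j l * (\<Sum>k\<in>UNIV. dPhi l k w * v k j w)) = (\<Sum>k\<in>UNIV. v k j w * (\<Sum>l\<in>UNIV. dv j l * dPhi l k w))"
      unfolding sum_distrib_left by (subst sum.swap) (simp add: mult_ac)
  qed
  also have "\<dots> = - (\<Sum>j\<in>UNIV. \<Sum>k\<in>UNIV. \<Sum>l\<in>UNIV. v k j w * v i l w * h j l k)"
    by (simp add: dinv sum_distrib_left sum_negf mult.assoc)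
  finally have div: "(\<Sum>j\<in>UNIV. dv j j) = - (\<Sum>j\<in>UNIV. \<Sum>k\<in>UNIV. \<Sum>l\<in>UNIV. v k j w * v i l w * h j l k)" .
  have "(\<Sum>j\<in>UNIV. v i j w * (\<Sum>l\<in>UNIV. \<Sum>k\<in>UNIV. v k l w * h j l k))
      = (\<Sum>j\<in>UNIV. \<Sum>l\<in>UNIV. \<Sum>k\<in>UNIV. v k l w * v i j w * h l j k)"
    by (simp add: sum_distrib_left mult_ac sym)
  also have "\<dots> = (\<Sum>l\<in>UNIV. \<Sum>k\<in>UNIV. \<Sum>j\<in>UNIV. v k l w * v i j w * h l j k)"
    by (subst sum.swap) (intro sum.cong refl sum.swap)
  finally have "(\<Sum>j\<in>UNIV. v i j w * (\<Sum>l\<in>UNIV. \<Sum>k\<in>UNIV. v k l w * h j l k)) = - (\<Sum>j\<in>UNIV. dv j j)"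
    by (simp add: div)
  moreover have "(\<Sum>j\<in>UNIV. dirderiv (axis j 1) (\<lambda>w. v i j w * jac w) w)
      = jac w * (\<Sum>j\<in>UNIV. v i j w * (\<Sum>l\<in>UNIV. \<Sum>k\<in>UNIV. v k l w * h j l k)) + jac w * (\<Sum>j\<in>UNIV. dv j j)"
  proof -
    have "dirderiv (axis j 1) (\<lambda>w. v i j w * jac w) w
        = jac w * (v i j w * (\<Sum>l\<in>UNIV. \<Sum>k\<in>UNIV. v k l w * h j l k)) + jac w * dv j j" for j
      unfolding dirderiv_mult[OF holo_v holo_jac w] djac dv_def by (simp add: mult_ac)
    then show ?thesis by (simp only: sum.distrib sum_distrib_left)
  qed
  ultimately show ?thesis by simp
qed

lemma holo_base_WW: "holo c W \<Longrightarrow> holo (\<lambda>y. c (fst y)) WW"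
  by (rule holo_compose) (auto intro!: holo_map_intros simp: WW_def)

lemma antipode_in_WW: "y \<in> WW \<Longrightarrow> antipode y \<in> WW"
  by (simp add: WW_def)

lemma vord_E:
  assumes "\<And>k. vord (M - 2 * k) (H k) (y, 0)"
  shows "vord (M - 2 * \<nu>) (E H \<nu>) y"
  unfolding E_def[abs_def]
proof (rule vord_compose[where Y = UNIV and g = "\<lambda>y. (y, 0)"])
  show "vord (M - 2 * \<nu>) (expo (pairop base_dir2 fibre_dir2) H \<nu>) (y, 0)"
    by (rule vord_expo[OF assms])
qed (auto intro!: holo_map_Pair)

text \<open>The Jacobian determinant times the pull-back of \<open>F\<close> composed on the right
  with \<open>c\<close>: as a right factor, \<open>c\<close> is evaluated at the shifted base point,
  here in the coordinate \<open>w\<close>.\<close>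

definition pull_function :: "(complex^'n \<Rightarrow> complex) \<Rightarrow> (nat \<Rightarrow> 'n pt \<Rightarrow> complex) \<Rightarrow> nat \<Rightarrow> 'n pt \<Rightarrow> complex" where
  "pull_function c F \<nu> y = jac (fst y) * E (\<lambda>k x. c (\<Psi> (shifted x)) * F k (pm x)) \<nu> y"

lemma holo_Psi_comp: "holo c W \<Longrightarrow> holo (\<lambda>x. c (\<Psi> (shifted x))) Y"
  by (rule holo_compose[OF _ holo_map_compose[OF holo_Psi holo_map_shifted]]) (auto simp: Y_D Psi_in)

context
  fixes F :: "nat \<Rightarrow> 'n pt \<Rightarrow> complex"
  assumes F: "\<And>k. holo (F k) UNIV"
begin

lemma holo_integrand: "holo c W \<Longrightarrow> holo (\<lambda>x. c (\<Psi> (shifted x)) * F k (pm x)) Y"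
  by (intro holo_mult holo_Psi_comp holo_pm F)

lemma holo_pull_function: "holo c W \<Longrightarrow> holo (pull_function c F \<nu>) WW"
  unfolding pull_function_def[abs_def]
  by (intro holo_mult holo_base_WW holo_jac E_holo holo_integrand)

text \<open>Right composition with \<open>w\<^sub>j\<close> adds \<open>t\<close> times the
  derivative in \<open>\<mu>\<^sub>j\<close>. By the difference identity the shifted coordinate is
  \<open>w\<^sub>j\<close> plus terms \<open>z'\<^sub>l\<close> times entries of \<open>J\<close>.
  The factors \<open>z'\<^sub>l\<close> become derivatives in \<open>\<zeta>'\<^sub>l\<close>, and
  these add up to the derivative in \<open>\<mu>\<^sub>j\<close>, since \<open>g\<close> is linear
  in \<open>\<mu>\<close> with the same entries.\<close>

lemma pull_function_coord:
  assumes c: "holo c W" and y: "y \<in> WW"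
  shows "pull_function (\<lambda>w. w $ j * c w) F \<nu> y
    = fst y $ j * pull_function c F \<nu> y
      + shift (\<lambda>\<nu>. dirderiv (fibre_dir j) (pull_function c F \<nu>)) \<nu> y"
proof -
  define H where "H k x = c (\<Psi> (shifted x)) * F k (pm x)" for k x
  have H: "holo (H k) Y" for k unfolding H_def by (rule holo_integrand[OF c])
  have hw: "holo (\<lambda>y :: 'n pt. fst y $ j) X" for X by (intro holo_nth holo_map_intros)
  have JH: "holo (\<lambda>x. Jx j l x * H k x) Y" for l k by (intro holo_mult holo_Jx H)
  note dJH = holo_dirderiv[OF JH open_Y]
  have dc: "dirderiv (0, fibre_dir l) (\<lambda>x. c (\<Psi> (shifted x))) x = 0"
       "dirderiv (fibre_dir l, 0) (\<lambda>x. c (\<Psi> (shifted x))) x = 0" for l x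
    by (simp_all add: dirderiv_def shifted_def)
  have key: "(\<Sum>l\<in>UNIV. dirderiv (0, fibre_dir l) (\<lambda>x. Jx j l x * H k x) x) = dirderiv (fibre_dir j, 0) (H k) x"
    if x: "x \<in> Y" for k x
  proof -
    note hc = holo_Psi_comp[OF c] and hF = holo_pm[OF F, of k]
    have "dirderiv (0, fibre_dir l) (\<lambda>x. Jx j l x * H k x) x
        = Jx j l x * (c (\<Psi> (shifted x)) * dirderiv (fibre_dir l) (F k) (pm x))" for l
      by (simp add: dirderiv_mult[OF holo_Jx H x] dirderiv_zeta'_Jx)
        (simp add: H_def[abs_def] dirderiv_mult[OF hc hF x] dc dirderiv_pm_zeta'[OF F x UNIV_I])
    moreover have "dirderiv (fibre_dir j, 0) (H k) x
        = c (\<Psi> (shifted x)) * (\<Sum>l\<in>UNIV. Jx j l x * dirderiv (fibre_dir l) (F k) (pm x))"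
      by (simp add: H_def[abs_def] dirderiv_mult[OF hc hF x] dc dirderiv_pm_mu[OF F x UNIV_I])
    ultimately show ?thesis by (simp add: sum_distrib_left mult_ac)
  qed
  have "E (\<lambda>k x. \<Psi> (shifted x) $ j * H k x) \<nu> y
      = E (\<lambda>k x. fst (fst x) $ j * H k x + (\<Sum>l\<in>UNIV. fst (snd x) $ l * (Jx j l x * H k x))) \<nu> y"
  proof (rule E_cong[OF _ y])
    fix k x assume x: "x \<in> Y"
    have "\<Psi> (shifted x) $ j = fst (fst x) $ j + (\<Sum>l\<in>UNIV. fst (snd x) $ l * Jx j l x)"
      by (simp add: difference_identity[OF x])
    then show "\<Psi> (shifted x) $ j * H k x
        = fst (fst x) $ j * H k x + (\<Sum>l\<in>UNIV. fst (snd x) $ l * (Jx j l x * H k x))"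
      by (simp add: distrib_right sum_distrib_right mult.assoc)
  qed (intro holo_mult holo_Psi_shifted H)
  also have "\<dots> = E (\<lambda>k x. fst (fst x) $ j * H k x) \<nu> y
      + E (\<lambda>k x. \<Sum>l\<in>UNIV. fst (snd x) $ l * (Jx j l x * H k x)) \<nu> y"
    by (rule E_add[OF _ _ y]) (intro holo_sum holo_mult holo_w holo_z' holo_Jx H)+
  also have "E (\<lambda>k x. \<Sum>l\<in>UNIV. fst (snd x) $ l * (Jx j l x * H k x)) \<nu> y
      = (\<Sum>l\<in>UNIV. E (\<lambda>k x. fst (snd x) $ l * (Jx j l x * H k x)) \<nu> y)"
    by (rule E_sum[OF finite _ y]) (intro holo_mult holo_z' holo_Jx H)
  also have "\<dots> = shift (\<lambda>k y. \<Sum>l\<in>UNIV. E (\<lambda>k. dirderiv (0, fibre_dir l) (\<lambda>x. Jx j l x * H k x)) k y) \<nu> y"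
    by (simp add: E_mult_z'[OF JH y] shift_sum)
  also have "\<dots> = shift (\<lambda>\<nu>. dirderiv (fibre_dir j) (E H \<nu>)) \<nu> y"
  proof (rule shift_cong)
    fix k
    have "(\<Sum>l\<in>UNIV. E (\<lambda>k. dirderiv (0, fibre_dir l) (\<lambda>x. Jx j l x * H k x)) k y)
        = E (\<lambda>k x. \<Sum>l\<in>UNIV. dirderiv (0, fibre_dir l) (\<lambda>x. Jx j l x * H k x) x) k y"
      by (rule E_sum[symmetric, OF finite dJH y])
    also have "\<dots> = E (\<lambda>k. dirderiv (fibre_dir j, 0) (H k)) k y"
      by (rule E_cong[OF _ y key]) (intro holo_sum dJH)
    also have "\<dots> = dirderiv (fibre_dir j) (E H k) y" by (rule dirderiv_E[OF H y, symmetric])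
    finally show "(\<Sum>l\<in>UNIV. E (\<lambda>k. dirderiv (0, fibre_dir l) (\<lambda>x. Jx j l x * H k x)) k y)
        = dirderiv (fibre_dir j) (E H k) y" .
  qed
  also have "E (\<lambda>k x. fst (fst x) $ j * H k x) \<nu> y = fst y $ j * E H \<nu> y"
    by (rule E_mult_param[OF H y hw])
  finally have main: "E (\<lambda>k x. \<Psi> (shifted x) $ j * H k x) \<nu> y
      = fst y $ j * E H \<nu> y + shift (\<lambda>\<nu>. dirderiv (fibre_dir j) (E H \<nu>)) \<nu> y" .
  have pf: "pull_function c F \<nu> = (\<lambda>y. jac (fst y) * E H \<nu> y)" for \<nu>
    by (simp add: fun_eq_iff pull_function_def H_def[abs_def])
  have "dirderiv (fibre_dir j) (\<lambda>y. jac (fst y)) y = 0" by (simp add: dirderiv_def)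
  then have d: "dirderiv (fibre_dir j) (pull_function c F \<nu>) y = jac (fst y) * dirderiv (fibre_dir j) (E H \<nu>) y" for \<nu>
    by (simp add: pf dirderiv_mult[OF holo_base_WW[OF holo_jac] E_holo[OF H] y])
  have "pull_function (\<lambda>w. w $ j * c w) F \<nu> y = jac (fst y) * E (\<lambda>k x. \<Psi> (shifted x) $ j * H k x) \<nu> y"
    by (simp add: pull_function_def H_def mult.assoc)
  moreover have "shift (\<lambda>\<nu>. dirderiv (fibre_dir j) (pull_function c F \<nu>)) \<nu> y
      = jac (fst y) * shift (\<lambda>\<nu>. dirderiv (fibre_dir j) (E H \<nu>)) \<nu> y"
    unfolding shift_cmult by (rule shift_cong) (rule d)
  moreover have "pull_function c F \<nu> y = jac (fst y) * E H \<nu> y" by (simp add: pf)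
  ultimately show ?thesis by (simp add: main distrib_left mult.left_commute)
qed

text \<open>The adjoint carries right multiplication to the left. In the step for
  \<open>w\<^sub>j\<close>, the adjoint of \<open>w\<^sub>j P\<close> produces a fibre derivative of
  order \<open>t\<close>, and the correction term of \<open>pull_function_coord\<close> produces the
  same one with a minus sign.\<close>

lemma local_adj_pull_polynomial:
  assumes "c \<in> polyfun (\<lambda>j (w::complex^'n). w $ j)" "y \<in> WW"
  shows "local_adj (pull_function c F) \<nu> y = c (fst y) * local_adj (pull_function (\<lambda>w. 1) F) \<nu> y"
  using assms
proof (induction arbitrary: y \<nu> rule: polyfun.induct)
  have hw: "holo (\<lambda>w :: complex^'n. w $ j) X" for j X by (intro holo_nth holo_map_id)
  have hol: "holo c W" if "c \<in> polyfun (\<lambda>j (w::complex^'n). w $ j)" for c by (rule holo_polyfun[OF that hw])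
  {
    case (const c)
    note h = holo_pull_function[OF holo_const]
    have "pull_function (\<lambda>w. c) F k y = c * pull_function (\<lambda>w. 1) F k y" if "y \<in> WW" for k y
      using E_cmult[OF holo_pm[OF F] that, where c = c and \<nu> = k] by (simp add: pull_function_def)
    then have "local_adj (pull_function (\<lambda>w. c) F) \<nu> y = local_adj (\<lambda>k y. c * pull_function (\<lambda>w. 1) F k y) \<nu> y"
      by (intro local_adj_cong[OF open_WW h]) (use const antipode_in_WW in auto)
    then show ?case
      using local_adj_cmult[OF open_WW h antipode_in_WW[OF const]] by simp
  next
    case (add c d)
    note hc = hol[OF add.hyps(1)] and hd = hol[OF add.hyps(2)]
    have "pull_function (\<lambda>w. c w + d w) F k y = pull_function c F k y + pull_function d F k y" if "y \<in> WW" for k y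
      using E_add[OF holo_integrand[OF hc] holo_integrand[OF hd] that, where \<nu> = k]
      by (simp add: pull_function_def distrib_right distrib_left)
    then have "local_adj (pull_function (\<lambda>w. c w + d w) F) \<nu> y
        = local_adj (\<lambda>k y. pull_function c F k y + pull_function d F k y) \<nu> y"
      by (intro local_adj_cong[OF open_WW holo_pull_function[OF holo_add[OF hc hd]]])
        (use add.prems antipode_in_WW in auto)
    also have "\<dots> = local_adj (pull_function c F) \<nu> y + local_adj (pull_function d F) \<nu> y"
      by (rule local_adj_add[OF open_WW holo_pull_function[OF hc] holo_pull_function[OF hd] antipode_in_WW[OF add.prems]])
    finally show ?case by (simp add: add.IH[OF add.prems] distrib_right)
  next
    case (coord c j)
    note hc = hol[OF coord.hyps]
    note h = holo_pull_function[OF hc] and ay = antipode_in_WW[OF coord.prems]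
    note dh = holo_dirderiv[OF h open_WW]
    let ?P = "pull_function c F" and ?D = "dirderiv (fibre_dir j)"
    have hf: "holo (\<lambda>y. fst y $ j * ?P k y) WW" for k by (intro holo_mult holo_nth holo_map_intros h)
    have "local_adj (pull_function (\<lambda>w. w $ j * c w) F) \<nu> y
        = local_adj (\<lambda>k y. fst y $ j * ?P k y + shift (\<lambda>k. ?D (?P k)) k y) \<nu> y"
      by (rule local_adj_cong[OF open_WW holo_pull_function[OF holo_mult[OF hw hc]] pull_function_coord[OF hc] ay])
    also have "\<dots> = local_adj (\<lambda>k y. fst y $ j * ?P k y) \<nu> y + local_adj (shift (\<lambda>k. ?D (?P k))) \<nu> y"
      by (rule local_adj_add[OF open_WW hf holo_shift[OF dh] ay])
    also have "local_adj (\<lambda>k y. fst y $ j * ?P k y) \<nu> y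
        = fst y $ j * local_adj ?P \<nu> y + shift (\<lambda>\<nu>. ?D (local_adj ?P \<nu>)) \<nu> y"
      by (rule local_adj_mult_fst[OF open_WW h ay])
    also have "local_adj (shift (\<lambda>k. ?D (?P k))) \<nu> y = - shift (\<lambda>\<nu>. ?D (local_adj ?P \<nu>)) \<nu> y"
      using local_adj_shift[OF open_WW dh ay] local_adj_dirderiv_fibre[OF open_WW h ay]
      by (cases \<nu>) simp_all
    finally show ?case by (simp add: coord.IH[OF coord.prems] mult.assoc)
  }
qed

text \<open>Both sides depend only on a finite jet of \<open>c\<close> at \<open>fst y\<close>, so \<open>c\<close> may be taken to be a polynomial.\<close>

lemma local_adj_pull_function:
  assumes c: "holo c W" and y: "y \<in> WW"
  shows "local_adj (pull_function c F) \<nu> y = c (fst y) * local_adj (pull_function (\<lambda>w. 1) F) \<nu> y"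
proof -
  interpret vec: coordinates "\<lambda>i (x::complex^'n). x $ i" "\<lambda>i. axis i 1" by (rule coordinates_vec)
  have w: "fst y \<in> W" using y by (simp add: WW_def)
  have hw: "holo (\<lambda>w :: complex^'n. w $ j) X" for j X by (intro holo_nth holo_map_id)
  \<comment> \<open>Two derivatives for each of the \<open>\<nu>\<close> powers of \<open>t\<close>,
    and one order more so that the result vanishes at the point.\<close>
  let ?M = "2 * \<nu> + 1"
  obtain p where p: "p \<in> polyfun (\<lambda>j (w::complex^'n). w $ j)" and vo: "vord ?M (\<lambda>w. c w - p w) (fst y)"
    using vec.polynomial_approximation[OF open_W w c hw] by blast
  have hp: "holo p W" by (rule holo_polyfun[OF p hw])
  let ?d = "\<lambda>w. c w - p w"
  have hd: "holo ?d W" by (intro holo_diff c hp)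
  note ay = antipode_in_WW[OF y]
  have "pull_function c F k y = pull_function p F k y + pull_function ?d F k y" if "y \<in> WW" for k y
  proof -
    have "E (\<lambda>k x. p (\<Psi> (shifted x)) * F k (pm x) + ?d (\<Psi> (shifted x)) * F k (pm x)) k y
        = E (\<lambda>k x. p (\<Psi> (shifted x)) * F k (pm x)) k y + E (\<lambda>k x. ?d (\<Psi> (shifted x)) * F k (pm x)) k y"
      by (rule E_add[OF holo_integrand[OF hp] holo_integrand[OF hd] that])
    moreover have "(\<lambda>k x. p (\<Psi> (shifted x)) * F k (pm x) + ?d (\<Psi> (shifted x)) * F k (pm x))
        = (\<lambda>k x. c (\<Psi> (shifted x)) * F k (pm x))"
      by (simp add: fun_eq_iff left_diff_distrib)
    ultimately show ?thesis by (simp only: pull_function_def distrib_left)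
  qed
  then have "local_adj (pull_function c F) \<nu> y = local_adj (\<lambda>k y. pull_function p F k y + pull_function ?d F k y) \<nu> y"
    by (intro local_adj_cong[OF open_WW holo_pull_function[OF c] _ ay])
  also have "\<dots> = local_adj (pull_function p F) \<nu> y + local_adj (pull_function ?d F) \<nu> y"
    by (rule local_adj_add[OF open_WW holo_pull_function[OF hp] holo_pull_function[OF hd] ay])
  also have "local_adj (pull_function ?d F) \<nu> y = 0"
  proof -
    note yY = Y_base[OF ay]
    \<comment> \<open>The adjoint at \<open>y\<close> reads its argument at the antipode, which has
      the same base point.\<close>
    have "vord ?M (\<lambda>x. ?d (\<Psi> (shifted x))) (antipode y, 0)"
    proof (rule vord_compose[OF _ holo_map_compose[OF holo_Psi holo_map_shifted Y_D(2)] open_Y yY])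
      have "\<Psi> (shifted (antipode y, 0)) = fst y" using w by (simp add: shifted_def Psi_Phi)
      with vo show "vord ?M ?d (\<Psi> (shifted (antipode y, 0)))" by simp
    qed
    from vord_mult[OF this vord_0[OF holo_pm[OF F] open_Y yY]]
    have "vord ?M (\<lambda>x. ?d (\<Psi> (shifted x)) * F k (pm x)) (antipode y, 0)" for k by simp
    then have "vord (?M - 2 * k) (\<lambda>x. ?d (\<Psi> (shifted x)) * F k (pm x)) (antipode y, 0)" for k
      by (rule vord_mono) simp
    from vord_mult[OF vord_0[OF holo_base_WW[OF holo_jac] open_WW ay] vord_E[OF this]]
    have "vord (?M - 2 * k) (pull_function ?d F k) (antipode y)" for k
      by (simp add: pull_function_def[abs_def])
    from vord_local_adj[OF this, of \<nu>] show ?thesis by (rule vord_eq_0) simp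
  qed
  also have "local_adj (pull_function p F) \<nu> y = p (fst y) * local_adj (pull_function (\<lambda>w. 1) F) \<nu> y"
    by (rule local_adj_pull_polynomial[OF p y])
  also have "p (fst y) = c (fst y)" using vord_eq_0[OF vo] by simp
  finally show ?thesis by simp
qed

end

end

section \<open>Induction over symbols polynomial in the fibre variable\<close>

definition const_series :: "('a \<Rightarrow> complex) \<Rightarrow> nat \<Rightarrow> 'a \<Rightarrow> complex" where
  "const_series f k = (if k = 0 then f else (\<lambda>x. 0))"

text \<open>The coefficients are entire functions of the base point, so members are holomorphic
  everywhere and the induction carries no condition on domains.\<close>

inductive_set fibre_poly :: "('n::finite pt \<Rightarrow> complex) set" where
  base: "holo p UNIV \<Longrightarrow> (\<lambda>y. p (fst y)) \<in> fibre_poly"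
| add: "f \<in> fibre_poly \<Longrightarrow> h \<in> fibre_poly \<Longrightarrow> (\<lambda>y. f y + h y) \<in> fibre_poly"
| zeta: "f \<in> fibre_poly \<Longrightarrow> (\<lambda>y. snd y $ i * f y) \<in> fibre_poly"

lemma holo_fibre_poly: "f \<in> fibre_poly \<Longrightarrow> holo f UNIV"
proof (induction rule: fibre_poly.induct)
  case (base p)
  then show ?case by (rule holo_compose) (auto intro!: holo_map_intros)
next
  case (zeta f i)
  then show ?case by (intro holo_mult holo_nth holo_map_intros)
qed auto

lemma fibre_poly_coord: "f \<in> fibre_poly \<Longrightarrow> (\<lambda>y. fst y $ i * f y) \<in> fibre_poly"
proof (induction rule: fibre_poly.induct)
  case (base p)
  have "holo (\<lambda>z :: complex^'a. z $ i * p z) UNIV" by (intro holo_mult holo_nth holo_map_id base)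
  from fibre_poly.base[OF this] show ?case by simp
next
  case (add f h)
  from fibre_poly.add[OF add.IH] show ?case by (simp add: distrib_left)
next
  case (zeta f j)
  from fibre_poly.zeta[OF zeta.IH, of j] show ?case by (simp add: mult.left_commute)
qed

lemma polyfun_fibre_poly: "f \<in> polyfun pt_coord \<Longrightarrow> f \<in> fibre_poly"
proof (induction rule: polyfun.induct)
  case (const c)
  show ?case by (rule fibre_poly.base[of "\<lambda>_. c"]) simp
next
  case (add f h)
  then show ?case by (intro fibre_poly.add)
next
  case (coord f i)
  then show ?case
    by (cases i) (auto simp: pt_coord_def intro: fibre_poly.zeta fibre_poly_coord)
qed

context coord_pullback
begin

lemma holo_local_adj_UNIV: "(\<And>k. holo (F k) UNIV) \<Longrightarrow> holo (local_adj F \<nu>) UNIV"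
  using local_adj_holo[OF open_UNIV, of F \<nu>] by simp

definition pull_domain :: "'n pt set \<Rightarrow> 'n pt set" where
  "pull_domain X = {y \<in> WW. pm (y, 0) \<in> X}"

context
  fixes X :: "'n pt set"
  assumes X: "open X"
begin

lemma open_pm_preimage: "open {x \<in> Y. pm x \<in> X}"
  using continuous_open_preimage[OF holo_map_continuous_on[OF holo_map_pm] open_Y X]
  by (simp add: Int_def vimage_def)

lemma op_pm: "hol_op {x \<in> Y. pm x \<in> X} (pairop base_dir2 fibre_dir2)"
  by (rule hol_op_pairop[OF open_pm_preimage])

lemma open_pull_domain: "open (pull_domain X)"
proof -
  have "pull_domain X = WW \<inter> (\<lambda>y. (y, 0)) -` {x \<in> Y. pm x \<in> X}"
    using Y_base by (auto simp: pull_domain_def)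
  moreover have "continuous_on UNIV (\<lambda>y :: 'n pt. (y, 0 :: 'n pt))" by (intro continuous_intros)
  ultimately show ?thesis using open_Int[OF open_WW open_vimage[OF open_pm_preimage]] by simp
qed

lemma pull_domain_Y: "y \<in> pull_domain X \<Longrightarrow> (y, 0) \<in> {x \<in> Y. pm x \<in> X}"
  using Y_base by (auto simp: pull_domain_def)

lemma holo_pm_on: "holo f X \<Longrightarrow> holo (\<lambda>x. f (pm x)) {x \<in> Y. pm x \<in> X}"
  by (rule holo_compose[OF _ holo_map_subset[OF holo_map_pm]]) auto

context
  fixes F :: "nat \<Rightarrow> 'n pt \<Rightarrow> complex"
  assumes F: "\<And>k. holo (F k) X"
begin

lemma local_pull_holo: "holo (local_pull \<Phi> J F \<nu>) (pull_domain X)"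
  unfolding local_pull_def[abs_def]
  by (rule holo_compose[OF hol_op.expo_holo[OF op_pm holo_pm_on[OF F]]])
    (auto intro!: holo_map_Pair dest: pull_domain_Y)

lemma local_pull_cong:
  assumes "\<And>k y. y \<in> X \<Longrightarrow> F k y = G k y" "y \<in> pull_domain X"
  shows "local_pull \<Phi> J F \<nu> y = local_pull \<Phi> J G \<nu> y"
  unfolding local_pull_def
  by (rule hol_op.expo_cong[OF op_pm holo_pm_on[OF F] _ pull_domain_Y[OF assms(2)]]) (use assms(1) in auto)

lemma local_pull_add:
  assumes G: "\<And>k. holo (G k) X" and y: "y \<in> pull_domain X"
  shows "local_pull \<Phi> J (\<lambda>k y. F k y + G k y) \<nu> y = local_pull \<Phi> J F \<nu> y + local_pull \<Phi> J G \<nu> y"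
  unfolding local_pull_def
  by (rule hol_op.expo_add[OF op_pm holo_pm_on[OF F] holo_pm_on[OF G] pull_domain_Y[OF y]])

lemma local_pull_shift:
  assumes y: "y \<in> pull_domain X"
  shows "local_pull \<Phi> J (shift F) \<nu> y = shift (local_pull \<Phi> J F) \<nu> y"
proof -
  have "(\<lambda>k x. shift F k (pm x)) = shift (\<lambda>k x. F k (pm x))"
    by (auto simp: fun_eq_iff shift_def split: nat.splits)
  then show ?thesis
    unfolding local_pull_def
    using hol_op.expo_shift[OF op_pm holo_pm_on[OF F] pull_domain_Y[OF y], where \<nu> = \<nu>]
    by (cases \<nu>) (simp_all add: local_pull_def)
qed

end

end

lemma pull_domain_UNIV: "pull_domain UNIV = WW"
  by (simp add: pull_domain_def)

lemma vord_local_pull: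
  assumes "\<And>k. vord (M - 2 * k) (F k) (pm (y, 0))" "y \<in> WW"
  shows "vord (M - 2 * \<nu>) (local_pull \<Phi> J F \<nu>) y"
proof -
  have "vord (M - 2 * k) (\<lambda>x. F k (pm x)) (y, 0)" for k
    by (rule vord_compose[OF assms(1) holo_map_pm open_Y Y_base[OF assms(2)]])
  from vord_E[OF this, of \<nu>] show ?thesis by (simp add: local_pull_eq_E[abs_def])
qed

text \<open>The claim of the induction, for a single power of \<open>t\<close>: multiplication by
  \<open>t\<close> is then handled by recursion on \<open>\<nu>\<close>.\<close>

definition adj_compatible :: "(nat \<Rightarrow> 'n pt \<Rightarrow> complex) \<Rightarrow> nat \<Rightarrow> bool" where
  "adj_compatible F \<nu> \<longleftrightarrow> (\<forall>y\<in>WW. jac (fst y) * local_pull \<Phi> J (local_adj F) \<nu> y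
    = local_adj (\<lambda>k y. jac (fst y) * local_pull \<Phi> J F k y) \<nu> y)"

lemma local_pull_holo_UNIV: "(\<And>k. holo (F k) UNIV) \<Longrightarrow> holo (local_pull \<Phi> J F \<nu>) WW"
  using local_pull_holo[OF open_UNIV] by (simp add: pull_domain_UNIV)

lemma holo_jac_pull: "(\<And>k. holo (F k) UNIV) \<Longrightarrow> holo (\<lambda>y. jac (fst y) * local_pull \<Phi> J F \<nu> y) WW"
  by (intro holo_mult holo_base_WW holo_jac local_pull_holo_UNIV)

lemma adj_compatible_add:
  assumes F: "\<And>k. holo (F k) UNIV" and G: "\<And>k. holo (G k) UNIV"
    and "adj_compatible F \<nu>" "adj_compatible G \<nu>"
  shows "adj_compatible (\<lambda>k y. F k y + G k y) \<nu>"
  unfolding adj_compatible_def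
proof
  fix y assume y: "y \<in> WW"
  note ay = antipode_in_WW[OF y]
  note pull_add = local_pull_add[OF open_UNIV, unfolded pull_domain_UNIV]
  have "local_adj (\<lambda>k y. F k y + G k y) = (\<lambda>k y. local_adj F k y + local_adj G k y)"
    by (intro ext local_adj_add[OF open_UNIV F G]) simp
  then have "local_pull \<Phi> J (local_adj (\<lambda>k y. F k y + G k y)) \<nu> y
      = local_pull \<Phi> J (local_adj F) \<nu> y + local_pull \<Phi> J (local_adj G) \<nu> y"
    by (simp only:) (rule pull_add[OF holo_local_adj_UNIV[OF F] holo_local_adj_UNIV[OF G] y])
  moreover have "local_adj (\<lambda>k y. jac (fst y) * local_pull \<Phi> J (\<lambda>k y. F k y + G k y) k y) \<nu> y
      = local_adj (\<lambda>k y. jac (fst y) * local_pull \<Phi> J F k y + jac (fst y) * local_pull \<Phi> J G k y) \<nu> y"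
    by (rule local_adj_cong[OF open_WW holo_jac_pull _ ay])
      (simp_all only: pull_add[OF F G] distrib_left holo_add[OF F G])
  moreover have "\<dots> = local_adj (\<lambda>k y. jac (fst y) * local_pull \<Phi> J F k y) \<nu> y
      + local_adj (\<lambda>k y. jac (fst y) * local_pull \<Phi> J G k y) \<nu> y"
    by (rule local_adj_add[OF open_WW holo_jac_pull[OF F] holo_jac_pull[OF G] ay])
  ultimately show "jac (fst y) * local_pull \<Phi> J (local_adj (\<lambda>k y. F k y + G k y)) \<nu> y
      = local_adj (\<lambda>k y. jac (fst y) * local_pull \<Phi> J (\<lambda>k y. F k y + G k y) k y) \<nu> y"
    using assms(3,4) y by (simp add: adj_compatible_def distrib_left)
qed

text \<open>The operations commute with multiplication by \<open>t\<close>, so only the coefficient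
  of order one lower matters, and at \<open>\<nu> = 0\<close> nothing has to be known.\<close>

lemma adj_compatible_shift:
  assumes F: "\<And>k. holo (F k) UNIV" and c: "\<And>k. Suc k = \<nu> \<Longrightarrow> adj_compatible F k"
  shows "adj_compatible (shift F) \<nu>"
  unfolding adj_compatible_def
proof
  fix y assume y: "y \<in> WW"
  note ay = antipode_in_WW[OF y]
  note pull_shift = local_pull_shift[OF open_UNIV, unfolded pull_domain_UNIV]
  have "local_adj (shift F) = shift (local_adj F)"
    by (intro ext local_adj_shift[OF open_UNIV F]) simp
  then have "local_pull \<Phi> J (local_adj (shift F)) \<nu> y = shift (local_pull \<Phi> J (local_adj F)) \<nu> y"
    using pull_shift[OF holo_local_adj_UNIV[OF F] y] by simp
  moreover have "local_adj (\<lambda>k y. jac (fst y) * local_pull \<Phi> J (shift F) k y) \<nu> y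
      = local_adj (shift (\<lambda>k y. jac (fst y) * local_pull \<Phi> J F k y)) \<nu> y"
  proof (rule local_adj_cong[OF open_WW holo_jac_pull[OF holo_shift[OF F]] _ ay])
    fix k y assume "y \<in> WW"
    then show "jac (fst y) * local_pull \<Phi> J (shift F) k y = shift (\<lambda>k y. jac (fst y) * local_pull \<Phi> J F k y) k y"
      by (cases k) (simp_all add: pull_shift[OF F])
  qed
  moreover have "\<dots> = shift (local_adj (\<lambda>k y. jac (fst y) * local_pull \<Phi> J F k y)) \<nu> y"
    by (rule local_adj_shift[OF open_WW holo_jac_pull[OF F] ay])
  ultimately show "jac (fst y) * local_pull \<Phi> J (local_adj (shift F)) \<nu> y
      = local_adj (\<lambda>k y. jac (fst y) * local_pull \<Phi> J (shift F) k y) \<nu> y"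
    using c y by (cases \<nu>) (simp_all add: adj_compatible_def)
qed

text \<open>For a function of \<open>z\<close> alone the adjoint changes nothing and the pull-back
  is mere substitution; multiplied by the Jacobian determinant it is still a function of
  \<open>w\<close> alone.\<close>

lemma adj_compatible_base:
  assumes p: "holo p UNIV"
  shows "adj_compatible (const_series (\<lambda>y. p (fst y))) \<nu>"
  unfolding adj_compatible_def
proof
  fix y assume y: "y \<in> WW"
  note ay = antipode_in_WW[OF y]
  define F where "F = const_series (\<lambda>y :: 'n pt. p (fst y))"
  have pf: "holo (\<lambda>y :: 'n pt. p (fst y)) UNIV"
    by (rule holo_compose[OF p]) (auto intro!: holo_map_intros)
  then have F: "holo (F k) UNIV" for k by (simp add: F_def const_series_def)
  have Fb: "F k y = const_series p k (fst y)" for k y by (simp add: F_def const_series_def)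
  have aF: "local_adj F = F"
    by (intro ext local_adj_base[OF open_UNIV F Fb]) simp
  have pull: "local_pull \<Phi> J F k y = const_series p k (\<Phi> (fst y))" if "y \<in> WW" for k y
  proof -
    have "local_pull \<Phi> J F k y = F k (pm (y, 0))"
      unfolding local_pull_def
    proof (rule hol_op.expo_annihilated[OF op_E _ holo_pm[OF F] Y_base[OF that]])
      fix k x
      have "dirderiv (0, base_dir i) (\<lambda>x. F k (pm x)) = (\<lambda>x. 0)" for i
        by (simp add: fun_eq_iff dirderiv_def Fb fst_pm)
      then show "pairop base_dir2 fibre_dir2 (\<lambda>x. F k (pm x)) x = 0" by (simp add: pairop_def)
    qed
    then show ?thesis by (simp add: Fb fst_pm)
  qed
  define G where "G k w = jac w * const_series p k (\<Phi> w)" for k w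
  have hG: "holo (G k) W" for k
  proof -
    have "holo (\<lambda>w. const_series p k (\<Phi> w)) W"
      by (rule holo_compose[of _ UNIV, OF _ holo_Phi]) (auto simp: const_series_def p)
    then show ?thesis unfolding G_def[abs_def] by (intro holo_mult holo_jac)
  qed
  have "local_adj (\<lambda>k y. jac (fst y) * local_pull \<Phi> J F k y) \<nu> y = local_adj (\<lambda>k y. G k (fst y)) \<nu> y"
    by (rule local_adj_cong[OF open_WW holo_jac_pull[OF F] _ ay]) (simp add: G_def pull)
  also have "\<dots> = G \<nu> (fst y)"
    by (rule local_adj_base[OF open_WW holo_base_WW[OF hG] refl ay])
  finally show "jac (fst y) * local_pull \<Phi> J (local_adj (const_series (\<lambda>y. p (fst y)))) \<nu> y
      = local_adj (\<lambda>k y. jac (fst y) * local_pull \<Phi> J (const_series (\<lambda>y. p (fst y))) k y) \<nu> y"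
    unfolding F_def[symmetric] by (simp add: aF pull[OF y] G_def)
qed

text \<open>On the left the adjoint puts \<open>-\<zeta>\<^sub>i\<close> in front, and the pull-back
  makes it the vector field with coefficients \<open>v i j\<close>. On the right the pull-back of
  \<open>F\<close> composed with \<open>\<zeta>\<^sub>i\<close> is a sum of
  \<open>\<mu>\<^sub>j\<close> times symbols with \<open>v i j\<close> as right factor; the adjoint
  moves \<open>v i j\<close> to the left. The two sides then differ only by derivatives of
  \<open>v i j\<close> times the determinant, and their sum is zero.\<close>

lemma adj_compatible_zeta:
  assumes F: "\<And>k. holo (F k) UNIV" and comp: "\<And>\<nu>. adj_compatible F \<nu>"
  shows "adj_compatible (\<lambda>k y. snd y $ i * F k y) \<nu>"
  unfolding adj_compatible_def
proof
  fix y assume y: "y \<in> WW"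
  note ay = antipode_in_WW[OF y]
  define A where "A = local_adj F"
  have A: "holo (A k) UNIV" for k unfolding A_def by (rule holo_local_adj_UNIV[OF F])
  note dA = holo_dirderiv[OF A open_UNIV]
  define L where "L = E (\<lambda>k x. A k (pm x))"
  have L: "L = local_pull \<Phi> J A" by (simp add: fun_eq_iff L_def local_pull_eq_E)
  have hL: "holo (L k) WW" for k unfolding L_def by (rule E_holo[OF holo_pm[OF A]])
  have hs: "holo (\<lambda>y. snd y $ i * F k y) UNIV" for k by (intro holo_mult holo_nth holo_map_intros F)
  have hv: "holo (\<lambda>y. v i j (fst y) * jac (fst y)) WW" for j
    by (intro holo_mult holo_base_WW holo_v holo_jac)

  have adjF: "local_adj (\<lambda>k y. snd y $ i * F k y) k y = - (snd y $ i * A k y + shift (\<lambda>k. dirderiv (base_dir i) (A k)) k y)" for k y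
    using local_adj_mult_snd[OF open_UNIV F, where y = y and i = i and \<nu> = k] by (simp add: A_def)
  have hz: "holo (\<lambda>x. snd (pm x) $ i * A k (pm x)) Y" for k
    by (intro holo_mult holo_nth holo_map_snd holo_map_pm holo_pm A)
  have hd: "holo (\<lambda>x. dirderiv (base_dir i) (A k) (pm x)) Y" for k by (rule holo_pm[OF dA])
  have sh: "(\<lambda>k x. shift (\<lambda>k. dirderiv (base_dir i) (A k)) k (pm x)) = shift (\<lambda>k x. dirderiv (base_dir i) (A k) (pm x))"
    by (auto simp: fun_eq_iff shift_def split: nat.splits)
  have "local_pull \<Phi> J (local_adj (\<lambda>k y. snd y $ i * F k y)) \<nu> y
      = E (\<lambda>k x. - (snd (pm x) $ i * A k (pm x) + shift (\<lambda>k x. dirderiv (base_dir i) (A k) (pm x)) k x)) \<nu> y"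
    unfolding local_pull_eq_E adjF sh[symmetric] ..
  also have "\<dots> = - E (\<lambda>k x. snd (pm x) $ i * A k (pm x) + shift (\<lambda>k x. dirderiv (base_dir i) (A k) (pm x)) k x) \<nu> y"
    by (rule E_minus[OF holo_add[OF hz holo_shift[OF hd]] y])
  also have "\<dots> = - (E (\<lambda>k x. snd (pm x) $ i * A k (pm x)) \<nu> y + shift (E (\<lambda>k x. dirderiv (base_dir i) (A k) (pm x))) \<nu> y)"
    using E_add[OF hz holo_shift[OF hd] y, where \<nu> = \<nu>] E_shift[OF hd y, where \<nu> = \<nu>] by simp
  also have "\<dots> = - ((\<Sum>j\<in>UNIV. snd y $ j * v i j (fst y)) * L \<nu> y
      + shift (\<lambda>k y. \<Sum>a\<in>UNIV. v i a (fst y) * dirderiv (base_dir a) (L k) y) \<nu> y)"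
    unfolding L_def by (subst pull_zeta_comp[OF A y]) (rule refl)
  finally have lhs: "local_pull \<Phi> J (local_adj (\<lambda>k y. snd y $ i * F k y)) \<nu> y = \<dots>" .

  \<comment> \<open>Collects what multiplies \<open>\<mu>\<^sub>j\<close> in the pull-back of
    \<open>\<zeta>\<^sub>i F\<close>, including the determinant.\<close>
  define Q where "Q j = pull_function (v i j) F" for j
  have hQ: "holo (Q j k) WW" for j k unfolding Q_def by (rule holo_pull_function[OF F holo_v])
  \<comment> \<open>The hypothesis on \<open>F\<close> is used here, and for every power of
    \<open>t\<close>.\<close>
  have one: "local_adj (pull_function (\<lambda>w. 1) F) k y = jac (fst y) * L k y" if "y \<in> WW" for k y
  proof -
    have "pull_function (\<lambda>w. 1) F = (\<lambda>k y. jac (fst y) * local_pull \<Phi> J F k y)"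
      by (simp add: fun_eq_iff pull_function_def local_pull_eq_E)
    then show ?thesis using comp[of k] that by (simp add: adj_compatible_def L A_def)
  qed
  have adjQ: "local_adj (Q j) k y = (v i j (fst y) * jac (fst y)) * L k y" if "y \<in> WW" for j k y
    unfolding Q_def by (simp add: local_adj_pull_function[OF F holo_v that] one[OF that] mult.assoc)
  have dQ: "dirderiv (base_dir j) (local_adj (Q j) k) y
      = (v i j (fst y) * jac (fst y)) * dirderiv (base_dir j) (L k) y
        + dirderiv (axis j 1) (\<lambda>w. v i j w * jac w) (fst y) * L k y" for j k
  proof -
    have "dirderiv (base_dir j) (local_adj (Q j) k) y
        = dirderiv (base_dir j) (\<lambda>y. (v i j (fst y) * jac (fst y)) * L k y) y"
      by (rule dirderiv_cong[OF open_WW y adjQ])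
    also have "\<dots> = (v i j (fst y) * jac (fst y)) * dirderiv (base_dir j) (L k) y
        + dirderiv (base_dir j) (\<lambda>y. v i j (fst y) * jac (fst y)) y * L k y"
      by (rule dirderiv_mult[OF hv hL y])
    also have "dirderiv (base_dir j) (\<lambda>y. v i j (fst y) * jac (fst y)) y
        = dirderiv (axis j 1) (\<lambda>w. v i j w * jac w) (fst y)"
      by (rule dirderiv_affine[where f = "\<lambda>w. v i j w * jac w" and g = fst]) simp
    finally show ?thesis .
  qed
  have hsQ: "holo (\<lambda>y. snd y $ j * Q j k y) WW" for j k by (intro holo_mult holo_nth holo_map_intros hQ)
  have "local_adj (\<lambda>k y. jac (fst y) * local_pull \<Phi> J (\<lambda>k y. snd y $ i * F k y) k y) \<nu> y
      = local_adj (\<lambda>k y. \<Sum>j\<in>UNIV. snd y $ j * Q j k y) \<nu> y"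
  proof (rule local_adj_cong[OF open_WW holo_jac_pull[OF hs] _ ay])
    fix k y assume y: "y \<in> WW"
    have "E (\<lambda>k x. dPsi i j (shifted x) * F k (pm x)) k y = E (\<lambda>k x. v i j (\<Psi> (shifted x)) * F k (pm x)) k y" for j
    proof (rule E_cong[OF _ y])
      show "holo (\<lambda>x. dPsi i j (shifted x) * F k (pm x)) Y" for k
        by (intro holo_mult holo_pm F holo_compose[OF holo_dPsi holo_map_shifted Y_D(2)])
    qed (simp add: v_def Phi_Psi Y_D(2))
    then show "jac (fst y) * local_pull \<Phi> J (\<lambda>k y. snd y $ i * F k y) k y = (\<Sum>j\<in>UNIV. snd y $ j * Q j k y)"
      by (simp add: local_pull_eq_E pull_mult_zeta[OF F y] Q_def pull_function_def sum_distrib_left mult.left_commute)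
  qed
  also have "\<dots> = (\<Sum>j\<in>UNIV. local_adj (\<lambda>k y. snd y $ j * Q j k y) \<nu> y)"
    by (rule local_adj_sum[OF open_WW finite hsQ ay])
  also have "\<dots> = (\<Sum>j\<in>UNIV. - (snd y $ j * local_adj (Q j) \<nu> y + shift (\<lambda>\<nu>. dirderiv (base_dir j) (local_adj (Q j) \<nu>)) \<nu> y))"
    by (intro sum.cong refl local_adj_mult_snd[OF open_WW hQ ay])
  also have "\<dots> = - ((\<Sum>j\<in>UNIV. snd y $ j * local_adj (Q j) \<nu> y)
      + shift (\<lambda>k y. \<Sum>j\<in>UNIV. dirderiv (base_dir j) (local_adj (Q j) k) y) \<nu> y)"
    by (simp only: sum_negf sum.distrib shift_sum)
  also have "(\<Sum>j\<in>UNIV. snd y $ j * local_adj (Q j) \<nu> y) = jac (fst y) * ((\<Sum>j\<in>UNIV. snd y $ j * v i j (fst y)) * L \<nu> y)"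
    by (simp add: adjQ[OF y] sum_distrib_left sum_distrib_right mult_ac)
  also have "shift (\<lambda>k y. \<Sum>j\<in>UNIV. dirderiv (base_dir j) (local_adj (Q j) k) y) \<nu> y
      = jac (fst y) * shift (\<lambda>k y. \<Sum>a\<in>UNIV. v i a (fst y) * dirderiv (base_dir a) (L k) y) \<nu> y"
    unfolding shift_cmult
  proof (rule shift_cong)
    fix k
    have "(\<Sum>j\<in>UNIV. dirderiv (base_dir j) (local_adj (Q j) k) y)
        = (\<Sum>j\<in>UNIV. (v i j (fst y) * jac (fst y)) * dirderiv (base_dir j) (L k) y)
          + (\<Sum>j\<in>UNIV. dirderiv (axis j 1) (\<lambda>w. v i j w * jac w) (fst y)) * L k y"
      by (simp add: dQ sum.distrib sum_distrib_right)
    \<comment> \<open>This is where the determinant is indispensable: it makes the vector field free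
      of divergence.\<close>
    also have "(\<Sum>j\<in>UNIV. dirderiv (axis j 1) (\<lambda>w. v i j w * jac w) (fst y)) = 0"
      by (rule piola_identity) (use y in \<open>simp add: WW_def\<close>)
    finally show "(\<Sum>j\<in>UNIV. dirderiv (base_dir j) (local_adj (Q j) k) y)
        = jac (fst y) * (\<Sum>a\<in>UNIV. v i a (fst y) * dirderiv (base_dir a) (L k) y)"
      by (simp add: sum_distrib_left mult_ac)
  qed
  finally show "jac (fst y) * local_pull \<Phi> J (local_adj (\<lambda>k y. snd y $ i * F k y)) \<nu> y
      = local_adj (\<lambda>k y. jac (fst y) * local_pull \<Phi> J (\<lambda>k y. snd y $ i * F k y) k y) \<nu> y"
    unfolding lhs by (simp add: distrib_left right_diff_distrib)
qed

lemma adj_compatible_fibre_poly: "f \<in> fibre_poly \<Longrightarrow> adj_compatible (const_series f) \<nu>"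
proof (induction arbitrary: \<nu> rule: fibre_poly.induct)
  case (base p)
  then show ?case by (rule adj_compatible_base)
next
  case (add f h)
  have hs: "holo (const_series f k) UNIV" "holo (const_series h k) UNIV" for k
    using holo_fibre_poly add.hyps by (auto simp: const_series_def)
  have "const_series (\<lambda>y. f y + h y) = (\<lambda>k y. const_series f k y + const_series h k y)"
    by (simp add: fun_eq_iff const_series_def)
  then show ?case using adj_compatible_add[OF hs add.IH] by simp
next
  case (zeta f i)
  have hs: "holo (const_series f k) UNIV" for k
    using holo_fibre_poly zeta.hyps by (auto simp: const_series_def)
  have "const_series (\<lambda>y. snd y $ i * f y) = (\<lambda>k y. snd y $ i * const_series f k y)"
    by (simp add: fun_eq_iff const_series_def)
  then show ?case using adj_compatible_zeta[OF hs zeta.IH] by simp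
qed

text \<open>The series is its constant term plus \<open>t\<close> times the series of the remaining
  coefficients, to which the claim for a smaller \<open>\<nu>\<close> applies.\<close>

lemma adj_compatible_poly_series:
  "(\<And>k. F k \<in> fibre_poly) \<Longrightarrow> adj_compatible F \<nu>"
proof (induction \<nu> arbitrary: F rule: less_induct)
  case (less \<nu>)
  let ?T = "\<lambda>k. F (Suc k)"
  have hT: "holo (?T k) UNIV" for k by (rule holo_fibre_poly[OF less.prems])
  have h0: "holo (const_series (F 0) k) UNIV" for k
    using holo_fibre_poly[OF less.prems] by (auto simp: const_series_def)
  have eq: "(\<lambda>k y. const_series (F 0) k y + shift ?T k y) = F"
    by (auto simp: fun_eq_iff const_series_def shift_def split: nat.splits)
  have "adj_compatible (shift ?T) \<nu>"
    by (rule adj_compatible_shift[OF hT], rule less.IH) (use less.prems in auto)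
  from adj_compatible_add[OF h0 holo_shift[OF hT] adj_compatible_fibre_poly[OF less.prems] this]
  show ?case unfolding eq .
qed

text \<open>With vanishing auxiliary variables the pull-back map is linear in the fibre.\<close>

lemma pm_antipode: "pm (antipode y, 0) = antipode (pm (y, 0))"
proof -
  have "snd (pm (antipode y, 0)) = - snd (pm (y, 0))"
    by (simp add: vec_eq_iff snd_pm g_def Jx_def shifted_def sum_negf)
  moreover have "fst (pm (antipode y, 0)) = fst (pm (y, 0))" by (simp add: fst_pm)
  ultimately show ?thesis by (intro prod_eqI) simp_all
qed

text \<open>Both sides read \<open>F\<close> at the same point, the antipode of
  \<open>pm (y, 0)\<close>: on the left the sign change follows the coordinate change, on the right
  it precedes it, and the two commute. So one family of Taylor polynomials at that point serves both
  sides. The remainders drop out because adjoint, pull-back and multiplication by the determinant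
  preserve the order filtration.\<close>

theorem local_pull_adj:
  assumes X: "open X" and F: "\<And>k. holo (F k) X" and y: "y \<in> WW" "antipode (pm (y, 0)) \<in> X"
  shows "jac (fst y) * local_pull \<Phi> J (local_adj F) \<nu> y
    = local_adj (\<lambda>k y. jac (fst y) * local_pull \<Phi> J F k y) \<nu> y"
proof -
  interpret pt: coordinates pt_coord "\<lambda>i. case i of Inl j \<Rightarrow> base_dir j | Inr j \<Rightarrow> fibre_dir j"
    by (rule coordinates_pt)
  let ?x = "antipode (pm (y, 0))" and ?M = "2 * \<nu> + 1"
  have "\<exists>p. p \<in> polyfun pt_coord \<and> vord ?M (\<lambda>x. F k x - p x) ?x" for k
    using pt.polynomial_approximation[OF X y(2) F holo_pt_coord] by metis
  then obtain p where p: "\<And>k. p k \<in> polyfun pt_coord" "\<And>k. vord ?M (\<lambda>x. F k x - p k x) ?x"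
    by metis
  have pX: "holo (p k) X" for k by (rule holo_polyfun[OF p(1) holo_pt_coord])
  define G where "G k x = F k x - p k x" for k x
  have G: "holo (G k) X" for k unfolding G_def by (intro holo_diff F pX)
  have vG: "vord (?M - 2 * k) (G k) ?x" for k
    unfolding G_def by (rule vord_mono[OF p(2)]) simp
  have FpG: "F k x = p k x + G k x" for k x by (simp add: G_def)
  note oX = open_antipode[OF X]
  have yD: "y \<in> pull_domain (antipode -` X)" using y by (simp add: pull_domain_def)
  have ayD: "antipode y \<in> pull_domain X"
    using y antipode_in_WW by (simp add: pull_domain_def pm_antipode)
  have DW: "pull_domain X \<subseteq> WW" by (auto simp: pull_domain_def)

  have "local_pull \<Phi> J (local_adj F) \<nu> y = local_pull \<Phi> J (\<lambda>k y. local_adj p k y + local_adj G k y) \<nu> y"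
  proof (rule local_pull_cong[OF oX local_adj_holo[OF X F] _ yD])
    fix k y assume "y \<in> antipode -` X"
    then have "antipode y \<in> X" by simp
    have "local_adj (\<lambda>k y. p k y + G k y) k y = local_adj p k y + local_adj G k y"
      by (rule local_adj_add[OF X pX G \<open>antipode y \<in> X\<close>])
    then show "local_adj F k y = local_adj p k y + local_adj G k y" by (simp flip: FpG)
  qed
  also have "\<dots> = local_pull \<Phi> J (local_adj p) \<nu> y + local_pull \<Phi> J (local_adj G) \<nu> y"
    by (rule local_pull_add[OF oX local_adj_holo[OF X pX] local_adj_holo[OF X G] yD])
  also have "local_pull \<Phi> J (local_adj G) \<nu> y = 0"
    by (rule vord_eq_0[OF vord_local_pull[OF vord_local_adj[OF vG] y(1), of \<nu>]]) simp
  finally have lhs: "local_pull \<Phi> J (local_adj F) \<nu> y = local_pull \<Phi> J (local_adj p) \<nu> y" by simp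

  have hJ: "holo (\<lambda>y. jac (fst y) * local_pull \<Phi> J H k y) (pull_domain X)" if "\<And>k. holo (H k) X" for H k
    by (intro holo_mult holo_on_subset[OF holo_base_WW[OF holo_jac] DW] local_pull_holo[OF X that])
  have "local_adj (\<lambda>k y. jac (fst y) * local_pull \<Phi> J F k y) \<nu> y
      = local_adj (\<lambda>k y. jac (fst y) * local_pull \<Phi> J p k y + jac (fst y) * local_pull \<Phi> J G k y) \<nu> y"
  proof (rule local_adj_cong[OF open_pull_domain[OF X] hJ[OF F] _ ayD])
    fix k y assume yX: "y \<in> pull_domain X"
    have "local_pull \<Phi> J (\<lambda>k y. p k y + G k y) k y = local_pull \<Phi> J p k y + local_pull \<Phi> J G k y"
      by (rule local_pull_add[OF X pX G yX])
    then show "jac (fst y) * local_pull \<Phi> J F k y = jac (fst y) * local_pull \<Phi> J p k y + jac (fst y) * local_pull \<Phi> J G k y"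
      by (simp add: distrib_left flip: FpG)
  qed
  also have "\<dots> = local_adj (\<lambda>k y. jac (fst y) * local_pull \<Phi> J p k y) \<nu> y
      + local_adj (\<lambda>k y. jac (fst y) * local_pull \<Phi> J G k y) \<nu> y"
    by (rule local_adj_add[OF open_pull_domain[OF X] hJ[OF pX] hJ[OF G] ayD])
  also have "local_adj (\<lambda>k y. jac (fst y) * local_pull \<Phi> J G k y) \<nu> y = 0"
  proof -
    note ay = antipode_in_WW[OF y(1)]
    have vG': "vord (?M - 2 * k) (G k) (pm (antipode y, 0))" for k using vG by (simp add: pm_antipode)
    from vord_mult[OF vord_0[OF holo_base_WW[OF holo_jac] open_WW ay] vord_local_pull[OF vG' ay]]
    have "vord (?M - 2 * k) (\<lambda>y. jac (fst y) * local_pull \<Phi> J G k y) (antipode y)" for k by simp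
    from vord_eq_0[OF vord_local_adj[OF this, of \<nu>]] show ?thesis by simp
  qed
  finally have rhs: "local_adj (\<lambda>k y. jac (fst y) * local_pull \<Phi> J F k y) \<nu> y
      = local_adj (\<lambda>k y. jac (fst y) * local_pull \<Phi> J p k y) \<nu> y" by simp
  have "adj_compatible p \<nu>" by (rule adj_compatible_poly_series) (rule polyfun_fibre_poly[OF p(1)])
  then show ?thesis using y(1) by (simp add: lhs rhs adj_compatible_def)
qed

end

section \<open>Domains under a coordinate change\<close>

lemma norm_le_card_maxnorm: "norm (x :: complex^'n) \<le> of_nat CARD('n) * maxnorm x"
proof -
  have "norm x \<le> (\<Sum>i\<in>UNIV. cmod (x $ i))"
    unfolding norm_vec_def by (rule L2_set_le_sum) simp
  also have "\<dots> \<le> of_nat CARD('n) * maxnorm x"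
    by (rule sum_bounded_above) (rule cmod_le_maxnorm)
  finally show ?thesis .
qed

text \<open>Shrinking the fibre variable towards 0 stays inside a conic set, so its closure contains
  the zero section over the closure of its projection.\<close>

lemma closure_fst_conic:
  fixes \<Omega> :: "'n::finite pt set"
  assumes conic: "fibre_conic \<Omega>" and z: "z \<in> closure (fst ` \<Omega>)"
  shows "(z, 0) \<in> closure \<Omega>"
  unfolding closure_approachable
proof (intro allI impI)
  fix e :: real assume e: "e > 0"
  then obtain z' \<zeta>' where *: "(z', \<zeta>') \<in> \<Omega>" "dist z' z < e / 2"
    using z[unfolded closure_approachable, rule_format, of "e / 2"] by auto
  define c where "c = e / (2 * (norm \<zeta>' + 1))"
  have n: "norm \<zeta>' + 1 > 0" by (simp add: add_nonneg_pos)
  then have c: "c > 0" using e by (simp add: c_def)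
  have "c * norm \<zeta>' \<le> c * (norm \<zeta>' + 1)" using c by simp
  also have "\<dots> = e / 2" using n by (simp add: c_def field_simps)
  finally have "norm (c *\<^sub>R \<zeta>') \<le> e / 2" using c by simp
  moreover have "dist (z', c *\<^sub>R \<zeta>') (z, 0) \<le> dist z' z + norm (c *\<^sub>R \<zeta>')"
    by (simp add: dist_prod_def sqrt_sum_squares_le_sum)
  ultimately have "dist (z', c *\<^sub>R \<zeta>') (z, 0) < e" using *(2) by simp
  moreover have "(z', c *\<^sub>R \<zeta>') \<in> \<Omega>" using conic *(1) c by (simp add: fibre_conic_def)
  ultimately show "\<exists>y\<in>\<Omega>. dist y (z, 0) < e" by blast
qed

lemma fst_antipodal: "fst ` antipodal \<Omega> = fst ` \<Omega>"
proof (intro set_eqI iffI)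
  fix z assume "z \<in> fst ` \<Omega>"
  then obtain \<zeta> where "(z, \<zeta>) \<in> \<Omega>" by auto
  then have "(z, - \<zeta>) \<in> antipodal \<Omega>" by (simp add: antipodal_def)
  then show "z \<in> fst ` antipodal \<Omega>" by (metis fst_conv imageI)
qed (force simp: antipodal_def)

text \<open>The projection ignores the conic scaling, hence it lies in the projection of a compact
  set. The zero section carries the hypothesis on the closure of \<open>\<Omega>\<close> over to the
  closure of the projection.\<close>

lemma base_relcompact:
  fixes \<Omega> :: "'n::finite pt set"
  assumes conic: "fibre_conic \<Omega>" and rel: "conically_relcompact_in \<Omega> UNIV" and U: "fst ` closure \<Omega> \<subseteq> U"
  shows "compact (closure (fst ` \<Omega>))" "closure (fst ` \<Omega>) \<subseteq> U"
proof -
  obtain K where K: "compact K" "\<Omega> \<subseteq> {(z, c *\<^sub>R \<zeta>) |z \<zeta> c. (z, \<zeta>) \<in> K \<and> 0 < c}"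
    using rel unfolding conically_relcompact_in_def by blast
  have "fst ` \<Omega> \<subseteq> fst ` K" using K(2) by force
  moreover have "compact (fst ` K)" by (intro compact_continuous_image continuous_intros K)
  ultimately have "bounded (fst ` \<Omega>)" using bounded_subset compact_imp_bounded by blast
  then show "compact (closure (fst ` \<Omega>))" by simp
  show "closure (fst ` \<Omega>) \<subseteq> U"
    using closure_fst_conic[OF conic] U by force
qed

context coord_pullback
begin

text \<open>The passage from cotangent coordinates \<open>(w, \<mu>)\<close> back to
  \<open>(z, \<zeta>)\<close>: restricted to zero auxiliary variables, the pull-back map is the
  inverse of the change used in \<open>cotangent_coords\<close>.\<close>

definition cot :: "'n pt \<Rightarrow> 'n pt" where "cot y = pm (y, 0)"

lemma fst_cot: "fst (cot y) = \<Phi> (fst y)"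
  by (simp add: cot_def fst_pm)

lemma snd_cot:
  assumes "y \<in> WW"
  shows "snd (cot y) $ i = (\<Sum>j\<in>UNIV. snd y $ j * v i j (fst y))"
  using g_expansion[OF Y_base[OF assms], of i] by (simp add: cot_def snd_pm)

lemma snd_from_cot:
  assumes y: "y \<in> WW"
  shows "snd y $ j = (\<Sum>k\<in>UNIV. dPhi j k (fst y) * snd (cot y) $ k)"
proof -
  have w: "fst y \<in> W" using y by (simp add: WW_def)
  have "(\<Sum>k\<in>UNIV. dPhi j k (fst y) * snd (cot y) $ k)
      = (\<Sum>k\<in>UNIV. \<Sum>l\<in>UNIV. snd y $ l * (dPhi j k (fst y) * v k l (fst y)))"
    by (simp add: snd_cot[OF y] sum_distrib_left mult_ac)
  also have "\<dots> = (\<Sum>l\<in>UNIV. snd y $ l * (\<Sum>k\<in>UNIV. dPhi j k (fst y) * v k l (fst y)))"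
    by (subst sum.swap) (simp add: sum_distrib_left)
  finally show ?thesis
    by (simp add: dPhi_dPsi[OF w] if_distrib[of "(*) _"] cong: if_cong)
qed

lemma cotangent_coordsE:
  assumes "(w, \<mu>) \<in> cotangent_coords W \<Phi> \<Omega>"
  shows "w \<in> W" "cot (w, \<mu>) \<in> \<Omega>"
proof -
  obtain \<zeta> where *: "w \<in> W" "(\<Phi> w, \<zeta>) \<in> \<Omega>" "\<mu> = transpose (cjacobian \<Phi> w) *v \<zeta>"
    using assms unfolding cotangent_coords_def by auto
  show "w \<in> W" by fact
  have wW: "(w, \<mu>) \<in> WW" using * by (simp add: WW_def)
  have mu: "\<mu> $ j = (\<Sum>k\<in>UNIV. dPhi j k w * \<zeta> $ k)" for j
    by (simp add: *(3) matrix_vector_mult_def transpose_def cjacobian_nth)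
  have "snd (cot (w, \<mu>)) $ i = \<zeta> $ i" for i
  proof -
    have "snd (cot (w, \<mu>)) $ i = (\<Sum>j\<in>UNIV. \<Sum>k\<in>UNIV. \<zeta> $ k * (v i j w * dPhi j k w))"
      by (simp add: snd_cot[OF wW] mu sum_distrib_left sum_distrib_right mult_ac)
    also have "\<dots> = (\<Sum>k\<in>UNIV. \<zeta> $ k * (\<Sum>j\<in>UNIV. v i j w * dPhi j k w))"
      by (subst sum.swap) (simp add: sum_distrib_left)
    finally show ?thesis
      by (simp add: dPsi_dPhi[OF *(1)] if_distrib[of "(*) _"] cong: if_cong)
  qed
  then have "cot (w, \<mu>) = (\<Phi> w, \<zeta>)"
    by (intro prod_eqI) (simp_all add: fst_cot vec_eq_iff)
  with * show "cot (w, \<mu>) \<in> \<Omega>" by simp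
qed

lemma continuous_on_cot: "continuous_on WW cot"
proof -
  have "holo_map (\<lambda>y. pm (y, 0)) WW"
    by (rule holo_map_compose[OF holo_map_pm]) (auto intro!: holo_map_Pair Y_base)
  then show ?thesis unfolding cot_def[abs_def] by (rule holo_map_continuous_on)
qed

text \<open>All data that depend on \<open>w\<close> in one continuous map, so that a single
  compactness argument bounds them and makes them uniformly continuous.\<close>

definition frame :: "complex^'n \<Rightarrow> (complex^'n) \<times> (complex^'n^'n) \<times> (complex^'n^'n)" where
  "frame w = (\<Phi> w, \<chi> i j. v i j w, \<chi> j k. dPhi j k w)"

lemma continuous_on_frame: "continuous_on W frame"
  unfolding frame_def[abs_def]
  by (intro continuous_intros holo_map_continuous_on[OF holo_Phi] holo_continuous_on[OF holo_v] holo_continuous_on[OF holo_dPhi])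

lemma frame_components:
  "maxnorm (\<Phi> w - \<Phi> w') \<le> dist (frame w) (frame w')"
  "cmod (v i j w - v i j w') \<le> dist (frame w) (frame w')"
  "cmod (v i j w) \<le> norm (frame w)"
  "cmod (dPhi j k w) \<le> norm (frame w)"
proof -
  have 1: "norm (A $ i $ j) \<le> norm A" for A :: "complex^'n^'n" and i j
    using Finite_Cartesian_Product.norm_nth_le[of "A $ i" j] Finite_Cartesian_Product.norm_nth_le[of A i] by simp
  have 2: "norm (fst x) \<le> norm x" "norm (snd x) \<le> norm x" for x :: "'b::real_normed_vector \<times> 'c::real_normed_vector"
    by (metis norm_fst_le prod.collapse, metis norm_snd_le prod.collapse)
  show "maxnorm (\<Phi> w - \<Phi> w') \<le> dist (frame w) (frame w')"
    using maxnorm_le_norm[of "\<Phi> w - \<Phi> w'"] 2(1)[of "frame w - frame w'"] by (simp add: frame_def dist_norm)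
  show "cmod (v i j w - v i j w') \<le> dist (frame w) (frame w')"
    using 1[of "fst (snd (frame w - frame w'))" i j] 2(1)[of "snd (frame w - frame w')"] 2(2)[of "frame w - frame w'"]
    by (simp add: frame_def dist_norm)
  show "cmod (v i j w) \<le> norm (frame w)"
    using 1[of "fst (snd (frame w))" i j] 2(1)[of "snd (frame w)"] 2(2)[of "frame w"] by (simp add: frame_def)
  show "cmod (dPhi j k w) \<le> norm (frame w)"
    using 1[of "snd (snd (frame w))" j k] 2(2)[of "snd (frame w)"] 2(2)[of "frame w"] by (simp add: frame_def)
qed

lemma maxnorm_snd_le_cot:
  assumes "y \<in> WW" "norm (frame (fst y)) \<le> M"
  shows "maxnorm (snd y) \<le> of_nat CARD('n) * M * maxnorm (snd (cot y))"
proof (rule maxnorm_le)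
  fix j
  have "cmod (snd y $ j) \<le> (\<Sum>k\<in>UNIV. cmod (dPhi j k (fst y) * snd (cot y) $ k))"
    unfolding snd_from_cot[OF assms(1), of j] by (rule norm_sum)
  also have "\<dots> \<le> of_nat CARD('n) * (M * maxnorm (snd (cot y)))"
  proof (rule sum_bounded_above)
    fix k
    show "cmod (dPhi j k (fst y) * snd (cot y) $ k) \<le> M * maxnorm (snd (cot y))"
      unfolding norm_mult
      by (intro mult_mono cmod_le_maxnorm order_trans[OF frame_components(4) assms(2)])
        (use order_trans[OF norm_ge_zero assms(2)] in auto)
  qed
  finally show "cmod (snd y $ j) \<le> of_nat CARD('n) * M * maxnorm (snd (cot y))" by (simp add: mult_ac)
qed

text \<open>A displacement of relative size \<open>\<rho>\<close> in \<open>(w, \<mu>)\<close> moves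
  \<open>z\<close> little and moves \<open>\<zeta>\<close> by a small multiple of its own norm,
  because the coordinate change is linear in the fibre with matrices bounded over a compact
  neighbourhood of the base.\<close>

lemma cot_symb_dom:
  fixes \<Omega> :: "'n pt set"
  assumes comp: "compact (closure (fst ` \<Omega>))" and sub: "closure (fst ` \<Omega>) \<subseteq> U"
    and d0: "0 < d0" and r0: "0 < \<rho>0" "\<rho>0 < 1"
  obtains d \<rho> where "0 < d" "0 < \<rho>" "\<rho> < 1"
    "\<forall>y\<in>symb_dom (cotangent_coords W \<Phi> \<Omega>) d \<rho>. y \<in> WW \<and> cot y \<in> symb_dom \<Omega> d0 \<rho>0"
proof -
  define n where "n = real CARD('n)"
  have n: "1 \<le> n" unfolding n_def using zero_less_card_finite[where 'a = 'n] by linarith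
  define L where "L = \<Psi> ` closure (fst ` \<Omega>)"
  have LW: "L \<subseteq> W" using sub Psi_in by (auto simp: L_def)
  have L: "compact L" unfolding L_def
    by (intro compact_continuous_image comp continuous_on_subset[OF holo_map_continuous_on[OF holo_Psi] sub])
  obtain e where e: "0 < e" "(\<Union>x\<in>L. cball x e) \<subseteq> W"
    using compact_subset_open_imp_cball_epsilon_subset[OF L open_W LW] by blast
  \<comment> \<open>The displaced base points must stay in a compact part of \<open>W\<close>, so
    the base is enlarged by closed balls of radius \<open>e\<close>.\<close>
  define L1 where "L1 = (\<Union>x\<in>L. cball x e)"
  have L1W: "L1 \<subseteq> W" using e(2) by (simp add: L1_def)
  have L1: "compact L1" unfolding L1_def by (rule compact_minkowski_sum_cball[OF L])
  have cont: "continuous_on L1 frame" by (rule continuous_on_subset[OF continuous_on_frame L1W])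
  obtain M where M: "0 < M" "\<And>w. w \<in> L1 \<Longrightarrow> norm (frame w) \<le> M"
    using compact_imp_bounded[OF compact_continuous_image[OF cont L1]] unfolding bounded_pos by blast
  \<comment> \<open>The fibre moves relative to \<open>\<zeta>\<close> by at most
    \<open>n\<^sup>2 * M\<^sup>2 * \<rho> + n\<^sup>2 * M * \<epsilon>\<close>; the bounds on
    \<open>\<epsilon>\<close> and \<open>\<rho>\<close> give half of \<open>\<rho>0\<close> to each
    term. The other bound on \<open>\<epsilon>\<close> limits the movement of the base
    point.\<close>
  define \<epsilon> where "\<epsilon> = min \<rho>0 (\<rho>0 / (2 * n\<^sup>2 * M))"
  have \<epsilon>: "0 < \<epsilon>" using r0 n M by (simp add: \<epsilon>_def)
  obtain \<delta> where \<delta>: "0 < \<delta>" "\<And>w w'. w \<in> L1 \<Longrightarrow> w' \<in> L1 \<Longrightarrow> dist w' w < \<delta> \<Longrightarrow> dist (frame w') (frame w) < \<epsilon>"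
    using compact_uniformly_continuous[OF cont L1] \<epsilon> unfolding uniformly_continuous_on_def by blast
  \<comment> \<open>The bounds \<open>e / n\<close> and \<open>\<delta> / (2 * n)\<close> account
    for passing from \<open>maxnorm\<close> to the Euclidean norm, which may cost a factor
    \<open>n\<close>.\<close>
  define \<rho> where "\<rho> = min (min (1 / 2) (\<rho>0 / (2 * n\<^sup>2 * M\<^sup>2))) (min (e / n) (\<delta> / (2 * n)))"
  have \<rho>: "0 < \<rho>" "\<rho> \<le> 1 / 2" "\<rho> \<le> \<rho>0 / (2 * n\<^sup>2 * M\<^sup>2)" "n * \<rho> \<le> e" "n * \<rho> < \<delta>"
  proof -
    show "0 < \<rho>" using r0 n M e \<delta> by (simp add: \<rho>_def)
    show "\<rho> \<le> 1 / 2" "\<rho> \<le> \<rho>0 / (2 * n\<^sup>2 * M\<^sup>2)" unfolding \<rho>_def by linarith+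
    have "\<rho> \<le> e / n" "\<rho> \<le> \<delta> / (2 * n)" unfolding \<rho>_def by linarith+
    then have "n * \<rho> \<le> e" "n * \<rho> \<le> \<delta> / 2" using n by (simp_all add: field_simps)
    then show "n * \<rho> \<le> e" "n * \<rho> < \<delta>" using \<delta>(1) by auto
  qed
  \<comment> \<open>Since \<open>\<rho> \<le> 1 / 2\<close>, the fibre variable has norm at least
    \<open>d / 2\<close> on the new domain, and \<open>n * M\<close> is the largest factor by which
    \<open>\<mu>\<close> can exceed \<open>\<zeta>\<close>.\<close>
  define d where "d = d0 * 2 * n * M"
  have d: "0 < d" using d0 n M by (simp add: d_def)
  let ?\<Omega>' = "cotangent_coords W \<Phi> \<Omega>"
  let ?C = "{y \<in> {y. fst y \<in> L1}. cot y \<in> thicken \<rho>0 \<Omega>}"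
  have "thicken \<rho> ?\<Omega>' \<subseteq> ?C"
    unfolding thicken_def[of \<rho>]
  \<comment> \<open>The target is closed because \<open>cot\<close> is continuous over the compact
    set \<open>L1\<close>; so only points of the union before taking the closure have to be
    treated.\<close>
  proof (rule closure_minimal)
    have "closed {y :: 'n pt. fst y \<in> L1}"
      using closed_vimage_fst[OF compact_imp_closed[OF L1]] by (simp add: vimage_def)
    moreover have "continuous_on {y. fst y \<in> L1} cot"
      by (rule continuous_on_subset[OF continuous_on_cot]) (use L1W in \<open>auto simp: WW_def\<close>)
    moreover have "closed (thicken \<rho>0 \<Omega>)" by (simp add: thicken_def)
    ultimately show "closed ?C"
      using continuous_closed_preimage[of "{y. fst y \<in> L1}" cot "thicken \<rho>0 \<Omega>"]
      by (simp add: Int_def vimage_def)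
    show "(\<Union>(w, \<mu>)\<in>?\<Omega>'. {(w + w', \<mu> + \<mu>') |w' \<mu>'. maxnorm w' \<le> \<rho> \<and> maxnorm \<mu>' \<le> \<rho> * maxnorm \<mu>}) \<subseteq> ?C"
    proof
      fix y assume "y \<in> (\<Union>(w, \<mu>)\<in>?\<Omega>'. {(w + w', \<mu> + \<mu>') |w' \<mu>'. maxnorm w' \<le> \<rho> \<and> maxnorm \<mu>' \<le> \<rho> * maxnorm \<mu>})"
      then obtain w \<mu> w' \<mu>' where y: "y = (w + w', \<mu> + \<mu>')" and w\<mu>: "(w, \<mu>) \<in> ?\<Omega>'"
        and w': "maxnorm w' \<le> \<rho>" and \<mu>': "maxnorm \<mu>' \<le> \<rho> * maxnorm \<mu>" by blast
      note co = cotangent_coordsE[OF w\<mu>]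
      have "\<Phi> w \<in> fst ` \<Omega>" using co(2) by (metis fst_cot fst_conv imageI)
      then have wL: "w \<in> L" unfolding L_def using Psi_Phi[OF co(1)] closure_subset by (metis imageI subsetD)
      have "norm w' \<le> n * \<rho>"
        using norm_le_card_maxnorm[of w'] mult_left_mono[OF w', of n] n unfolding n_def by linarith
      then have nw: "norm w' \<le> e" "norm w' < \<delta>" using \<rho>(4,5) by auto
      have wL1: "w \<in> L1" "w + w' \<in> L1" using wL nw(1) e(1) by (auto simp: L1_def dist_norm intro!: bexI[of _ w])
      have wW: "(w, \<mu>) \<in> WW" and yW: "y \<in> WW" using wL1 L1W by (auto simp: WW_def y)
      have dist: "dist (frame (w + w')) (frame w) < \<epsilon>"
        by (rule \<delta>(2)) (use wL1 nw in \<open>auto simp: dist_norm\<close>)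
      have 1: "maxnorm (\<Phi> (w + w') - \<Phi> w) \<le> \<rho>0"
        using frame_components(1)[of "w + w'" w] dist by (simp add: \<epsilon>_def)
      have mu: "maxnorm \<mu> \<le> n * M * maxnorm (snd (cot (w, \<mu>)))"
        using maxnorm_snd_le_cot[OF wW, of M] M(2)[OF wL1(1)] by (simp add: n_def)
      have 2: "maxnorm (snd (cot y) - snd (cot (w, \<mu>))) \<le> \<rho>0 * maxnorm (snd (cot (w, \<mu>)))"
      proof (rule maxnorm_le)
        fix i
        have "(snd (cot y) - snd (cot (w, \<mu>))) $ i
            = (\<Sum>j\<in>UNIV. \<mu>' $ j * v i j (w + w') + \<mu> $ j * (v i j (w + w') - v i j w))"
          unfolding vector_minus_component snd_cot[OF yW] snd_cot[OF wW] sum_subtractf[symmetric]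
          by (rule sum.cong[OF refl]) (simp add: y algebra_simps)
        then have "cmod ((snd (cot y) - snd (cot (w, \<mu>))) $ i)
            \<le> (\<Sum>j\<in>UNIV. cmod (\<mu>' $ j * v i j (w + w') + \<mu> $ j * (v i j (w + w') - v i j w)))"
          by (simp add: norm_sum)
        also have "\<dots> \<le> of_nat CARD('n) * (\<rho> * maxnorm \<mu> * M + maxnorm \<mu> * \<epsilon>)"
        proof (rule sum_bounded_above)
          fix j
          have "cmod (\<mu>' $ j) * cmod (v i j (w + w')) \<le> (\<rho> * maxnorm \<mu>) * M"
            by (intro mult_mono order_trans[OF cmod_le_maxnorm \<mu>'] order_trans[OF frame_components(3) M(2)[OF wL1(2)]])
              (use \<rho>(1) maxnorm_nonneg in \<open>auto intro!: mult_nonneg_nonneg\<close>)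
          moreover have "cmod (\<mu> $ j) * cmod (v i j (w + w') - v i j w) \<le> maxnorm \<mu> * \<epsilon>"
            by (intro mult_mono cmod_le_maxnorm order_trans[OF frame_components(2) less_imp_le[OF dist]] maxnorm_nonneg) simp
          ultimately show "cmod (\<mu>' $ j * v i j (w + w') + \<mu> $ j * (v i j (w + w') - v i j w))
              \<le> \<rho> * maxnorm \<mu> * M + maxnorm \<mu> * \<epsilon>"
            by (intro order_trans[OF norm_triangle_ineq] add_mono) (simp_all add: norm_mult)
        qed
        also have "\<dots> = n * (\<rho> * M + \<epsilon>) * maxnorm \<mu>" by (simp add: n_def algebra_simps)
        also have "\<dots> \<le> n * (\<rho> * M + \<epsilon>) * (n * M * maxnorm (snd (cot (w, \<mu>))))"
          using n \<rho>(1) M(1) \<epsilon> by (intro mult_left_mono[OF mu]) simp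
        also have "\<dots> = (n\<^sup>2 * M\<^sup>2 * \<rho> + n\<^sup>2 * M * \<epsilon>) * maxnorm (snd (cot (w, \<mu>)))"
          by (simp add: power2_eq_square algebra_simps)
        also have "\<dots> \<le> \<rho>0 * maxnorm (snd (cot (w, \<mu>)))"
        proof (rule mult_right_mono[OF _ maxnorm_nonneg])
          have "n\<^sup>2 * M\<^sup>2 * \<rho> \<le> \<rho>0 / 2" using \<rho>(3) n M(1) by (simp add: field_simps)
          moreover have "\<epsilon> \<le> \<rho>0 / (2 * n\<^sup>2 * M)" unfolding \<epsilon>_def by linarith
          then have "n\<^sup>2 * M * \<epsilon> \<le> \<rho>0 / 2" using n M(1) by (simp add: field_simps)
          ultimately show "n\<^sup>2 * M\<^sup>2 * \<rho> + n\<^sup>2 * M * \<epsilon> \<le> \<rho>0" by simp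
        qed
        finally show "cmod ((snd (cot y) - snd (cot (w, \<mu>))) $ i) \<le> \<rho>0 * maxnorm (snd (cot (w, \<mu>)))" .
      qed
      have "cot y \<in> (\<Union>(z, \<zeta>)\<in>\<Omega>. {(z + z', \<zeta> + \<zeta>') |z' \<zeta>'. maxnorm z' \<le> \<rho>0 \<and> maxnorm \<zeta>' \<le> \<rho>0 * maxnorm \<zeta>})"
      proof (rule UN_I[OF co(2)])
        have e: "cot y = (\<Phi> w + (\<Phi> (w + w') - \<Phi> w), snd (cot (w, \<mu>)) + (snd (cot y) - snd (cot (w, \<mu>))))"
          by (intro prod_eqI) (simp_all add: fst_cot y)
        show "cot y \<in> (case cot (w, \<mu>) of (z, \<zeta>) \<Rightarrow>
            {(z + z', \<zeta> + \<zeta>') |z' \<zeta>'. maxnorm z' \<le> \<rho>0 \<and> maxnorm \<zeta>' \<le> \<rho>0 * maxnorm \<zeta>})"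
          unfolding case_prod_beta fst_cot fst_conv
          by (rule CollectI, rule exI, rule exI, rule conjI[OF e conjI[OF 1 2]])
      qed
      then have "cot y \<in> thicken \<rho>0 \<Omega>" unfolding thicken_def by (rule closure_subset[THEN subsetD])
      then show "y \<in> ?C" using wL1(2) by (simp add: y)
    qed
  qed
  then have C: "fst y \<in> L1 \<and> cot y \<in> thicken \<rho>0 \<Omega>" if "y \<in> thicken \<rho> ?\<Omega>'" for y
    using that by blast
  show ?thesis
  proof (rule that[OF d \<rho>(1)]; (rule ballI)?)
    show "\<rho> < 1" using \<rho>(2) by simp
    fix y assume "y \<in> symb_dom ?\<Omega>' d \<rho>"
    then have y: "y \<in> thicken \<rho> ?\<Omega>'" "d * (1 - \<rho>) \<le> maxnorm (snd y)"
      by (auto simp: symb_dom_def truncate_below_def)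
    have yL: "fst y \<in> L1" and cy: "cot y \<in> thicken \<rho>0 \<Omega>" using C[OF y(1)] by auto
    have yW: "y \<in> WW" using yL L1W by (auto simp: WW_def)
    have "n * M * d0 \<le> d * (1 - \<rho>)"
      using mult_left_mono[of "1 / 2" "1 - \<rho>" d] \<rho>(2) d by (simp add: d_def mult_ac)
    also have "\<dots> \<le> n * M * maxnorm (snd (cot y))"
      using y(2) maxnorm_snd_le_cot[OF yW M(2)[OF yL]] by (simp add: n_def)
    finally have "d0 \<le> maxnorm (snd (cot y))" using n M(1) by simp
    moreover have "d0 * (1 - \<rho>0) \<le> d0" using d0 r0 by simp
    ultimately have "cot y \<in> symb_dom \<Omega> d0 \<rho>0"
      using cy by (cases "cot y") (simp add: symb_dom_def truncate_below_def)
    then show "y \<in> WW \<and> cot y \<in> symb_dom \<Omega> d0 \<rho>0" using yW by simp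
  qed
qed

end

section \<open>Coordinate changes of symbols\<close>

lemma holo_composand:
  fixes P Q :: "nat \<Rightarrow> 'n::finite pt \<Rightarrow> complex"
  assumes "\<And>k. holo (Q k) X" "\<And>k. holo (P k) X"
  shows "holo (conv (\<lambda>k x. Q k (fst (fst x), snd (fst x) + snd (snd x)))
      (\<lambda>k x. P k (fst (fst x) + fst (snd x), snd (fst x))) k)
    {x. (fst (fst x), snd (fst x) + snd (snd x)) \<in> X \<and> (fst (fst x) + fst (snd x), snd (fst x)) \<in> X}" (is "holo _ ?X")
proof (rule holo_conv)
  show "holo (\<lambda>x. Q k (fst (fst x), snd (fst x) + snd (snd x))) ?X" for k
    by (rule holo_compose[OF assms(1), of "\<lambda>x. (fst (fst x), snd (fst x) + snd (snd x))"])
      (intro holo_map_intros, auto)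
  show "holo (\<lambda>x. P k (fst (fst x) + fst (snd x), snd (fst x))) ?X" for k
    by (rule holo_compose[OF assms(2), of "\<lambda>x. (fst (fst x) + fst (snd x), snd (fst x))"])
      (intro holo_map_intros, auto)
qed

lemma open_composand:
  fixes X :: "'n::finite pt set"
  assumes "open X"
  shows "open {x :: 'n pt \<times> 'n pt. (fst (fst x), snd (fst x) + snd (snd x)) \<in> X \<and> (fst (fst x) + fst (snd x), snd (fst x)) \<in> X}"
proof -
  have "open ((\<lambda>x :: 'n pt \<times> 'n pt. (fst (fst x), snd (fst x) + snd (snd x))) -` X)"
    "open ((\<lambda>x :: 'n pt \<times> 'n pt. (fst (fst x) + fst (snd x), snd (fst x))) -` X)"
    by (intro open_vimage assms continuous_intros)+
  from open_Int[OF this] show ?thesis by (simp add: vimage_def Int_def)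
qed

lemma local_comp_cong:
  fixes P Q :: "nat \<Rightarrow> 'n::finite pt \<Rightarrow> complex"
  assumes X: "open X" and Q: "\<And>k. holo (Q k) X" and P: "\<And>k. holo (P k) X" and y: "y \<in> X"
    and Q': "\<And>k x. x \<in> X \<Longrightarrow> Q k x = Q' k x" and P': "\<And>k x. x \<in> X \<Longrightarrow> P k x = P' k x"
  shows "local_comp Q P \<nu> y = local_comp Q' P' \<nu> y"
  unfolding local_comp_def
  by (rule hol_op.expo_cong[OF hol_op_pairop[OF open_composand[OF X]] holo_composand[OF Q P]])
    (use y in \<open>auto simp: conv_def Q' P' intro!: sum.cong\<close>)

text \<open>A left factor independent of the fibre variable leaves nothing for the derivative in
  \<open>\<zeta>'\<close> to act on, so the product is the ordinary one.\<close>

lemma local_comp_base_left: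
  fixes P Q :: "nat \<Rightarrow> 'n::finite pt \<Rightarrow> complex"
  assumes X: "open X" and Q: "\<And>k. holo (Q k) X" and P: "\<And>k. holo (P k) X" and y: "y \<in> X"
    and base: "\<And>k x. Q k x = q k (fst x)"
  shows "local_comp Q P \<nu> y = conv Q P \<nu> y"
proof -
  let ?Z = "{x. (fst (fst x), snd (fst x) + snd (snd x)) \<in> X \<and> (fst (fst x) + fst (snd x), snd (fst x)) \<in> X}"
  let ?F = "conv (\<lambda>k x. Q k (fst (fst x), snd (fst x) + snd (snd x)))
      (\<lambda>k x. P k (fst (fst x) + fst (snd x), snd (fst x)))"
  note h = holo_composand[OF Q P] and o = open_composand[OF X]
  have "local_comp Q P \<nu> y = ?F \<nu> (y, 0)"
    unfolding local_comp_def
  proof (rule hol_op.expo_annihilated[OF hol_op_pairop[OF o] _ h])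
    fix k x assume x: "x \<in> ?Z"
    have "dirderiv (fibre_dir2 i) (?F k) = (\<lambda>x. 0)" for i
      by (simp add: fun_eq_iff dirderiv_def base fibre_dir_def conv_def)
    moreover have "dirderiv (fibre_dir2 i) (dirderiv (base_dir2 i) (?F k)) x
        = dirderiv (base_dir2 i) (dirderiv (fibre_dir2 i) (?F k)) x" for i
      by (rule dirderiv_commute[OF h o x])
    ultimately show "pairop base_dir2 fibre_dir2 (?F k) x = 0"
      by (simp add: pairop_def dirderiv_def)
  qed (use y in auto)
  then show ?thesis by (simp add: conv_def)
qed

lemma conv_const_series: "conv (const_series f) P \<nu> y = f y * P \<nu> y"
proof -
  have "conv (const_series f) P \<nu> y = (\<Sum>j\<le>\<nu>. if j = 0 then f y * P \<nu> y else 0)"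
    unfolding conv_def by (rule sum.cong) (auto simp: const_series_def)
  then show ?thesis by simp
qed

lemma symb_eqI:
  assumes "0 < d" "0 < \<rho>" "\<rho> < 1"
    and "\<And>\<nu> z \<zeta> \<eta>. (z, \<zeta>) \<in> symb_dom \<Omega> d \<rho> \<Longrightarrow> \<eta> \<in> S \<Longrightarrow> P \<nu> z \<zeta> \<eta> = Q \<nu> z \<zeta> \<eta>"
  shows "symb_eq \<Omega> S P Q"
  unfolding symb_eq_def using assms by blast

lemma slice_fun_mult: "slice (fun_mult f P) \<eta> = (\<lambda>k y. f (fst y) * slice P \<eta> k y)"
  by (simp add: slice_def fun_mult_def fun_eq_iff)

lemma slice_fun_symb: "slice (fun_symb f) \<eta> = const_series (\<lambda>y. f (fst y))"
  by (auto simp: slice_def fun_symb_def const_series_def fun_eq_iff)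

lemma coord_pullbackI:
  assumes "coord_change W U \<Phi> \<Psi>" "difference_matrix U \<Psi> J"
  obtains N where "coord_pullback W U \<Phi> \<Psi> J N"
proof -
  from assms(1) have *: "open W" "open U" "bij_betw \<Phi> W U" "\<forall>w\<in>W. \<Psi> (\<Phi> w) = w"
    "\<forall>i. holo (\<lambda>w. \<Phi> w $ i) W" "\<forall>i. holo (\<lambda>z. \<Psi> z $ i) U"
    by (simp_all add: coord_change_def vector_scale_eq)
  from assms(2) obtain N where N: "open N" "N \<subseteq> U \<times> U" "\<forall>z\<in>U. (z, z) \<in> N"
    "\<forall>i j. holo (\<lambda>p. J (fst p) (snd p) $ i $ j) N"
    "\<forall>p\<in>N. \<Psi> (fst p) - \<Psi> (snd p) = J (fst p) (snd p) *v (fst p - snd p)"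
    by (auto simp: difference_matrix_def scale2_eq case_prod_beta')
  have "\<Phi> (\<Psi> z) = z \<and> \<Psi> z \<in> W" if "z \<in> U" for z
    using that *(3,4) by (auto simp: bij_betw_def)
  moreover have "\<Phi> w \<in> U" if "w \<in> W" for w using that *(3) by (auto simp: bij_betw_def)
  moreover have "holo_map \<Phi> W" "holo_map \<Psi> U" by (rule holo_map_vec, rule *(5,6)[rule_format])+
  moreover have "\<Psi> z' - \<Psi> z = J z' z *v (z' - z)" if "(z', z) \<in> N" for z' z
    using bspec[OF N(5) that] by simp
  ultimately have "coord_pullback W U \<Phi> \<Psi> J N"
    using * N unfolding coord_pullback_def by simp
  then show ?thesis by (rule that)
qed

context coord_pullback
begin

text \<open>Multiplication by the determinant is composition with it on the left, and a function of
  \<open>w\<close> is its own adjoint; the product rule for adjoints then puts it on the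
  right.\<close>

lemma local_adj_jac_pull:
  assumes X: "open X" and F: "\<And>k. holo (F k) X" and y: "y \<in> WW" "antipode (pm (y, 0)) \<in> X"
  shows "local_adj (\<lambda>k y. jac (fst y) * local_pull \<Phi> J F k y) \<nu> y
    = local_comp (local_adj (local_pull \<Phi> J F)) (const_series (\<lambda>y. jac (fst y))) \<nu> y"
proof -
  let ?V = "pull_domain X" and ?D = "const_series (\<lambda>y. jac (fst y))"
  let ?P = "local_pull \<Phi> J F"
  have V: "open ?V" by (rule open_pull_domain[OF X])
  have P: "holo (?P k) ?V" for k by (rule local_pull_holo[OF X F])
  have D: "holo (?D k) ?V" for k
    by (auto simp: const_series_def holo_const pull_domain_def intro!: holo_on_subset[OF holo_base_WW[OF holo_jac]])
  have ay: "antipode y \<in> ?V" using y by (simp add: pull_domain_def antipode_in_WW pm_antipode)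
  have "local_adj (\<lambda>k y. jac (fst y) * ?P k y) \<nu> y = local_adj (local_comp ?D ?P) \<nu> y"
  proof (rule local_adj_cong[OF V _ _ ay])
    show "holo (\<lambda>y. jac (fst y) * ?P k y) ?V" for k
      using holo_mult[OF D[of 0] P] by (simp add: const_series_def)
    fix k y assume "y \<in> ?V"
    have "local_comp ?D ?P k y = conv ?D ?P k y"
      by (rule local_comp_base_left[OF V D P \<open>y \<in> ?V\<close>, where q = "const_series jac"]) (simp add: const_series_def)
    then show "jac (fst y) * ?P k y = local_comp ?D ?P k y" by (simp add: conv_const_series)
  qed
  also have "\<dots> = local_comp (local_adj ?P) (local_adj ?D) \<nu> y"
    by (rule local_adj_comp[OF V D P ay])
  also have "\<dots> = local_comp (local_adj ?P) ?D \<nu> y"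
  proof (rule local_comp_cong[OF open_antipode[OF V] local_adj_holo[OF V P] local_adj_holo[OF V D]])
    fix k x assume "x \<in> antipode -` ?V"
    then show "local_adj ?D k x = ?D k x"
      by (intro local_adj_base[OF V D, where G = "const_series jac"]) (simp_all add: const_series_def)
  qed (use ay in auto)
  finally show ?thesis .
qed

text \<open>Only finitely many coefficients are involved for each \<open>\<nu>\<close>, so the open
  set \<open>X\<close> may depend on \<open>\<eta>\<close> and \<open>\<nu>\<close>, while
  \<open>d\<close> and \<open>\<rho>\<close> do not.\<close>

lemma symb_dom_cot:
  assumes P: "coeffs_holo \<Omega> S d0 \<rho>0 P" and d0: "0 < d0" "0 < \<rho>0" "\<rho>0 < 1"
    and comp: "compact (closure (fst ` \<Omega>))" and sub: "closure (fst ` \<Omega>) \<subseteq> U"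
  obtains d \<rho> where "0 < d" "0 < \<rho>" "\<rho> < 1"
    "\<forall>y\<in>symb_dom (cotangent_coords W \<Phi> (antipodal \<Omega>)) d \<rho>. \<forall>\<eta>\<in>S. \<forall>\<nu>.
      y \<in> WW \<and> (\<exists>X. open X \<and> (\<forall>k. holo (trunc \<nu> (slice P \<eta>) k) X) \<and> antipode (pm (y, 0)) \<in> X)"
proof -
  obtain d \<rho> where d: "0 < d" "0 < \<rho>" "\<rho> < 1"
    "\<forall>y\<in>symb_dom (cotangent_coords W \<Phi> (antipodal \<Omega>)) d \<rho>. y \<in> WW \<and> cot y \<in> symb_dom (antipodal \<Omega>) d0 \<rho>0"
    by (rule cot_symb_dom[of "antipodal \<Omega>", unfolded fst_antipodal, OF comp sub d0])
  show ?thesis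
  proof (rule that[OF d(1-3)], intro ballI allI conjI)
    fix y \<eta> \<nu> assume y: "y \<in> symb_dom (cotangent_coords W \<Phi> (antipodal \<Omega>)) d \<rho>" and \<eta>: "\<eta> \<in> S"
    show "y \<in> WW" by (rule conjunct1[OF bspec[OF d(4) y]])
    obtain X where X: "open X" "symb_dom \<Omega> d0 \<rho>0 \<subseteq> X" "\<And>k. k \<le> \<nu> \<Longrightarrow> holo (slice P \<eta> k) X"
      using coeffs_holo_slice[OF P \<eta>] by metis
    have "cot y \<in> antipode -` symb_dom \<Omega> d0 \<rho>0"
      using bspec[OF d(4) y] unfolding symb_dom_antipodal by (rule conjunct2)
    then have "antipode (pm (y, 0)) \<in> X"
      using X(2) unfolding cot_def vimage_eq by (rule subsetD[rotated])
    moreover have "\<forall>k. holo (trunc \<nu> (slice P \<eta>) k) X" by (rule allI, rule holo_trunc, rule X(3))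
    ultimately show "\<exists>X. open X \<and> (\<forall>k. holo (trunc \<nu> (slice P \<eta>) k) X) \<and> antipode (pm (y, 0)) \<in> X"
      using X(1) by (intro exI[of _ X] conjI)
  qed
qed

text \<open>The constant \<open>c\<close> makes room for the value of the form: evaluated at the
  columns of \<open>V\<close>, the pull-back of the volume form is \<open>det V\<close> times the
  Jacobian determinant. The case \<open>c = 1\<close> is the scalar identity.\<close>

lemma symb_eq_pullback_adj:
  assumes P: "coeffs_holo \<Omega> S d0 \<rho>0 P" and d0: "0 < d0" "0 < \<rho>0" "\<rho>0 < 1"
    and comp: "compact (closure (fst ` \<Omega>))" and sub: "closure (fst ` \<Omega>) \<subseteq> U"
  shows "symb_eq (cotangent_coords W \<Phi> (antipodal \<Omega>)) S
      (fun_mult (\<lambda>w. c * jac w) (symb_pullback \<Phi> J (adj P)))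
      (adj (fun_mult (\<lambda>w. c * jac w) (symb_pullback \<Phi> J P)))" (is ?A)
    and "symb_eq (cotangent_coords W \<Phi> (antipodal \<Omega>)) S
      (adj (fun_mult jac (symb_pullback \<Phi> J P)))
      (symb_comp (adj (symb_pullback \<Phi> J P)) (fun_symb jac))" (is ?B)
proof -
  obtain d \<rho> where d: "0 < d" "0 < \<rho>" "\<rho> < 1" and dom:
    "\<forall>y\<in>symb_dom (cotangent_coords W \<Phi> (antipodal \<Omega>)) d \<rho>. \<forall>\<eta>\<in>S. \<forall>\<nu>.
      y \<in> WW \<and> (\<exists>X. open X \<and> (\<forall>k. holo (trunc \<nu> (slice P \<eta>) k) X) \<and> antipode (pm (y, 0)) \<in> X)"
    by (rule symb_dom_cot[OF assms])
  have eq: "fun_mult (\<lambda>w. c * jac w) (symb_pullback \<Phi> J (adj P)) \<nu> w \<mu> \<eta>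
      = adj (fun_mult (\<lambda>w. c * jac w) (symb_pullback \<Phi> J P)) \<nu> w \<mu> \<eta> \<and>
    adj (fun_mult jac (symb_pullback \<Phi> J P)) \<nu> w \<mu> \<eta>
      = symb_comp (adj (symb_pullback \<Phi> J P)) (fun_symb jac) \<nu> w \<mu> \<eta>"
    if mem: "(w, \<mu>) \<in> symb_dom (cotangent_coords W \<Phi> (antipodal \<Omega>)) d \<rho>" and \<eta>: "\<eta> \<in> S" for \<nu> w \<mu> \<eta>
  proof -
    define F where "F = trunc \<nu> (slice P \<eta>)"
    obtain X where X: "open X" "\<And>k. holo (F k) X" "antipode (pm ((w, \<mu>), 0)) \<in> X"
      using dom[rule_format, OF mem \<eta>, of \<nu>] unfolding F_def by blast
    have wW: "(w, \<mu>) \<in> WW" using dom mem \<eta> by blast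
    have ay: "antipode (w, \<mu>) \<in> pull_domain X" using wW X(3) by (simp add: pull_domain_def antipode_in_WW pm_antipode)
    have Fk: "k \<le> \<nu> \<Longrightarrow> slice P \<eta> k = F k" for k by (simp add: F_def)
    have pull: "local_pull \<Phi> J (slice P \<eta>) k = local_pull \<Phi> J F k" if "k \<le> \<nu>" for k
      by (rule local_pull_local) (use that Fk in auto)
    have adjP: "local_pull \<Phi> J (local_adj (slice P \<eta>)) \<nu> = local_pull \<Phi> J (local_adj F) \<nu>"
      by (rule local_pull_local, rule local_adj_local) (use Fk in auto)
    let ?R = "\<lambda>k y. jac (fst y) * local_pull \<Phi> J F k y"
    have R: "holo (?R k) (pull_domain X)" for k
      by (intro holo_mult local_pull_holo[OF X(1,2)] holo_on_subset[OF holo_base_WW[OF holo_jac]]) (auto simp: pull_domain_def)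
    have "fun_mult (\<lambda>w. c * jac w) (symb_pullback \<Phi> J (adj P)) \<nu> w \<mu> \<eta>
        = c * (jac (fst (w, \<mu>)) * local_pull \<Phi> J (local_adj F) \<nu> (w, \<mu>))"
      by (simp add: fun_mult_def symb_pullback_eq_local slice_adj adjP)
    also have "\<dots> = c * local_adj ?R \<nu> (w, \<mu>)"
      by (subst local_pull_adj[OF X(1,2) wW X(3)]) simp
    also have "\<dots> = local_adj (\<lambda>k y. c * ?R k y) \<nu> (w, \<mu>)"
      by (rule local_adj_cmult[OF open_pull_domain[OF X(1)] R ay, symmetric])
    also have "\<dots> = adj (fun_mult (\<lambda>w. c * jac w) (symb_pullback \<Phi> J P)) \<nu> w \<mu> \<eta>"
      unfolding adj_eq_local slice_fun_mult slice_pullback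
      by (rule fun_cong[OF local_adj_local]) (simp add: pull mult.assoc)
    finally have A: "fun_mult (\<lambda>w. c * jac w) (symb_pullback \<Phi> J (adj P)) \<nu> w \<mu> \<eta>
        = adj (fun_mult (\<lambda>w. c * jac w) (symb_pullback \<Phi> J P)) \<nu> w \<mu> \<eta>" .
    have "adj (fun_mult jac (symb_pullback \<Phi> J P)) \<nu> w \<mu> \<eta> = local_adj ?R \<nu> (w, \<mu>)"
      unfolding adj_eq_local slice_fun_mult slice_pullback
      by (rule fun_cong[OF local_adj_local]) (simp add: pull)
    also have "\<dots> = local_comp (local_adj (local_pull \<Phi> J F)) (const_series (\<lambda>y. jac (fst y))) \<nu> (w, \<mu>)"
      by (rule local_adj_jac_pull[OF X(1,2) wW X(3)])
    also have "\<dots> = symb_comp (adj (symb_pullback \<Phi> J P)) (fun_symb jac) \<nu> w \<mu> \<eta>"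
      unfolding symb_comp_eq_local slice_adj slice_pullback slice_fun_symb
      by (rule fun_cong[OF local_comp_local[OF local_adj_local refl]]) (simp add: pull)
    finally show ?thesis using A by blast
  qed
  show ?A by (rule symb_eqI[OF d conjunct1[OF eq]])
  show ?B by (rule symb_eqI[OF d conjunct2[OF eq]])
qed

end

lemma symb_eq_tensor_pullback_adj:
  assumes P: "P \<in> Scl \<Omega> S" and \<Omega>: "fibre_conic \<Omega>" "conically_relcompact_in \<Omega> UNIV"
    and \<Phi>: "coord_change W U \<Phi> \<Psi>" "fst ` closure \<Omega> \<subseteq> U" "difference_matrix U \<Psi> J"
  defines "\<Omega>' \<equiv> cotangent_coords W \<Phi> (antipodal \<Omega>)" and "D \<equiv> \<lambda>w. det (cjacobian \<Phi> w)"
  shows "symb_eq \<Omega>' S (tensor_pullback \<Phi> J (adj P) vol_form V) (adj_form (tensor_pullback \<Phi> J P vol_form) V)"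
    and "symb_eq \<Omega>' S (fun_mult D (symb_pullback \<Phi> J (adj P))) (adj (fun_mult D (symb_pullback \<Phi> J P)))"
    and "symb_eq \<Omega>' S (adj (fun_mult D (symb_pullback \<Phi> J P)))
      (symb_comp (adj (symb_pullback \<Phi> J P)) (fun_symb D))"
proof -
  obtain d \<rho> where d: "0 < d" "0 < \<rho>" "\<rho> < 1" and hol: "coeffs_holo \<Omega> S d \<rho> P"
    using P unfolding Scl_iff by blast
  obtain N where "coord_pullback W U \<Phi> \<Psi> J N" by (rule coord_pullbackI[OF \<Phi>(1,3)])
  then interpret coord_pullback W U \<Phi> \<Psi> J N .
  note eqs = symb_eq_pullback_adj[OF hol d base_relcompact[OF \<Omega> \<Phi>(2)]]
  have D: "D = jac" by (simp add: D_def jac_def fun_eq_iff)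
  have "tensor_pullback \<Phi> J Q vol_form V = fun_mult (\<lambda>w. det V * jac w) (symb_pullback \<Phi> J Q)" for Q
    by (simp add: tensor_pullback_def symb_tensor_def form_pullback_def vol_form_def det_mul jac_def mult.commute)
  with eqs(1)[of "det V"]
  show "symb_eq \<Omega>' S (tensor_pullback \<Phi> J (adj P) vol_form V) (adj_form (tensor_pullback \<Phi> J P vol_form) V)"
    by (simp only: adj_form_def \<Omega>'_def)
  show "symb_eq \<Omega>' S (fun_mult D (symb_pullback \<Phi> J (adj P))) (adj (fun_mult D (symb_pullback \<Phi> J P)))"
    using eqs(1)[of 1] by (simp only: D \<Omega>'_def mult_1)
  show "symb_eq \<Omega>' S (adj (fun_mult D (symb_pullback \<Phi> J P)))
      (symb_comp (adj (symb_pullback \<Phi> J P)) (fun_symb D))"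
    using eqs(2) by (simp only: D \<Omega>'_def)
qed

theorem theorem6p18:
  fixes \<Omega> :: "((complex^'n) \<times> (complex^'n)) set" and r \<theta> :: real and S :: "complex set"
  assumes "0 < r" "r < 1/2" "0 < \<theta>" "\<theta> < 1/2"
    and "S = sector r \<theta>"
    and "open \<Omega>" "fibre_conic \<Omega>" "conically_relcompact_in \<Omega> UNIV"
  shows
    "(\<forall>P \<in> Scl \<Omega> S. adj P \<in> Scl (antipodal \<Omega>) S \<and> symb_eq \<Omega> S (adj (adj P)) P) \<and>
     (\<forall>P \<in> Ncl \<Omega> S. adj P \<in> Ncl (antipodal \<Omega>) S) \<and>
     (\<forall>P \<in> Scl \<Omega> S. \<forall>Q \<in> Scl \<Omega> S.
        symb_eq (antipodal \<Omega>) S (adj (symb_comp Q P)) (symb_comp (adj P) (adj Q))) \<and>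
     (\<forall>P \<in> Scl \<Omega> S. \<forall>W U \<Phi> \<Psi> J.
        coord_change W U \<Phi> \<Psi> \<and> fst ` closure \<Omega> \<subseteq> U \<and> difference_matrix U \<Psi> J \<longrightarrow>
        (let \<Omega>' = cotangent_coords W \<Phi> (antipodal \<Omega>);
             D = (\<lambda>w. det (cjacobian \<Phi> w))
         in (\<forall>V. symb_eq \<Omega>' S
                (tensor_pullback \<Phi> J (adj P) vol_form V)
                (adj_form (tensor_pullback \<Phi> J P vol_form) V)) \<and>
            symb_eq \<Omega>' S
              (fun_mult D (symb_pullback \<Phi> J (adj P)))
              (adj (fun_mult D (symb_pullback \<Phi> J P))) \<and>
            symb_eq \<Omega>' S
              (adj (fun_mult D (symb_pullback \<Phi> J P)))
              (symb_comp (adj (symb_pullback \<Phi> J P)) (fun_symb D))))"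
proof -
  \<comment> \<open>The growth estimate inserts powers of \<open>1 / cmod \<eta>\<close>; here the
    bound \<open>r < 1/2\<close> on the radius of the sector justifies it.\<close>
  have S: "0 < cmod \<eta> \<and> cmod \<eta> \<le> 1" if "\<eta> \<in> S" for \<eta>
    using that assms(2) by (auto simp: assms(5) sector_def)
  show ?thesis
    unfolding Let_def
    by (intro conjI ballI allI impI; (elim conjE)?; rule adj_Scl adj_Ncl symb_eq_adj_adj symb_eq_adj_comp
        symb_eq_tensor_pullback_adj[OF _ assms(7,8)]; (rule S)?; assumption)
qed

end
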